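(* Let $k$ be a field, let $m\ge2$ and $E\in\mathrm{GL}_m(k)$. Let $$X_0(E)=\{F\in\mathrm{GL}_n(k),\ n\ge2\ |\ \mathrm{tr}(E^{-1}E^t)=\mathrm{tr}(F^{-1}F^t)\}$$ and let $\sim$ be the equivalence relation on $X_0(E)$ defined, for $F\in\mathrm{GL}_n(k)$ and $G\in\mathrm{GL}_p(k)$ in $X_0(E)$, by $F\sim G$ if and only if $n=p$ and there exists $P\in\mathrm{GL}_n(k)$ with $F=PGP^t$. Put $X(E)=X_0(E)/\sim$. Then the map $$X_0(E)\to\mathrm{Gal}(\mathcal B(E)),\quad F\mapsto[\mathcal B(E,F)]$$ induces a bijection $X(E)\simeq\mathrm{Gal}(\mathcal B(E))$.
   Context: For $E\in\mathrm{GL}_m(k)$ and $F\in\mathrm{GL}_n(k)$, $\mathcal B(E,F)$ is the $k$-algebra presented by generators $a_{ij}$, $1\le i\le m$, $1\le j\le n$, with relations $F^{-1}a^tEa=I_n$ and $aF^{-1}a^tE=I_m$, where $a=(a_{ij})$ and $t$ denotes transpose. $\mathcal B(E)=\mathcal B(E,E)$ is a Hopf algebra with $\Delta(a_{ij})=\sum_k a_{ik}\otimes a_{kj}$, $\varepsilon(a_{ij})=\delta_{ij}$, $S(a)=E^{-1}a^tE$. $\mathcal B(E,F)$ is a left $\mathcal B(E)$-comodule algebra with coaction $a_{ij}\mapsto\sum_{k=1}^m a_{ik}\otimes a_{kj}$, and it is a left $\mathcal B(E)$-Galois object whenever $F\in X_0(E)$. For a Hopf algebra $H$, a left $H$-Galois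 object is a left $H$-comodule algebra $A\neq(0)$ with coaction $\alpha:A\to H\otimes A$ such that $(1_H\otimes m_A)(\alpha\otimes 1_A):A\otimes A\to H\otimes A$ is bijective ($m_A$ is the multiplication of $A$). $\mathrm{Gal}(\mathcal B(E))$ is the set of isomorphism classes of left $\mathcal B(E)$-Galois objects, isomorphisms being left colinear algebra isomorphisms; $[A]$ is the class of $A$. *)

theory Defs
  imports
    "Jordan_Normal_Form.VS_Connect"
    "HOL-Algebra.QuotRing"
    "HOL-Library.Poly_Mapping"
begin

section \<open>Algebras over a field\<close>

text \<open>
  The base field is a type \<open>'k\<close> of class \<open>field\<close>, used through the record \<open>class_ring\<close>.
  Vector spaces and (noncommutative, unital) algebras are \<open>module\<close> records of HOL-Algebra; for
  vector spaces the fields \<open>mult\<close> and \<open>one\<close> are irrelevant. The locale \<open>algebra\<close> of HOL-Algebra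
  is restricted to commutative algebras and is therefore not used.
\<close>

definition k_algebra :: "('k::field, 'a, 'z) module_scheme \<Rightarrow> bool" where
  "k_algebra A \<longleftrightarrow> vectorspace class_ring A \<and> ring A \<and>
     (\<forall>c. \<forall>x\<in>carrier A. \<forall>y\<in>carrier A.
        (c \<odot>\<^bsub>A\<^esub> x) \<otimes>\<^bsub>A\<^esub> y = c \<odot>\<^bsub>A\<^esub> (x \<otimes>\<^bsub>A\<^esub> y) \<and>
        x \<otimes>\<^bsub>A\<^esub> (c \<odot>\<^bsub>A\<^esub> y) = c \<odot>\<^bsub>A\<^esub> (x \<otimes>\<^bsub>A\<^esub> y))"

abbreviation lin_hom ::
    "('k::field, 'a, 'y) module_scheme \<Rightarrow> ('k, 'b, 'z) module_scheme \<Rightarrow> ('a \<Rightarrow> 'b) set" where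
  "lin_hom M N \<equiv> LinearCombinations.module_hom class_ring M N"

definition alg_hom ::
    "('k::field, 'a, 'y) module_scheme \<Rightarrow> ('k, 'b, 'z) module_scheme \<Rightarrow> ('a \<Rightarrow> 'b) set" where
  "alg_hom A B = Ring.ring_hom A B \<inter> lin_hom A B"

definition scalar_alg :: "('k::field, 'k) module" where
  "scalar_alg = ring.extend class_ring (module.fields (*))"

definition op_alg :: "('k, 'a) module \<Rightarrow> ('k, 'a) module" where
  "op_alg A = A\<lparr>mult := \<lambda>x y. y \<otimes>\<^bsub>A\<^esub> x\<rparr>"

text \<open>
  Quotient of an algebra by an ideal. For a vector space and a subspace \<open>I\<close> this is the quotient
  space, with an irrelevant multiplication.
\<close>

definition alg_quot :: "('k, 'a) module \<Rightarrow> 'a set \<Rightarrow> ('k, 'a set) module" where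
  "alg_quot A I = ring.extend (A Quot I) (module.fields (\<lambda>c X. \<Union>x\<in>X. I +>\<^bsub>A\<^esub> (c \<odot>\<^bsub>A\<^esub> x)))"

definition free_space :: "'x set \<Rightarrow> ('k::field, 'x \<Rightarrow>\<^sub>0 'k) module" where
  "free_space S = \<lparr>carrier = {p. Poly_Mapping.keys p \<subseteq> S}, mult = undefined, one = undefined,
     zero = 0, add = (+), smult = (\<lambda>c. Poly_Mapping.map ((*) c))\<rparr>"


section \<open>Tensor products\<close>

type_synonym ('k, 'a, 'b) tensor = "(('a \<times> 'b) \<Rightarrow>\<^sub>0 'k) set"

definition tensor_rels ::
    "('k::field, 'a, 'y) module_scheme \<Rightarrow> ('k, 'b, 'z) module_scheme \<Rightarrow> (('a \<times> 'b) \<Rightarrow>\<^sub>0 'k) set" where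
  "tensor_rels M N = (let e = (\<lambda>x y. Poly_Mapping.single (x, y) (1::'k)) in
     {e (x \<oplus>\<^bsub>M\<^esub> x') y - e x y - e x' y | x x' y. x \<in> carrier M \<and> x' \<in> carrier M \<and> y \<in> carrier N} \<union>
     {e x (y \<oplus>\<^bsub>N\<^esub> y') - e x y - e x y' | x y y'. x \<in> carrier M \<and> y \<in> carrier N \<and> y' \<in> carrier N} \<union>
     {e (c \<odot>\<^bsub>M\<^esub> x) y - Poly_Mapping.single (x, y) c | c x y. x \<in> carrier M \<and> y \<in> carrier N} \<union>
     {e x (c \<odot>\<^bsub>N\<^esub> y) - Poly_Mapping.single (x, y) c | c x y. x \<in> carrier M \<and> y \<in> carrier N})"

definition tensor_ker ::
    "('k::field, 'a, 'y) module_scheme \<Rightarrow> ('k, 'b, 'z) module_scheme \<Rightarrow> (('a \<times> 'b) \<Rightarrow>\<^sub>0 'k) set" where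
  "tensor_ker M N = LinearCombinations.module.span class_ring
     (free_space (carrier M \<times> carrier N)) (tensor_rels M N)"

definition tensor_space ::
    "('k::field, 'a, 'y) module_scheme \<Rightarrow> ('k, 'b, 'z) module_scheme \<Rightarrow> ('k, ('k, 'a, 'b) tensor) module" where
  "tensor_space M N = alg_quot (free_space (carrier M \<times> carrier N)) (tensor_ker M N)"

definition tens ::
    "('k::field, 'a, 'y) module_scheme \<Rightarrow> ('k, 'b, 'z) module_scheme \<Rightarrow> 'a \<Rightarrow> 'b \<Rightarrow> ('k, 'a, 'b) tensor" where
  "tens M N x y = tensor_ker M N +>\<^bsub>free_space (carrier M \<times> carrier N)\<^esub> Poly_Mapping.single (x, y) 1"

text \<open>The linear map on \<open>M \<otimes> N\<close> induced by a bilinear map \<open>\<beta>\<close> into \<open>P\<close>.\<close>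

definition tensor_lift ::
    "('k::field, 'a, 'x) module_scheme \<Rightarrow> ('k, 'b, 'y) module_scheme \<Rightarrow> ('k, 'c, 'z) module_scheme
     \<Rightarrow> ('a \<Rightarrow> 'b \<Rightarrow> 'c) \<Rightarrow> ('k, 'a, 'b) tensor \<Rightarrow> 'c" where
  "tensor_lift M N P \<beta> = (THE f.
     f \<in> lin_hom (tensor_space M N) P \<and> f \<in> extensional (carrier (tensor_space M N)) \<and>
     (\<forall>x\<in>carrier M. \<forall>y\<in>carrier N. f (tens M N x y) = \<beta> x y))"

text \<open>
  The tensor product with its algebra structure: \<open>(x \<otimes> y)(x' \<otimes> y') = x x' \<otimes> y y'\<close>.
\<close>

definition tensor_alg ::
    "('k::field, 'a, 'y) module_scheme \<Rightarrow> ('k, 'b, 'z) module_scheme \<Rightarrow> ('k, ('k, 'a, 'b) tensor) module" where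
  "tensor_alg A B = (let T = tensor_space A B in
     T\<lparr>mult := \<lambda>s t. tensor_lift A B T (\<lambda>x y.
                  tensor_lift A B T (\<lambda>x' y'. tens A B (x \<otimes>\<^bsub>A\<^esub> x') (y \<otimes>\<^bsub>B\<^esub> y')) t) s,
       one := tens A B \<one>\<^bsub>A\<^esub> \<one>\<^bsub>B\<^esub>\<rparr>)"

definition tensor_map ::
    "('k::field, 'a, 'w) module_scheme \<Rightarrow> ('k, 'b, 'x) module_scheme
     \<Rightarrow> ('k, 'c, 'y) module_scheme \<Rightarrow> ('k, 'd, 'z) module_scheme
     \<Rightarrow> ('a \<Rightarrow> 'c) \<Rightarrow> ('b \<Rightarrow> 'd) \<Rightarrow> ('k, 'a, 'b) tensor \<Rightarrow> ('k, 'c, 'd) tensor" where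
  "tensor_map M N M' N' f g =
     tensor_lift M N (tensor_alg M' N') (\<lambda>x y. tens M' N' (f x) (g y))"

text \<open>The associativity isomorphism from \<open>(M \<otimes> N) \<otimes> P\<close> to \<open>M \<otimes> (N \<otimes> P)\<close>.\<close>

definition tensor_assoc ::
    "('k::field, 'a, 'x) module_scheme \<Rightarrow> ('k, 'b, 'y) module_scheme \<Rightarrow> ('k, 'c, 'z) module_scheme
     \<Rightarrow> ('k, ('k, 'a, 'b) tensor, 'c) tensor \<Rightarrow> ('k, 'a, ('k, 'b, 'c) tensor) tensor" where
  "tensor_assoc M N P = (let Q = tensor_alg M (tensor_alg N P) in
     tensor_lift (tensor_alg M N) P Q (\<lambda>t z.
       tensor_lift M N Q (\<lambda>x y. tens M (tensor_alg N P) x (tens N P y z)) t))"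


section \<open>Hopf algebras, comodule algebras and Galois objects\<close>

record (overloaded) ('k::zero, 'h) hopf = "('k, 'h) module" +
  comult :: "'h \<Rightarrow> ('k, 'h, 'h) tensor"
  counit :: "'h \<Rightarrow> 'k"
  antipode :: "'h \<Rightarrow> 'h"

definition hopf_algebra :: "('k::field, 'h) hopf \<Rightarrow> bool" where
  "hopf_algebra H \<longleftrightarrow> k_algebra H \<and>
     comult H \<in> alg_hom H (tensor_alg H H) \<and>
     counit H \<in> alg_hom H scalar_alg \<and>
     antipode H \<in> lin_hom H H \<and>
     (\<forall>h\<in>carrier H.
        tensor_assoc H H H (tensor_map H H (tensor_alg H H) H (comult H) id (comult H h)) =
          tensor_map H H H (tensor_alg H H) id (comult H) (comult H h) \<and>
        tensor_lift H H H (\<lambda>x y. counit H x \<odot>\<^bsub>H\<^esub> y) (comult H h) = h \<and>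
        tensor_lift H H H (\<lambda>x y. counit H y \<odot>\<^bsub>H\<^esub> x) (comult H h) = h \<and>
        tensor_lift H H H (\<lambda>x y. antipode H x \<otimes>\<^bsub>H\<^esub> y) (comult H h) = counit H h \<odot>\<^bsub>H\<^esub> \<one>\<^bsub>H\<^esub> \<and>
        tensor_lift H H H (\<lambda>x y. x \<otimes>\<^bsub>H\<^esub> antipode H y) (comult H h) = counit H h \<odot>\<^bsub>H\<^esub> \<one>\<^bsub>H\<^esub>)"

record (overloaded) ('k::zero, 'h, 'a) comod_alg = "('k, 'a) module" +
  coact :: "'a \<Rightarrow> ('k, 'h, 'a) tensor"

definition comodule_algebra :: "('k::field, 'h) hopf \<Rightarrow> ('k, 'h, 'a) comod_alg \<Rightarrow> bool" where
  "comodule_algebra H A \<longleftrightarrow> k_algebra A \<and>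
     coact A \<in> alg_hom A (tensor_alg H A) \<and>
     (\<forall>a\<in>carrier A.
        tensor_assoc H H A (tensor_map H A (tensor_alg H H) A (comult H) id (coact A a)) =
          tensor_map H A H (tensor_alg H A) id (coact A) (coact A a) \<and>
        tensor_lift H A A (\<lambda>h x. counit H h \<odot>\<^bsub>A\<^esub> x) (coact A a) = a)"

text \<open>The canonical map from \<open>A \<otimes> A\<close> to \<open>H \<otimes> A\<close>.\<close>

definition galois_map ::
    "('k::field, 'h) hopf \<Rightarrow> ('k, 'h, 'a) comod_alg \<Rightarrow> ('k, 'a, 'a) tensor \<Rightarrow> ('k, 'h, 'a) tensor" where
  "galois_map H A t =
     tensor_map H (tensor_alg A A) H A id (tensor_lift A A A (mult A))
       (tensor_assoc H A A (tensor_map A A (tensor_alg H A) A (coact A) id t))"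

definition galois_object :: "('k::field, 'h) hopf \<Rightarrow> ('k, 'h, 'a) comod_alg \<Rightarrow> bool" where
  "galois_object H A \<longleftrightarrow> hopf_algebra H \<and> comodule_algebra H A \<and> carrier A \<noteq> {\<zero>\<^bsub>A\<^esub>} \<and>
     bij_betw (galois_map H A) (carrier (tensor_alg A A)) (carrier (tensor_alg H A))"

definition comod_alg_iso ::
    "('k::field, 'h) hopf \<Rightarrow> ('k, 'h, 'a) comod_alg \<Rightarrow> ('k, 'h, 'b) comod_alg \<Rightarrow> bool" where
  "comod_alg_iso H A B \<longleftrightarrow> (\<exists>f. f \<in> alg_hom A B \<and> bij_betw f (carrier A) (carrier B) \<and>
     (\<forall>a\<in>carrier A. coact B (f a) = tensor_map H A H B id f (coact A a)))"

text \<open>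
  \<open>Gal H\<close> is formed relative to a type \<open>'u\<close> containing the carriers of the Galois objects;
  it is the intended set of isomorphism classes once \<open>'u\<close> is large enough to contain a copy of
  every Galois object considered. \<open>gal_class H B\<close>, the class of \<open>B\<close> in \<open>Gal H\<close>, makes sense
  also when the carrier of \<open>B\<close> lives in another type.
\<close>

definition Gal :: "('k::field, 'h) hopf \<Rightarrow> ('k, 'h, 'u) comod_alg set set" where
  "Gal H = {A. galois_object H A} //
     {(A, A'). galois_object H A \<and> galois_object H A' \<and> comod_alg_iso H A A'}"

definition gal_class ::
    "('k::field, 'h) hopf \<Rightarrow> ('k, 'h, 'b) comod_alg \<Rightarrow> ('k, 'h, 'u) comod_alg set" where
  "gal_class H B = {A. galois_object H A \<and> comod_alg_iso H B A}"


section \<open>Free algebras\<close>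

datatype 'x word = Word (letters: "'x list")

instantiation word :: (type) monoid_add
begin

definition zero_word :: "'a word" where
  "0 = Word []"

definition plus_word :: "'a word \<Rightarrow> 'a word \<Rightarrow> 'a word" where
  "u + v = Word (letters u @ letters v)"

instance
  by standard (simp_all add: zero_word_def plus_word_def)

end

text \<open>
  The multiplication of \<^typ>\<open>'x word \<Rightarrow>\<^sub>0 'k\<close> is the convolution product extending the
  concatenation of words.
\<close>

definition free_alg :: "'x set \<Rightarrow> ('k::field, 'x word \<Rightarrow>\<^sub>0 'k) module" where
  "free_alg S = (free_space {w. set (letters w) \<subseteq> S})\<lparr>mult := (*), one := 1\<rparr>"

definition free_var :: "'x \<Rightarrow> 'x word \<Rightarrow>\<^sub>0 'k::field" where
  "free_var x = Poly_Mapping.single (Word [x]) 1"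


section \<open>The algebras \<open>\<B>(E,F)\<close>\<close>

definition GL :: "nat \<Rightarrow> 'k::field mat set" where
  "GL n = Units (ring_mat TYPE('k) n ())"

definition minv :: "'k::field mat \<Rightarrow> 'k mat" where
  "minv A = inv\<^bsub>ring_mat TYPE('k) (dim_row A) ()\<^esub> A"

definition tr :: "'k::field mat \<Rightarrow> 'k" where
  "tr A = (\<Sum>i<dim_row A. A $$ (i, i))"

text \<open>Row and column indices start at \<open>0\<close>.\<close>

type_synonym 'k bpoly = "(nat \<times> nat) word \<Rightarrow>\<^sub>0 'k"
type_synonym 'k belem = "'k bpoly set"

definition const_mat :: "'k::field mat \<Rightarrow> 'k bpoly mat" where
  "const_mat A = map_mat (Poly_Mapping.single 0) A"

definition gen_mat :: "nat \<Rightarrow> nat \<Rightarrow> 'k::field bpoly mat" where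
  "gen_mat m n = mat m n free_var"

definition B_free :: "'k::field mat \<Rightarrow> 'k mat \<Rightarrow> ('k, 'k bpoly) module" where
  "B_free E F = free_alg ({..<dim_row E} \<times> {..<dim_row F})"

definition B_rels :: "'k::field mat \<Rightarrow> 'k mat \<Rightarrow> 'k bpoly set" where
  "B_rels E F = (let m = dim_row E; n = dim_row F; a = gen_mat m n in
     {(const_mat (minv F) * transpose_mat a * const_mat E * a - 1\<^sub>m n) $$ (i, j) | i j. i < n \<and> j < n} \<union>
     {(a * const_mat (minv F) * transpose_mat a * const_mat E - 1\<^sub>m m) $$ (i, j) | i j. i < m \<and> j < m})"

definition B_ideal :: "'k::field mat \<Rightarrow> 'k mat \<Rightarrow> 'k bpoly set" where
  "B_ideal E F = Idl\<^bsub>B_free E F\<^esub> (B_rels E F)"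

definition B_alg :: "'k::field mat \<Rightarrow> 'k mat \<Rightarrow> ('k, 'k belem) module" where
  "B_alg E F = alg_quot (B_free E F) (B_ideal E F)"

definition B_class :: "'k::field mat \<Rightarrow> 'k mat \<Rightarrow> 'k bpoly \<Rightarrow> 'k belem" where
  "B_class E F p = B_ideal E F +>\<^bsub>B_free E F\<^esub> p"

definition B_gen :: "'k::field mat \<Rightarrow> 'k mat \<Rightarrow> nat \<Rightarrow> nat \<Rightarrow> 'k belem" where
  "B_gen E F i j = B_class E F (free_var (i, j))"

text \<open>The algebra morphism from \<open>\<B>(E,F)\<close> to \<open>A\<close> sending the generator \<open>a\<^sub>i\<^sub>j\<close> to \<open>\<phi> i j\<close>.\<close>

definition B_hom ::
    "'k::field mat \<Rightarrow> 'k mat \<Rightarrow> ('k, 'c) module \<Rightarrow> (nat \<Rightarrow> nat \<Rightarrow> 'c) \<Rightarrow> 'k belem \<Rightarrow> 'c" where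
  "B_hom E F A \<phi> = (THE f. f \<in> alg_hom (B_alg E F) A \<and> f \<in> extensional (carrier (B_alg E F)) \<and>
     (\<forall>i<dim_row E. \<forall>j<dim_row F. f (B_gen E F i j) = \<phi> i j))"

text \<open>
  The map with \<open>a\<^sub>i\<^sub>j \<mapsto> \<Sum>k a\<^sub>i\<^sub>k \<otimes> a\<^sub>k\<^sub>j\<close>; it is the coaction of \<open>\<B>(E)\<close> on \<open>\<B>(E,F)\<close> and, for
  \<open>F = E\<close>, the comultiplication of \<open>\<B>(E)\<close>.
\<close>

definition B_coact :: "'k::field mat \<Rightarrow> 'k mat \<Rightarrow> 'k belem \<Rightarrow> ('k, 'k belem, 'k belem) tensor" where
  "B_coact E F = (let T = tensor_alg (B_alg E E) (B_alg E F) in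
     B_hom E F T (\<lambda>i j. \<Oplus>\<^bsub>T\<^esub>k\<in>{..<dim_row E}.
       tens (B_alg E E) (B_alg E F) (B_gen E E i k) (B_gen E F k j)))"

definition B_counit :: "'k::field mat \<Rightarrow> 'k belem \<Rightarrow> 'k" where
  "B_counit E = B_hom E E scalar_alg (\<lambda>i j. if i = j then 1 else 0)"

definition B_antipode :: "'k::field mat \<Rightarrow> 'k belem \<Rightarrow> 'k belem" where
  "B_antipode E = (let a = gen_mat (dim_row E) (dim_row E) in
     B_hom E E (op_alg (B_alg E E))
       (\<lambda>i j. B_class E E ((const_mat (minv E) * transpose_mat a * const_mat E) $$ (i, j))))"

definition B_hopf :: "'k::field mat \<Rightarrow> ('k, 'k belem) hopf" where
  "B_hopf E = module.extend (B_alg E E) (hopf.fields (B_coact E E) (B_counit E) (B_antipode E))"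

definition B_comod :: "'k::field mat \<Rightarrow> 'k mat \<Rightarrow> ('k, 'k belem, 'k belem) comod_alg" where
  "B_comod E F = module.extend (B_alg E F) (comod_alg.fields (B_coact E F))"


section \<open>The parameter set \<open>X(E)\<close>\<close>

definition X0 :: "'k::field mat \<Rightarrow> 'k mat set" where
  "X0 E = {F. \<exists>n\<ge>2. F \<in> GL n \<and> tr (minv E * transpose_mat E) = tr (minv F * transpose_mat F)}"

definition congr_rel :: "'k::field mat \<Rightarrow> ('k mat \<times> 'k mat) set" where
  "congr_rel E = {(F, G). F \<in> X0 E \<and> G \<in> X0 E \<and> dim_row F = dim_row G \<and>
     (\<exists>P\<in>GL (dim_row F). F = P * G * transpose_mat P)}"

definition X :: "'k::field mat \<Rightarrow> 'k mat set set" where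
  "X E = X0 E // congr_rel E"

end

theory Submission
  imports Defs "HOL-Algebra.Algebraic_Closure_Type"
begin

text \<open>
  For matrices \<open>E\<close> and \<open>F\<close> call an \<open>m \<times> n\<close> matrix \<open>a\<close> over an algebra a
  solution for \<open>(E,F)\<close> if \<open>a\<^sup>t E a = F\<close> and \<open>a F\<^sup>-\<^sup>1 a\<^sup>t = E\<^sup>-\<^sup>1\<close>, so that \<open>\<B>(E,F)\<close> carries the universal solution.
  Solutions compose: if \<open>a\<close> solves \<open>(E,F)\<close> and \<open>b\<close> solves \<open>(F,G)\<close>, then \<open>a \<otimes> b\<close> solves \<open>(E,G)\<close>; and the
  inverse of a solution for \<open>(E,F)\<close> is a solution for \<open>(F,E)\<close> in the opposite algebra. The first fact gives
  comultiplication and coaction, the second one the antipode, and both together an inverse of the canonical map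
  of \<open>\<B>(E,F)\<close>. Hence \<open>\<B>(E,F)\<close> is a Galois object as soon as it is nonzero (\<open>B_galois_object\<close>), and every
  colinear algebra morphism from \<open>\<B>(E,F)\<close> to a Galois object is bijective (\<open>B_to_galois_bij\<close>).

  That \<open>\<B>(E,F)\<close> is nonzero for \<open>F \<in> X\<^sub>0(E)\<close> (\<open>B_nonzero\<close>) is a diamond lemma argument. Over an algebraic closure a
  change of bases makes the first diagonal entries of \<open>E\<close> and \<open>F\<^sup>-\<^sup>1\<close> vanish, and the relations become rewriting
  rules for words. Rules at disjoint positions commute, rules at positions shifted by one are compatible because
  \<open>E\<close> and \<open>F\<close> are invertible, and rules at the same position are compatible because of the trace condition. The argument is carried out for scalar functions on words (\<open>contraction_functional_exists\<close>),
  which yields a functional that vanishes on the ideal of relations but not at \<open>1\<close>.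

  Conversely, let \<open>A\<close> be a Galois object. Its coinvariants are the scalars. The preimages of \<open>u\<^sub>i\<^sub>j \<otimes> 1\<close> under
  the canonical map provide columns, that is, tuples with the coaction of a column of generators, and enough of
  them to form a matrix with a right inverse (\<open>enough_columns\<close>). The entries of \<open>a\<^sup>t E a\<close> for a matrix \<open>a\<close> of
  columns are coinvariant, hence scalars; for a minimal such \<open>a\<close> they form an invertible matrix \<open>F\<close>, and \<open>a\<close> is a
  solution for \<open>(E,F)\<close> (\<open>column_solution\<close>). The trace condition then follows from evaluating both relations, and
  \<open>\<B>(E,F) \<rightarrow> A\<close> is an isomorphism. This gives surjectivity.

  For injectivity, every column of \<open>\<B>(E,G)\<close> is a linear combination of the columns of generators
  (\<open>column_expansion\<close>). An isomorphism from \<open>\<B>(E,F)\<close> to \<open>\<B>(E,G)\<close> is thus given on generators by a scalar matrix \<open>P\<close>,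
  and the relations turn this into \<open>F = P\<^sup>t G P\<close>; comparing ranks in both directions shows that \<open>P\<close> is
  square and invertible. The injection \<open>\<iota>\<close> only serves to place copies of the algebras \<open>\<B>(E,F)\<close> into the type over
  which the isomorphism classes are formed.

  Identities between elements of vector spaces, algebras and tensor products are mostly verified after applying
  arbitrary linear functionals, which separate points (\<open>dual_separates\<close>) and turn them into identities between
  finite sums in the field.
\<close>

no_notation Polynomials.var (\<open>X\<index>\<close>)
hide_const (open) Multiset.mult Polynomial.smult

abbreviation "single \<equiv> Poly_Mapping.single"

section \<open>Vector spaces and their linear functionals\<close>

definition kspace :: "('k::field, 'a, 'z) module_scheme => bool" where
 "kspace M \<longleftrightarrow> vectorspace class_ring M"

lemma kspace_module: "kspace M ==> Module.module class_ring M"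
 by (simp add: kspace_def vectorspace_def)

lemma kspace_abelian_group: "kspace M ==> abelian_group M"
 using kspace_module Module.module.axioms(2) by blast

lemma kspaceI:
 fixes M (structure)
 assumes "\<And>x y. x \<in> carrier M ==> y \<in> carrier M ==> x \<oplus> y \<in> carrier M"
  and "\<zero> \<in> carrier M"
  and "\<And>c x. x \<in> carrier M ==> c \<odot> x \<in> carrier M"
  and "\<And>x y z. x \<in> carrier M ==> y \<in> carrier M ==> z \<in> carrier M ==> (x \<oplus> y) \<oplus> z = x \<oplus> (y \<oplus> z)"
  and "\<And>x y. x \<in> carrier M ==> y \<in> carrier M ==> x \<oplus> y = y \<oplus> x"
  and "\<And>x. x \<in> carrier M ==> \<zero> \<oplus> x = x"
  and "\<And>x. x \<in> carrier M ==> 0 \<odot> x = \<zero>"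
  and "\<And>x. x \<in> carrier M ==> 1 \<odot> x = x"
  and "\<And>c d x. x \<in> carrier M ==> (c + d) \<odot> x = c \<odot> x \<oplus> d \<odot> x"
  and "\<And>c x y. x \<in> carrier M ==> y \<in> carrier M ==> c \<odot> (x \<oplus> y) = c \<odot> x \<oplus> c \<odot> y"
  and "\<And>c d x. x \<in> carrier M ==> (c * d) \<odot> x = c \<odot> (d \<odot> x)"
 shows "kspace (M :: ('k::field, 'a, 'z) module_scheme)"
proof -
 have inv: "\<exists>y\<in>carrier M. y \<oplus> x = \<zero>" if x: "x \<in> carrier M" for x
 proof
  show "(-1) \<odot> x \<in> carrier M" using assms(3) x .
  show "(-1) \<odot> x \<oplus> x = \<zero>"
   using assms(9)[OF x, of "-1" 1] assms(7,8)[OF x] by simp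
 qed
 have "abelian_group M"
  by (rule abelian_groupI) (use assms inv in auto)
 moreover have "cring (class_ring :: 'k ring)" ..
 ultimately have "Module.module class_ring M"
  by (intro moduleI) (use assms in auto)
 moreover have "field (class_ring :: 'k ring)" ..
 ultimately show ?thesis by (simp add: kspace_def vectorspace_def)
qed

context
 fixes M :: "('k::field, 'a, 'z) module_scheme" (structure)
 assumes M: "kspace M"
begin

interpretation Module.module class_ring M by (rule kspace_module[OF M])

lemma kspace_zero [simp]: "\<zero> \<in> carrier M"
 by simp

lemma kspace_add [simp]: "x \<in> carrier M ==> y \<in> carrier M ==> x \<oplus> y \<in> carrier M"
 by simp

lemma kspace_smult [simp]: "x \<in> carrier M ==> c \<odot> x \<in> carrier M"
 by (simp add: smult_closed)

lemma kspace_assoc: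
 "x \<in> carrier M ==> y \<in> carrier M ==> z \<in> carrier M ==> (x \<oplus> y) \<oplus> z = x \<oplus> (y \<oplus> z)"
 by (rule a_assoc)

lemma kspace_comm: "x \<in> carrier M ==> y \<in> carrier M ==> x \<oplus> y = y \<oplus> x"
 by (rule a_comm)

lemma kspace_lzero [simp]: "x \<in> carrier M ==> \<zero> \<oplus> x = x"
 by simp

lemma kspace_rzero [simp]: "x \<in> carrier M ==> x \<oplus> \<zero> = x"
 by simp

lemma kspace_smult0 [simp]: "x \<in> carrier M ==> 0 \<odot> x = \<zero>"
 using smult_l_null[of x] by simp

lemma kspace_smult_zero [simp]: "c \<odot> \<zero> = \<zero>"
 using smult_r_null[of c] by simp

lemma kspace_smult1 [simp]: "x \<in> carrier M ==> 1 \<odot> x = x"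
 using smult_one[of x] by simp

lemma kspace_smult_add_left: "x \<in> carrier M ==> (c + d) \<odot> x = c \<odot> x \<oplus> d \<odot> x"
 using smult_l_distr[of c d x] by simp

lemma kspace_smult_add_right:
 "x \<in> carrier M ==> y \<in> carrier M ==> c \<odot> (x \<oplus> y) = c \<odot> x \<oplus> c \<odot> y"
 using smult_r_distr[of c x y] by simp

lemma kspace_smult_smult: "x \<in> carrier M ==> c \<odot> (d \<odot> x) = (c * d) \<odot> x"
 using smult_assoc1[of c d x] by simp

lemma kspace_uminus: "x \<in> carrier M ==> \<ominus> x = (-1) \<odot> x"
 using smult_l_minus[of 1 x] kspace_smult1[of x] by (simp add: class_ring_simps)

lemma kspace_right_minus: "x \<in> carrier M ==> x \<oplus> (-1) \<odot> x = \<zero>"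
 using r_neg[of x] by (simp add: kspace_uminus)

lemma kspace_eq_if_diff_zero:
 assumes "x \<in> carrier M" "y \<in> carrier M" "x \<oplus> (-1) \<odot> y = \<zero>"
 shows "x = y"
proof -
 have "x = x \<oplus> ((-1) \<odot> y \<oplus> y)"
  using assms(1,2) kspace_comm[of "(-1) \<odot> y" y] kspace_right_minus[of y] by simp
 also have "... = y" using assms kspace_assoc[of x "(-1) \<odot> y" y] by simp
 finally show ?thesis .
qed

lemma kspace_finsum [simp]:
 "(\<And>i. i \<in> I ==> f i \<in> carrier M) ==> finsum M f I \<in> carrier M"
 by (rule finsum_closed) auto

lemma kspace_finsum_insert:
 "finite I ==> i \<notin> I ==> (\<And>j. j \<in> insert i I ==> f j \<in> carrier M) ==>
   finsum M f (insert i I) = f i \<oplus> finsum M f I"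
 by (rule finsum_insert) auto

lemma kspace_finsum_empty [simp]: "finsum M f {} = \<zero>"
 by simp

lemma kspace_finsum_cong:
 "I = J ==> (\<And>i. i \<in> J ==> f i = g i) ==> (\<And>i. i \<in> J ==> g i \<in> carrier M) ==>
   finsum M f I = finsum M g J"
 by (rule finsum_cong') auto

end

text \<open>
 Linear functionals separate the points of a vector space. Every identity between finite linear
 combinations can therefore be checked after applying an arbitrary functional, where it becomes an
 identity between ordinary sums in the field.
\<close>

definition dual :: "('k::field, 'a, 'z) module_scheme => ('a => 'k) set" where
 "dual M = {\<phi>. (\<forall>x\<in>carrier M. \<forall>y\<in>carrier M. \<phi> (x \<oplus>\<^bsub>M\<^esub> y) = \<phi> x + \<phi> y) \<and>
        (\<forall>c. \<forall>x\<in>carrier M. \<phi> (c \<odot>\<^bsub>M\<^esub> x) = c * \<phi> x)}"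

lemma dualI:
 "(\<And>x y. x \<in> carrier M ==> y \<in> carrier M ==> \<phi> (x \<oplus>\<^bsub>M\<^esub> y) = \<phi> x + \<phi> y) ==>
  (\<And>c x. x \<in> carrier M ==> \<phi> (c \<odot>\<^bsub>M\<^esub> x) = c * \<phi> x) ==> \<phi> \<in> dual M"
 by (simp add: dual_def)

lemma dual_add [simp]:
 "\<phi> \<in> dual M ==> x \<in> carrier M ==> y \<in> carrier M ==> \<phi> (x \<oplus>\<^bsub>M\<^esub> y) = \<phi> x + \<phi> y"
 by (simp add: dual_def)

lemma dual_smult [simp]: "\<phi> \<in> dual M ==> x \<in> carrier M ==> \<phi> (c \<odot>\<^bsub>M\<^esub> x) = c * \<phi> x"
 by (simp add: dual_def)

lemma dual_zero [simp]: "kspace M ==> \<phi> \<in> dual M ==> \<phi> \<zero>\<^bsub>M\<^esub> = 0"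
 using dual_smult[of \<phi> M "\<zero>\<^bsub>M\<^esub>" 0] by simp

lemma dual_finsum:
 assumes "kspace M" "\<phi> \<in> dual M" "finite I" "\<And>i. i \<in> I ==> f i \<in> carrier M"
 shows "\<phi> (finsum M f I) = (\<Sum>i\<in>I. \<phi> (f i))"
 using assms(3,4)
proof (induction I rule: finite_induct)
 case empty
 then show ?case using assms by simp
next
 case (insert i I)
 then show ?case using assms by (subst kspace_finsum_insert) auto
qed

lemma dual_finsum_lessThan [simp]:
 "kspace M ==> \<phi> \<in> dual M ==> (\<And>i. i < (n::nat) ==> f i \<in> carrier M) ==>
   \<phi> (finsum M f {..<n}) = (\<Sum>i<n. \<phi> (f i))"
 by (rule dual_finsum) auto

text \<open>
 A subspace that is maximal among those avoiding a given nonzero vector is a hyperplane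
 complementary to that vector, and the coordinate along the vector is the required functional.
\<close>

lemma dual_separates:
 fixes M :: "('k::field, 'a, 'z) module_scheme" (structure)
 assumes M: "kspace M" and x: "x \<in> carrier M" "x \<noteq> \<zero>"
 shows "\<exists>\<phi>\<in>dual M. \<phi> x = 1"
proof -
 define sub where "sub W \<longleftrightarrow> W \<subseteq> carrier M \<and> \<zero> \<in> W \<and> (\<forall>u\<in>W. \<forall>v\<in>W. u \<oplus> v \<in> W) \<and>
  (\<forall>c. \<forall>u\<in>W. c \<odot> u \<in> W)" for W
 define \<A> where "\<A> = {W. sub W \<and> x \<notin> W}"
 have "\<exists>W\<in>\<A>. \<forall>X\<in>\<A>. W \<subseteq> X --> X = W"
 proof (rule subset_Zorn_nonempty)
  have "{\<zero>} \<in> \<A>" using x M by (auto simp: \<A>_def sub_def)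
  then show "\<A> \<noteq> {}" by blast
  fix C assume C: "C \<noteq> {}" "subset.chain \<A> C"
  then have CA: "C \<subseteq> \<A>" and ch: "\<And>X Y. X \<in> C ==> Y \<in> C ==> X \<subseteq> Y \<or> Y \<subseteq> X"
   by (auto simp: subset_chain_def)
  have "sub (\<Union>C)"
   unfolding sub_def
  proof (intro conjI ballI allI)
   show "\<Union>C \<subseteq> carrier M" "\<zero> \<in> \<Union>C" using CA C(1) by (auto simp: \<A>_def sub_def)
   fix u v assume "u \<in> \<Union>C" "v \<in> \<Union>C"
   then obtain X Y where XY: "X \<in> C" "Y \<in> C" "u \<in> X" "v \<in> Y" by auto
   have su: "sub X" "sub Y" using XY CA by (auto simp: \<A>_def)
   show "u \<oplus> v \<in> \<Union>C"
    using ch[OF XY(1,2)] XY su unfolding sub_def by (meson UnionI subsetD)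
  next
   fix c u assume "u \<in> \<Union>C"
   then show "c \<odot> u \<in> \<Union>C" using CA by (auto simp: \<A>_def sub_def)
  qed
  moreover have "x \<notin> \<Union>C" using CA by (auto simp: \<A>_def)
  ultimately show "\<Union>C \<in> \<A>" by (simp add: \<A>_def)
 qed
 then obtain W where W: "sub W" "x \<notin> W" and max: "\<And>X. sub X ==> x \<notin> X ==> W \<subseteq> X ==> X = W"
  by (auto simp: \<A>_def)
 note Wd = W(1)[unfolded sub_def]
 have Wc: "u \<in> carrier M" if "u \<in> W" for u using that Wd by auto
 have ex: "\<exists>c. y \<oplus> (- c) \<odot> x \<in> W" if y: "y \<in> carrier M" for y
 proof (cases "y \<in> W")
  case True
  then show ?thesis using y x M by (intro exI[of _ 0]) simp
 next
  case False
  define X where "X = {u \<oplus> c \<odot> y | u c. u \<in> W}"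
  have "sub X"
   unfolding sub_def
  proof (intro conjI ballI allI)
   show "X \<subseteq> carrier M" using Wd y M by (auto simp: X_def)
   show "\<zero> \<in> X" unfolding X_def using Wd y M by (auto intro!: exI[of _ "\<zero>"] exI[of _ 0])
   fix u v assume "u \<in> X" "v \<in> X"
   then obtain u' c v' d where uv: "u = u' \<oplus> c \<odot> y" "v = v' \<oplus> d \<odot> y" "u' \<in> W" "v' \<in> W"
    by (auto simp: X_def)
   have "u \<oplus> v = (u' \<oplus> v') \<oplus> (c + d) \<odot> y"
    unfolding uv using Wc uv(3,4) y M kspace_abelian_group[OF M]
    by (simp add: kspace_smult_add_left abelian_group.a_group abelian_monoid.a_ac
       abelian_group.axioms(1))
   then show "u \<oplus> v \<in> X" unfolding X_def using uv(3,4) Wd by blast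
  next
   fix e u assume "u \<in> X"
   then obtain u' c where uv: "u = u' \<oplus> c \<odot> y" "u' \<in> W" by (auto simp: X_def)
   have "e \<odot> u = e \<odot> u' \<oplus> (e * c) \<odot> y"
    unfolding uv using Wc uv y M by (simp add: kspace_smult_add_right kspace_smult_smult)
   then show "e \<odot> u \<in> X" unfolding X_def using uv Wd by blast
  qed
  moreover have "W \<subseteq> X"
  proof
   fix u assume "u \<in> W"
   then have "u = u \<oplus> 0 \<odot> y" using Wc y M by simp
   then show "u \<in> X" unfolding X_def using \<open>u \<in> W\<close> by blast
  qed
  moreover have "y \<in> X"
  proof -
   have "y = \<zero> \<oplus> 1 \<odot> y" using y M by simp
   then show ?thesis unfolding X_def using Wd by blast
  qed
  ultimately have "x \<in> X" using max False by auto
  then obtain u c where uc: "x = u \<oplus> c \<odot> y" "u \<in> W" by (auto simp: X_def)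
  have "c \<noteq> 0" using uc W(2) Wc y M by auto
  have "y \<oplus> (- inverse c) \<odot> x = (- inverse c) \<odot> u"
  proof -
   have uM: "u \<in> carrier M" using Wc uc by simp
   have "(- inverse c) \<odot> x = (- inverse c) \<odot> u \<oplus> (-1) \<odot> y"
    unfolding uc(1) using uM y M \<open>c \<noteq> 0\<close>
    by (simp add: kspace_smult_add_right kspace_smult_smult)
   then have "y \<oplus> (- inverse c) \<odot> x = (- inverse c) \<odot> u \<oplus> (y \<oplus> (-1) \<odot> y)"
    using uM y M kspace_abelian_group[OF M]
    by (simp add: abelian_monoid.a_ac abelian_group.axioms(1))
   then show ?thesis using uM y M by (simp add: kspace_right_minus)
  qed
  then show ?thesis using uc Wd by metis
 qed
 have uniq: "c = d" if "y \<in> carrier M" "y \<oplus> (- c) \<odot> x \<in> W" "y \<oplus> (- d) \<odot> x \<in> W" for y c d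
 proof (rule ccontr)
  assume "c \<noteq> d"
  have "(y \<oplus> (- d) \<odot> x) \<oplus> (-1) \<odot> (y \<oplus> (- c) \<odot> x) \<in> W"
   using that Wd by blast
  also have "(y \<oplus> (- d) \<odot> x) \<oplus> (-1) \<odot> (y \<oplus> (- c) \<odot> x) = (y \<oplus> (-1) \<odot> y) \<oplus> (c - d) \<odot> x"
   using kspace_smult_add_left[OF M x(1), of c "-d"] that x M kspace_abelian_group[OF M]
   by (simp add: kspace_smult_add_right kspace_smult_smult
      abelian_monoid.a_ac abelian_group.axioms(1))
  also have "... = (c - d) \<odot> x" using that x M by (simp add: kspace_right_minus)
  finally have "inverse (c - d) \<odot> ((c - d) \<odot> x) \<in> W" using Wd by blast
  then show False using \<open>c \<noteq> d\<close> x M W(2) by (simp add: kspace_smult_smult)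
 qed
 define \<phi> where "\<phi> y = (THE c. y \<oplus> (- c) \<odot> x \<in> W)" for y
 have \<phi>: "\<phi> y = c" if "y \<in> carrier M" "y \<oplus> (- c) \<odot> x \<in> W" for y c
  unfolding \<phi>_def using that uniq by blast
 have \<phi>W: "y \<oplus> (- \<phi> y) \<odot> x \<in> W" if "y \<in> carrier M" for y
  using ex[OF that] \<phi>[OF that] by metis
 have "\<phi> \<in> dual M"
 proof (rule dualI)
  fix y z assume yz: "y \<in> carrier M" "z \<in> carrier M"
  have "(y \<oplus> (- \<phi> y) \<odot> x) \<oplus> (z \<oplus> (- \<phi> z) \<odot> x) \<in> W" using \<phi>W yz Wd by blast
  also have "(y \<oplus> (- \<phi> y) \<odot> x) \<oplus> (z \<oplus> (- \<phi> z) \<odot> x) = (y \<oplus> z) \<oplus> (- (\<phi> y + \<phi> z)) \<odot> x"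
   using kspace_smult_add_left[OF M x(1), of "- \<phi> y" "- \<phi> z"] yz x M kspace_abelian_group[OF M]
   by (simp add: abelian_monoid.a_ac abelian_group.axioms(1))
  finally show "\<phi> (y \<oplus> z) = \<phi> y + \<phi> z" using \<phi> yz M by simp
 next
  fix c y assume y: "y \<in> carrier M"
  have "c \<odot> (y \<oplus> (- \<phi> y) \<odot> x) \<in> W" using \<phi>W y Wd by blast
  also have "c \<odot> (y \<oplus> (- \<phi> y) \<odot> x) = c \<odot> y \<oplus> (- (c * \<phi> y)) \<odot> x"
   using y x M by (simp add: kspace_smult_add_right kspace_smult_smult)
  finally show "\<phi> (c \<odot> y) = c * \<phi> y" using \<phi> y M by simp
 qed
 moreover have "\<phi> x = 1"
  by (rule \<phi>) (use x M Wd in \<open>simp_all add: kspace_right_minus\<close>)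
 ultimately show ?thesis by blast
qed

lemma kspace_eqI:
 fixes M :: "('k::field, 'a, 'z) module_scheme" (structure)
 assumes M: "kspace M" and xy: "x \<in> carrier M" "y \<in> carrier M"
  and eq: "\<And>\<phi>. \<phi> \<in> dual M ==> \<phi> x = \<phi> y"
 shows "x = y"
proof (rule kspace_eq_if_diff_zero[OF M xy], rule ccontr)
 assume "x \<oplus> (-1) \<odot> y \<noteq> \<zero>"
 then obtain \<phi> where "\<phi> \<in> dual M" "\<phi> (x \<oplus> (-1) \<odot> y) = 1"
  using dual_separates[OF M, of "x \<oplus> (-1) \<odot> y"] M xy by auto
 then show False using eq[of \<phi>] xy M by simp
qed

section \<open>Linear maps\<close>

lemma lin_homI:
 assumes "\<And>x. x \<in> carrier M ==> f x \<in> carrier N"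
  and "\<And>x y. x \<in> carrier M ==> y \<in> carrier M ==> f (x \<oplus>\<^bsub>M\<^esub> y) = f x \<oplus>\<^bsub>N\<^esub> f y"
  and "\<And>c x. x \<in> carrier M ==> f (c \<odot>\<^bsub>M\<^esub> x) = c \<odot>\<^bsub>N\<^esub> f x"
 shows "f \<in> lin_hom M N"
 using assms by (auto simp: LinearCombinations.module_hom_def)

lemma lin_hom_closed [simp]: "f \<in> lin_hom M N ==> x \<in> carrier M ==> f x \<in> carrier N"
 using LinearCombinations.module_hom_closed by fast

lemma lin_hom_add [simp]:
 "f \<in> lin_hom M N ==> x \<in> carrier M ==> y \<in> carrier M ==> f (x \<oplus>\<^bsub>M\<^esub> y) = f x \<oplus>\<^bsub>N\<^esub> f y"
 by (rule LinearCombinations.module_hom_add)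

lemma lin_hom_smult [simp]:
 "f \<in> lin_hom M N ==> x \<in> carrier M ==> f (c \<odot>\<^bsub>M\<^esub> x) = c \<odot>\<^bsub>N\<^esub> f x"
 by (rule LinearCombinations.module_hom_smult) auto

lemma lin_hom_zero [simp]:
 "kspace M ==> kspace N ==> f \<in> lin_hom M N ==> f \<zero>\<^bsub>M\<^esub> = \<zero>\<^bsub>N\<^esub>"
 using lin_hom_smult[of f M N "\<zero>\<^bsub>M\<^esub>" 0] by simp

lemma lin_hom_finsum:
 assumes "kspace M" "kspace N" "f \<in> lin_hom M N" "finite I" "\<And>i. i \<in> I ==> g i \<in> carrier M"
 shows "f (finsum M g I) = finsum N (\<lambda>i. f (g i)) I"
 using assms(4,5)
proof (induction I rule: finite_induct)
 case empty
 then show ?case using assms by simp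
next
 case (insert i I)
 then have "f (finsum M g (insert i I)) = f (g i) \<oplus>\<^bsub>N\<^esub> finsum N (\<lambda>i. f (g i)) I"
  using assms(1-3) by (subst kspace_finsum_insert) auto
 also have "... = finsum N (\<lambda>i. f (g i)) (insert i I)"
  using insert assms(1-3) by (subst kspace_finsum_insert) auto
 finally show ?case .
qed

lemma lin_hom_finsum_lessThan [simp]:
 "kspace M ==> kspace N ==> f \<in> lin_hom M N ==> (\<And>i. i < (n::nat) ==> g i \<in> carrier M) ==>
  f (finsum M g {..<n}) = finsum N (\<lambda>i. f (g i)) {..<n}"
 by (rule lin_hom_finsum) auto

lemma lin_hom_id [simp]: "id \<in> lin_hom M M" "(\<lambda>x. x) \<in> lin_hom M M"
 by (auto intro!: lin_homI)

lemma lin_hom_comp: "f \<in> lin_hom M N ==> g \<in> lin_hom N P ==> (\<lambda>x. g (f x)) \<in> lin_hom M P"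
 by (auto intro!: lin_homI)

lemma dual_comp: "f \<in> lin_hom M N ==> \<phi> \<in> dual N ==> (\<lambda>x. \<phi> (f x)) \<in> dual M"
 by (auto intro!: dualI)

lemma inv_into_lin_hom:
 assumes "kspace M" "kspace N" "f \<in> lin_hom M N" "bij_betw f (carrier M) (carrier N)"
 shows "inv_into (carrier M) f \<in> lin_hom N M"
proof (rule lin_homI)
 let ?g = "inv_into (carrier M) f"
 have g: "?g y \<in> carrier M" "f (?g y) = y" if "y \<in> carrier N" for y
  using assms(4) that by (auto simp: bij_betw_def inv_into_into f_inv_into_f)
 have gf: "?g (f x) = x" if "x \<in> carrier M" for x
  using assms(4) that by (simp add: bij_betw_def)
 show "?g y \<in> carrier M" if "y \<in> carrier N" for y using g that by simp
 show "?g (x \<oplus>\<^bsub>N\<^esub> y) = ?g x \<oplus>\<^bsub>M\<^esub> ?g y" if "x \<in> carrier N" "y \<in> carrier N" for x y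
  using gf[of "?g x \<oplus>\<^bsub>M\<^esub> ?g y"] g that assms by simp
 show "?g (c \<odot>\<^bsub>N\<^esub> x) = c \<odot>\<^bsub>M\<^esub> ?g x" if "x \<in> carrier N" for c x
  using gf[of "c \<odot>\<^bsub>M\<^esub> ?g x"] g that assms by simp
qed

lemma kspace_image:
 fixes M :: "('k::field, 'a, 'y) module_scheme" and N :: "('k, 'b, 'z) module_scheme"
 assumes M: "kspace M" and f: "f \<in> lin_hom M N" "f ` carrier M = carrier N" "f \<zero>\<^bsub>M\<^esub> = \<zero>\<^bsub>N\<^esub>"
 shows "kspace N"
proof -
 have [simp]: "f x \<oplus>\<^bsub>N\<^esub> f y = f (x \<oplus>\<^bsub>M\<^esub> y)" if "x \<in> carrier M" "y \<in> carrier M" for x y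
  using f that by simp
 have [simp]: "c \<odot>\<^bsub>N\<^esub> f x = f (c \<odot>\<^bsub>M\<^esub> x)" if "x \<in> carrier M" for x c
  using f that by simp
 note lin_hom_add[simp del] lin_hom_smult[simp del]
 have ab: "abelian_monoid M" using kspace_abelian_group[OF M] by (simp add: abelian_group_def)
 show ?thesis
  by (rule kspaceI) (use M in \<open>auto simp: f(3)[symmetric] abelian_monoid.a_ac[OF ab]
   kspace_smult_add_left kspace_smult_add_right kspace_smult_smult f(2)[symmetric]\<close>)
qed

section \<open>Algebras\<close>

lemma k_algebra_kspace [simp]: "k_algebra A ==> kspace A"
 by (simp add: k_algebra_def kspace_def)

lemma k_algebra_ring: "k_algebra A ==> ring A"
 by (simp add: k_algebra_def)

lemma k_algebraI:
 fixes A (structure)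
 assumes A: "kspace A"
  and "\<And>x y. x \<in> carrier A ==> y \<in> carrier A ==> x \<otimes> y \<in> carrier A"
  and "\<one> \<in> carrier A"
  and "\<And>x y z. x \<in> carrier A ==> y \<in> carrier A ==> z \<in> carrier A ==> (x \<otimes> y) \<otimes> z = x \<otimes> (y \<otimes> z)"
  and "\<And>x. x \<in> carrier A ==> \<one> \<otimes> x = x" and "\<And>x. x \<in> carrier A ==> x \<otimes> \<one> = x"
  and "\<And>x y z. x \<in> carrier A ==> y \<in> carrier A ==> z \<in> carrier A ==> (x \<oplus> y) \<otimes> z = x \<otimes> z \<oplus> y \<otimes> z"
  and "\<And>x y z. x \<in> carrier A ==> y \<in> carrier A ==> z \<in> carrier A ==> z \<otimes> (x \<oplus> y) = z \<otimes> x \<oplus> z \<otimes> y"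
  and "\<And>c x y. x \<in> carrier A ==> y \<in> carrier A ==> (c \<odot> x) \<otimes> y = c \<odot> (x \<otimes> y)"
  and "\<And>c x y. x \<in> carrier A ==> y \<in> carrier A ==> x \<otimes> (c \<odot> y) = c \<odot> (x \<otimes> y)"
 shows "k_algebra (A :: ('k::field, 'a, 'z) module_scheme)"
proof -
 have "ring A"
  by (rule ringI, rule kspace_abelian_group[OF A], rule monoidI) (use assms in auto)
 then show ?thesis using assms by (auto simp: k_algebra_def kspace_def)
qed

context
 fixes A :: "('k::field, 'a, 'z) module_scheme" (structure)
 assumes A: "k_algebra A"
begin

interpretation ring A by (rule k_algebra_ring[OF A])

lemma k_algebra_mult [simp]: "x \<in> carrier A ==> y \<in> carrier A ==> x \<otimes> y \<in> carrier A"
 by simp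
lemma k_algebra_one [simp]: "\<one> \<in> carrier A"
 by simp
lemma k_algebra_assoc:
 "x \<in> carrier A ==> y \<in> carrier A ==> z \<in> carrier A ==> (x \<otimes> y) \<otimes> z = x \<otimes> (y \<otimes> z)"
 by (rule m_assoc)
lemma k_algebra_lone [simp]: "x \<in> carrier A ==> \<one> \<otimes> x = x"
 by simp
lemma k_algebra_rone [simp]: "x \<in> carrier A ==> x \<otimes> \<one> = x"
 by simp
lemma k_algebra_add_mult:
 "x \<in> carrier A ==> y \<in> carrier A ==> z \<in> carrier A ==> (x \<oplus> y) \<otimes> z = x \<otimes> z \<oplus> y \<otimes> z"
 by (rule l_distr)
lemma k_algebra_mult_add:
 "x \<in> carrier A ==> y \<in> carrier A ==> z \<in> carrier A ==> z \<otimes> (x \<oplus> y) = z \<otimes> x \<oplus> z \<otimes> y"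
 by (rule r_distr)
lemma k_algebra_smult_mult [simp]:
 "x \<in> carrier A ==> y \<in> carrier A ==> (c \<odot> x) \<otimes> y = c \<odot> (x \<otimes> y)"
 using A by (simp add: k_algebra_def)
lemma k_algebra_mult_smult [simp]:
 "x \<in> carrier A ==> y \<in> carrier A ==> x \<otimes> (c \<odot> y) = c \<odot> (x \<otimes> y)"
 using A by (simp add: k_algebra_def)

lemma lin_hom_mult_left: "a \<in> carrier A ==> (\<lambda>x. a \<otimes> x) \<in> lin_hom A A"
 using A by (intro lin_homI) (auto simp: r_distr)
lemma lin_hom_mult_right: "a \<in> carrier A ==> (\<lambda>x. x \<otimes> a) \<in> lin_hom A A"
 using A by (intro lin_homI) (auto simp: l_distr)

end

lemma k_algebra_image:
 fixes A :: "('k::field, 'a, 'y) module_scheme" (structure) and B :: "('k, 'b, 'z) module_scheme"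
 assumes A: "k_algebra A" and f: "f \<in> lin_hom A B" "f ` carrier A = carrier B" "f \<zero> = \<zero>\<^bsub>B\<^esub>"
  and m: "\<And>x y. x \<in> carrier A ==> y \<in> carrier A ==> f (x \<otimes> y) = f x \<otimes>\<^bsub>B\<^esub> f y"
  and o: "f \<one> = \<one>\<^bsub>B\<^esub>"
 shows "k_algebra B"
proof -
 have [simp]: "f x \<oplus>\<^bsub>B\<^esub> f y = f (x \<oplus> y)" if "x \<in> carrier A" "y \<in> carrier A" for x y
  using f that by simp
 have [simp]: "c \<odot>\<^bsub>B\<^esub> f x = f (c \<odot> x)" if "x \<in> carrier A" for x c
  using f that by simp
 note lin_hom_add[simp del] lin_hom_smult[simp del]
 show ?thesis
  by (rule k_algebraI, rule kspace_image[OF _ f])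
   (use A in \<open>auto simp: o[symmetric] k_algebra_assoc k_algebra_add_mult k_algebra_mult_add
    m[symmetric] f(2)[symmetric]\<close>)
qed

lemma alg_homI:
 assumes "f \<in> lin_hom A B"
  and "\<And>x y. x \<in> carrier A ==> y \<in> carrier A ==> f (x \<otimes>\<^bsub>A\<^esub> y) = f x \<otimes>\<^bsub>B\<^esub> f y"
  and "f \<one>\<^bsub>A\<^esub> = \<one>\<^bsub>B\<^esub>"
 shows "f \<in> alg_hom A B"
 using assms by (auto simp: alg_hom_def Ring.ring_hom_def)

lemma alg_hom_lin [simp]: "f \<in> alg_hom A B ==> f \<in> lin_hom A B"
 by (simp add: alg_hom_def)
lemma alg_hom_closed [simp]: "f \<in> alg_hom A B ==> x \<in> carrier A ==> f x \<in> carrier B"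
 by (rule lin_hom_closed[OF alg_hom_lin])
lemma alg_hom_add [simp]:
 "f \<in> alg_hom A B ==> x \<in> carrier A ==> y \<in> carrier A ==> f (x \<oplus>\<^bsub>A\<^esub> y) = f x \<oplus>\<^bsub>B\<^esub> f y"
 by (rule lin_hom_add[OF alg_hom_lin])
lemma alg_hom_smult [simp]:
 "f \<in> alg_hom A B ==> x \<in> carrier A ==> f (c \<odot>\<^bsub>A\<^esub> x) = c \<odot>\<^bsub>B\<^esub> f x"
 by (rule lin_hom_smult[OF alg_hom_lin])
lemma alg_hom_mult [simp]:
 "f \<in> alg_hom A B ==> x \<in> carrier A ==> y \<in> carrier A ==> f (x \<otimes>\<^bsub>A\<^esub> y) = f x \<otimes>\<^bsub>B\<^esub> f y"
 unfolding alg_hom_def by (rule Ring.ring_hom_mult) auto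
lemma alg_hom_one [simp]: "f \<in> alg_hom A B ==> f \<one>\<^bsub>A\<^esub> = \<one>\<^bsub>B\<^esub>"
 unfolding alg_hom_def by (rule Ring.ring_hom_one) auto
lemma alg_hom_comp: "f \<in> alg_hom A B ==> g \<in> alg_hom B C ==> (\<lambda>x. g (f x)) \<in> alg_hom A C"
 by (rule alg_homI, rule lin_hom_comp[of _ A B]) auto

section \<open>Quotients and free vector spaces\<close>

definition ksubspace :: "'a set => ('k::field, 'a, 'z) module_scheme => bool" where
 "ksubspace I M \<longleftrightarrow> I \<subseteq> carrier M \<and> \<zero>\<^bsub>M\<^esub> \<in> I \<and> (\<forall>u\<in>I. \<forall>v\<in>I. u \<oplus>\<^bsub>M\<^esub> v \<in> I) \<and>
  (\<forall>c. \<forall>u\<in>I. c \<odot>\<^bsub>M\<^esub> u \<in> I)"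

lemma alg_quot_sel:
 "add (alg_quot A I) = set_add A" "zero (alg_quot A I) = I"
 "carrier (alg_quot A I) = a_rcosets\<^bsub>A\<^esub> I"
 "one (alg_quot A I) = I +>\<^bsub>A\<^esub> \<one>\<^bsub>A\<^esub>" "mult (alg_quot A I) = rcoset_mult A I"
 "smult (alg_quot A I) = (\<lambda>c X. \<Union>x\<in>X. I +>\<^bsub>A\<^esub> (c \<odot>\<^bsub>A\<^esub> x))"
 by (simp_all add: alg_quot_def ring.defs module.defs FactRing_def)

context
 fixes M :: "('k::field, 'a) module" (structure) and I
 assumes M: "kspace M" and I: "ksubspace I M"
begin

lemma ksubspace_carrier: "u \<in> I ==> u \<in> carrier M"
 using I by (auto simp: ksubspace_def)

lemma ksubspace_abelian_subgroup: "abelian_subgroup I M"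
proof (rule abelian_subgroupI3)
 show "abelian_group M" by (rule kspace_abelian_group[OF M])
 then interpret abelian_group M .
 have "\<ominus> u \<in> I" if "u \<in> I" for u
  using that ksubspace_carrier[OF that] I M by (simp add: kspace_uminus ksubspace_def)
 moreover have "inv\<^bsub>add_monoid M\<^esub> u = \<ominus> u" for u by (simp add: a_inv_def)
 ultimately show "additive_subgroup I M"
  using I by unfold_locales (auto simp: ksubspace_def)
qed

declare ksubspace_carrier [simp]
interpretation abelian_subgroup I M by (rule ksubspace_abelian_subgroup)

lemma mem_coset_iff:
 assumes x: "x \<in> carrier M"
 shows "z \<in> I +> x \<longleftrightarrow> z \<in> carrier M \<and> z \<oplus> (-1) \<odot> x \<in> I"
proof
 assume "z \<in> I +> x"
 then obtain h where h: "h \<in> I" "z = h \<oplus> x" by (auto simp: a_r_coset_def')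
 have "z \<oplus> (-1) \<odot> x = h \<oplus> (x \<oplus> (-1) \<odot> x)"
  unfolding h using x h M by (simp add: kspace_assoc)
 then show "z \<in> carrier M \<and> z \<oplus> (-1) \<odot> x \<in> I"
  using h x M by (simp add: kspace_right_minus)
next
 assume z: "z \<in> carrier M \<and> z \<oplus> (-1) \<odot> x \<in> I"
 have "z = (z \<oplus> (-1) \<odot> x) \<oplus> x"
  using z x M kspace_comm[OF M, of "(-1) \<odot> x" x] by (simp add: kspace_assoc kspace_right_minus)
 then show "z \<in> I +> x" using z by (auto simp: a_r_coset_def')
qed

lemma coset_eq_iff:
 assumes x: "x \<in> carrier M" and y: "y \<in> carrier M"
 shows "I +> x = I +> y \<longleftrightarrow> x \<oplus> (-1) \<odot> y \<in> I"
proof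
 assume "I +> x = I +> y"
 moreover have "x \<in> I +> x" using x by (rule a_rcos_self)
 ultimately show "x \<oplus> (-1) \<odot> y \<in> I" using mem_coset_iff[OF y] by blast
next
 assume "x \<oplus> (-1) \<odot> y \<in> I"
 then have "x \<in> I +> y" using mem_coset_iff[OF y] x by blast
 then show "I +> x = I +> y" using a_repr_independence[OF _ y a_subgroup] by simp
qed

lemma quot_carrier: "carrier (alg_quot M I) = (\<lambda>x. I +> x) ` carrier M"
 by (auto simp: alg_quot_sel A_RCOSETS_def')

lemma coset_smult:
 assumes x: "x \<in> carrier M"
 shows "(\<Union>y\<in>I +> x. I +> (c \<odot> y)) = I +> (c \<odot> x)"
proof -
 have eq: "I +> (c \<odot> y) = I +> (c \<odot> x)" if "y \<in> I +> x" for y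
 proof -
  have y: "y \<in> carrier M" "y \<oplus> (-1) \<odot> x \<in> I" using that mem_coset_iff[OF x] by auto
  have "c \<odot> y \<oplus> (-1) \<odot> (c \<odot> x) = c \<odot> (y \<oplus> (-1) \<odot> x)"
   using x y M by (simp add: kspace_smult_add_right kspace_smult_smult)
  then have "c \<odot> y \<oplus> (-1) \<odot> (c \<odot> x) \<in> I" using y I by (simp add: ksubspace_def)
  then show ?thesis using coset_eq_iff x y M by simp
 qed
 have "I +> x \<noteq> {}" using a_rcos_self[OF x] by blast
 moreover have "(\<Union>y\<in>I +> x. I +> (c \<odot> y)) = (\<Union>y\<in>I +> x. I +> (c \<odot> x))"
  by (rule SUP_cong) (auto dest: eq)
 ultimately show ?thesis by auto
qed

lemma coset_lin_hom: "(\<lambda>x. I +> x) \<in> lin_hom M (alg_quot M I)"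
 by (rule lin_homI) (auto simp: quot_carrier, simp_all add: alg_quot_sel a_rcos_sum coset_smult)

lemma coset_zero: "I +> \<zero> = \<zero>\<^bsub>alg_quot M I\<^esub>"
proof -
 have "I +> \<zero> = I" by (rule a_coset_join2[OF _ a_subgroup]) (use M I in \<open>auto simp: ksubspace_def\<close>)
 then show ?thesis by (simp add: alg_quot_sel)
qed

lemma kspace_quot: "kspace (alg_quot M I)"
 by (rule kspace_image[OF M coset_lin_hom quot_carrier[symmetric] coset_zero])

declare ksubspace_carrier [simp del]

lemma quot_lift:
 fixes P :: "('k, 'b, 'y) module_scheme"
 assumes P: "kspace P" and f: "f \<in> lin_hom M P" and 0: "\<And>x. x \<in> I ==> f x = \<zero>\<^bsub>P\<^esub>"
 shows "\<exists>g\<in>lin_hom (alg_quot M I) P. \<forall>x\<in>carrier M. g (I +> x) = f x"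
proof -
 define g where "g X = f (SOME x. x \<in> carrier M \<and> X = I +> x)" for X
 have g: "g (I +> x) = f x" if x: "x \<in> carrier M" for x
 proof -
  let ?y = "SOME y. y \<in> carrier M \<and> I +> x = I +> y"
  have y: "?y \<in> carrier M \<and> I +> x = I +> ?y" by (rule someI[of _ x]) (use x in auto)
  then have "x \<oplus> (-1) \<odot> ?y \<in> I" using coset_eq_iff x by blast
  then have "f x \<oplus>\<^bsub>P\<^esub> (-1) \<odot>\<^bsub>P\<^esub> f ?y = \<zero>\<^bsub>P\<^esub>" using 0 f x y M by force
  then have "f x = f ?y" using kspace_eq_if_diff_zero[OF P, of "f x" "f ?y"] f x y by simp
  then show ?thesis by (simp add: g_def)
 qed
 have "g \<in> lin_hom (alg_quot M I) P"
 proof (rule lin_homI)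
  show "g X \<in> carrier P" if "X \<in> carrier (alg_quot M I)" for X
   using that f by (auto simp: quot_carrier g)
  show "g (X \<oplus>\<^bsub>alg_quot M I\<^esub> Y) = g X \<oplus>\<^bsub>P\<^esub> g Y"
   if X: "X \<in> carrier (alg_quot M I)" and Y: "Y \<in> carrier (alg_quot M I)" for X Y
  proof -
   obtain x y where xy: "X = I +> x" "Y = I +> y" "x \<in> carrier M" "y \<in> carrier M"
    using X Y by (auto simp: quot_carrier)
   then have "X \<oplus>\<^bsub>alg_quot M I\<^esub> Y = I +> (x \<oplus> y)"
    using lin_hom_add[OF coset_lin_hom, of x y] by simp
   then show ?thesis using xy f M by (simp add: g)
  qed
  show "g (c \<odot>\<^bsub>alg_quot M I\<^esub> X) = c \<odot>\<^bsub>P\<^esub> g X" if X: "X \<in> carrier (alg_quot M I)" for c X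
  proof -
   obtain x where xy: "X = I +> x" "x \<in> carrier M"
    using X by (auto simp: quot_carrier)
   then have "c \<odot>\<^bsub>alg_quot M I\<^esub> X = I +> (c \<odot> x)"
    using lin_hom_smult[OF coset_lin_hom, of x c] by simp
   then show ?thesis using xy f M by (simp add: g)
  qed
 qed
 then show ?thesis using g by blast
qed

end

lemma ideal_ksubspace:
 fixes A :: "('k::field, 'a) module" (structure)
 assumes A: "k_algebra A" and I: "ideal I A"
 shows "ksubspace I A"
proof -
 interpret ideal I A by fact
 have "c \<odot> u \<in> I" if u: "u \<in> I" for c u
 proof -
  have "c \<odot> u = (c \<odot> \<one>) \<otimes> u" using u A a_subset by (simp add: subsetD)
  then show ?thesis using I_l_closed[OF u, of "c \<odot> \<one>"] A by simp
 qed
 then show ?thesis using a_subset by (auto simp: ksubspace_def)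
qed

lemma coset_alg_hom:
 fixes A :: "('k::field, 'a) module" (structure)
 assumes A: "k_algebra A" and I: "ideal I A"
 shows "(\<lambda>x. I +> x) \<in> alg_hom A (alg_quot A I)"
proof (rule alg_homI)
 show "(+>) I \<in> lin_hom A (alg_quot A I)"
  using coset_lin_hom[OF _ ideal_ksubspace[OF A I]] A by simp
qed (use I in \<open>simp_all add: alg_quot_sel ideal.rcoset_mult_add\<close>)

lemma k_algebra_quot:
 fixes A :: "('k::field, 'a) module" (structure)
 assumes A: "k_algebra A" and I: "ideal I A"
 shows "k_algebra (alg_quot A I)"
proof (rule k_algebra_image[OF A])
 note sub = ideal_ksubspace[OF A I] and hom = coset_alg_hom[OF A I]
 show "(+>) I \<in> lin_hom A (alg_quot A I)" by (rule alg_hom_lin[OF hom])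
 show "(+>) I ` carrier A = carrier (alg_quot A I)"
  by (rule quot_carrier[OF k_algebra_kspace[OF A] sub, symmetric])
 show "I +> \<zero> = \<zero>\<^bsub>alg_quot A I\<^esub>" using coset_zero[OF _ sub] A by simp
 show "I +> \<one> = \<one>\<^bsub>alg_quot A I\<^esub>" by (rule alg_hom_one[OF hom])
qed (rule alg_hom_mult[OF coset_alg_hom[OF A I]])

lemma free_space_sel [simp]:
 "carrier (free_space S) = {p. Poly_Mapping.keys p \<subseteq> S}" "zero (free_space S) = 0"
 "add (free_space S) = (+)" "smult (free_space S) = (\<lambda>c. Poly_Mapping.map ((*) c))"
 by (simp_all add: free_space_def)

lemma lookup_map_times [simp]:
 "Poly_Mapping.lookup (Poly_Mapping.map ((*) c) p) x = c * Poly_Mapping.lookup p (x::'x) "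
 for c :: "'k::field"
 by (simp add: Poly_Mapping.map.rep_eq when_def)

lemma keys_map_times: "Poly_Mapping.keys (Poly_Mapping.map ((*) c) p) \<subseteq> Poly_Mapping.keys p"
 for c :: "'k::field"
 by (auto simp: in_keys_iff)

lemma kspace_free_space: "kspace (free_space S :: ('k::field, 'x \<Rightarrow>\<^sub>0 'k) module)"
proof (rule kspaceI)
 fix p q :: "'x \<Rightarrow>\<^sub>0 'k" and c
 assume p: "p \<in> carrier (free_space S)"
 show "c \<odot>\<^bsub>free_space S\<^esub> p \<in> carrier (free_space S)"
  using p keys_map_times[of c p] by auto
 assume q: "q \<in> carrier (free_space S)"
 show "p \<oplus>\<^bsub>free_space S\<^esub> q \<in> carrier (free_space S)"
  using p q keys_add[of p q] by auto
qed (simp_all add: ac_simps, (rule poly_mapping_eqI, simp add: lookup_add algebra_simps)+)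

lemma poly_mapping_sum_induct [consumes 1, case_names zero add]:
 fixes p :: "'x \<Rightarrow>\<^sub>0 'k::field"
 assumes "Poly_Mapping.keys p \<subseteq> S" "P 0"
  and "\<And>x c p. x \<in> S ==> Poly_Mapping.keys p \<subseteq> S ==> P p ==> P (single x c + p)"
 shows "P p"
 using assms(1)
proof (induction p rule: Poly_Mapping.update_induct)
 case const
 then show ?case using assms(2) by simp
next
 case (update p x c)
 have eq: "Poly_Mapping.update x c p = single x c + p"
  using update(1) by (intro poly_mapping_eqI)
   (auto simp: lookup_update lookup_add lookup_single when_def in_keys_iff)
 have "Poly_Mapping.keys (Poly_Mapping.update x c p) = insert x (Poly_Mapping.keys p)"
  using update by (simp add: keys_update)
 then show ?case using update assms(3)[of x p c] eq by simp
qed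

definition lin_ext :: "('k::field, 'b, 'z) module_scheme => ('x => 'b) => ('x \<Rightarrow>\<^sub>0 'k) => 'b" where
 "lin_ext P g p = finsum P (\<lambda>x. Poly_Mapping.lookup p x \<odot>\<^bsub>P\<^esub> g x) (Poly_Mapping.keys p)"

lemma lin_ext_lin_hom:
 fixes P :: "('k::field, 'b, 'z) module_scheme" and S :: "'x set"
 assumes P: "kspace P" and g: "\<And>x. x \<in> S ==> g x \<in> carrier P"
 shows "lin_ext P g \<in> lin_hom (free_space S) P"
proof -
 have cl: "lin_ext P g p \<in> carrier P" if "Poly_Mapping.keys p \<subseteq> S" for p
  unfolding lin_ext_def using that P g by (intro kspace_finsum) auto
 have ev: "\<phi> (lin_ext P g p) = (\<Sum>x\<in>T. Poly_Mapping.lookup p x * \<phi> (g x))"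
  if "Poly_Mapping.keys p \<subseteq> T" "T \<subseteq> S" "finite T" "\<phi> \<in> dual P" for p T \<phi>
 proof -
  have "\<phi> (lin_ext P g p) = (\<Sum>x\<in>Poly_Mapping.keys p. Poly_Mapping.lookup p x * \<phi> (g x))"
   unfolding lin_ext_def using that P g by (subst dual_finsum) (auto intro!: sum.cong)
  also have "... = (\<Sum>x\<in>T. Poly_Mapping.lookup p x * \<phi> (g x))"
   by (rule sum.mono_neutral_left) (use that in \<open>auto simp: in_keys_iff\<close>)
  finally show ?thesis .
 qed
 show ?thesis
 proof (rule lin_homI)
  show "lin_ext P g p \<in> carrier P" if "p \<in> carrier (free_space S)" for p using cl that by simp
  fix p :: "'x \<Rightarrow>\<^sub>0 'k" assume p: "p \<in> carrier (free_space S)"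
  have kc: "Poly_Mapping.keys (Poly_Mapping.map ((*) c) p) \<subseteq> S" for c :: 'k
   using p keys_map_times[of c p] by auto
  show "lin_ext P g (c \<odot>\<^bsub>free_space S\<^esub> p) = c \<odot>\<^bsub>P\<^esub> lin_ext P g p" for c :: 'k
  proof (rule kspace_eqI[OF P])
   fix \<phi> assume \<phi>: "\<phi> \<in> dual P"
   show "\<phi> (lin_ext P g (c \<odot>\<^bsub>free_space S\<^esub> p)) = \<phi> (c \<odot>\<^bsub>P\<^esub> lin_ext P g p)"
    using p cl \<phi> keys_map_times[of c p]
    by (simp add: ev[of _ "Poly_Mapping.keys p"] sum_distrib_left mult.assoc)
  qed (use cl kc P p in auto)
  fix q :: "'x \<Rightarrow>\<^sub>0 'k" assume q: "q \<in> carrier (free_space S)"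
  let ?T = "Poly_Mapping.keys p \<union> Poly_Mapping.keys q"
  have kq: "Poly_Mapping.keys (p + q) \<subseteq> S" using p q keys_add[of p q] by auto
  show "lin_ext P g (p \<oplus>\<^bsub>free_space S\<^esub> q) = lin_ext P g p \<oplus>\<^bsub>P\<^esub> lin_ext P g q"
  proof (rule kspace_eqI[OF P])
   fix \<phi> assume \<phi>: "\<phi> \<in> dual P"
   show "\<phi> (lin_ext P g (p \<oplus>\<^bsub>free_space S\<^esub> q)) = \<phi> (lin_ext P g p \<oplus>\<^bsub>P\<^esub> lin_ext P g q)"
    using p q cl \<phi> keys_add[of p q]
    by (simp add: ev[of _ ?T] lookup_add distrib_right sum.distrib)
  qed (use cl kq P p q in auto)
 qed
qed

lemma lin_ext_single:
 assumes "kspace P" "g x \<in> carrier P"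
 shows "lin_ext P g (single x c) = c \<odot>\<^bsub>P\<^esub> g x"
 using assms kspace_finsum_insert[OF assms(1), of "{}" x "\<lambda>y. Poly_Mapping.lookup (single x c) y \<odot>\<^bsub>P\<^esub> g y"]
 by (cases "c = 0") (simp_all add: lin_ext_def)

lemma free_space_minus: "p + Poly_Mapping.map ((*) (-1)) q = p - q"
 for p :: "'x \<Rightarrow>\<^sub>0 'k::field"
 by (rule poly_mapping_eqI) (simp add: lookup_add lookup_minus)

section \<open>Tensor products of vector spaces\<close>

definition bilin :: "('k::field, 'a, 'x) module_scheme => ('k, 'b, 'y) module_scheme =>
  ('k, 'c, 'z) module_scheme => ('a => 'b => 'c) => bool" where
 "bilin M N P \<beta> \<longleftrightarrow> (\<forall>x\<in>carrier M. (\<lambda>y. \<beta> x y) \<in> lin_hom N P) \<and>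
   (\<forall>y\<in>carrier N. (\<lambda>x. \<beta> x y) \<in> lin_hom M P)"

lemma bilinI:
 "(\<And>x. x \<in> carrier M ==> (\<lambda>y. \<beta> x y) \<in> lin_hom N P) ==>
  (\<And>y. y \<in> carrier N ==> (\<lambda>x. \<beta> x y) \<in> lin_hom M P) ==> bilin M N P \<beta>"
 by (simp add: bilin_def)

lemma bilinD:
 assumes "bilin M N P \<beta>"
 shows "x \<in> carrier M ==> (\<lambda>y. \<beta> x y) \<in> lin_hom N P"
  and "y \<in> carrier N ==> (\<lambda>x. \<beta> x y) \<in> lin_hom M P"
  and "x \<in> carrier M ==> y \<in> carrier N ==> \<beta> x y \<in> carrier P"
 using assms lin_hom_closed[of "\<beta> x" N P y] by (auto simp: bilin_def)

context
 fixes M :: "('k::field, 'a, 'y) module_scheme" and N :: "('k, 'b, 'z) module_scheme"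
 assumes M: "kspace M" and N: "kspace N"
begin

private abbreviation "FS \<equiv> free_space (carrier M \<times> carrier N) :: ('k, ('a \<times> 'b) \<Rightarrow>\<^sub>0 'k) module"
private abbreviation "K \<equiv> tensor_ker M N"
private abbreviation "T \<equiv> tensor_space M N"

private lemma FS: "kspace FS" by (rule kspace_free_space)

private lemma keys_minus_subset:
 "Poly_Mapping.keys p \<subseteq> S ==> Poly_Mapping.keys q \<subseteq> S ==> Poly_Mapping.keys (p - q) \<subseteq> S"
 for p q :: "'x \<Rightarrow>\<^sub>0 'k"
 using Poly_Mapping.keys_diff[of p q] by blast

private lemma rel1: "x \<in> carrier M ==> x' \<in> carrier M ==> y \<in> carrier N ==>
  single (x \<oplus>\<^bsub>M\<^esub> x', y) 1 - single (x, y) 1 - single (x', y) 1 \<in> tensor_rels M N"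
 unfolding tensor_rels_def Let_def by (rule UnI1, rule UnI1, rule UnI1) blast

private lemma rel2: "x \<in> carrier M ==> y \<in> carrier N ==> y' \<in> carrier N ==>
  single (x, y \<oplus>\<^bsub>N\<^esub> y') 1 - single (x, y) 1 - single (x, y') 1 \<in> tensor_rels M N"
 unfolding tensor_rels_def Let_def by (rule UnI1, rule UnI1, rule UnI2) blast

private lemma rel3: "x \<in> carrier M ==> y \<in> carrier N ==>
  single (c \<odot>\<^bsub>M\<^esub> x, y) 1 - single (x, y) c \<in> tensor_rels M N"
 unfolding tensor_rels_def Let_def by (rule UnI1, rule UnI2) blast

private lemma rel4: "x \<in> carrier M ==> y \<in> carrier N ==>
  single (x, c \<odot>\<^bsub>N\<^esub> y) 1 - single (x, y) c \<in> tensor_rels M N"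
 unfolding tensor_rels_def Let_def by (rule UnI2) blast

private lemma rels_subset:
 assumes "\<And>x x' y. x \<in> carrier M ==> x' \<in> carrier M ==> y \<in> carrier N ==>
   single (x \<oplus>\<^bsub>M\<^esub> x', y) 1 - single (x, y) 1 - single (x', y) 1 \<in> Z"
  and "\<And>x y y'. x \<in> carrier M ==> y \<in> carrier N ==> y' \<in> carrier N ==>
   single (x, y \<oplus>\<^bsub>N\<^esub> y') 1 - single (x, y) 1 - single (x, y') 1 \<in> Z"
  and "\<And>x y c. x \<in> carrier M ==> y \<in> carrier N ==>
   single (c \<odot>\<^bsub>M\<^esub> x, y) 1 - single (x, y) c \<in> Z"
  and "\<And>x y c. x \<in> carrier M ==> y \<in> carrier N ==>
   single (x, c \<odot>\<^bsub>N\<^esub> y) 1 - single (x, y) c \<in> Z"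
 shows "tensor_rels M N \<subseteq> Z"
 unfolding tensor_rels_def Let_def Un_subset_iff
 by (intro conjI subsetI; elim CollectE exE conjE; hypsubst; rule assms; assumption)

lemma tensor_rels_carrier: "tensor_rels M N \<subseteq> carrier FS"
 by (rule rels_subset) (use M N in \<open>simp_all add: keys_minus_subset\<close>)

lemma tensor_ker_subspace: "ksubspace K FS"
proof -
 have "submodule class_ring K FS"
  unfolding tensor_ker_def
  by (rule LinearCombinations.module.span_is_submodule[OF kspace_module[OF FS] tensor_rels_carrier,
    unfolded])
 then show ?thesis
  using submodule.subset submodule.m_closed submodule.zero_closed submodule.smult_closed
  unfolding ksubspace_def by fastforce
qed

lemma tensor_rels_ker: "tensor_rels M N \<subseteq> K"
 unfolding tensor_ker_def
 by (rule LinearCombinations.module.in_own_span[OF kspace_module[OF FS] tensor_rels_carrier])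

private lemma T: "kspace T"
 unfolding tensor_space_def by (rule kspace_quot[OF FS tensor_ker_subspace])

private lemma cl: "(\<lambda>p. K +>\<^bsub>FS\<^esub> p) \<in> lin_hom FS T"
 unfolding tensor_space_def by (rule coset_lin_hom[OF FS tensor_ker_subspace])

private lemma single_cls:
 assumes "x \<in> carrier M" "y \<in> carrier N"
 shows "K +>\<^bsub>FS\<^esub> single (x, y) c = c \<odot>\<^bsub>T\<^esub> tens M N x y"
proof -
 have "single (x, y) c = c \<odot>\<^bsub>FS\<^esub> single (x, y) 1" by simp
 then show ?thesis
  unfolding tens_def using lin_hom_smult[OF cl, of "single (x, y) 1" c] assms by simp
qed

private lemma cls_eq:
 assumes "p \<in> carrier FS" "q \<in> carrier FS" "p - q \<in> K"
 shows "K +>\<^bsub>FS\<^esub> p = K +>\<^bsub>FS\<^esub> q"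
 using coset_eq_iff[OF FS tensor_ker_subspace assms(1,2)] assms(3) by (simp add: free_space_minus)

private lemma tens_cl: "x \<in> carrier M ==> y \<in> carrier N ==> tens M N x y \<in> carrier T"
 unfolding tens_def by (rule lin_hom_closed[OF cl]) simp

private lemma tens_bilin: "bilin M N T (tens M N)"
proof (rule bilinI; rule lin_homI)
 note mem = subsetD[OF tensor_rels_ker]
 have add: "tens M N x y \<oplus>\<^bsub>T\<^esub> tens M N x' y' =
  K +>\<^bsub>FS\<^esub> (single (x,y) 1 + single (x',y') 1)"
  if "x \<in> carrier M" "y \<in> carrier N" "x' \<in> carrier M" "y' \<in> carrier N" for x y x' y'
  using lin_hom_add[OF cl, of "single (x,y) 1" "single (x',y') 1"] that
  by (simp add: tens_def)
 have ks: "Poly_Mapping.keys (single (x,y) (1::'k) + single (x',y') 1)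
   \<subseteq> carrier M \<times> carrier N"
  if "x \<in> carrier M" "y \<in> carrier N" "x' \<in> carrier M" "y' \<in> carrier N" for x y x' y'
  using that keys_add[of "single (x,y) (1::'k)" "single (x',y') 1"] by auto
 fix x y assume xy: "x \<in> carrier M" "y \<in> carrier N"
 show "tens M N x y \<in> carrier T" "tens M N x y \<in> carrier T" using tens_cl xy by auto
 show "tens M N x (y \<oplus>\<^bsub>N\<^esub> y') = tens M N x y \<oplus>\<^bsub>T\<^esub> tens M N x y'" if "y' \<in> carrier N" for y'
 proof -
  have "single (x, y \<oplus>\<^bsub>N\<^esub> y') (1::'k) - (single (x,y) 1 + single (x,y') 1) \<in> K"
   using mem[OF rel2[OF xy that]] by (simp add: diff_diff_eq)
  then show ?thesis unfolding add[OF xy xy(1) that] unfolding tens_def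
   by (intro cls_eq) (use xy that N ks in simp_all)
 qed
 show "tens M N (x \<oplus>\<^bsub>M\<^esub> x') y = tens M N x y \<oplus>\<^bsub>T\<^esub> tens M N x' y" if "x' \<in> carrier M" for x'
 proof -
  have "single (x \<oplus>\<^bsub>M\<^esub> x', y) (1::'k) - (single (x,y) 1 + single (x',y) 1) \<in> K"
   using mem[OF rel1[OF xy(1) that xy(2)]] by (simp add: diff_diff_eq)
  then show ?thesis unfolding add[OF xy that xy(2)] unfolding tens_def
   by (intro cls_eq) (use xy that M ks in simp_all)
 qed
 show "tens M N x (c \<odot>\<^bsub>N\<^esub> y) = c \<odot>\<^bsub>T\<^esub> tens M N x y" for c
 proof -
  have "single (x, c \<odot>\<^bsub>N\<^esub> y) (1::'k) - single (x,y) c \<in> K"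
   by (rule mem[OF rel4[OF xy]])
  then show ?thesis unfolding single_cls[OF xy, symmetric] unfolding tens_def
   by (intro cls_eq) (use xy N in simp_all)
 qed
 show "tens M N (c \<odot>\<^bsub>M\<^esub> x) y = c \<odot>\<^bsub>T\<^esub> tens M N x y" for c
 proof -
  have "single (c \<odot>\<^bsub>M\<^esub> x, y) (1::'k) - single (x,y) c \<in> K"
   by (rule mem[OF rel3[OF xy]])
  then show ?thesis unfolding single_cls[OF xy, symmetric] unfolding tens_def
   by (intro cls_eq) (use xy M in simp_all)
 qed
qed

private lemma tens_induct:
 assumes t: "t \<in> carrier T" and 0: "Q \<zero>\<^bsub>T\<^esub>"
  and add: "\<And>x y s. x \<in> carrier M ==> y \<in> carrier N ==> s \<in> carrier T ==> Q s ==> Q (tens M N x y \<oplus>\<^bsub>T\<^esub> s)"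
 shows "Q t"
proof -
 obtain p where p: "t = K +>\<^bsub>FS\<^esub> p" "Poly_Mapping.keys p \<subseteq> carrier M \<times> carrier N"
  using t quot_carrier[OF FS tensor_ker_subspace] by (auto simp: tensor_space_def)
 have "Q (K +>\<^bsub>FS\<^esub> p)"
  using p(2)
 proof (induction p rule: poly_mapping_sum_induct)
  show "Q (K +>\<^bsub>FS\<^esub> 0)" using coset_zero[OF FS tensor_ker_subspace] 0 by (simp add: tensor_space_def)
  fix z c p assume z: "z \<in> carrier M \<times> carrier N" and p: "Poly_Mapping.keys p \<subseteq> carrier M \<times> carrier N"
   and Q: "Q (K +>\<^bsub>FS\<^esub> p)"
  obtain x y where xy: "z = (x, y)" "x \<in> carrier M" "y \<in> carrier N" using z by auto
  have "K +>\<^bsub>FS\<^esub> (single z c + p) = (K +>\<^bsub>FS\<^esub> single z c) \<oplus>\<^bsub>T\<^esub> (K +>\<^bsub>FS\<^esub> p)"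
   using lin_hom_add[OF cl, of "single z c" p] z p by simp
  also have "K +>\<^bsub>FS\<^esub> single z c = tens M N (c \<odot>\<^bsub>M\<^esub> x) y"
   using single_cls[OF xy(2,3)] lin_hom_smult[OF bilinD(2)[OF tens_bilin xy(3)] xy(2)] xy(1) by simp
  finally show "Q (K +>\<^bsub>FS\<^esub> (single z c + p))"
   using add[of "c \<odot>\<^bsub>M\<^esub> x" y "K +>\<^bsub>FS\<^esub> p"] Q xy M lin_hom_closed[OF cl, of p] p by simp
 qed
 then show ?thesis using p by simp
qed

private lemma tensor_lift_ex:
 fixes P :: "('k, 'c, 'x) module_scheme"
 assumes P: "kspace P" and b: "bilin M N P \<beta>"
 shows "\<exists>f\<in>lin_hom T P. \<forall>x\<in>carrier M. \<forall>y\<in>carrier N. f (tens M N x y) = \<beta> x y"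
proof -
 define g where "g = lin_ext P (\<lambda>z. \<beta> (fst z) (snd z))"
 have bc: "\<beta> x y \<in> carrier P" if "x \<in> carrier M" "y \<in> carrier N" for x y using bilinD(3)[OF b that] .
 have g: "g \<in> lin_hom FS P" unfolding g_def by (rule lin_ext_lin_hom[OF P]) (auto simp: bc)
 have gs: "g (single (x, y) c) = c \<odot>\<^bsub>P\<^esub> \<beta> x y" if "x \<in> carrier M" "y \<in> carrier N" for x y c
  unfolding g_def using lin_ext_single[OF P, of "\<lambda>z. \<beta> (fst z) (snd z)" "(x, y)" c] bc that by simp
 define Z where "Z = {p \<in> carrier FS. g p = \<zero>\<^bsub>P\<^esub>}"
 have "submodule class_ring Z FS"
  by (rule submodule.intro[OF kspace_module[OF FS]])
   (unfold Z_def, use g P FS in \<open>auto simp del: free_space_sel\<close>)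
 moreover have gm: "g (p - q) = g p \<oplus>\<^bsub>P\<^esub> (-1) \<odot>\<^bsub>P\<^esub> g q" if "p \<in> carrier FS" "q \<in> carrier FS" for p q
 proof -
  have "g (p \<oplus>\<^bsub>FS\<^esub> (-1) \<odot>\<^bsub>FS\<^esub> q) = g p \<oplus>\<^bsub>P\<^esub> (-1) \<odot>\<^bsub>P\<^esub> g q"
   using lin_hom_add[OF g, of p "(-1) \<odot>\<^bsub>FS\<^esub> q"] lin_hom_smult[OF g, of q "-1"] that
    kspace_smult[OF FS, of q "-1"] by simp
  then show ?thesis by (simp add: free_space_minus)
 qed
 have mF: "p - q \<in> carrier FS" if "p \<in> carrier FS" "q \<in> carrier FS" for p q
  using that keys_minus_subset by simp
 have sF: "single (x, y) c \<in> carrier FS" if "x \<in> carrier M" "y \<in> carrier N" for x y c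
  using that by simp
 have minus2: "(a \<oplus>\<^bsub>P\<^esub> b) \<oplus>\<^bsub>P\<^esub> (-1) \<odot>\<^bsub>P\<^esub> a \<oplus>\<^bsub>P\<^esub> (-1) \<odot>\<^bsub>P\<^esub> b = \<zero>\<^bsub>P\<^esub>"
  if "a \<in> carrier P" "b \<in> carrier P" for a b
  by (rule kspace_eqI[OF P]) (use P that in auto)
 have "tensor_rels M N \<subseteq> Z"
  by (rule rels_subset; unfold Z_def; intro CollectI conjI)
   (simp_all only: mF sF kspace_add[OF M] kspace_add[OF N] kspace_smult[OF M] kspace_smult[OF N],
    simp_all add: M N P gm mF sF gs bc lin_hom_add[OF bilinD(1)[OF b]] lin_hom_smult[OF bilinD(1)[OF b]]
     lin_hom_add[OF bilinD(2)[OF b]] lin_hom_smult[OF bilinD(2)[OF b]] minus2 kspace_right_minus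
    del: free_space_sel)
 ultimately have "K \<subseteq> Z"
  unfolding tensor_ker_def
  by (intro LinearCombinations.module.span_is_subset[OF kspace_module[OF FS]]) auto
 then have "\<exists>f\<in>lin_hom (alg_quot FS K) P. \<forall>p\<in>carrier FS. f (K +>\<^bsub>FS\<^esub> p) = g p"
  by (intro quot_lift[OF FS tensor_ker_subspace P g]) (auto simp: Z_def)
 then obtain f where f: "f \<in> lin_hom T P" "\<And>p. p \<in> carrier FS ==> f (K +>\<^bsub>FS\<^esub> p) = g p"
  by (auto simp: tensor_space_def)
 show ?thesis
 proof (intro bexI[OF _ f(1)] ballI)
  fix x y assume xy: "x \<in> carrier M" "y \<in> carrier N"
  show "f (tens M N x y) = \<beta> x y"
   unfolding tens_def using f(2)[OF sF[OF xy]] gs[OF xy] bc[OF xy] P by simp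
 qed
qed

lemma tensor_alg_sel:
 "carrier (tensor_alg M N) = carrier T" "zero (tensor_alg M N) = zero T"
 "add (tensor_alg M N) = add T" "smult (tensor_alg M N) = smult T"
 "one (tensor_alg M N) = tens M N \<one>\<^bsub>M\<^esub> \<one>\<^bsub>N\<^esub>"
 by (simp_all add: tensor_alg_def Let_def)

lemma lin_hom_tensor_alg:
 "lin_hom (tensor_alg M N) P = lin_hom T P" "lin_hom P (tensor_alg M N) = lin_hom P T"
 unfolding LinearCombinations.module_hom_def tensor_alg_sel by (rule refl)+

lemma kspace_tensor_alg [simp]: "kspace (tensor_alg M N)"
 by (rule kspace_image[OF T, of id]) (auto simp: tensor_alg_sel lin_hom_tensor_alg)

lemma bilin_tens: "bilin M N (tensor_alg M N) (tens M N)"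
 using tens_bilin by (simp add: bilin_def lin_hom_tensor_alg)

lemma tens_closed [simp]: "x \<in> carrier M ==> y \<in> carrier N ==> tens M N x y \<in> carrier (tensor_alg M N)"
 by (rule bilinD(3)[OF bilin_tens])

lemma tens_add_left:
 "x \<in> carrier M ==> x' \<in> carrier M ==> y \<in> carrier N ==>
  tens M N (x \<oplus>\<^bsub>M\<^esub> x') y = tens M N x y \<oplus>\<^bsub>tensor_alg M N\<^esub> tens M N x' y"
 using lin_hom_add[OF bilinD(2)[OF bilin_tens]] .

lemma tens_smult_left:
 "x \<in> carrier M ==> y \<in> carrier N ==>
  tens M N (c \<odot>\<^bsub>M\<^esub> x) y = c \<odot>\<^bsub>tensor_alg M N\<^esub> tens M N x y"
 using lin_hom_smult[OF bilinD(2)[OF bilin_tens]] .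

lemma tens_smult_right:
 "x \<in> carrier M ==> y \<in> carrier N ==>
  tens M N x (c \<odot>\<^bsub>N\<^esub> y) = c \<odot>\<^bsub>tensor_alg M N\<^esub> tens M N x y"
 using lin_hom_smult[OF bilinD(1)[OF bilin_tens]] .

lemma tensor_induct [consumes 1, case_names zero add]:
 assumes "t \<in> carrier (tensor_alg M N)" and "Q \<zero>\<^bsub>tensor_alg M N\<^esub>"
  and "\<And>x y s. x \<in> carrier M ==> y \<in> carrier N ==> s \<in> carrier (tensor_alg M N) ==> Q s ==>
   Q (tens M N x y \<oplus>\<^bsub>tensor_alg M N\<^esub> s)"
 shows "Q t"
 using tens_induct[of t Q] assms by (simp add: tensor_alg_sel)

lemma tensor_ext:
 assumes P: "kspace P" and f: "f \<in> lin_hom (tensor_alg M N) P" "g \<in> lin_hom (tensor_alg M N) P"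
  and eq: "\<And>x y. x \<in> carrier M ==> y \<in> carrier N ==> f (tens M N x y) = g (tens M N x y)"
  and t: "t \<in> carrier (tensor_alg M N)"
 shows "f t = g t"
 using t
proof (induction t rule: tensor_induct)
 case zero
 then show ?case using lin_hom_zero[OF kspace_tensor_alg P f(1)] lin_hom_zero[OF kspace_tensor_alg P f(2)] by simp
next
 case (add x y s)
 then show ?case using f eq by simp
qed

context
 fixes P :: "('k, 'c, 'x) module_scheme" and \<beta>
 assumes P: "kspace P" and b: "bilin M N P \<beta>"
begin

private lemma tensor_lift_unique:
 "\<exists>!f. f \<in> lin_hom T P \<and> f \<in> extensional (carrier T) \<and>
   (\<forall>x\<in>carrier M. \<forall>y\<in>carrier N. f (tens M N x y) = \<beta> x y)"
proof -
 obtain f where f: "f \<in> lin_hom T P" "\<And>x y. x \<in> carrier M ==> y \<in> carrier N ==> f (tens M N x y) = \<beta> x y"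
  using tensor_lift_ex[OF P b] by blast
 let ?f = "restrict f (carrier T)"
 show ?thesis
 proof (rule ex1I[of _ ?f], intro conjI ballI)
  show "?f \<in> lin_hom T P" using f(1) T by (intro lin_homI) auto
  show "?f (tens M N x y) = \<beta> x y" if "x \<in> carrier M" "y \<in> carrier N" for x y
   using f(2)[OF that] tens_cl[OF that] by simp
  fix g assume g: "g \<in> lin_hom T P \<and> g \<in> extensional (carrier T) \<and>
   (\<forall>x\<in>carrier M. \<forall>y\<in>carrier N. g (tens M N x y) = \<beta> x y)"
  show "g = ?f"
  proof
   fix t show "g t = ?f t"
    using tensor_ext[OF P, of f g t] f g
    by (cases "t \<in> carrier T") (auto simp: lin_hom_tensor_alg tensor_alg_sel extensional_def)
  qed
 qed simp
qed

lemma tensor_lift_lin_hom: "tensor_lift M N P \<beta> \<in> lin_hom (tensor_alg M N) P"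
 using theI'[OF tensor_lift_unique] unfolding tensor_lift_def lin_hom_tensor_alg by simp

lemma tensor_lift_tens: "x \<in> carrier M ==> y \<in> carrier N ==> tensor_lift M N P \<beta> (tens M N x y) = \<beta> x y"
 using theI'[OF tensor_lift_unique] unfolding tensor_lift_def by simp

end

end

lemma kspace_abelian_monoid: "kspace M ==> abelian_monoid M"
 by (rule abelian_group.axioms(1)[OF kspace_abelian_group])

lemmas kspace_ac = abelian_monoid.a_ac[OF kspace_abelian_monoid]

lemma kspace_add4:
 assumes "kspace M" "a \<in> carrier M" "b \<in> carrier M" "c \<in> carrier M" "d \<in> carrier M"
 shows "(a \<oplus>\<^bsub>M\<^esub> b) \<oplus>\<^bsub>M\<^esub> (c \<oplus>\<^bsub>M\<^esub> d) = (a \<oplus>\<^bsub>M\<^esub> c) \<oplus>\<^bsub>M\<^esub> (b \<oplus>\<^bsub>M\<^esub> d)"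
 using assms by (simp add: kspace_ac)

lemma tensor_lift_space:
 assumes "kspace M" "kspace N"
 shows "tensor_lift A B (tensor_space M N) = tensor_lift A B (tensor_alg M N)"
 unfolding tensor_lift_def lin_hom_tensor_alg(2)[OF assms, symmetric] ..

text \<open>This makes the nested lifts in the definitions of the product and of the associativity map linear in each argument.\<close>

lemma tensor_lift_param:
 assumes M: "kspace M" and N: "kspace N" and P: "kspace P" and Q: "kspace Q"
  and b: "\<And>x. x \<in> carrier M ==> bilin N P Q (\<beta> x)"
  and l: "\<And>y z. y \<in> carrier N ==> z \<in> carrier P ==> (\<lambda>x. \<beta> x y z) \<in> lin_hom M Q"
  and t: "t \<in> carrier (tensor_alg N P)"
 shows "(\<lambda>x. tensor_lift N P Q (\<beta> x) t) \<in> lin_hom M Q"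
 using t
proof (induction rule: tensor_induct[OF N P, consumes 1, case_names zero add])
 case zero
 have "tensor_lift N P Q (\<beta> x) \<zero>\<^bsub>tensor_alg N P\<^esub> = \<zero>\<^bsub>Q\<^esub>" if "x \<in> carrier M" for x
  using lin_hom_zero[OF kspace_tensor_alg[OF N P] Q tensor_lift_lin_hom[OF N P Q b[OF that]]] .
 then show ?case using M Q by (intro lin_homI) auto
next
 case (add y z s)
 have eq: "tensor_lift N P Q (\<beta> x) (tens N P y z \<oplus>\<^bsub>tensor_alg N P\<^esub> s) = \<beta> x y z \<oplus>\<^bsub>Q\<^esub> tensor_lift N P Q (\<beta> x) s"
  if "x \<in> carrier M" for x
  using lin_hom_add[OF tensor_lift_lin_hom[OF N P Q b[OF that]], of "tens N P y z" s]
   tensor_lift_tens[OF N P Q b[OF that] add(1,2)] add N P by simp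
 note l' = l[OF add(1,2)] and IH = add(4)
 show ?case
 proof (rule lin_homI)
  fix x assume x: "x \<in> carrier M"
  note c = lin_hom_closed[OF l'] lin_hom_closed[OF IH]
  show "tensor_lift N P Q (\<beta> x) (tens N P y z \<oplus>\<^bsub>tensor_alg N P\<^esub> s) \<in> carrier Q"
   using eq[OF x] c[OF x] Q by simp
  show "tensor_lift N P Q (\<beta> (k \<odot>\<^bsub>M\<^esub> x)) (tens N P y z \<oplus>\<^bsub>tensor_alg N P\<^esub> s) =
   k \<odot>\<^bsub>Q\<^esub> tensor_lift N P Q (\<beta> x) (tens N P y z \<oplus>\<^bsub>tensor_alg N P\<^esub> s)" for k
   using eq[OF x] eq[of "k \<odot>\<^bsub>M\<^esub> x"] lin_hom_smult[OF l' x] lin_hom_smult[OF IH x] x M Q c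
   by (simp add: kspace_smult_add_right)
  fix x' assume x': "x' \<in> carrier M"
  show "tensor_lift N P Q (\<beta> (x \<oplus>\<^bsub>M\<^esub> x')) (tens N P y z \<oplus>\<^bsub>tensor_alg N P\<^esub> s) =
   tensor_lift N P Q (\<beta> x) (tens N P y z \<oplus>\<^bsub>tensor_alg N P\<^esub> s) \<oplus>\<^bsub>Q\<^esub>
   tensor_lift N P Q (\<beta> x') (tens N P y z \<oplus>\<^bsub>tensor_alg N P\<^esub> s)"
   using eq[OF x] eq[OF x'] eq[of "x \<oplus>\<^bsub>M\<^esub> x'"] lin_hom_add[OF l' x x'] lin_hom_add[OF IH x x'] x x' M Q c
   by (simp add: kspace_add4)
 qed
qed

lemma bilin_comp:
 assumes "bilin M' N' P \<beta>" "f \<in> lin_hom M M'" "g \<in> lin_hom N N'"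
 shows "bilin M N P (\<lambda>x y. \<beta> (f x) (g y))"
proof (rule bilinI)
 show "(\<lambda>y. \<beta> (f x) (g y)) \<in> lin_hom N P" if "x \<in> carrier M" for x
  using lin_hom_comp[OF assms(3) bilinD(1)[OF assms(1), of "f x"]] that assms(2) by simp
 show "(\<lambda>x. \<beta> (f x) (g y)) \<in> lin_hom M P" if "y \<in> carrier N" for y
  using lin_hom_comp[OF assms(2) bilinD(2)[OF assms(1), of "g y"]] that assms(3) by simp
qed

lemma bilin_mult: "k_algebra A ==> bilin A A A (mult A)"
 by (rule bilinI) (auto simp: lin_hom_mult_left lin_hom_mult_right)

lemma lin_hom_smult_map: "kspace M ==> (\<lambda>x. c \<odot>\<^bsub>M\<^esub> x) \<in> lin_hom M M"
 by (rule lin_homI) (auto simp: kspace_smult_add_right kspace_smult_smult mult.commute)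

lemma bilin_smult_left:
 assumes "kspace N" "\<phi> \<in> dual M"
 shows "bilin M N N (\<lambda>x y. \<phi> x \<odot>\<^bsub>N\<^esub> y)"
 by (rule bilinI)
  (use assms in \<open>auto intro!: lin_hom_smult_map lin_homI simp: kspace_smult_add_left kspace_smult_smult\<close>)

lemma bilin_smult_right:
 assumes "kspace M" "\<phi> \<in> dual N"
 shows "bilin M N M (\<lambda>x y. \<phi> y \<odot>\<^bsub>M\<^esub> x)"
 by (rule bilinI)
  (use assms in \<open>auto intro!: lin_hom_smult_map lin_homI simp: kspace_smult_add_left kspace_smult_smult\<close>)

lemma dual_tens_left:
 assumes "kspace M" "kspace N" "\<Phi> \<in> dual (tensor_alg M N)" "y \<in> carrier N"
 shows "(\<lambda>x. \<Phi> (tens M N x y)) \<in> dual M"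
 using dual_comp[OF bilinD(2)[OF bilin_tens[OF assms(1,2)] assms(4)] assms(3)] .

lemma dual_tens_right:
 assumes "kspace M" "kspace N" "\<Phi> \<in> dual (tensor_alg M N)" "x \<in> carrier M"
 shows "(\<lambda>y. \<Phi> (tens M N x y)) \<in> dual N"
 using dual_comp[OF bilinD(1)[OF bilin_tens[OF assms(1,2)] assms(4)] assms(3)] .

lemma dual_mult_left:
 "k_algebra A ==> \<Phi> \<in> dual A ==> a \<in> carrier A ==> (\<lambda>x. \<Phi> (a \<otimes>\<^bsub>A\<^esub> x)) \<in> dual A"
 by (rule dual_comp[OF lin_hom_mult_left])
lemma dual_mult_right:
 "k_algebra A ==> \<Phi> \<in> dual A ==> a \<in> carrier A ==> (\<lambda>x. \<Phi> (x \<otimes>\<^bsub>A\<^esub> a)) \<in> dual A"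
 by (rule dual_comp[OF lin_hom_mult_right])

lemma dual_mult_finsum_right [simp]:
 assumes "k_algebra A" "\<Phi> \<in> dual A" "a \<in> carrier A" "\<And>i. i < (n::nat) ==> f i \<in> carrier A"
 shows "\<Phi> (a \<otimes>\<^bsub>A\<^esub> finsum A f {..<n}) = (\<Sum>i<n. \<Phi> (a \<otimes>\<^bsub>A\<^esub> f i))"
 using dual_finsum_lessThan[OF _ dual_mult_left[OF assms(1-3)], of n f] assms by simp
lemma dual_mult_finsum_left [simp]:
 assumes "k_algebra A" "\<Phi> \<in> dual A" "a \<in> carrier A" "\<And>i. i < (n::nat) ==> f i \<in> carrier A"
 shows "\<Phi> (finsum A f {..<n} \<otimes>\<^bsub>A\<^esub> a) = (\<Sum>i<n. \<Phi> (f i \<otimes>\<^bsub>A\<^esub> a))"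
 using dual_finsum_lessThan[OF _ dual_mult_right[OF assms(1-3)], of n f] assms by simp

section \<open>Tensor products of algebras\<close>

context
 fixes A :: "('k::field, 'a, 'y) module_scheme" (structure) and B :: "('k, 'b, 'z) module_scheme"
 assumes A: "k_algebra A" and B: "k_algebra B"
begin

private abbreviation "TA \<equiv> tensor_alg A B"
private lemma kA3: "kspace A" and kB3: "kspace B" using A B by auto
private lemma kTA: "kspace TA" by (rule kspace_tensor_alg[OF kA3 kB3])

private lemma inner_bilin:
 "x \<in> carrier A ==> y \<in> carrier B ==> bilin A B TA (\<lambda>x' y'. tens A B (x \<otimes> x') (y \<otimes>\<^bsub>B\<^esub> y'))"
 by (rule bilin_comp[OF bilin_tens[OF kA3 kB3] lin_hom_mult_left[OF A] lin_hom_mult_left[OF B]])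

private abbreviation "RA x y \<equiv> tensor_lift A B TA (\<lambda>x' y'. tens A B (x \<otimes> x') (y \<otimes>\<^bsub>B\<^esub> y'))"

private lemma mult_T: "mult TA = (\<lambda>s t. tensor_lift A B TA (\<lambda>x y. RA x y t) s)"
 unfolding tensor_lift_space[OF kA3 kB3, symmetric] by (simp add: tensor_alg_def Let_def)

private lemma R_bilin:
 assumes t: "t \<in> carrier TA"
 shows "bilin A B TA (\<lambda>x y. RA x y t)"
proof (rule bilinI)
 show "(\<lambda>y. RA x y t) \<in> lin_hom B TA" if x: "x \<in> carrier A" for x
 proof (rule tensor_lift_param[OF kB3 kA3 kB3 kTA _ _ t])
  fix x' y' assume xy: "x' \<in> carrier A" "y' \<in> carrier B"
  show "(\<lambda>y. tens A B (x \<otimes> x') (y \<otimes>\<^bsub>B\<^esub> y')) \<in> lin_hom B TA"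
   by (rule lin_hom_comp[OF lin_hom_mult_right[OF B xy(2)] bilinD(1)[OF bilin_tens[OF kA3 kB3]]])
    (use x xy A in simp)
 qed (rule inner_bilin[OF x])
 show "(\<lambda>x. RA x y t) \<in> lin_hom A TA" if y: "y \<in> carrier B" for y
 proof (rule tensor_lift_param[OF kA3 kA3 kB3 kTA _ _ t])
  fix x' y' assume xy: "x' \<in> carrier A" "y' \<in> carrier B"
  show "(\<lambda>x. tens A B (x \<otimes> x') (y \<otimes>\<^bsub>B\<^esub> y')) \<in> lin_hom A TA"
   by (rule lin_hom_comp[OF lin_hom_mult_right[OF A xy(1)] bilinD(2)[OF bilin_tens[OF kA3 kB3]]])
    (use y xy B in simp)
 qed (rule inner_bilin[OF _ y])
qed

lemma tensor_mult_lin_left: "t \<in> carrier TA ==> (\<lambda>s. s \<otimes>\<^bsub>TA\<^esub> t) \<in> lin_hom TA TA"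
 unfolding mult_T by (rule tensor_lift_lin_hom[OF kA3 kB3 kTA R_bilin])

lemma tens_mult [simp]:
 "x \<in> carrier A ==> y \<in> carrier B ==> x' \<in> carrier A ==> y' \<in> carrier B ==>
  tens A B x y \<otimes>\<^bsub>TA\<^esub> tens A B x' y' = tens A B (x \<otimes> x') (y \<otimes>\<^bsub>B\<^esub> y')"
 unfolding mult_T
 by (simp add: tensor_lift_tens[OF kA3 kB3 kTA R_bilin] tensor_lift_tens[OF kA3 kB3 kTA inner_bilin] kA3 kB3)

lemma tensor_mult_lin_right: "s \<in> carrier TA ==> (\<lambda>t. s \<otimes>\<^bsub>TA\<^esub> t) \<in> lin_hom TA TA"
 unfolding mult_T
 by (rule tensor_lift_param[OF kTA kA3 kB3 kTA R_bilin tensor_lift_lin_hom[OF kA3 kB3 kTA inner_bilin]])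

lemma k_algebra_tensor [simp]: "k_algebra TA"
proof (rule k_algebraI[OF kTA])
 note L = tensor_mult_lin_left and Rr = tensor_mult_lin_right
 show cl: "s \<otimes>\<^bsub>TA\<^esub> t \<in> carrier TA" if "s \<in> carrier TA" "t \<in> carrier TA" for s t
  using lin_hom_closed[OF L] that by blast
 show one: "\<one>\<^bsub>TA\<^esub> \<in> carrier TA" using kA3 kB3 A B by (simp add: tensor_alg_sel(5))
 show "(s \<oplus>\<^bsub>TA\<^esub> t) \<otimes>\<^bsub>TA\<^esub> u = s \<otimes>\<^bsub>TA\<^esub> u \<oplus>\<^bsub>TA\<^esub> t \<otimes>\<^bsub>TA\<^esub> u"
  if "s \<in> carrier TA" "t \<in> carrier TA" "u \<in> carrier TA" for s t u
  using lin_hom_add[OF L] that by blast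
 show "u \<otimes>\<^bsub>TA\<^esub> (s \<oplus>\<^bsub>TA\<^esub> t) = u \<otimes>\<^bsub>TA\<^esub> s \<oplus>\<^bsub>TA\<^esub> u \<otimes>\<^bsub>TA\<^esub> t"
  if "s \<in> carrier TA" "t \<in> carrier TA" "u \<in> carrier TA" for s t u
  using lin_hom_add[OF Rr] that by blast
 show "(c \<odot>\<^bsub>TA\<^esub> s) \<otimes>\<^bsub>TA\<^esub> t = c \<odot>\<^bsub>TA\<^esub> (s \<otimes>\<^bsub>TA\<^esub> t)" if "s \<in> carrier TA" "t \<in> carrier TA" for c s t
  using lin_hom_smult[OF L] that by blast
 show "s \<otimes>\<^bsub>TA\<^esub> (c \<odot>\<^bsub>TA\<^esub> t) = c \<odot>\<^bsub>TA\<^esub> (s \<otimes>\<^bsub>TA\<^esub> t)" if "s \<in> carrier TA" "t \<in> carrier TA" for c s t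
  using lin_hom_smult[OF Rr] that by blast
 show "\<one>\<^bsub>TA\<^esub> \<otimes>\<^bsub>TA\<^esub> s = s" if "s \<in> carrier TA" for s
  by (rule tensor_ext[OF kA3 kB3 kTA Rr[OF one] lin_hom_id(2) _ that]) (use A B in \<open>simp add: tensor_alg_sel(5)\<close>)
 show "s \<otimes>\<^bsub>TA\<^esub> \<one>\<^bsub>TA\<^esub> = s" if "s \<in> carrier TA" for s
  by (rule tensor_ext[OF kA3 kB3 kTA L[OF one] lin_hom_id(2) _ that]) (use A B in \<open>simp add: tensor_alg_sel(5)\<close>)
 show "(s \<otimes>\<^bsub>TA\<^esub> t) \<otimes>\<^bsub>TA\<^esub> u = s \<otimes>\<^bsub>TA\<^esub> (t \<otimes>\<^bsub>TA\<^esub> u)"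
  if s: "s \<in> carrier TA" and t: "t \<in> carrier TA" and u: "u \<in> carrier TA" for s t u
 proof (rule tensor_ext[OF kA3 kB3 kTA lin_hom_comp[OF L[OF t] L[OF u]] L[OF cl[OF t u]] _ s])
  fix x y assume xy: "x \<in> carrier A" "y \<in> carrier B"
  let ?s = "tens A B x y"
  have s': "?s \<in> carrier TA" using xy kA3 kB3 by simp
  show "(?s \<otimes>\<^bsub>TA\<^esub> t) \<otimes>\<^bsub>TA\<^esub> u = ?s \<otimes>\<^bsub>TA\<^esub> (t \<otimes>\<^bsub>TA\<^esub> u)"
  proof (rule tensor_ext[OF kA3 kB3 kTA lin_hom_comp[OF Rr[OF s'] L[OF u]] lin_hom_comp[OF L[OF u] Rr[OF s']] _ t])
   fix x' y' assume xy': "x' \<in> carrier A" "y' \<in> carrier B"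
   let ?t = "tens A B x' y'"
   have t': "?t \<in> carrier TA" using xy' kA3 kB3 by simp
   show "(?s \<otimes>\<^bsub>TA\<^esub> ?t) \<otimes>\<^bsub>TA\<^esub> u = ?s \<otimes>\<^bsub>TA\<^esub> (?t \<otimes>\<^bsub>TA\<^esub> u)"
    by (rule tensor_ext[OF kA3 kB3 kTA Rr[OF cl[OF s' t']] lin_hom_comp[OF Rr[OF t'] Rr[OF s']] _ u])
     (use xy xy' A B in \<open>simp add: k_algebra_assoc\<close>)
  qed
 qed
qed

lemma tensor_alg_homI:
 fixes C :: "('k, 'c, 'w) module_scheme"
 assumes C: "k_algebra C" and F: "F \<in> lin_hom TA C"
  and o: "F (tens A B \<one> \<one>\<^bsub>B\<^esub>) = \<one>\<^bsub>C\<^esub>"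
  and m: "\<And>x y x' y'. x \<in> carrier A ==> y \<in> carrier B ==> x' \<in> carrier A ==> y' \<in> carrier B ==>
   F (tens A B (x \<otimes> x') (y \<otimes>\<^bsub>B\<^esub> y')) = F (tens A B x y) \<otimes>\<^bsub>C\<^esub> F (tens A B x' y')"
 shows "F \<in> alg_hom TA C"
proof (rule alg_homI[OF F])
 have kC: "kspace C" using C by simp
 show "F \<one>\<^bsub>TA\<^esub> = \<one>\<^bsub>C\<^esub>" using o by (simp add: tensor_alg_sel(5) kA3 kB3)
 fix s t assume s: "s \<in> carrier TA" and t: "t \<in> carrier TA"
 show "F (s \<otimes>\<^bsub>TA\<^esub> t) = F s \<otimes>\<^bsub>C\<^esub> F t"
 proof (rule tensor_ext[OF kA3 kB3 kC lin_hom_comp[OF tensor_mult_lin_left[OF t] F]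
    lin_hom_comp[OF F lin_hom_mult_right[OF C lin_hom_closed[OF F t]]] _ s])
  fix x y assume xy: "x \<in> carrier A" "y \<in> carrier B"
  let ?s = "tens A B x y"
  have s': "?s \<in> carrier TA" using xy kA3 kB3 by simp
  show "F (?s \<otimes>\<^bsub>TA\<^esub> t) = F ?s \<otimes>\<^bsub>C\<^esub> F t"
   by (rule tensor_ext[OF kA3 kB3 kC lin_hom_comp[OF tensor_mult_lin_right[OF s'] F]
    lin_hom_comp[OF F lin_hom_mult_left[OF C lin_hom_closed[OF F s']]] _ t])
    (use xy m in simp)
 qed
qed

end

section \<open>Induced maps\<close>

lemma tensor_map_lin_hom:
 assumes "kspace M" "kspace N" "kspace M'" "kspace N'" "f \<in> lin_hom M M'" "g \<in> lin_hom N N'"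
 shows "tensor_map M N M' N' f g \<in> lin_hom (tensor_alg M N) (tensor_alg M' N')"
 unfolding tensor_map_def
 by (rule tensor_lift_lin_hom[OF assms(1,2) kspace_tensor_alg[OF assms(3,4)]
    bilin_comp[OF bilin_tens[OF assms(3,4)] assms(5,6)]])

lemma tensor_map_tens:
 assumes "kspace M" "kspace N" "kspace M'" "kspace N'" "f \<in> lin_hom M M'" "g \<in> lin_hom N N'"
  and "x \<in> carrier M" "y \<in> carrier N"
 shows "tensor_map M N M' N' f g (tens M N x y) = tens M' N' (f x) (g y)"
 unfolding tensor_map_def
 by (rule tensor_lift_tens[OF assms(1,2) kspace_tensor_alg[OF assms(3,4)]
    bilin_comp[OF bilin_tens[OF assms(3,4)] assms(5,6)] assms(7,8)])

lemma tensor_map_alg_hom: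
 assumes "k_algebra A" "k_algebra B" "k_algebra A'" "k_algebra B'" "f \<in> alg_hom A A'" "g \<in> alg_hom B B'"
 shows "tensor_map A B A' B' f g \<in> alg_hom (tensor_alg A B) (tensor_alg A' B')"
 by (rule tensor_alg_homI)
  (use assms in \<open>simp_all add: tensor_map_lin_hom tensor_map_tens tensor_alg_sel\<close>)

context
 fixes M :: "('k::field, 'a, 'x) module_scheme" and N :: "('k, 'b, 'y) module_scheme"
  and P :: "('k, 'c, 'z) module_scheme"
 assumes M: "kspace M" and N: "kspace N" and P: "kspace P"
begin

private lemma assoc_bilin1:
 "z \<in> carrier P ==> bilin M N (tensor_alg M (tensor_alg N P)) (\<lambda>x y. tens M (tensor_alg N P) x (tens N P y z))"
 by (rule bilin_comp[OF bilin_tens[OF M kspace_tensor_alg[OF N P]] lin_hom_id(2) bilinD(2)[OF bilin_tens[OF N P]]])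

private lemma assoc_bilin2:
 "bilin (tensor_alg M N) P (tensor_alg M (tensor_alg N P))
   (\<lambda>t z. tensor_lift M N (tensor_alg M (tensor_alg N P)) (\<lambda>x y. tens M (tensor_alg N P) x (tens N P y z)) t)"
proof (rule bilinI)
 have Q: "kspace (tensor_alg M (tensor_alg N P))" using M N P by simp
 show "tensor_lift M N (tensor_alg M (tensor_alg N P)) (\<lambda>x y. tens M (tensor_alg N P) x (tens N P y z))
    \<in> lin_hom (tensor_alg M N) (tensor_alg M (tensor_alg N P))" if "z \<in> carrier P" for z
  by (rule tensor_lift_lin_hom[OF M N Q assoc_bilin1[OF that]])
 show "(\<lambda>z. tensor_lift M N (tensor_alg M (tensor_alg N P)) (\<lambda>x y. tens M (tensor_alg N P) x (tens N P y z)) t)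
    \<in> lin_hom P (tensor_alg M (tensor_alg N P))" if t: "t \<in> carrier (tensor_alg M N)" for t
 proof (rule tensor_lift_param[OF P M N Q assoc_bilin1 _ t])
  fix x y assume xy: "x \<in> carrier M" "y \<in> carrier N"
  show "(\<lambda>z. tens M (tensor_alg N P) x (tens N P y z)) \<in> lin_hom P (tensor_alg M (tensor_alg N P))"
   by (rule lin_hom_comp[OF bilinD(1)[OF bilin_tens[OF N P] xy(2)] bilinD(1)[OF bilin_tens[OF M kspace_tensor_alg[OF N P]] xy(1)]])
 qed
qed

lemma tensor_assoc_lin_hom:
 "tensor_assoc M N P \<in> lin_hom (tensor_alg (tensor_alg M N) P) (tensor_alg M (tensor_alg N P))"
 unfolding tensor_assoc_def Let_def using M N P
 by (intro tensor_lift_lin_hom assoc_bilin2) simp_all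

lemma tensor_assoc_tens:
 assumes "t \<in> carrier (tensor_alg M N)" "z \<in> carrier P"
 shows "tensor_assoc M N P (tens (tensor_alg M N) P t z) =
  tensor_map M N M (tensor_alg N P) id (\<lambda>y. tens N P y z) t"
proof -
 have "tensor_assoc M N P (tens (tensor_alg M N) P t z) =
  tensor_lift M N (tensor_alg M (tensor_alg N P)) (\<lambda>x y. tens M (tensor_alg N P) x (tens N P y z)) t"
  unfolding tensor_assoc_def Let_def
  using tensor_lift_tens[OF kspace_tensor_alg[OF M N] P _ assoc_bilin2 assms] M N P by simp
 then show ?thesis by (simp add: tensor_map_def)
qed

lemma tensor_assoc_tens_tens [simp]:
 assumes "x \<in> carrier M" "y \<in> carrier N" "z \<in> carrier P"
 shows "tensor_assoc M N P (tens (tensor_alg M N) P (tens M N x y) z) = tens M (tensor_alg N P) x (tens N P y z)"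
 using tensor_map_tens[OF M N M kspace_tensor_alg[OF N P] lin_hom_id(1) bilinD(2)[OF bilin_tens[OF N P] assms(3)] assms(1,2)]
  assms M N P by (simp add: tensor_assoc_tens)

end

lemma tensor_assoc_alg_hom:
 assumes A: "k_algebra A" and B: "k_algebra B" and C: "k_algebra C"
 shows "tensor_assoc A B C \<in> alg_hom (tensor_alg (tensor_alg A B) C) (tensor_alg A (tensor_alg B C))"
proof (rule tensor_alg_homI)
 let ?TA = "tensor_alg A B"
 note l = k_algebra_kspace[OF A] k_algebra_kspace[OF B] k_algebra_kspace[OF C]
 show F: "tensor_assoc A B C \<in> lin_hom (tensor_alg ?TA C) (tensor_alg A (tensor_alg B C))"
  by (rule tensor_assoc_lin_hom[OF l])
 show "tensor_assoc A B C (tens ?TA C \<one>\<^bsub>?TA\<^esub> \<one>\<^bsub>C\<^esub>) = \<one>\<^bsub>tensor_alg A (tensor_alg B C)\<^esub>"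
  using A B C by (simp add: tensor_alg_sel)
 fix s z t z' assume st: "s \<in> carrier ?TA" "z \<in> carrier C" "t \<in> carrier ?TA" "z' \<in> carrier C"
 let ?Q = "tensor_alg A (tensor_alg B C)"
 have zz: "z \<otimes>\<^bsub>C\<^esub> z' \<in> carrier C" using st C by simp
 have kTA: "k_algebra ?TA" and kQ: "k_algebra ?Q" using A B C by auto
 note lz = lin_hom_comp[OF bilinD(2)[OF bilin_tens[OF k_algebra_kspace[OF kTA] l(3)]] F]
 note ksp = k_algebra_kspace[OF kQ]
 show "tensor_assoc A B C (tens ?TA C (s \<otimes>\<^bsub>?TA\<^esub> t) (z \<otimes>\<^bsub>C\<^esub> z')) =
   tensor_assoc A B C (tens ?TA C s z) \<otimes>\<^bsub>?Q\<^esub> tensor_assoc A B C (tens ?TA C t z')"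
 proof (rule tensor_ext[OF l(1,2) ksp lin_hom_comp[OF tensor_mult_lin_left[OF A B st(3)] lz[OF zz]]
     lin_hom_comp[OF lz[OF st(2)] lin_hom_mult_right[OF kQ]] _ st(1)])
  show "tensor_assoc A B C (tens ?TA C t z') \<in> carrier ?Q"
   using lin_hom_closed[OF lz[OF st(4)] st(3)] .
  fix x y assume xy: "x \<in> carrier A" "y \<in> carrier B"
  have s': "tens A B x y \<in> carrier ?TA" using xy A B by simp
  show "tensor_assoc A B C (tens ?TA C (tens A B x y \<otimes>\<^bsub>?TA\<^esub> t) (z \<otimes>\<^bsub>C\<^esub> z')) =
   tensor_assoc A B C (tens ?TA C (tens A B x y) z) \<otimes>\<^bsub>?Q\<^esub> tensor_assoc A B C (tens ?TA C t z')"
  proof (rule tensor_ext[OF l(1,2) ksp lin_hom_comp[OF tensor_mult_lin_right[OF A B s'] lz[OF zz]]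
     lin_hom_comp[OF lz[OF st(4)] lin_hom_mult_left[OF kQ]] _ st(3)])
   show "tensor_assoc A B C (tens ?TA C (tens A B x y) z) \<in> carrier ?Q"
    using lin_hom_closed[OF lz[OF st(2)] s'] .
  qed (use xy st A B C in simp)
 qed
qed (use assms in auto)

section \<open>Slicing tensors by functionals\<close>

text \<open>The map \<open>id \<otimes> \<phi>\<close>.\<close>

definition rslice :: "('k::field, 'a, 'y) module_scheme => ('k, 'b, 'z) module_scheme =>
  ('b => 'k) => ('k, 'a, 'b) tensor => 'a" where
 "rslice M N \<phi> = tensor_lift M N M (\<lambda>x y. \<phi> y \<odot>\<^bsub>M\<^esub> x)"

lemma rslice_lin_hom:
 "kspace M ==> kspace N ==> \<phi> \<in> dual N ==> rslice M N \<phi> \<in> lin_hom (tensor_alg M N) M"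
 unfolding rslice_def by (rule tensor_lift_lin_hom[OF _ _ _ bilin_smult_right]) auto

lemma rslice_tens [simp]:
 "kspace M ==> kspace N ==> \<phi> \<in> dual N ==> x \<in> carrier M ==> y \<in> carrier N ==>
  rslice M N \<phi> (tens M N x y) = \<phi> y \<odot>\<^bsub>M\<^esub> x"
 unfolding rslice_def by (rule tensor_lift_tens[OF _ _ _ bilin_smult_right]) auto

text \<open>
 Finitely many vectors are fixed by some operator of finite rank: if such an operator \<open>\<pi>\<close> moves
 one more vector \<open>y\<close>, replace \<open>1 - \<pi>\<close> by \<open>(1 - \<rho>)(1 - \<pi>)\<close>, where \<open>\<rho>\<close> has rank one and fixes
 \<open>y - \<pi> y\<close>.
\<close>

lemma finite_rank_fix:
 fixes N :: "('k::field, 'b, 'z) module_scheme"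
 assumes N: "kspace N" and Y: "finite Y" "Y \<subseteq> carrier N"
 shows "\<exists>n q \<phi>. (\<forall>s<n. q s \<in> carrier N \<and> \<phi> s \<in> dual N) \<and>
  (\<forall>y\<in>Y. y = finsum N (\<lambda>s. \<phi> s y \<odot>\<^bsub>N\<^esub> q s) {..<n::nat})"
 using Y
proof (induction rule: finite_induct)
 case empty
 show ?case by (intro exI[of _ 0]) simp
next
 case (insert y Y)
 have "Y \<subseteq> carrier N" using insert by simp
 from insert.IH[OF this] obtain n q \<phi> where
  q0: "\<forall>s<n. q s \<in> carrier N \<and> \<phi> s \<in> dual N" and
  fx: "\<forall>z\<in>Y. z = finsum N (\<lambda>s. \<phi> s z \<odot>\<^bsub>N\<^esub> q s) {..<n::nat}" by blast
 have q: "\<And>s. s < n ==> q s \<in> carrier N" and \<phi>: "\<And>s. s < n ==> \<phi> s \<in> dual N"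
  using q0 by auto
 note fx0 = bspec[OF fx]
 define \<pi> where "\<pi> z = finsum N (\<lambda>s. \<phi> s z \<odot>\<^bsub>N\<^esub> q s) {..<n}" for z
 have \<pi>c: "\<pi> z \<in> carrier N" if "z \<in> carrier N" for z
  unfolding \<pi>_def using q N by (intro kspace_finsum) auto
 have \<psi>\<pi>: "\<psi> (\<pi> z) = (\<Sum>s<n. \<phi> s z * \<psi> (q s))" if "z \<in> carrier N" "\<psi> \<in> dual N" for z \<psi>
  unfolding \<pi>_def using q N that by simp
 have y: "y \<in> carrier N" using insert by simp
 show ?case
 proof (cases "y = \<pi> y")
  case True
  then show ?thesis using q0 fx unfolding \<pi>_def by blast
 next
  case False
  define y' where "y' = y \<oplus>\<^bsub>N\<^esub> (-1) \<odot>\<^bsub>N\<^esub> \<pi> y"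
  have y'c: "y' \<in> carrier N" unfolding y'_def using y \<pi>c N by simp
  have "y' \<noteq> \<zero>\<^bsub>N\<^esub>"
   unfolding y'_def using False kspace_eq_if_diff_zero[OF N y \<pi>c[OF y]] by (rule contrapos_nn)
  then obtain \<psi> where \<psi>: "\<psi> \<in> dual N" "\<psi> y' = 1" using dual_separates[OF N y'c] by blast
  define \<phi>' where "\<phi>' s z = (if s < n then \<phi> s z else \<psi> z - (\<Sum>r<n. \<phi> r z * \<psi> (q r)))" for s z
  define q' where "q' s = (if s < n then q s else y')" for s
  have \<phi>'d: "\<phi>' s \<in> dual N" for s
   using \<phi> \<psi> by (cases "s < n") (auto intro!: dualI simp: \<phi>'_def distrib_right sum.distrib algebra_simps sum_distrib_left)
  have q'c: "q' s \<in> carrier N" for s using q y'c by (simp add: q'_def)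
  have ev: "\<chi> (finsum N (\<lambda>s. \<phi>' s z \<odot>\<^bsub>N\<^esub> q' s) {..<Suc n}) = \<chi> (\<pi> z) + (\<psi> z - \<psi> (\<pi> z)) * \<chi> y'"
   if "z \<in> carrier N" "\<chi> \<in> dual N" for z \<chi>
   using that N q'c \<psi> y'c by (simp add: \<psi>\<pi>) (simp add: \<phi>'_def q'_def)
  have "z = finsum N (\<lambda>s. \<phi>' s z \<odot>\<^bsub>N\<^esub> q' s) {..<Suc n}" if z: "z \<in> insert y Y" for z
  proof (rule kspace_eqI[OF N])
   show zc: "z \<in> carrier N" using z y insert by auto
   show "finsum N (\<lambda>s. \<phi>' s z \<odot>\<^bsub>N\<^esub> q' s) {..<Suc n} \<in> carrier N"
    using q'c N by simp
   fix \<chi> assume \<chi>: "\<chi> \<in> dual N"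
   show "\<chi> z = \<chi> (finsum N (\<lambda>s. \<phi>' s z \<odot>\<^bsub>N\<^esub> q' s) {..<Suc n})"
   proof (cases "z = y")
    case True
    have "\<psi> y - \<psi> (\<pi> y) = 1" using \<psi> y \<pi>c N unfolding y'_def by simp
    then show ?thesis unfolding ev[OF zc \<chi>] using True \<chi> y \<pi>c N by (simp add: y'_def)
   next
    case False
    then have "z \<in> Y" using z by simp
    then have "\<pi> z = z" unfolding \<pi>_def by (rule fx0[symmetric])
    then show ?thesis unfolding ev[OF zc \<chi>] by simp
   qed
  qed
  then show ?thesis using q'c \<phi>'d by blast
 qed
qed

text \<open>
 A tensor involves finitely many right factors, and an operator of finite rank fixing all of them
 reproduces the tensor. The left factors of the resulting expansion are slices of the tensor itself,
 so they inherit every property of the tensor that slicing preserves.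
\<close>

lemma tensor_expand:
 fixes M :: "('k::field, 'a, 'y) module_scheme" and N :: "('k, 'b, 'z) module_scheme"
 assumes M: "kspace M" and N: "kspace N" and I: "finite I" and t: "\<And>i. i \<in> I ==> t i \<in> carrier (tensor_alg M N)"
 shows "\<exists>n q \<phi>. (\<forall>s<n. q s \<in> carrier N \<and> \<phi> s \<in> dual N) \<and>
  (\<forall>i\<in>I. t i = finsum (tensor_alg M N) (\<lambda>s. tens M N (rslice M N (\<phi> s) (t i)) (q s)) {..<n::nat})"
proof -
 let ?TA = "tensor_alg M N"
 have TA: "kspace ?TA" using M N by simp
 define good where "good Y u \<longleftrightarrow> (\<forall>n q \<phi>. (\<forall>s<n. q s \<in> carrier N \<and> \<phi> s \<in> dual N) -->
  (\<forall>y\<in>Y. y = finsum N (\<lambda>s. \<phi> s y \<odot>\<^bsub>N\<^esub> q s) {..<n::nat}) -->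
  u = finsum ?TA (\<lambda>s. tens M N (rslice M N (\<phi> s) u) (q s)) {..<n})" for Y u
 have ex: "\<exists>Y. finite Y \<and> Y \<subseteq> carrier N \<and> good Y u" if "u \<in> carrier ?TA" for u
  using that
 proof (induction u rule: tensor_induct[OF M N, consumes 1, case_names zero add])
  case zero
  have "good {} \<zero>\<^bsub>?TA\<^esub>"
   unfolding good_def
  proof (intro allI impI)
   fix n q \<phi> assume q: "\<forall>s<n::nat. q s \<in> carrier N \<and> \<phi> s \<in> dual N"
   show "\<zero>\<^bsub>?TA\<^esub> = finsum ?TA (\<lambda>s. tens M N (rslice M N (\<phi> s) \<zero>\<^bsub>?TA\<^esub>) (q s)) {..<n}"
   proof (rule kspace_eqI[OF TA])
    have z: "rslice M N (\<phi> s) \<zero>\<^bsub>?TA\<^esub> = \<zero>\<^bsub>M\<^esub>" if "s < n" for s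
     using lin_hom_zero[OF TA M rslice_lin_hom[OF M N]] q that by simp
    then show c: "finsum ?TA (\<lambda>s. tens M N (rslice M N (\<phi> s) \<zero>\<^bsub>?TA\<^esub>) (q s)) {..<n} \<in> carrier ?TA"
     using TA M N q by (intro kspace_finsum) auto
    fix \<Phi> assume \<Phi>: "\<Phi> \<in> dual ?TA"
    show "\<Phi> \<zero>\<^bsub>?TA\<^esub> = \<Phi> (finsum ?TA (\<lambda>s. tens M N (rslice M N (\<phi> s) \<zero>\<^bsub>?TA\<^esub>) (q s)) {..<n})"
     using TA M N q z \<Phi> dual_zero[OF M dual_tens_left[OF M N \<Phi>]] by simp
   qed (use TA in simp)
  qed
  then show ?case by blast
 next
  case (add x y u)
  then obtain Y where Y: "finite Y" "Y \<subseteq> carrier N" "good Y u" by blast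
  have "good (insert y Y) (tens M N x y \<oplus>\<^bsub>?TA\<^esub> u)"
   unfolding good_def
  proof (intro allI impI)
   fix n q \<phi> assume q: "\<forall>s<n::nat. q s \<in> carrier N \<and> \<phi> s \<in> dual N"
    and fx: "\<forall>y\<in>insert y Y. y = finsum N (\<lambda>s. \<phi> s y \<odot>\<^bsub>N\<^esub> q s) {..<n}"
   have u: "u = finsum ?TA (\<lambda>s. tens M N (rslice M N (\<phi> s) u) (q s)) {..<n}"
    using Y(3) q fx unfolding good_def by blast
   have rc: "rslice M N (\<phi> s) u \<in> carrier M" if "s < n" for s
    using lin_hom_closed[OF rslice_lin_hom[OF M N] add(3)] q that by simp
   have r: "rslice M N (\<phi> s) (tens M N x y \<oplus>\<^bsub>?TA\<^esub> u) = \<phi> s y \<odot>\<^bsub>M\<^esub> x \<oplus>\<^bsub>M\<^esub> rslice M N (\<phi> s) u" if "s < n" for s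
    using lin_hom_add[OF rslice_lin_hom[OF M N], of "\<phi> s" "tens M N x y" u] q that add M N by simp
   let ?g = "\<lambda>s. tens M N (rslice M N (\<phi> s) (tens M N x y \<oplus>\<^bsub>?TA\<^esub> u)) (q s)"
   have gc: "?g s \<in> carrier ?TA" if "s < n" for s
    using r rc q that add M N by simp
   show "tens M N x y \<oplus>\<^bsub>?TA\<^esub> u = finsum ?TA ?g {..<n}"
   proof (rule kspace_eqI[OF TA])
    show "finsum ?TA ?g {..<n} \<in> carrier ?TA" by (intro kspace_finsum[OF TA] gc) simp
    fix \<Phi> assume \<Phi>: "\<Phi> \<in> dual ?TA"
    have "\<Phi> (tens M N x y) = \<Phi> (tens M N x (finsum N (\<lambda>s. \<phi> s y \<odot>\<^bsub>N\<^esub> q s) {..<n}))"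
     using fx by auto
    also have "... = (\<Sum>s<n. \<phi> s y * \<Phi> (tens M N x (q s)))"
     using dual_finsum_lessThan[OF N dual_tens_right[OF M N \<Phi> add(1)], of n "\<lambda>s. \<phi> s y \<odot>\<^bsub>N\<^esub> q s"] q N
      dual_smult[OF dual_tens_right[OF M N \<Phi> add(1)]] by simp
    finally have 1: "\<Phi> (tens M N x y) = (\<Sum>s<n. \<phi> s y * \<Phi> (tens M N x (q s)))" .
    have "\<Phi> u = \<Phi> (finsum ?TA (\<lambda>s. tens M N (rslice M N (\<phi> s) u) (q s)) {..<n})" using u by simp
    also have "... = (\<Sum>s<n. \<Phi> (tens M N (rslice M N (\<phi> s) u) (q s)))"
     using \<Phi> TA M N rc q by simp
    finally have 2: "\<Phi> u = (\<Sum>s<n. \<Phi> (tens M N (rslice M N (\<phi> s) u) (q s)))" .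
    have 3: "\<Phi> (?g s) = \<phi> s y * \<Phi> (tens M N x (q s)) + \<Phi> (tens M N (rslice M N (\<phi> s) u) (q s))" if "s < n" for s
     using r that rc q add M N dual_tens_left[OF M N \<Phi>, of "q s"]
      dual_add[OF dual_tens_left[OF M N \<Phi>, of "q s"], of "\<phi> s y \<odot>\<^bsub>M\<^esub> x" "rslice M N (\<phi> s) u"]
      dual_smult[OF dual_tens_left[OF M N \<Phi>, of "q s"], of x "\<phi> s y"] by simp
    show "\<Phi> (tens M N x y \<oplus>\<^bsub>?TA\<^esub> u) = \<Phi> (finsum ?TA ?g {..<n})"
     using \<Phi> TA gc add M N 1 2 by (simp add: 3 sum.distrib)
   qed (use add M N in auto)
  qed
  then show ?case using Y add by (intro exI[of _ "insert y Y"]) auto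
 qed
 then obtain Y where Y: "\<And>u. u \<in> carrier ?TA ==> finite (Y u) \<and> Y u \<subseteq> carrier N \<and> good (Y u) u"
  by metis
 have "finite (\<Union>i\<in>I. Y (t i))" "(\<Union>i\<in>I. Y (t i)) \<subseteq> carrier N" using Y t I by (simp, blast)
 from finite_rank_fix[OF N this] obtain n q \<phi> where
  q: "\<forall>s<n::nat. q s \<in> carrier N \<and> \<phi> s \<in> dual N" and
  fx: "\<forall>y\<in>(\<Union>i\<in>I. Y (t i)). y = finsum N (\<lambda>s. \<phi> s y \<odot>\<^bsub>N\<^esub> q s) {..<n}" by blast
 have "t i = finsum ?TA (\<lambda>s. tens M N (rslice M N (\<phi> s) (t i)) (q s)) {..<n}" if "i \<in> I" for i
  using Y[OF t[OF that]] q fx that unfolding good_def by blast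
 then show ?thesis using q by blast
qed

section \<open>Scalars and opposite algebras\<close>

lemma scalar_alg_sel [simp]:
 "carrier scalar_alg = UNIV" "mult scalar_alg = (*)" "one scalar_alg = 1" "zero scalar_alg = 0"
 "add scalar_alg = (+)" "smult scalar_alg = (*)"
 by (simp_all add: scalar_alg_def ring.defs module.defs)

lemma k_algebra_scalar [simp]: "k_algebra (scalar_alg :: ('k::field, 'k) module)"
 by (intro k_algebraI kspaceI) (simp_all add: algebra_simps)

lemma lin_hom_scalar: "f \<in> lin_hom M scalar_alg \<longleftrightarrow> f \<in> dual M"
proof
 assume f: "f \<in> lin_hom M scalar_alg"
 show "f \<in> dual M"
  by (rule dualI) (simp_all add: lin_hom_add[OF f] lin_hom_smult[OF f])
next
 assume f: "f \<in> dual M"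
 show "f \<in> lin_hom M scalar_alg"
  by (rule lin_homI) (simp_all add: f)
qed

lemma alg_hom_dual: "f \<in> alg_hom M scalar_alg ==> f \<in> dual M"
 using lin_hom_scalar alg_hom_lin by blast

lemma op_alg_sel [simp]:
 "carrier (op_alg A) = carrier A" "mult (op_alg A) = (\<lambda>x y. y \<otimes>\<^bsub>A\<^esub> x)" "one (op_alg A) = one A"
 "zero (op_alg A) = zero A" "add (op_alg A) = add A" "smult (op_alg A) = smult A"
 by (simp_all add: op_alg_def)

lemma k_algebra_op [simp]: "k_algebra A ==> k_algebra (op_alg A)"
 by (intro k_algebraI kspaceI)
  (simp_all add: kspace_ac[OF k_algebra_kspace] kspace_smult_add_left kspace_smult_add_right
   kspace_smult_smult k_algebra_assoc k_algebra_add_mult k_algebra_mult_add)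

lemma dual_op [simp]: "dual (op_alg A) = dual A"
 unfolding dual_def op_alg_sel by (rule refl)

lemma lin_hom_op [simp]: "lin_hom M (op_alg A) = lin_hom M A" "lin_hom (op_alg A) M = lin_hom A M"
 unfolding LinearCombinations.module_hom_def op_alg_sel by (rule refl)+

section \<open>Free algebras\<close>

lemma free_alg_sel [simp]:
 "carrier (free_alg S) = {p. Poly_Mapping.keys p \<subseteq> {w. set (letters w) \<subseteq> S}}" "zero (free_alg S) = 0"
 "add (free_alg S) = (+)" "smult (free_alg S) = (\<lambda>c. Poly_Mapping.map ((*) c))"
 "mult (free_alg S) = (*)" "one (free_alg S) = 1"
 by (simp_all add: free_alg_def)

lemma single_zero_commute: "p * single 0 c = single 0 c * p"
 for p :: "'x word \<Rightarrow>\<^sub>0 'k::field"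
 using subset_UNIV
 by (induction p rule: poly_mapping_sum_induct)
  (simp_all add: distrib_left distrib_right mult_single mult.commute)

lemma keys_mult_subset:
 fixes p q :: "'x word \<Rightarrow>\<^sub>0 'k::field"
 assumes "Poly_Mapping.keys p \<subseteq> {w. set (letters w) \<subseteq> S}" "Poly_Mapping.keys q \<subseteq> {w. set (letters w) \<subseteq> S}"
 shows "Poly_Mapping.keys (p * q) \<subseteq> {w. set (letters w) \<subseteq> S}"
proof
 fix w assume "w \<in> Poly_Mapping.keys (p * q)"
 then obtain u v where "w = u + v" "u \<in> Poly_Mapping.keys p" "v \<in> Poly_Mapping.keys q"
  using keys_mult[of p q] by auto
 then show "w \<in> {w. set (letters w) \<subseteq> S}" using assms by (auto simp: plus_word_def)
qed

lemma kspace_free_alg: "kspace (free_alg S :: ('k::field, 'x word \<Rightarrow>\<^sub>0 'k) module)"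
proof (rule kspace_image[OF kspace_free_space])
 show "id \<in> lin_hom (free_space {w. set (letters w) \<subseteq> S}) (free_alg S)"
  by (rule lin_homI) simp_all
qed auto

lemma k_algebra_free_alg [simp]: "k_algebra (free_alg S :: ('k::field, 'x word \<Rightarrow>\<^sub>0 'k) module)"
proof (rule k_algebraI[OF kspace_free_alg])
 fix p q :: "'x word \<Rightarrow>\<^sub>0 'k" and c
 assume p: "p \<in> carrier (free_alg S)" and q: "q \<in> carrier (free_alg S)"
 show "p \<otimes>\<^bsub>free_alg S\<^esub> q \<in> carrier (free_alg S)" using p q keys_mult_subset by simp
 show "(c \<odot>\<^bsub>free_alg S\<^esub> p) \<otimes>\<^bsub>free_alg S\<^esub> q = c \<odot>\<^bsub>free_alg S\<^esub> (p \<otimes>\<^bsub>free_alg S\<^esub> q)"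
  by (simp add: mult_map_scale_conv_mult mult.assoc)
 show "p \<otimes>\<^bsub>free_alg S\<^esub> (c \<odot>\<^bsub>free_alg S\<^esub> q) = c \<odot>\<^bsub>free_alg S\<^esub> (p \<otimes>\<^bsub>free_alg S\<^esub> q)"
  by (simp add: mult_map_scale_conv_mult single_zero_commute flip: mult.assoc)
qed (auto simp: mult.assoc distrib_left distrib_right zero_word_def)

definition wordprod :: "('k::field, 'a, 'z) module_scheme => ('x => 'a) => 'x word => 'a" where
 "wordprod A \<phi> w = foldr (\<lambda>x r. \<phi> x \<otimes>\<^bsub>A\<^esub> r) (letters w) \<one>\<^bsub>A\<^esub>"

lemma wordprod_simps [simp]:
 "wordprod A \<phi> 0 = \<one>\<^bsub>A\<^esub>"
 "wordprod A \<phi> (Word (x # xs)) = \<phi> x \<otimes>\<^bsub>A\<^esub> wordprod A \<phi> (Word xs)"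
 by (simp_all add: wordprod_def zero_word_def)

lemma wordprod_closed:
 assumes "k_algebra A" "\<And>x. x \<in> S ==> \<phi> x \<in> carrier A" "set (letters w) \<subseteq> S"
 shows "wordprod A \<phi> w \<in> carrier A"
proof -
 have "set xs \<subseteq> S ==> wordprod A \<phi> (Word xs) \<in> carrier A" for xs
  by (induction xs) (use assms(1,2) in \<open>auto simp: wordprod_def\<close>)
 from this[of "letters w"] show ?thesis using assms(3) by simp
qed

lemma wordprod_add:
 assumes A: "k_algebra A" and \<phi>: "\<And>x. x \<in> S ==> \<phi> x \<in> carrier A"
  and u: "set (letters u) \<subseteq> S" and v: "set (letters v) \<subseteq> S"
 shows "wordprod A \<phi> (u + v) = wordprod A \<phi> u \<otimes>\<^bsub>A\<^esub> wordprod A \<phi> v"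
proof -
 note vc = wordprod_closed[of A S \<phi> v, OF A \<phi> v]
 have "set xs \<subseteq> S ==> wordprod A \<phi> (Word (xs @ letters v)) = wordprod A \<phi> (Word xs) \<otimes>\<^bsub>A\<^esub> wordprod A \<phi> v" for xs
 proof (induction xs)
  case Nil
  then show ?case using A vc by (simp add: wordprod_def)
 next
  case (Cons x xs)
  have "wordprod A \<phi> (Word xs) \<in> carrier A"
   by (rule wordprod_closed[of A S, OF A \<phi>]) (use Cons in auto)
  then show ?case using Cons A \<phi> vc by (simp add: k_algebra_assoc)
 qed
 from this[of "letters u"] show ?thesis using u by (simp add: plus_word_def)
qed

lemma free_alg_hom:
 fixes A :: "('k::field, 'a, 'z) module_scheme" (structure)
 assumes A: "k_algebra A" and \<phi>: "\<And>x. x \<in> S ==> \<phi> x \<in> carrier A"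
 shows "\<exists>f\<in>alg_hom (free_alg S) A. \<forall>x\<in>S. f (free_var x) = \<phi> x"
proof
 let ?W = "{w. set (letters w) \<subseteq> S}"
 let ?f = "lin_ext A (wordprod A \<phi>)"
 have kA: "kspace A" using A by simp
 have wc: "wordprod A \<phi> w \<in> carrier A" if "w \<in> ?W" for w
  by (rule wordprod_closed[of A S, OF A \<phi>]) (use that in auto)
 have f: "?f \<in> lin_hom (free_space ?W) A" by (rule lin_ext_lin_hom[OF kA wc])
 then have f': "?f \<in> lin_hom (free_alg S) A"
  by (rule_tac lin_homI) (use lin_hom_closed[OF f] lin_hom_add[OF f] lin_hom_smult[OF f] in auto)
 have fs: "?f (single w c) = c \<odot> wordprod A \<phi> w" if "w \<in> ?W" for w c
  by (rule lin_ext_single[where g = "wordprod A \<phi>", OF kA wc[OF that]])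
 have fa: "?f (p + q) = ?f p \<oplus> ?f q" if "Poly_Mapping.keys p \<subseteq> ?W" "Poly_Mapping.keys q \<subseteq> ?W" for p q
  using lin_hom_add[OF f] that by simp
 have fc: "?f p \<in> carrier A" if "Poly_Mapping.keys p \<subseteq> ?W" for p
  using lin_hom_closed[OF f] that by simp
 have f0: "?f 0 = \<zero>" using kA by (simp add: lin_ext_def)
 have km: "Poly_Mapping.keys (p * q) \<subseteq> ?W" if "Poly_Mapping.keys p \<subseteq> ?W" "Poly_Mapping.keys q \<subseteq> ?W"
  for p q :: "'b word \<Rightarrow>\<^sub>0 'k" by (rule keys_mult_subset[OF that])
 have wW: "u + v \<in> ?W" if "u \<in> ?W" "v \<in> ?W" for u v using that by (auto simp: plus_word_def)
 have ks: "Poly_Mapping.keys (single w c) \<subseteq> ?W" if "w \<in> ?W" for w and c :: 'k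
  using that by simp
 have z1: "\<zero> \<otimes> x = \<zero>" "x \<otimes> \<zero> = \<zero>" if "x \<in> carrier A" for x
  using lin_hom_zero[OF kA kA lin_hom_mult_right[OF A that]]
   lin_hom_zero[OF kA kA lin_hom_mult_left[OF A that]] by auto
 have m1: "?f (single u c * q) = ?f (single u c) \<otimes> ?f q"
  if u: "u \<in> ?W" and q: "Poly_Mapping.keys q \<subseteq> ?W" for u c q
  using q
 proof (induction q rule: poly_mapping_sum_induct)
  case zero
  then show ?case using f0 z1 fs[OF u] wc[OF u] kA by simp
 next
  case (add v d q)
  have "?f (single u c * single v d) = (c * d) \<odot> (wordprod A \<phi> u \<otimes> wordprod A \<phi> v)"
   using fs[OF wW[OF u add(1)]] wordprod_add[of A S \<phi> u v, OF A \<phi>] u add(1) by (simp add: mult_single)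
  also have "... = ?f (single u c) \<otimes> ?f (single v d)"
   using fs u add(1) wc A by (simp add: kspace_smult_smult mult.commute)
  finally show ?case
   using add u ks[OF u, of c] ks[OF add(1), of d] fa[OF km km] fa[OF ks add(2)] fc A
   by (simp add: distrib_left k_algebra_mult_add del: keys_single)
 qed
 have m: "?f (p * q) = ?f p \<otimes> ?f q"
  if p: "Poly_Mapping.keys p \<subseteq> ?W" and q: "Poly_Mapping.keys q \<subseteq> ?W" for p q
  using p
 proof (induction p rule: poly_mapping_sum_induct)
  case zero
  then show ?case using f0 z1 fc[OF q] by simp
 next
  case (add u c p)
  then show ?case
   using q ks[OF add(1), of c] fa[OF km km] fa[OF ks add(2)] fc A m1[OF add(1) q]
   by (simp add: distrib_right k_algebra_add_mult del: keys_single)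
 qed
 have "?f 1 = \<one>"
  using fs[of 0 1] A by (simp add: zero_word_def flip: single_one) (simp add: wordprod_def)
 then show "?f \<in> alg_hom (free_alg S) A"
  by (intro alg_homI f') (simp_all add: m)
 show "\<forall>x\<in>S. ?f (free_var x) = \<phi> x"
 proof
  fix x assume x: "x \<in> S"
  have "wordprod A \<phi> (Word [x]) = \<phi> x" using \<phi>[OF x] A by (simp add: wordprod_def)
  then show "?f (free_var x) = \<phi> x"
   unfolding free_var_def using fs[of "Word [x]" 1] \<phi>[OF x] x kA by simp
 qed
qed

lemma free_alg_induct [consumes 1, case_names one var add smult]:
 fixes p :: "'x word \<Rightarrow>\<^sub>0 'k::field"
 assumes p: "p \<in> carrier (free_alg S)" and 1: "Q 1"
  and v: "\<And>x q. x \<in> S ==> q \<in> carrier (free_alg S) ==> Q q ==> Q (free_var x * q)"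
  and a: "\<And>p q. p \<in> carrier (free_alg S) ==> q \<in> carrier (free_alg S) ==> Q p ==> Q q ==> Q (p + q)"
  and s: "\<And>c q. q \<in> carrier (free_alg S) ==> Q q ==> Q (Poly_Mapping.map ((*) c) q)"
 shows "Q p"
proof -
 have w: "Q (single (Word xs) 1)" if "set xs \<subseteq> S" for xs
  using that
 proof (induction xs)
  case Nil
  then show ?case using 1 by (simp flip: zero_word_def)
 next
  case (Cons x xs)
  have "single (Word (x # xs)) (1::'k) = free_var x * single (Word xs) 1"
   by (simp add: free_var_def mult_single plus_word_def)
  then show ?case using v[of x "single (Word xs) 1"] Cons by simp
 qed
 have w': "Q (single u c)" if "set (letters u) \<subseteq> S" for u c
  using s[OF _ w[OF that], of c] that by simp
 have z: "Q 0" using w'[of "Word []" 0] by simp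
 have "Poly_Mapping.keys p \<subseteq> {w. set (letters w) \<subseteq> S}" using p by simp
 then show ?thesis
  by (induction p rule: poly_mapping_sum_induct) (use z a w' in auto)
qed

section \<open>Matrices as functions of two indices\<close>

text \<open>
 Mutually inverse square matrices, given by their entries so that all relations become iterated sums
 in the field.
\<close>

definition inverse_fun :: "nat => (nat => nat => 'k::field) => (nat => nat => 'k) => bool" where
 "inverse_fun n E E' \<longleftrightarrow> (\<forall>i<n. \<forall>j<n. (\<Sum>k<n. E i k * E' k j) = of_bool (i = j) \<and>
   (\<Sum>k<n. E' i k * E k j) = of_bool (i = j))"

lemma inverse_funD:
 assumes "inverse_fun n E E'" "i < n" "j < n"
 shows "(\<Sum>k<n. E i k * E' k j) = of_bool (i = j)" "(\<Sum>k<n. E' i k * E k j) = of_bool (i = j)"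
 using assms by (auto simp: inverse_fun_def)

lemma inverse_fun_sym: "inverse_fun n E E' ==> inverse_fun n E' E"
 by (auto simp: inverse_fun_def)

lemma sum_of_bool_mult [simp]:
 "i < n ==> (\<Sum>k<n. of_bool (i = k) * f k) = (f i :: 'k::field)"
 "i < n ==> (\<Sum>k<n. of_bool (k = i) * f k) = (f i :: 'k::field)"
 "i < n ==> (\<Sum>k<n. f k * of_bool (i = k)) = (f i :: 'k::field)"
 "i < n ==> (\<Sum>k<n. f k * of_bool (k = i)) = (f i :: 'k::field)"
 for n :: nat
 by (simp_all add: of_bool_def if_distrib[of "\<lambda>x. x * _"] if_distrib[of "\<lambda>x. _ * x"] cong: if_cong)

lemma inverse_fun_cancel:
 assumes "inverse_fun n E E'" "i < n"
 shows "(\<Sum>j<n. E i j * (\<Sum>k<n. E' j k * f k)) = f i"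
proof -
 have "(\<Sum>j<n. E i j * (\<Sum>k<n. E' j k * f k)) = (\<Sum>k<n. (\<Sum>j<n. E i j * E' j k) * f k)"
  unfolding sum_distrib_left sum_distrib_right by (subst sum.swap) (simp add: mult.assoc)
 also have "... = (\<Sum>k<n. of_bool (i = k) * f k)"
  by (rule sum.cong) (use inverse_funD(1)[OF assms(1,2)] in auto)
 finally show ?thesis using assms(2) by simp
qed

lemma inverse_fun_cancel_right:
 assumes "inverse_fun n E E'" "i < n"
 shows "(\<Sum>j<n. (\<Sum>k<n. f k * E k j) * E' j i) = f i"
proof -
 have "(\<Sum>j<n. (\<Sum>k<n. f k * E k j) * E' j i) = (\<Sum>k<n. f k * (\<Sum>j<n. E k j * E' j i))"
  unfolding sum_distrib_left sum_distrib_right by (subst sum.swap) (simp add: mult.assoc)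
 also have "... = (\<Sum>k<n. f k * of_bool (k = i))"
  by (rule sum.cong) (use inverse_funD(1)[OF assms(1) _ assms(2)] in auto)
 finally show ?thesis using assms(2) by simp
qed

abbreviation entry :: "'k mat => nat => nat => 'k" where "entry M \<equiv> (\<lambda>i j. M $$ (i, j))"

lemma GL_carrier: "E \<in> GL n ==> E \<in> carrier_mat n n"
 by (auto simp: GL_def Units_def ring_mat_simps)

lemma GL_dim [simp]: "E \<in> GL n ==> dim_row E = n" "E \<in> GL n ==> dim_col E = n"
 using GL_carrier by auto

lemma GL_inverse:
 assumes "E \<in> GL n"
 shows "minv E \<in> carrier_mat n n" "E * minv E = 1\<^sub>m n" "minv E * E = 1\<^sub>m n"
proof -
 let ?R = "ring_mat TYPE('a) n ()"
 interpret ring ?R by (rule ring_mat)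
 have u: "E \<in> Units ?R" using assms by (simp add: GL_def)
 have m: "minv E = inv\<^bsub>?R\<^esub> E" using assms by (simp add: minv_def)
 show "minv E \<in> carrier_mat n n" using Units_inv_closed[OF u] by (simp add: m ring_mat_simps)
 show "E * minv E = 1\<^sub>m n" using Units_r_inv[OF u] by (simp add: m ring_mat_simps)
 show "minv E * E = 1\<^sub>m n" using Units_l_inv[OF u] by (simp add: m ring_mat_simps)
qed

lemma GLI: "E \<in> carrier_mat n n ==> E' \<in> carrier_mat n n ==> E * E' = 1\<^sub>m n ==> E' * E = 1\<^sub>m n ==> E \<in> GL n"
 by (auto simp: GL_def Units_def ring_mat_simps)

lemma entry_mult:
 "A \<in> carrier_mat m n ==> B \<in> carrier_mat n p ==> i < m ==> j < p ==>
  (A * B) $$ (i, j) = (\<Sum>k<n. A $$ (i, k) * B $$ (k, j))"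
 by (simp add: scalar_prod_def atLeast0LessThan)

lemma GL_inverse_fun:
 assumes "E \<in> GL n"
 shows "inverse_fun n (entry E) (entry (minv E))"
 unfolding inverse_fun_def
proof (intro allI impI conjI)
 fix i j assume ij: "i < n" "j < n"
 note c = GL_carrier[OF assms] GL_inverse(1)[OF assms]
 show "(\<Sum>k<n. entry E i k * entry (minv E) k j) = of_bool (i = j)"
  unfolding entry_mult[OF c(1,2) ij, symmetric] GL_inverse(2)[OF assms] using ij by simp
 show "(\<Sum>k<n. entry (minv E) i k * entry E k j) = of_bool (i = j)"
  unfolding entry_mult[OF c(2,1) ij, symmetric] GL_inverse(3)[OF assms] using ij by simp
qed

section \<open>Solutions of the defining relations\<close>

text \<open>
 \<open>BR A m n E E' F F' a\<close> says that the \<open>m \<times> n\<close> matrix \<open>a\<close> over \<open>A\<close> satisfies \<open>a\<^sup>t E a = F\<close> and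
 \<open>a F' a\<^sup>t = E'\<close>, tested against all linear functionals. For \<open>E' = E\<^sup>-\<^sup>1\<close> and \<open>F' = F\<^sup>-\<^sup>1\<close> these are
 the defining relations of \<open>\<B>(E,F)\<close>. The form is symmetric in the pairs \<open>(E, E')\<close> and \<open>(F', F)\<close>.
\<close>

definition BR :: "('k::field, 'a, 'z) module_scheme => nat => nat => (nat => nat => 'k) => (nat => nat => 'k) =>
  (nat => nat => 'k) => (nat => nat => 'k) => (nat => nat => 'a) => bool" where
 "BR A m n E E' F F' a \<longleftrightarrow> (\<forall>i<m. \<forall>j<n. a i j \<in> carrier A) \<and> (\<forall>\<phi>\<in>dual A.
   (\<forall>i<n. \<forall>j<n. (\<Sum>k<m. \<Sum>l<m. E k l * \<phi> (a k i \<otimes>\<^bsub>A\<^esub> a l j)) = F i j * \<phi> \<one>\<^bsub>A\<^esub>) \<and>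
   (\<forall>k<m. \<forall>l<m. (\<Sum>i<n. \<Sum>j<n. F' i j * \<phi> (a k i \<otimes>\<^bsub>A\<^esub> a l j)) = E' k l * \<phi> \<one>\<^bsub>A\<^esub>))"

lemma BR_closed: "BR A m n E E' F F' a ==> i < m ==> j < n ==> a i j \<in> carrier A"
 by (simp add: BR_def)

lemma BR1: "BR A m n E E' F F' a ==> \<phi> \<in> dual A ==> i < n ==> j < n ==>
  (\<Sum>k<m. \<Sum>l<m. E k l * \<phi> (a k i \<otimes>\<^bsub>A\<^esub> a l j)) = F i j * \<phi> \<one>\<^bsub>A\<^esub>"
 by (simp add: BR_def)

lemma BR2: "BR A m n E E' F F' a ==> \<phi> \<in> dual A ==> k < m ==> l < m ==>
  (\<Sum>i<n. \<Sum>j<n. F' i j * \<phi> (a k i \<otimes>\<^bsub>A\<^esub> a l j)) = E' k l * \<phi> \<one>\<^bsub>A\<^esub>"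
 by (simp add: BR_def)

lemma BRI:
 fixes A (structure)
 assumes "\<And>i j. i < m ==> j < n ==> a i j \<in> carrier A"
  and "\<And>\<phi> i j. \<phi> \<in> dual A ==> i < n ==> j < n ==>
   (\<Sum>k<m. \<Sum>l<m. E k l * \<phi> (a k i \<otimes> a l j)) = F i j * \<phi> \<one>"
  and "\<And>\<phi> k l. \<phi> \<in> dual A ==> k < m ==> l < m ==>
   (\<Sum>i<n. \<Sum>j<n. F' i j * \<phi> (a k i \<otimes> a l j)) = E' k l * \<phi> \<one>"
 shows "BR A m n E E' F F' a"
 using assms unfolding BR_def by blast

lemma BR_transpose:
 assumes "BR A m n E E' F F' a"
 shows "BR A n m F' F E' E (\<lambda>i j. a j i)"
 using assms unfolding BR_def by blast

lemma BR_hom: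
 assumes r: "BR A m n E E' F F' a" and f: "f \<in> alg_hom A B"
 shows "BR B m n E E' F F' (\<lambda>i j. f (a i j))"
proof (rule BRI)
 show "f (a i j) \<in> carrier B" if "i < m" "j < n" for i j
  using BR_closed[OF r that] f by simp
 fix \<phi> assume \<phi>: "\<phi> \<in> dual B"
 have d: "(\<lambda>x. \<phi> (f x)) \<in> dual A" by (rule dual_comp[OF alg_hom_lin[OF f] \<phi>])
 have fm: "f (a k i) \<otimes>\<^bsub>B\<^esub> f (a l j) = f (a k i \<otimes>\<^bsub>A\<^esub> a l j)" if "k < m" "i < n" "l < m" "j < n" for k i l j
  using BR_closed[OF r] that f by simp
 have f1: "\<one>\<^bsub>B\<^esub> = f \<one>\<^bsub>A\<^esub>" using f by simp
 show "(\<Sum>k<m. \<Sum>l<m. E k l * \<phi> (f (a k i) \<otimes>\<^bsub>B\<^esub> f (a l j))) = F i j * \<phi> \<one>\<^bsub>B\<^esub>"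
  if "i < n" "j < n" for i j
  using BR1[OF r d that] that by (simp add: fm f1 cong: sum.cong_simp)
 show "(\<Sum>i<n. \<Sum>j<n. F' i j * \<phi> (f (a k i) \<otimes>\<^bsub>B\<^esub> f (a l j))) = E' k l * \<phi> \<one>\<^bsub>B\<^esub>"
  if "k < m" "l < m" for k l
  using BR2[OF r d that] that by (simp add: fm f1 cong: sum.cong_simp)
qed

section \<open>The universal property of \<open>\<B>(E,F)\<close>\<close>

lemma free_alg_closed:
 "(1 :: 'x word \<Rightarrow>\<^sub>0 'k::field) \<in> carrier (free_alg S)"
 "x \<in> S ==> (free_var x :: 'x word \<Rightarrow>\<^sub>0 'k::field) \<in> carrier (free_alg S)"
 "p \<in> carrier (free_alg S) ==> q \<in> carrier (free_alg S) ==> p * q \<in> carrier (free_alg S)"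
 "p \<in> carrier (free_alg S) ==> q \<in> carrier (free_alg S) ==> p - q \<in> carrier (free_alg S)"
 "(\<And>i. i \<in> I ==> f i \<in> carrier (free_alg S)) ==> sum f I \<in> carrier (free_alg S)"
 "(single 0 c :: 'x word \<Rightarrow>\<^sub>0 'k::field) \<in> carrier (free_alg S)"
 for p q :: "'x word \<Rightarrow>\<^sub>0 'k::field"
proof -
 show "(1 :: 'x word \<Rightarrow>\<^sub>0 'k::field) \<in> carrier (free_alg S)"
  "x \<in> S ==> (free_var x :: 'x word \<Rightarrow>\<^sub>0 'k::field) \<in> carrier (free_alg S)"
  "(single 0 c :: 'x word \<Rightarrow>\<^sub>0 'k::field) \<in> carrier (free_alg S)"
  by (simp_all add: zero_word_def free_var_def)
 show "p \<in> carrier (free_alg S) ==> q \<in> carrier (free_alg S) ==> p * q \<in> carrier (free_alg S)"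
  using keys_mult_subset by simp
 show "p \<in> carrier (free_alg S) ==> q \<in> carrier (free_alg S) ==> p - q \<in> carrier (free_alg S)"
  using keys_diff[of p q] by auto
 show "(\<And>i. i \<in> I ==> f i \<in> carrier (free_alg S)) ==> sum f I \<in> carrier (free_alg S)"
  using keys_sum[of f I] by auto blast
qed

context
 fixes L :: "('x word \<Rightarrow>\<^sub>0 'k::field) => 'k" and S :: "'x set"
 assumes L: "L \<in> dual (free_alg S)"
begin

lemma free_dual_add: "p \<in> carrier (free_alg S) ==> q \<in> carrier (free_alg S) ==> L (p + q) = L p + L q"
 using dual_add[OF L] by simp

lemma free_dual_scalar: "p \<in> carrier (free_alg S) ==> L (single 0 c * p) = c * L p"
 using dual_smult[OF L, of p c] by (simp add: mult_map_scale_conv_mult)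

lemma free_dual_minus: "p \<in> carrier (free_alg S) ==> q \<in> carrier (free_alg S) ==> L (p - q) = L p - L q"
 using free_dual_add[of "p - q" q] free_alg_closed(4)[of p S q] by simp

lemma free_dual_sum:
 "finite I ==> (\<And>i. i \<in> I ==> f i \<in> carrier (free_alg S)) ==> L (sum f I) = (\<Sum>i\<in>I. L (f i))"
proof (induction I rule: finite_induct)
 case empty
 then show ?case using dual_zero[OF kspace_free_alg L] by simp
next
 case (insert i I)
 have "f i \<in> carrier (free_alg S)" "sum f I \<in> carrier (free_alg S)"
  using insert.prems by (auto intro!: free_alg_closed(5) simp del: free_alg_sel)
 then have "L (f i + sum f I) = L (f i) + L (sum f I)" by (rule free_dual_add)
 then show ?case using insert by simp
qed

lemma free_dual_sum2:
 "(\<And>i j. i < (m::nat) ==> j < (n::nat) ==> f i j \<in> carrier (free_alg S)) ==>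
  L (\<Sum>i<m. \<Sum>j<n. f i j) = (\<Sum>i<m. \<Sum>j<n. L (f i j))"
 by (subst free_dual_sum, (auto intro!: sum.cong free_dual_sum free_alg_closed(5) simp del: free_alg_sel)+)

lemma free_dual_sum3:
 "(\<And>i j r. i < (m::nat) ==> j < (n::nat) ==> r < (p::nat) ==> f i j r \<in> carrier (free_alg S)) ==>
  L (\<Sum>i<m. \<Sum>j<n. \<Sum>r<p. f i j r) = (\<Sum>i<m. \<Sum>j<n. \<Sum>r<p. L (f i j r))"
 by (subst free_dual_sum2, (auto intro!: sum.cong free_dual_sum free_alg_closed(5) simp del: free_alg_sel)+)

end

lemma const_gen_carrier:
 "E \<in> carrier_mat m n ==> const_mat E \<in> carrier_mat m n" "gen_mat m n \<in> carrier_mat m n"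
 by (auto simp: const_mat_def gen_mat_def)

lemma gen_mat_dim [simp]: "dim_row (gen_mat m n) = m" "dim_col (gen_mat m n) = n"
 by (simp_all add: gen_mat_def)

lemma const_gen_entry:
 "E \<in> carrier_mat m n ==> i < m ==> j < n ==> const_mat E $$ (i, j) = single 0 (E $$ (i, j))"
 "i < m ==> j < n ==> gen_mat m n $$ (i, j) = free_var (i, j)"
 by (auto simp: const_mat_def gen_mat_def)

context
 fixes E F :: "'k::field mat" and m n :: nat
 assumes E: "E \<in> GL m" and F: "F \<in> GL n"
begin

private abbreviation "FA \<equiv> (free_alg ({..<m} \<times> {..<n}) :: ('k, 'k bpoly) module)"
private abbreviation v :: "nat => nat => 'k bpoly" where "v i j \<equiv> free_var (i, j)"
private abbreviation s0 :: "'k => 'k bpoly" where "s0 c \<equiv> single 0 c"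

private lemma B_free_eq: "B_free E F = FA"
 using E F by (simp add: B_free_def)

private definition "M1 = const_mat (minv F) * transpose_mat (gen_mat m n) * const_mat E * gen_mat m n - 1\<^sub>m n"
private definition "M2 = gen_mat m n * const_mat (minv F) * transpose_mat (gen_mat m n) * const_mat E - 1\<^sub>m m"

private lemma B_rels_eq: "B_rels E F = {M1 $$ (i, j) | i j. i < n \<and> j < n} \<union> {M2 $$ (i, j) | i j. i < m \<and> j < m}"
 using E F by (simp add: B_rels_def Let_def M1_def M2_def)

private lemmas car = const_gen_carrier(1)[OF GL_carrier[OF E]] const_gen_carrier(1)[OF GL_inverse(1)[OF F]]
 const_gen_carrier(2)[of m n]

private lemmas car' = mult_carrier_mat[OF car(2) transpose_carrier_mat[THEN iffD2, OF car(3)]] mult_carrier_mat[OF car(3) car(2)]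
private lemmas car'' = mult_carrier_mat[OF car'(1) car(1)] mult_carrier_mat[OF car'(2) transpose_carrier_mat[THEN iffD2, OF car(3)]]

private lemma scal_move: "s0 c * x * s0 d * y = s0 (c * d) * (x * y)"
proof -
 have "s0 c * x * s0 d = s0 (c * d) * x"
  unfolding mult.assoc single_zero_commute[of x] by (simp add: mult_single flip: mult.assoc)
 then show ?thesis by (simp add: mult.assoc)
qed

private lemma M1_entry: "i < n ==> j < n ==>
  M1 $$ (i, j) = (\<Sum>l<m. \<Sum>k<m. \<Sum>p<n. s0 (minv F $$ (i, p) * E $$ (k, l)) * (v k p * v l j)) - of_bool (i = j)"
proof -
 assume ij: "i < n" "j < n"
 have 1: "(const_mat (minv F) * transpose_mat (gen_mat m n)) $$ (i, k) = (\<Sum>p<n. s0 (minv F $$ (i, p)) * v k p)" if "k < m" for k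
  using ij that by (subst entry_mult[OF car(2)]) (auto simp: const_gen_entry(1)[OF GL_inverse(1)[OF F]] const_gen_entry(2) const_gen_carrier
    intro!: sum.cong)
 have 2: "(const_mat (minv F) * transpose_mat (gen_mat m n) * const_mat E) $$ (i, l) =
   (\<Sum>k<m. (\<Sum>p<n. s0 (minv F $$ (i, p)) * v k p) * s0 (E $$ (k, l)))" if "l < m" for l
  using ij that car car' by (subst entry_mult[of _ n m _ m]) (auto simp del: index_mult_mat(1) simp: 1 const_gen_entry(1)[OF GL_carrier[OF E]] intro!: sum.cong)
 have 3: "(const_mat (minv F) * transpose_mat (gen_mat m n) * const_mat E * gen_mat m n) $$ (i, j) =
   (\<Sum>l<m. (\<Sum>k<m. (\<Sum>p<n. s0 (minv F $$ (i, p)) * v k p) * s0 (E $$ (k, l))) * v l j)"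
  using ij car car'' by (subst entry_mult[of _ n m _ n]) (auto simp del: index_mult_mat(1) simp: 2 const_gen_entry(2) intro!: sum.cong)
 have "M1 $$ (i, j) = (\<Sum>l<m. (\<Sum>k<m. (\<Sum>p<n. s0 (minv F $$ (i, p)) * v k p) * s0 (E $$ (k, l))) * v l j) - of_bool (i = j)"
  using ij 3 by (simp add: M1_def)
 then show ?thesis by (simp only: sum_distrib_right scal_move)
qed

private lemma M2_entry: "i < m ==> j < m ==>
  M2 $$ (i, j) = (\<Sum>l<m. \<Sum>q<n. \<Sum>p<n. s0 (minv F $$ (p, q) * E $$ (l, j)) * (v i p * v l q)) - of_bool (i = j)"
proof -
 assume ij: "i < m" "j < m"
 have 1: "(gen_mat m n * const_mat (minv F)) $$ (i, q) = (\<Sum>p<n. v i p * s0 (minv F $$ (p, q)))" if "q < n" for q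
  using ij that by (subst entry_mult[OF car(3) car(2)]) (auto simp: const_gen_entry(1)[OF GL_inverse(1)[OF F]] const_gen_entry(2) const_gen_carrier
    intro!: sum.cong)
 have 2: "(gen_mat m n * const_mat (minv F) * transpose_mat (gen_mat m n)) $$ (i, l) =
   (\<Sum>q<n. (\<Sum>p<n. v i p * s0 (minv F $$ (p, q))) * v l q)" if "l < m" for l
  using ij that car car' by (subst entry_mult[of _ m n _ m]) (auto simp del: index_mult_mat(1) simp: 1 const_gen_entry(2) intro!: sum.cong)
 have 3: "(gen_mat m n * const_mat (minv F) * transpose_mat (gen_mat m n) * const_mat E) $$ (i, j) =
   (\<Sum>l<m. (\<Sum>q<n. (\<Sum>p<n. v i p * s0 (minv F $$ (p, q))) * v l q) * s0 (E $$ (l, j)))"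
  using ij car car'' by (subst entry_mult[of _ m m _ m]) (auto simp del: index_mult_mat(1) simp: 2 const_gen_entry(1)[OF GL_carrier[OF E]] intro!: sum.cong)
 have mv: "x * s0 c * y * s0 d = s0 (c * d) * (x * y)" for x y c d
 proof -
  have "x * s0 c * y * s0 d = s0 d * (s0 c * x * y)"
   using single_zero_commute[of "x * s0 c * y" d] single_zero_commute[of x c] by simp
  then show ?thesis by (simp add: mult_single mult.commute[of d c] flip: mult.assoc)
 qed
 have "M2 $$ (i, j) = (\<Sum>l<m. (\<Sum>q<n. (\<Sum>p<n. v i p * s0 (minv F $$ (p, q))) * v l q) * s0 (E $$ (l, j))) - of_bool (i = j)"
  using ij 3 by (simp add: M2_def)
 then show ?thesis by (simp only: sum_distrib_right mv)
qed

private lemma vmem: "k < m ==> p < n ==> v k p \<in> carrier FA"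
 by (intro free_alg_closed) auto

private lemma vv: "k < m ==> p < n ==> l < m ==> j < n ==> v k p * v l j \<in> carrier FA"
 by (intro free_alg_closed) auto

private lemma svv: "k < m ==> p < n ==> l < m ==> j < n ==> s0 c * (v k p * v l j) \<in> carrier FA"
 by (intro free_alg_closed) auto

private lemma rels_carrier: "B_rels E F \<subseteq> carrier FA"
proof -
 have ob: "of_bool b \<in> carrier FA" for b by (cases b) (auto simp: zero_word_def)
 have "M1 $$ (i, j) \<in> carrier FA" if "i < n" "j < n" for i j
  unfolding M1_entry[OF that] by (intro free_alg_closed ob) (use that in auto)
 moreover have "M2 $$ (i, j) \<in> carrier FA" if "i < m" "j < m" for i j
  unfolding M2_entry[OF that] by (intro free_alg_closed ob) (use that in auto)
 ultimately show ?thesis unfolding B_rels_eq by blast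
qed

private lemma L_M1:
 assumes L: "L \<in> dual FA" and ij: "i < n" "j < n"
 shows "L (M1 $$ (i, j)) = (\<Sum>p<n. minv F $$ (i, p) * (\<Sum>k<m. \<Sum>l<m. E $$ (k, l) * L (v k p * v l j))) - of_bool (i = j) * L 1"
proof -
 have ob: "of_bool b \<in> carrier FA" "L (of_bool b) = of_bool b * L 1" for b
  using dual_zero[OF kspace_free_alg L] by (cases b; simp add: zero_word_def)+
 have "L (M1 $$ (i, j)) = L (\<Sum>l<m. \<Sum>k<m. \<Sum>p<n. s0 (minv F $$ (i, p) * E $$ (k, l)) * (v k p * v l j)) - of_bool (i = j) * L 1"
  unfolding M1_entry[OF ij]
  by (subst free_dual_minus[OF L]) (use ij in \<open>(intro free_alg_closed ob; auto)?; simp add: ob\<close>)+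
 also have "L (\<Sum>l<m. \<Sum>k<m. \<Sum>p<n. s0 (minv F $$ (i, p) * E $$ (k, l)) * (v k p * v l j)) =
   (\<Sum>l<m. \<Sum>k<m. \<Sum>p<n. minv F $$ (i, p) * E $$ (k, l) * L (v k p * v l j))"
  by (subst free_dual_sum3[OF L]) (use ij in \<open>auto simp: svv free_dual_scalar[OF L vv] simp del: free_alg_sel\<close>)
 also have "... = (\<Sum>k<m. \<Sum>l<m. \<Sum>p<n. minv F $$ (i, p) * E $$ (k, l) * L (v k p * v l j))"
  by (rule sum.swap)
 also have "... = (\<Sum>k<m. \<Sum>p<n. \<Sum>l<m. minv F $$ (i, p) * E $$ (k, l) * L (v k p * v l j))"
  by (rule sum.cong[OF refl], rule sum.swap)
 also have "... = (\<Sum>p<n. \<Sum>k<m. \<Sum>l<m. minv F $$ (i, p) * E $$ (k, l) * L (v k p * v l j))"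
  by (rule sum.swap)
 finally show ?thesis by (simp add: sum_distrib_left mult.assoc)
qed

private lemma L_M2:
 assumes L: "L \<in> dual FA" and ij: "i < m" "j < m"
 shows "L (M2 $$ (i, j)) = (\<Sum>l<m. (\<Sum>p<n. \<Sum>q<n. minv F $$ (p, q) * L (v i p * v l q)) * E $$ (l, j)) - of_bool (i = j) * L 1"
proof -
 have ob: "of_bool b \<in> carrier FA" "L (of_bool b) = of_bool b * L 1" for b
  using dual_zero[OF kspace_free_alg L] by (cases b; simp add: zero_word_def)+
 have "L (M2 $$ (i, j)) = L (\<Sum>l<m. \<Sum>q<n. \<Sum>p<n. s0 (minv F $$ (p, q) * E $$ (l, j)) * (v i p * v l q)) - of_bool (i = j) * L 1"
  unfolding M2_entry[OF ij]
  by (subst free_dual_minus[OF L]) (use ij in \<open>(intro free_alg_closed ob; auto)?; simp add: ob\<close>)+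
 also have "L (\<Sum>l<m. \<Sum>q<n. \<Sum>p<n. s0 (minv F $$ (p, q) * E $$ (l, j)) * (v i p * v l q)) =
   (\<Sum>l<m. \<Sum>q<n. \<Sum>p<n. minv F $$ (p, q) * E $$ (l, j) * L (v i p * v l q))"
  by (subst free_dual_sum3[OF L]) (use ij in \<open>auto simp: svv free_dual_scalar[OF L vv] simp del: free_alg_sel\<close>)
 also have "... = (\<Sum>l<m. \<Sum>p<n. \<Sum>q<n. minv F $$ (p, q) * E $$ (l, j) * L (v i p * v l q))"
  by (rule sum.cong[OF refl], rule sum.swap)
 finally show ?thesis by (simp add: sum_distrib_right sum_distrib_left mult_ac)
qed

text \<open>
 Multiplying the first family of relations by \<open>F\<close> and the second one by \<open>E\<^sup>-\<^sup>1\<close> puts them into the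
 symmetric form \<open>a\<^sup>t E a = F\<close>, \<open>a F\<^sup>-\<^sup>1 a\<^sup>t = E\<^sup>-\<^sup>1\<close>.
\<close>

private lemma L_rels:
 assumes L: "L \<in> dual FA"
 shows "(\<forall>r\<in>B_rels E F. L r = 0) \<longleftrightarrow>
   (\<forall>i<n. \<forall>j<n. (\<Sum>k<m. \<Sum>l<m. E $$ (k, l) * L (v k i * v l j)) = F $$ (i, j) * L 1) \<and>
   (\<forall>k<m. \<forall>l<m. (\<Sum>i<n. \<Sum>j<n. minv F $$ (i, j) * L (v k i * v l j)) = minv E $$ (k, l) * L 1)"
  (is "?l = (?r1 \<and> ?r2)")
proof -
 note iF = GL_inverse_fun[OF F] and iE = GL_inverse_fun[OF E]
 define S where "S p j = (\<Sum>k<m. \<Sum>l<m. E $$ (k, l) * L (v k p * v l j))" for p j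
 define U where "U k l = (\<Sum>i<n. \<Sum>j<n. minv F $$ (i, j) * L (v k i * v l j))" for k l
 have 1: "(\<forall>i<n. \<forall>j<n. L (M1 $$ (i, j)) = 0) \<longleftrightarrow> (\<forall>i<n. \<forall>j<n. S i j = F $$ (i, j) * L 1)"
 proof (intro iffI allI impI)
  fix i j assume h: "\<forall>i<n. \<forall>j<n. L (M1 $$ (i, j)) = 0" and ij: "i < n" "j < n"
  have "(\<Sum>p<n. minv F $$ (r, p) * S p j) = of_bool (r = j) * L 1" if "r < n" for r
   using h L_M1[OF L that ij(2)] that ij by (simp add: S_def)
  then have "(\<Sum>r<n. F $$ (i, r) * (\<Sum>p<n. minv F $$ (r, p) * S p j)) = (\<Sum>r<n. F $$ (i, r) * L 1 * of_bool (r = j))"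
   by (intro sum.cong) auto
  then show "S i j = F $$ (i, j) * L 1"
   using inverse_fun_cancel[OF iF ij(1), of "\<lambda>p. S p j"] ij by simp
 next
  fix i j assume h: "\<forall>i<n. \<forall>j<n. S i j = F $$ (i, j) * L 1" and ij: "i < n" "j < n"
  have "(\<Sum>p<n. minv F $$ (i, p) * S p j) = (\<Sum>p<n. minv F $$ (i, p) * F $$ (p, j)) * L 1"
   unfolding sum_distrib_right by (rule sum.cong) (use h ij in auto)
  then show "L (M1 $$ (i, j)) = 0"
   using L_M1[OF L ij] inverse_funD(2)[OF iF ij] by (simp add: S_def)
 qed
 have 2: "(\<forall>i<m. \<forall>j<m. L (M2 $$ (i, j)) = 0) \<longleftrightarrow> (\<forall>i<m. \<forall>j<m. U i j = minv E $$ (i, j) * L 1)"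
 proof (intro iffI allI impI)
  fix i j assume h: "\<forall>i<m. \<forall>j<m. L (M2 $$ (i, j)) = 0" and ij: "i < m" "j < m"
  have "(\<Sum>l<m. U i l * E $$ (l, r)) = of_bool (i = r) * L 1" if "r < m" for r
   using h L_M2[OF L ij(1) that] that ij by (simp add: U_def)
  then have "(\<Sum>r<m. (\<Sum>l<m. U i l * E $$ (l, r)) * minv E $$ (r, j)) = (\<Sum>r<m. of_bool (i = r) * (minv E $$ (r, j) * L 1))"
   by (intro sum.cong) auto
  then show "U i j = minv E $$ (i, j) * L 1"
   using inverse_fun_cancel_right[OF iE ij(2), of "U i"] ij by simp
 next
  fix i j assume h: "\<forall>i<m. \<forall>j<m. U i j = minv E $$ (i, j) * L 1" and ij: "i < m" "j < m"
  have "(\<Sum>l<m. U i l * E $$ (l, j)) = (\<Sum>l<m. minv E $$ (i, l) * E $$ (l, j)) * L 1"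
   unfolding sum_distrib_right by (rule sum.cong) (use h ij in auto)
  then show "L (M2 $$ (i, j)) = 0"
   using L_M2[OF L ij] inverse_funD(2)[OF iE ij] by (simp add: U_def)
 qed
 have "?l \<longleftrightarrow> (\<forall>i<n. \<forall>j<n. L (M1 $$ (i, j)) = 0) \<and> (\<forall>i<m. \<forall>j<m. L (M2 $$ (i, j)) = 0)"
  unfolding B_rels_eq by blast
 then show ?thesis unfolding 1 2 S_def U_def .
qed

lemma B_ideal_ideal: "ideal (B_ideal E F) (free_alg ({..<m} \<times> {..<n}))"
 unfolding B_ideal_def B_free_eq
 by (rule ring.genideal_ideal[OF k_algebra_ring rels_carrier]) simp

lemma B_alg_eq: "B_alg E F = alg_quot (free_alg ({..<m} \<times> {..<n})) (B_ideal E F)"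
 by (simp add: B_alg_def B_free_eq)

lemma k_algebra_B: "k_algebra (B_alg E F)"
 unfolding B_alg_eq by (rule k_algebra_quot[OF k_algebra_free_alg B_ideal_ideal])

lemma B_class_alg_hom: "B_class E F \<in> alg_hom (free_alg ({..<m} \<times> {..<n})) (B_alg E F)"
 using coset_alg_hom[OF k_algebra_free_alg B_ideal_ideal]
 unfolding B_alg_eq B_class_def B_free_eq .

lemma B_class_surj: "carrier (B_alg E F) = B_class E F ` carrier (free_alg ({..<m} \<times> {..<n}))"
 unfolding B_alg_eq B_class_def B_free_eq
 by (rule quot_carrier[OF kspace_free_alg ideal_ksubspace[OF k_algebra_free_alg B_ideal_ideal]])

private lemma map_zero: "Poly_Mapping.map ((*) c) (0 :: 'k bpoly) = 0" for c :: 'k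
 by (rule poly_mapping_eqI) simp

lemma B_class_eq_zero:
 "p \<in> carrier (free_alg ({..<m} \<times> {..<n})) ==> B_class E F p = \<zero>\<^bsub>B_alg E F\<^esub> \<longleftrightarrow> p \<in> B_ideal E F"
 using coset_eq_iff[OF kspace_free_alg ideal_ksubspace[OF k_algebra_free_alg B_ideal_ideal], of p 0]
  coset_zero[OF kspace_free_alg ideal_ksubspace[OF k_algebra_free_alg B_ideal_ideal]]
 unfolding B_alg_eq B_class_def B_free_eq by (simp add: map_zero)

lemma B_gen_closed: "i < m ==> j < n ==> B_gen E F i j \<in> carrier (B_alg E F)"
 unfolding B_gen_def using alg_hom_closed[OF B_class_alg_hom free_alg_closed(2)] by simp

lemma B_gen_BR:
 "BR (B_alg E F) m n (entry E) (entry (minv E)) (entry F) (entry (minv F)) (B_gen E F)"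
proof (rule BRI[OF B_gen_closed])
 note h = B_class_alg_hom
 fix \<phi> assume \<phi>: "\<phi> \<in> dual (B_alg E F)"
 define L where "L p = \<phi> (B_class E F p)" for p
 have L: "L \<in> dual FA" unfolding L_def by (rule dual_comp[OF alg_hom_lin[OF h] \<phi>])
 have "L r = 0" if "r \<in> B_rels E F" for r
 proof -
  have "r \<in> B_ideal E F"
   unfolding B_ideal_def B_free_eq
   using ring.genideal_self[OF k_algebra_ring rels_carrier] that by auto
  then have "B_class E F r = \<zero>\<^bsub>B_alg E F\<^esub>" using B_class_eq_zero rels_carrier that by blast
  then show ?thesis unfolding L_def using dual_zero[OF k_algebra_kspace[OF k_algebra_B] \<phi>] by simp
 qed
 note r = L_rels[OF L, THEN iffD1, OF ballI[OF this]]
 have Lv: "\<phi> (B_gen E F k i \<otimes>\<^bsub>B_alg E F\<^esub> B_gen E F l j) = L (v k i * v l j)"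
  if "k < m" "i < n" "l < m" "j < n" for k i l j
  unfolding L_def B_gen_def
  using alg_hom_mult[OF h vmem vmem] that by simp
 have L1: "\<phi> \<one>\<^bsub>B_alg E F\<^esub> = L 1" unfolding L_def using alg_hom_one[OF h] by simp
 show "(\<Sum>k<m. \<Sum>l<m. E $$ (k, l) * \<phi> (B_gen E F k i \<otimes>\<^bsub>B_alg E F\<^esub> B_gen E F l j)) = F $$ (i, j) * \<phi> \<one>\<^bsub>B_alg E F\<^esub>"
  if "i < n" "j < n" for i j using r that by (simp add: Lv L1 cong: sum.cong_simp)
 show "(\<Sum>i<n. \<Sum>j<n. minv F $$ (i, j) * \<phi> (B_gen E F k i \<otimes>\<^bsub>B_alg E F\<^esub> B_gen E F l j)) = minv E $$ (k, l) * \<phi> \<one>\<^bsub>B_alg E F\<^esub>"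
  if "k < m" "l < m" for k l using r that by (simp add: Lv L1 cong: sum.cong_simp)
qed

lemma B_induct [consumes 1, case_names one gen add smult]:
 assumes x: "x \<in> carrier (B_alg E F)" and 1: "Q \<one>\<^bsub>B_alg E F\<^esub>"
  and v: "\<And>i j y. i < m ==> j < n ==> y \<in> carrier (B_alg E F) ==> Q y ==> Q (B_gen E F i j \<otimes>\<^bsub>B_alg E F\<^esub> y)"
  and a: "\<And>x y. x \<in> carrier (B_alg E F) ==> y \<in> carrier (B_alg E F) ==> Q x ==> Q y ==> Q (x \<oplus>\<^bsub>B_alg E F\<^esub> y)"
  and s: "\<And>c x. x \<in> carrier (B_alg E F) ==> Q x ==> Q (c \<odot>\<^bsub>B_alg E F\<^esub> x)"
 shows "Q x"
proof -
 note h = B_class_alg_hom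
 obtain p where p: "x = B_class E F p" "p \<in> carrier FA"
  using x unfolding B_class_surj by (rule imageE)
 have "Q (B_class E F p)"
  using p(2)
 proof (induction p rule: free_alg_induct)
  case one
  then show ?case using 1 alg_hom_one[OF h] by simp
 next
  case (var x q)
  obtain i j where ij: "x = (i, j)" "i < m" "j < n" using var(1) by auto
  then show ?case
   using v[of i j "B_class E F q"] alg_hom_mult[OF h vmem[OF ij(2,3)] var(2)] var(3) alg_hom_closed[OF h var(2)]
   by (simp add: B_gen_def)
 next
  case (add p q)
  then show ?case using a[of "B_class E F p" "B_class E F q"] alg_hom_add[OF h, of p q]
   alg_hom_closed[OF h, of q] alg_hom_closed[OF h, of p] by simp
 next
  case (smult c q)
  then show ?case using s[of "B_class E F q" c] alg_hom_smult[OF h, of q c]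
   alg_hom_closed[OF h, of q] by simp
 qed
 then show ?thesis using p by simp
qed

lemma B_ext:
 assumes A: "k_algebra A" and f: "f \<in> alg_hom (B_alg E F) A" and g: "g \<in> alg_hom (B_alg E F) A"
  and eq: "\<And>i j. i < m ==> j < n ==> f (B_gen E F i j) = g (B_gen E F i j)"
  and x: "x \<in> carrier (B_alg E F)"
 shows "f x = g x"
 using x
proof (induction x rule: B_induct)
 case (gen i j y)
 then show ?case using alg_hom_mult[OF f B_gen_closed] alg_hom_mult[OF g B_gen_closed] eq by simp
qed (use f g in simp_all)

lemma B_hom_ex:
 fixes A :: "('k, 'a, 'z) module_scheme" (structure)
 assumes A: "k_algebra A" and r: "BR A m n (entry E) (entry (minv E)) (entry F) (entry (minv F)) \<phi>"
 shows "\<exists>f\<in>alg_hom (B_alg E F) A. \<forall>i<m. \<forall>j<n. f (B_gen E F i j) = \<phi> i j"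
proof -
 have kA: "kspace A" using A by simp
 obtain f where f: "f \<in> alg_hom FA A" "\<And>i j. i < m ==> j < n ==> f (v i j) = \<phi> i j"
  using free_alg_hom[OF A, of "{..<m} \<times> {..<n}" "\<lambda>x. \<phi> (fst x) (snd x)"] BR_closed[OF r] by auto
 let ?Z = "a_kernel FA A f"
 have rh: "ring_hom_ring FA A f"
  using f(1) k_algebra_ring[OF A] k_algebra_ring[OF k_algebra_free_alg]
  by (intro ring_hom_ringI2) (auto simp: alg_hom_def)
 have "f r = \<zero>" if "r \<in> B_rels E F" for r
 proof (rule kspace_eqI[OF kA])
  have rc: "r \<in> carrier FA" using that rels_carrier by blast
  then show "f r \<in> carrier A" by (rule alg_hom_closed[OF f(1)])
  fix \<psi> assume \<psi>: "\<psi> \<in> dual A"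
  define L where "L p = \<psi> (f p)" for p
  have L: "L \<in> dual FA" unfolding L_def by (rule dual_comp[OF alg_hom_lin[OF f(1)] \<psi>])
  have Lv: "L (v k i * v l j) = \<psi> (\<phi> k i \<otimes> \<phi> l j)"
   if "k < m" "i < n" "l < m" "j < n" for k i l j
   unfolding L_def
   using alg_hom_mult[OF f(1) vmem vmem] f(2) that by simp
  have L1: "L 1 = \<psi> \<one>" unfolding L_def using alg_hom_one[OF f(1)] by simp
  have "\<forall>r\<in>B_rels E F. L r = 0"
   unfolding L_rels[OF L] using BR1[OF r \<psi>] BR2[OF r \<psi>] by (simp add: Lv L1 cong: sum.cong_simp)
  then show "\<psi> (f r) = \<psi> \<zero>" using that dual_zero[OF kA \<psi>] unfolding L_def by simp
 qed (use kA in simp)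
 then have "B_rels E F \<subseteq> ?Z" using rels_carrier by (auto simp: a_kernel_def' simp del: free_alg_sel)
 then have "B_ideal E F \<subseteq> ?Z"
  unfolding B_ideal_def B_free_eq
  by (rule ring.genideal_minimal[OF k_algebra_ring[OF k_algebra_free_alg] ring_hom_ring.kernel_is_ideal[OF rh]])
 then have "f x = \<zero>" if "x \<in> B_ideal E F" for x using that by (auto simp: a_kernel_def')
 then obtain g where g: "g \<in> lin_hom (alg_quot FA (B_ideal E F)) A"
  "\<And>x. x \<in> carrier FA ==> g (B_ideal E F +>\<^bsub>FA\<^esub> x) = f x"
  using quot_lift[OF kspace_free_alg ideal_ksubspace[OF k_algebra_free_alg B_ideal_ideal] kA alg_hom_lin[OF f(1)]]
  by blast
 have g': "g \<in> lin_hom (B_alg E F) A" "\<And>x. x \<in> carrier FA ==> g (B_class E F x) = f x"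
  unfolding B_alg_eq B_class_def B_free_eq by (rule g(1), rule g(2))
 note h = B_class_alg_hom
 have "g \<in> alg_hom (B_alg E F) A"
 proof (rule alg_homI[OF g'(1)])
  fix x y assume x: "x \<in> carrier (B_alg E F)" and y: "y \<in> carrier (B_alg E F)"
  obtain p where p: "x = B_class E F p" "p \<in> carrier FA"
   using x unfolding B_class_surj by (rule imageE)
  obtain q where q: "y = B_class E F q" "q \<in> carrier FA"
   using y unfolding B_class_surj by (rule imageE)
  note pq = p(1) q(1) p(2) q(2)
  have "x \<otimes>\<^bsub>B_alg E F\<^esub> y = B_class E F (p \<otimes>\<^bsub>FA\<^esub> q)"
   unfolding pq(1,2) by (rule alg_hom_mult[OF h pq(3,4), symmetric])
  then show "g (x \<otimes>\<^bsub>B_alg E F\<^esub> y) = g x \<otimes> g y"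
   unfolding pq(1,2) g'(2)[OF pq(3)] g'(2)[OF pq(4)] alg_hom_mult[OF f(1) pq(3,4), symmetric]
   using g'(2)[OF k_algebra_mult[OF k_algebra_free_alg pq(3,4)]] by (simp only:)
 next
  show "g \<one>\<^bsub>B_alg E F\<^esub> = \<one>"
   using g'(2)[OF k_algebra_one[OF k_algebra_free_alg]]
   unfolding alg_hom_one[OF h] alg_hom_one[OF f(1)] .
 qed
 moreover have "g (B_gen E F i j) = \<phi> i j" if "i < m" "j < n" for i j
  unfolding B_gen_def g'(2)[OF vmem[OF that]] by (rule f(2)[OF that])
 ultimately show ?thesis by blast
qed

lemma B_hom:
 fixes A :: "('k, 'a) module"
 assumes A: "k_algebra A" and r: "BR A m n (entry E) (entry (minv E)) (entry F) (entry (minv F)) \<phi>"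
 shows "B_hom E F A \<phi> \<in> alg_hom (B_alg E F) A"
  and "i < m ==> j < n ==> B_hom E F A \<phi> (B_gen E F i j) = \<phi> i j"
proof -
 let ?B = "B_alg E F"
 let ?P = "\<lambda>f. f \<in> alg_hom ?B A \<and> f \<in> extensional (carrier ?B) \<and>
   (\<forall>i<dim_row E. \<forall>j<dim_row F. f (B_gen E F i j) = \<phi> i j)"
 obtain f where f: "f \<in> alg_hom ?B A" "\<And>i j. i < m ==> j < n ==> f (B_gen E F i j) = \<phi> i j"
  using B_hom_ex[OF A r] by blast
 let ?f = "restrict f (carrier ?B)"
 note B = k_algebra_B
 have "\<exists>!f. ?P f"
 proof (rule ex1I[of _ ?f])
  have "?f \<in> alg_hom ?B A"
   by (intro alg_homI lin_homI) (use f(1) B in simp_all)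
  then show "?P ?f" using f(2) E F B_gen_closed by simp
  fix g assume g: "?P g"
  show "g = ?f"
  proof
   fix x show "g x = ?f x"
    using B_ext[OF A _ f(1), of g x] g f(2) E F by (cases "x \<in> carrier ?B") (auto simp: extensional_def)
  qed
 qed
 then have "?P (B_hom E F A \<phi>)" unfolding B_hom_def by (rule theI')
 then show "B_hom E F A \<phi> \<in> alg_hom ?B A"
  "i < m ==> j < n ==> B_hom E F A \<phi> (B_gen E F i j) = \<phi> i j" using E F by auto
qed

end

text \<open>
 The antipode is prescribed on generators by the matrix \<open>E\<^sup>-\<^sup>1 a\<^sup>t E\<close>; tested against functionals,
 this is the inverse of the matrix of generators.
\<close>

lemma B_class_antipode_entry:
 fixes E :: "'k::field mat"
 assumes E: "E \<in> GL m" and ij: "i < m" "j < m"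
 shows "B_class E E ((const_mat (minv E) * transpose_mat (gen_mat m m) * const_mat E) $$ (i, j)) \<in> carrier (B_alg E E)"
  and "\<phi> \<in> dual (B_alg E E) ==>
   \<phi> (B_class E E ((const_mat (minv E) * transpose_mat (gen_mat m m) * const_mat E) $$ (i, j))) =
   (\<Sum>l<m. \<Sum>k<m. minv E $$ (i, k) * E $$ (l, j) * \<phi> (B_gen E E l k))"
proof -
 let ?FA = "free_alg ({..<m} \<times> {..<m}) :: ('k, 'k bpoly) module"
 note car = const_gen_carrier(1)[OF GL_carrier[OF E]] const_gen_carrier(1)[OF GL_inverse(1)[OF E]]
  const_gen_carrier(2)[of m m]
 have 1: "(const_mat (minv E) * transpose_mat (gen_mat m m)) $$ (i, l) =
   (\<Sum>k<m. single 0 (minv E $$ (i, k)) * free_var (l, k))" if "l < m" for l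
  using ij that by (subst entry_mult[OF car(2)]) (auto simp: const_gen_entry(1)[OF GL_inverse(1)[OF E]] const_gen_entry(2) const_gen_carrier
    intro!: sum.cong)
 have 2: "(const_mat (minv E) * transpose_mat (gen_mat m m) * const_mat E) $$ (i, j) =
   (\<Sum>l<m. (\<Sum>k<m. single 0 (minv E $$ (i, k)) * free_var (l, k)) * single 0 (E $$ (l, j)))"
  using ij car by (subst entry_mult[of _ m m _ m]) (auto simp del: index_mult_mat(1) simp: 1 const_gen_entry(1)[OF GL_carrier[OF E]] intro!: sum.cong)
 have mv: "single 0 c * x * single 0 d = single 0 (c * d) * x"
  for c d and x :: "'k bpoly"
  unfolding mult.assoc single_zero_commute[of x] by (simp add: mult_single flip: mult.assoc)
 have 3: "(const_mat (minv E) * transpose_mat (gen_mat m m) * const_mat E) $$ (i, j) =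
   (\<Sum>l<m. \<Sum>k<m. single 0 (minv E $$ (i, k) * E $$ (l, j)) * free_var (l, k))"
  unfolding 2 by (simp only: sum_distrib_right mv)
 have c: "(\<Sum>l<m. \<Sum>k<m. single 0 (minv E $$ (i, k) * E $$ (l, j)) * free_var (l, k)) \<in> carrier ?FA"
  by (intro free_alg_closed) auto
 show "B_class E E ((const_mat (minv E) * transpose_mat (gen_mat m m) * const_mat E) $$ (i, j)) \<in> carrier (B_alg E E)"
  unfolding 3 by (rule alg_hom_closed[OF B_class_alg_hom[OF E E] c])
 assume \<phi>: "\<phi> \<in> dual (B_alg E E)"
 define L where "L p = \<phi> (B_class E E p)" for p
 have L: "L \<in> dual ?FA" unfolding L_def by (rule dual_comp[OF alg_hom_lin[OF B_class_alg_hom[OF E E]] \<phi>])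
 have v: "free_var (l, k) \<in> carrier ?FA" if "l < m" "k < m" for l k
  using that by (intro free_alg_closed) auto
 have "L (\<Sum>l<m. \<Sum>k<m. single 0 (minv E $$ (i, k) * E $$ (l, j)) * free_var (l, k)) =
   (\<Sum>l<m. \<Sum>k<m. minv E $$ (i, k) * E $$ (l, j) * L (free_var (l, k)))"
  by (subst free_dual_sum2[OF L])
   (auto intro!: free_alg_closed(3)[OF free_alg_closed(6)] v sum.cong free_dual_scalar[OF L] simp del: free_alg_sel)
 then show "\<phi> (B_class E E ((const_mat (minv E) * transpose_mat (gen_mat m m) * const_mat E) $$ (i, j))) =
   (\<Sum>l<m. \<Sum>k<m. minv E $$ (i, k) * E $$ (l, j) * \<phi> (B_gen E E l k))"
  unfolding 3 by (simp add: L_def B_gen_def)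
qed

section \<open>Extended records and their underlying algebras\<close>

lemma truncate_sel [simp]:
 "carrier (module.truncate A) = carrier A" "mult (module.truncate A) = mult A"
 "one (module.truncate A) = one A" "zero (module.truncate A) = zero A"
 "add (module.truncate A) = add A" "smult (module.truncate A) = smult A"
 by (simp_all add: module.defs)

text \<open>
 Linear maps, tensor products and algebra structure only see the module fields of a record. Forgetting
 the coaction or the Hopf structure therefore identifies all constructions for \<open>B_hopf\<close> and \<open>B_comod\<close>
 with those for \<open>B_alg\<close>.
\<close>

lemma truncate_lin_hom:
 "lin_hom (module.truncate A) P = lin_hom A P" "lin_hom P (module.truncate A) = lin_hom P A"
 unfolding LinearCombinations.module_hom_def truncate_sel by (rule refl)+

lemma truncate_alg_hom:
 "alg_hom (module.truncate A) P = alg_hom A P" "alg_hom P (module.truncate A) = alg_hom P A"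
 unfolding alg_hom_def Ring.ring_hom_def truncate_lin_hom truncate_sel by (rule refl)+

lemma truncate_dual: "dual (module.truncate A) = dual A"
 unfolding dual_def truncate_sel by (rule refl)

lemma truncate_kspace: "kspace (module.truncate A) \<longleftrightarrow> kspace A"
proof
 have *: "id \<in> lin_hom (module.truncate A) A" "id \<in> lin_hom A (module.truncate A)"
  unfolding truncate_lin_hom by simp_all
 show "kspace A" if "kspace (module.truncate A)" by (rule kspace_image[OF that *(1)]) simp_all
 show "kspace (module.truncate A)" if "kspace A" by (rule kspace_image[OF that *(2)]) simp_all
qed

lemma truncate_k_algebra: "k_algebra (module.truncate A) \<longleftrightarrow> k_algebra A"
proof
 have *: "id \<in> lin_hom (module.truncate A) A" "id \<in> lin_hom A (module.truncate A)"
  unfolding truncate_lin_hom by simp_all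
 show "k_algebra A" if "k_algebra (module.truncate A)" by (rule k_algebra_image[OF that *(1)]) simp_all
 show "k_algebra (module.truncate A)" if "k_algebra A" by (rule k_algebra_image[OF that *(2)]) simp_all
qed

lemma truncate_tensor_rels:
 "tensor_rels (module.truncate A) N = tensor_rels A N" "tensor_rels M (module.truncate A) = tensor_rels M A"
 unfolding tensor_rels_def truncate_sel by (rule refl)+

lemma truncate_tensor_ker:
 "tensor_ker (module.truncate A) N = tensor_ker A N" "tensor_ker M (module.truncate A) = tensor_ker M A"
 unfolding tensor_ker_def truncate_tensor_rels truncate_sel by (rule refl)+

lemma truncate_tensor_space:
 "tensor_space (module.truncate A) N = tensor_space A N" "tensor_space M (module.truncate A) = tensor_space M A"
 unfolding tensor_space_def truncate_tensor_ker truncate_sel by (rule refl)+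

lemma truncate_tens:
 "tens (module.truncate A) N = tens A N" "tens M (module.truncate A) = tens M A"
 unfolding tens_def truncate_tensor_ker truncate_sel by (rule refl)+

lemma truncate_tensor_lift:
 "tensor_lift (module.truncate A) N P = tensor_lift A N P"
 "tensor_lift M (module.truncate A) P = tensor_lift M A P"
 "tensor_lift M N (module.truncate A) = tensor_lift M N A"
 unfolding tensor_lift_def truncate_tensor_space truncate_tens truncate_sel truncate_lin_hom by (rule refl)+

lemma truncate_tensor_alg:
 "tensor_alg (module.truncate A) N = tensor_alg A N" "tensor_alg M (module.truncate A) = tensor_alg M A"
 unfolding tensor_alg_def truncate_tensor_space truncate_tens truncate_sel truncate_tensor_lift by (rule refl)+

lemma truncate_tensor_map:
 "tensor_map (module.truncate A) N M' N' = tensor_map A N M' N'"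
 "tensor_map M (module.truncate A) M' N' = tensor_map M A M' N'"
 "tensor_map M N (module.truncate A) N' = tensor_map M N A N'"
 "tensor_map M N M' (module.truncate A) = tensor_map M N M' A"
 unfolding tensor_map_def truncate_tensor_alg truncate_tens truncate_sel truncate_tensor_lift by (rule refl)+

lemma truncate_tensor_assoc:
 "tensor_assoc (module.truncate A) N P = tensor_assoc A N P"
 "tensor_assoc M (module.truncate A) P = tensor_assoc M A P"
 "tensor_assoc M N (module.truncate A) = tensor_assoc M N A"
 unfolding tensor_assoc_def truncate_tensor_alg truncate_tens truncate_sel truncate_tensor_lift by (rule refl)+

lemmas truncate_conv = truncate_lin_hom truncate_alg_hom truncate_dual truncate_kspace truncate_k_algebra
 truncate_tens truncate_tensor_lift truncate_tensor_alg truncate_tensor_map truncate_tensor_assoc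

lemma op_tensor_alg:
 "tens M (op_alg A) = tens M A"
 "lin_hom (tensor_space M (op_alg A)) P = lin_hom (tensor_space M A) P"
 "lin_hom P (tensor_space M (op_alg A)) = lin_hom P (tensor_space M A)"
 "carrier (tensor_space M (op_alg A)) = carrier (tensor_space M A)"
proof -
 have *: "tensor_rels M (op_alg A) = tensor_rels M A" unfolding tensor_rels_def op_alg_sel by (rule refl)
 show "tens M (op_alg A) = tens M A" unfolding tens_def tensor_ker_def * op_alg_sel by (rule refl)
 show "lin_hom (tensor_space M (op_alg A)) P = lin_hom (tensor_space M A) P"
  "lin_hom P (tensor_space M (op_alg A)) = lin_hom P (tensor_space M A)"
  "carrier (tensor_space M (op_alg A)) = carrier (tensor_space M A)"
  unfolding tensor_space_def tensor_ker_def * op_alg_sel by (rule refl)+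
qed

section \<open>Composing and inverting solutions\<close>

lemma sum_swap4:
 "(\<Sum>k<(a::nat). \<Sum>l<(b::nat). \<Sum>r<(c::nat). \<Sum>s<(d::nat). f k l r s) =
  (\<Sum>r<c. \<Sum>s<d. \<Sum>k<a. \<Sum>l<b. f k l r s)" for f :: "_ => _ => _ => _ => 'k::field"
proof -
 have "(\<Sum>k<a. \<Sum>l<b. \<Sum>r<c. \<Sum>s<d. f k l r s) = (\<Sum>k<a. \<Sum>r<c. \<Sum>l<b. \<Sum>s<d. f k l r s)"
  by (intro sum.cong refl sum.swap)
 also have "... = (\<Sum>r<c. \<Sum>k<a. \<Sum>l<b. \<Sum>s<d. f k l r s)" by (rule sum.swap)
 also have "... = (\<Sum>r<c. \<Sum>k<a. \<Sum>s<d. \<Sum>l<b. f k l r s)"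
  by (intro sum.cong refl sum.swap)
 also have "... = (\<Sum>r<c. \<Sum>s<d. \<Sum>k<a. \<Sum>l<b. f k l r s)"
  by (intro sum.cong refl sum.swap)
 finally show ?thesis .
qed

text \<open>
 The product \<open>a \<otimes> b\<close> pulls \<open>E\<close> back to \<open>F\<close> in the first tensor factor and \<open>F\<close> to \<open>G\<close> in the second one.
 Comultiplication, coaction and the translation map all arise from this composition.
\<close>

lemma BR_tensor:
 fixes A :: "('k::field, 'a, 'y) module_scheme" (structure) and B :: "('k, 'b, 'z) module_scheme"
 assumes A: "k_algebra A" and B: "k_algebra B"
  and a: "BR A m p E E' F F' a" and b: "BR B p n F F' G G' b"
  and c: "\<And>i j. i < m ==> j < n ==> c i j = finsum (tensor_alg A B) (\<lambda>k. tens A B (a i k) (b k j)) {..<p}"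
 shows "BR (tensor_alg A B) m n E E' G G' c"
proof (rule BRI)
 let ?HH = "tensor_alg A B"
 note kA = k_algebra_kspace[OF A] and kB = k_algebra_kspace[OF B]
 have HH: "k_algebra ?HH" using A B by simp
 note ac = BR_closed[OF a] and bc = BR_closed[OF b]
 have tc: "tens A B (a i k) (b k j) \<in> carrier ?HH" if "i < m" "k < p" "j < n" for i k j
  using ac bc that kA kB by simp
 show cc: "c i j \<in> carrier ?HH" if "i < m" "j < n" for i j
  unfolding c[OF that] by (intro kspace_finsum[OF k_algebra_kspace[OF HH]] tc) (use that in auto)
 fix \<Phi> assume \<Phi>: "\<Phi> \<in> dual ?HH"
 have P: "\<Phi> (c k i \<otimes>\<^bsub>?HH\<^esub> c l j) = (\<Sum>r<p. \<Sum>s<p. \<Phi> (tens A B (a k r \<otimes> a l s) (b r i \<otimes>\<^bsub>B\<^esub> b s j)))"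
  if "k < m" "l < m" "i < n" "j < n" for k l i j
 proof -
  have "\<Phi> (c k i \<otimes>\<^bsub>?HH\<^esub> c l j) = (\<Sum>r<p. \<Phi> (tens A B (a k r) (b r i) \<otimes>\<^bsub>?HH\<^esub> c l j))"
   unfolding c[OF that(1,3)] using HH \<Phi> cc tc that by simp
  also have "... = (\<Sum>r<p. \<Sum>s<p. \<Phi> (tens A B (a k r) (b r i) \<otimes>\<^bsub>?HH\<^esub> tens A B (a l s) (b s j)))"
   unfolding c[OF that(2,4)] using HH \<Phi> tc that by (intro sum.cong refl dual_mult_finsum_right) auto
  also have "... = (\<Sum>r<p. \<Sum>s<p. \<Phi> (tens A B (a k r \<otimes> a l s) (b r i \<otimes>\<^bsub>B\<^esub> b s j)))"
   using A B ac bc that by (intro sum.cong refl) simp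
  finally show ?thesis .
 qed
 have oneT: "\<one>\<^bsub>?HH\<^esub> = tens A B \<one> \<one>\<^bsub>B\<^esub>" by (simp add: tensor_alg_sel kA kB)
 show "(\<Sum>k<m. \<Sum>l<m. E k l * \<Phi> (c k i \<otimes>\<^bsub>?HH\<^esub> c l j)) = G i j * \<Phi> \<one>\<^bsub>?HH\<^esub>" if ij: "i < n" "j < n" for i j
 proof -
  have "(\<Sum>k<m. \<Sum>l<m. E k l * \<Phi> (c k i \<otimes>\<^bsub>?HH\<^esub> c l j)) =
   (\<Sum>k<m. \<Sum>l<m. \<Sum>r<p. \<Sum>s<p. E k l * \<Phi> (tens A B (a k r \<otimes> a l s) (b r i \<otimes>\<^bsub>B\<^esub> b s j)))"
   using P ij by (simp add: sum_distrib_left cong: sum.cong_simp)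
  also have "... = (\<Sum>r<p. \<Sum>s<p. \<Sum>k<m. \<Sum>l<m. E k l * \<Phi> (tens A B (a k r \<otimes> a l s) (b r i \<otimes>\<^bsub>B\<^esub> b s j)))"
   by (rule sum_swap4)
  also have "... = (\<Sum>r<p. \<Sum>s<p. F r s * \<Phi> (tens A B \<one> (b r i \<otimes>\<^bsub>B\<^esub> b s j)))"
   using BR1[OF a dual_tens_left[OF kA kB \<Phi>]] bc B ij by (intro sum.cong refl) simp
  also have "... = G i j * \<Phi> (tens A B \<one> \<one>\<^bsub>B\<^esub>)"
   using BR1[OF b dual_tens_right[OF kA kB \<Phi> k_algebra_one[OF A]] ij] .
  finally show ?thesis by (simp only: oneT)
 qed
 show "(\<Sum>i<n. \<Sum>j<n. G' i j * \<Phi> (c k i \<otimes>\<^bsub>?HH\<^esub> c l j)) = E' k l * \<Phi> \<one>\<^bsub>?HH\<^esub>" if kl: "k < m" "l < m" for k l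
 proof -
  have "(\<Sum>i<n. \<Sum>j<n. G' i j * \<Phi> (c k i \<otimes>\<^bsub>?HH\<^esub> c l j)) =
   (\<Sum>i<n. \<Sum>j<n. \<Sum>r<p. \<Sum>s<p. G' i j * \<Phi> (tens A B (a k r \<otimes> a l s) (b r i \<otimes>\<^bsub>B\<^esub> b s j)))"
   using P kl by (simp add: sum_distrib_left cong: sum.cong_simp)
  also have "... = (\<Sum>r<p. \<Sum>s<p. \<Sum>i<n. \<Sum>j<n. G' i j * \<Phi> (tens A B (a k r \<otimes> a l s) (b r i \<otimes>\<^bsub>B\<^esub> b s j)))"
   by (rule sum_swap4)
  also have "... = (\<Sum>r<p. \<Sum>s<p. F' r s * \<Phi> (tens A B (a k r \<otimes> a l s) \<one>\<^bsub>B\<^esub>))"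
   using BR2[OF b dual_tens_right[OF kA kB \<Phi>]] ac A kl by (intro sum.cong refl) simp
  also have "... = E' k l * \<Phi> (tens A B \<one> \<one>\<^bsub>B\<^esub>)"
   using BR2[OF a dual_tens_left[OF kA kB \<Phi> k_algebra_one[OF B]] kl] .
  finally show ?thesis by (simp only: oneT)
 qed
qed

text \<open>The matrix \<open>s = F' a\<^sup>t E\<close> is inverse to a solution \<open>a\<close> and solves the relations of \<open>(F,E)\<close>
 in the opposite algebra.\<close>

locale BR_inverse =
 fixes A :: "('k::field, 'a) module" (structure) and m n :: nat and E E' F F' a s
 assumes A: "k_algebra A" and a: "BR A m n E E' F F' a"
  and E: "inverse_fun m E E'" and F: "inverse_fun n F F'"
  and sc: "\<And>j i. j < n ==> i < m ==> s j i \<in> carrier A"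
  and sd: "\<And>\<phi> j i. \<phi> \<in> dual A ==> j < n ==> i < m ==>
   \<phi> (s j i) = (\<Sum>l<m. \<Sum>k<n. F' j k * E l i * \<phi> (a l k))"
begin

lemma right_inverse:
 assumes \<phi>: "\<phi> \<in> dual A" and "q < m" "i < m"
 shows "(\<Sum>k<n. \<phi> (a q k \<otimes> s k i)) = of_bool (q = i) * \<phi> \<one>"
proof -
 note ac = BR_closed[OF a]
 have "(\<Sum>k<n. \<phi> (a q k \<otimes> s k i)) = (\<Sum>k<n. \<Sum>l<m. \<Sum>r<n. F' k r * E l i * \<phi> (a q k \<otimes> a l r))"
  using sd[OF dual_mult_left[OF A \<phi> ac]] assms by (intro sum.cong) auto
 also have "... = (\<Sum>l<m. \<Sum>k<n. \<Sum>r<n. F' k r * E l i * \<phi> (a q k \<otimes> a l r))" by (rule sum.swap)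
 also have "... = (\<Sum>l<m. (\<Sum>k<n. \<Sum>r<n. F' k r * \<phi> (a q k \<otimes> a l r)) * E l i)"
  by (simp add: sum_distrib_right sum_distrib_left mult_ac)
 also have "... = (\<Sum>l<m. (E' q l * \<phi> \<one>) * E l i)"
  using BR2[OF a \<phi> assms(2)] by (intro sum.cong) auto
 also have "... = (\<Sum>l<m. E' q l * E l i) * \<phi> \<one>"
  by (simp add: sum_distrib_right sum_distrib_left mult_ac)
 finally show ?thesis using inverse_funD(2)[OF E assms(2,3)] by simp
qed

lemma left_inverse:
 assumes \<phi>: "\<phi> \<in> dual A" and "l < n" "r < n"
 shows "(\<Sum>j<m. \<phi> (s l j \<otimes> a j r)) = of_bool (l = r) * \<phi> \<one>"
proof -
 note ac = BR_closed[OF a]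
 have "(\<Sum>j<m. \<phi> (s l j \<otimes> a j r)) = (\<Sum>j<m. \<Sum>q<m. \<Sum>p<n. F' l p * E q j * \<phi> (a q p \<otimes> a j r))"
  using sd[OF dual_mult_right[OF A \<phi> ac]] assms by (intro sum.cong) auto
 also have "... = (\<Sum>q<m. \<Sum>j<m. \<Sum>p<n. F' l p * E q j * \<phi> (a q p \<otimes> a j r))" by (rule sum.swap)
 also have "... = (\<Sum>q<m. \<Sum>p<n. \<Sum>j<m. F' l p * E q j * \<phi> (a q p \<otimes> a j r))"
  by (intro sum.cong refl sum.swap)
 also have "... = (\<Sum>p<n. \<Sum>q<m. \<Sum>j<m. F' l p * E q j * \<phi> (a q p \<otimes> a j r))" by (rule sum.swap)
 also have "... = (\<Sum>p<n. F' l p * (\<Sum>q<m. \<Sum>j<m. E q j * \<phi> (a q p \<otimes> a j r)))"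
  by (simp add: sum_distrib_left mult_ac)
 also have "... = (\<Sum>p<n. F' l p * F p r) * \<phi> \<one>"
  unfolding sum_distrib_right using BR1[OF a \<phi> _ assms(3)] by (intro sum.cong) auto
 finally show ?thesis using inverse_funD(2)[OF F assms(2,3)] by simp
qed

lemma sum_F_s:
 assumes \<phi>: "\<phi> \<in> dual A" and "k < n" "j < m"
 shows "(\<Sum>l<n. F k l * \<phi> (s l j)) = (\<Sum>q<m. E q j * \<phi> (a q k))"
proof -
 have "(\<Sum>l<n. F k l * \<phi> (s l j)) = (\<Sum>l<n. F k l * (\<Sum>p<n. F' l p * (\<Sum>q<m. E q j * \<phi> (a q p))))"
 proof (intro sum.cong refl arg_cong2[of _ _ _ _ "(*)"])
  fix l assume "l \<in> {..<n}"
  then have "\<phi> (s l j) = (\<Sum>q<m. \<Sum>p<n. F' l p * E q j * \<phi> (a q p))" using sd[OF \<phi>] assms by simp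
  also have "... = (\<Sum>p<n. \<Sum>q<m. F' l p * E q j * \<phi> (a q p))" by (rule sum.swap)
  finally show "\<phi> (s l j) = (\<Sum>p<n. F' l p * (\<Sum>q<m. E q j * \<phi> (a q p)))"
   by (simp add: sum_distrib_left mult.assoc)
 qed
 then show ?thesis using inverse_fun_cancel[OF F assms(2)] by simp
qed

lemma sum_s_E:
 assumes \<phi>: "\<phi> \<in> dual A" and "k < n" "j < m"
 shows "(\<Sum>i<m. E' i j * \<phi> (s k i)) = (\<Sum>r<n. F' k r * \<phi> (a j r))"
proof -
 have "(\<Sum>i<m. E' i j * \<phi> (s k i)) = (\<Sum>i<m. (\<Sum>u<m. (\<Sum>r<n. F' k r * \<phi> (a u r)) * E u i) * E' i j)"
  using sd[OF \<phi>] assms by (intro sum.cong refl) (simp add: sum_distrib_left sum_distrib_right mult_ac)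
 then show ?thesis using inverse_fun_cancel_right[OF E assms(3)] by simp
qed

lemma opposite: "BR (op_alg A) n m F F' E E' s"
proof (rule BRI)
 note ac = BR_closed[OF a]
 show "s j i \<in> carrier (op_alg A)" if "j < n" "i < m" for j i using sc that by simp
 fix \<phi> assume "\<phi> \<in> dual (op_alg A)"
 then have \<phi>: "\<phi> \<in> dual A" unfolding dual_op .
 show "(\<Sum>k<n. \<Sum>l<n. F k l * \<phi> (s k i \<otimes>\<^bsub>op_alg A\<^esub> s l j)) = E i j * \<phi> \<one>\<^bsub>op_alg A\<^esub>" if ij: "i < m" "j < m" for i j
 proof -
  have "(\<Sum>k<n. \<Sum>l<n. F k l * \<phi> (s k i \<otimes>\<^bsub>op_alg A\<^esub> s l j)) = (\<Sum>k<n. \<Sum>q<m. E q j * \<phi> (a q k \<otimes> s k i))"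
   by (rule sum.cong[OF refl]) (use sum_F_s[OF dual_mult_right[OF A \<phi> sc]] ij in simp)
  also have "... = (\<Sum>q<m. \<Sum>k<n. E q j * \<phi> (a q k \<otimes> s k i))" by (rule sum.swap)
  also have "... = (\<Sum>q<m. (E q j * \<phi> \<one>) * of_bool (q = i))"
   using right_inverse[OF \<phi>] ij by (intro sum.cong) (auto simp flip: sum_distrib_left)
  finally show ?thesis using ij by simp
 qed
 show "(\<Sum>i<m. \<Sum>j<m. E' i j * \<phi> (s k i \<otimes>\<^bsub>op_alg A\<^esub> s l j)) = F' k l * \<phi> \<one>\<^bsub>op_alg A\<^esub>" if kl: "k < n" "l < n" for k l
 proof -
  have "(\<Sum>i<m. \<Sum>j<m. E' i j * \<phi> (s k i \<otimes>\<^bsub>op_alg A\<^esub> s l j)) = (\<Sum>j<m. \<Sum>i<m. E' i j * \<phi> (s l j \<otimes> s k i))"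
   unfolding op_alg_sel by (rule sum.swap)
  also have "... = (\<Sum>j<m. \<Sum>r<n. F' k r * \<phi> (s l j \<otimes> a j r))"
   by (rule sum.cong[OF refl]) (use sum_s_E[OF dual_mult_left[OF A \<phi> sc]] kl in simp)
  also have "... = (\<Sum>r<n. \<Sum>j<m. F' k r * \<phi> (s l j \<otimes> a j r))" by (rule sum.swap)
  also have "... = (\<Sum>r<n. (F' k r * \<phi> \<one>) * of_bool (l = r))"
   using left_inverse[OF \<phi>] kl by (intro sum.cong) (auto simp flip: sum_distrib_left)
  finally show ?thesis using kl by simp
 qed
qed

end

lemma BR_inverse_exists:
 fixes A :: "('k::field, 'a) module"
 assumes A: "k_algebra A" and a: "BR A m n E E' F F' a"
  and E: "inverse_fun m E E'" and F: "inverse_fun n F F'"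
 shows "\<exists>s. BR_inverse A m n E E' F F' a s"
proof -
 let ?s = "\<lambda>j i. finsum A (\<lambda>l. finsum A (\<lambda>k. (F' j k * E l i) \<odot>\<^bsub>A\<^esub> a l k) {..<n}) {..<m}"
 have kA: "kspace A" using A by simp
 have c: "finsum A (\<lambda>k. (F' j k * E l i) \<odot>\<^bsub>A\<^esub> a l k) {..<n} \<in> carrier A" if "l < m" for j i l
  by (intro kspace_finsum[OF kA] kspace_smult[OF kA] BR_closed[OF a]) (use that in auto)
 have "BR_inverse A m n E E' F F' a ?s"
 proof (unfold_locales; (fact)?)
  show sc: "?s j i \<in> carrier A" for j i by (intro kspace_finsum[OF kA] c) simp
  show "\<phi> (?s j i) = (\<Sum>l<m. \<Sum>k<n. F' j k * E l i * \<phi> (a l k))" if "\<phi> \<in> dual A" for \<phi> j i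
   using kA c that BR_closed[OF a] by simp
 qed
 then show ?thesis by blast
qed

section \<open>The Hopf algebra \<open>\<B>(E)\<close> and the comodule algebras \<open>\<B>(E,F)\<close>\<close>

lemma BR_scalar:
 fixes E E' :: "nat => nat => 'k::field"
 shows "BR scalar_alg m m E E' E E' (\<lambda>i j. of_bool (i = j))"
proof (rule BRI)
 fix \<phi> :: "'k => 'k" assume \<phi>: "\<phi> \<in> dual scalar_alg"
 have v: "\<phi> x = x * \<phi> 1" for x using dual_smult[OF \<phi>, of 1 x] by simp
 have *: "(\<Sum>k<m. \<Sum>l<m. e k l * \<phi> (of_bool (k = i) * of_bool (l = j))) = e i j * \<phi> 1"
  "(\<Sum>k<m. \<Sum>l<m. e k l * \<phi> (of_bool (i = k) * of_bool (j = l))) = e i j * \<phi> 1"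
  if "i < m" "j < m" for i j and e :: "nat => nat => 'k"
 proof -
  have "(\<Sum>l<m. e k l * \<phi> (of_bool (k = i) * of_bool (l = j))) = (e k j * \<phi> 1) * of_bool (k = i)" for k
  proof -
   have "(\<Sum>l<m. e k l * \<phi> (of_bool (k = i) * of_bool (l = j))) =
    (\<Sum>l<m. (e k l * \<phi> 1 * of_bool (k = i)) * of_bool (l = j))"
    by (intro sum.cong refl, subst v) (simp add: mult_ac)
   then show ?thesis using that by simp
  qed
  then show "(\<Sum>k<m. \<Sum>l<m. e k l * \<phi> (of_bool (k = i) * of_bool (l = j))) = e i j * \<phi> 1"
   using that by simp
  then show "(\<Sum>k<m. \<Sum>l<m. e k l * \<phi> (of_bool (i = k) * of_bool (j = l))) = e i j * \<phi> 1"
   by (simp only: eq_commute[of i] eq_commute[of j])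
 qed
 show "(\<Sum>k<m. \<Sum>l<m. E k l * \<phi> (of_bool (k = i) \<otimes>\<^bsub>scalar_alg\<^esub> of_bool (l = j))) = E i j * \<phi> \<one>\<^bsub>scalar_alg\<^esub>"
  if "i < m" "j < m" for i j using *(1)[OF that] by simp
 show "(\<Sum>i<m. \<Sum>j<m. E' i j * \<phi> (of_bool (k = i) \<otimes>\<^bsub>scalar_alg\<^esub> of_bool (l = j))) = E' k l * \<phi> \<one>\<^bsub>scalar_alg\<^esub>"
  if "k < m" "l < m" for k l using *(2)[OF that] by simp
qed simp

lemma B_hopf_sel [simp]:
 "comult (B_hopf E) = B_coact E E" "counit (B_hopf E) = B_counit E" "antipode (B_hopf E) = B_antipode E"
 "module.truncate (B_hopf E) = B_alg E E"
 by (simp_all add: B_hopf_def module.defs hopf.defs)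

lemma B_comod_sel [simp]:
 "coact (B_comod E F) = B_coact E F" "module.truncate (B_comod E F) = B_alg E F"
 by (simp_all add: B_comod_def module.defs comod_alg.defs)

lemmas B_hopf_conv = truncate_conv[where A = "B_hopf E" for E, unfolded B_hopf_sel, symmetric]
 truncate_sel[where A = "B_hopf E" for E, unfolded B_hopf_sel, symmetric]
lemmas B_comod_conv = truncate_conv[where A = "B_comod E F" for E F, unfolded B_comod_sel, symmetric]
 truncate_sel[where A = "B_comod E F" for E F, unfolded B_comod_sel, symmetric]

context
 fixes E F :: "'k::field mat" and m n :: nat
 assumes E: "E \<in> GL m" and F: "F \<in> GL n"
begin

private abbreviation "H0 \<equiv> B_alg E E"
private abbreviation "C0 \<equiv> B_alg E F"
private abbreviation "u0 \<equiv> B_gen E E"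
private abbreviation "g0 \<equiv> B_gen E F"

private lemmas kH0 = k_algebra_B[OF E E] and kC0 = k_algebra_B[OF E F]
private lemmas vH0 = k_algebra_kspace[OF k_algebra_B[OF E E]] and vC0 = k_algebra_kspace[OF k_algebra_B[OF E F]]
private lemmas uc0 = B_gen_closed[OF E E] and gc0 = B_gen_closed[OF E F]

private lemma coact_BR:
 "BR (tensor_alg H0 C0) m n (entry E) (entry (minv E)) (entry F) (entry (minv F))
  (\<lambda>i j. finsum (tensor_alg H0 C0) (\<lambda>k. tens H0 C0 (u0 i k) (g0 k j)) {..<m})"
 by (rule BR_tensor[OF kH0 kC0 B_gen_BR[OF E E] B_gen_BR[OF E F]]) simp

lemma B_coact_alg_hom: "B_coact E F \<in> alg_hom (B_alg E F) (tensor_alg (B_alg E E) (B_alg E F))"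
 unfolding B_coact_def Let_def using B_hom(1)[OF E F k_algebra_tensor[OF kH0 kC0] coact_BR] E by simp

lemma B_coact_gen:
 "i < m ==> j < n ==> B_coact E F (B_gen E F i j) =
   finsum (tensor_alg (B_alg E E) (B_alg E F)) (\<lambda>k. tens (B_alg E E) (B_alg E F) (B_gen E E i k) (B_gen E F k j)) {..<m}"
 unfolding B_coact_def Let_def using B_hom(2)[OF E F k_algebra_tensor[OF kH0 kC0] coact_BR] E by simp

lemma B_coact_gen_dual:
 assumes \<Phi>: "\<Phi> \<in> dual (tensor_alg (B_alg E E) (B_alg E F))" and ij: "i < m" "j < n"
 shows "\<Phi> (B_coact E F (B_gen E F i j)) = (\<Sum>k<m. \<Phi> (tens (B_alg E E) (B_alg E F) (B_gen E E i k) (B_gen E F k j)))"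
 unfolding B_coact_gen[OF ij] using \<Phi> uc0 gc0 ij vH0 vC0 by simp

end

context
 fixes E :: "'k::field mat" and m :: nat
 assumes E: "E \<in> GL m"
begin

private abbreviation "H \<equiv> B_alg E E"
private abbreviation "u \<equiv> B_gen E E"
private lemmas kH = k_algebra_B[OF E E] and vH = k_algebra_kspace[OF k_algebra_B[OF E E]]
private lemmas uc = B_gen_closed[OF E E]

lemma B_counit_alg_hom: "B_counit E \<in> alg_hom (B_alg E E) scalar_alg"
 unfolding B_counit_def of_bool_def[symmetric]
 by (rule B_hom(1)[OF E E k_algebra_scalar BR_scalar])

lemma B_counit_gen: "i < m ==> j < m ==> B_counit E (B_gen E E i j) = of_bool (i = j)"
 unfolding B_counit_def of_bool_def[symmetric]
 by (rule B_hom(2)[OF E E k_algebra_scalar BR_scalar])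

private abbreviation "sa \<equiv> \<lambda>i j. B_class E E ((const_mat (minv E) * transpose_mat (gen_mat m m) * const_mat E) $$ (i, j))"

private lemma s0_inv: "BR_inverse H m m (entry E) (entry (minv E)) (entry E) (entry (minv E)) u sa"
 by unfold_locales
  (use k_algebra_B[OF E E] B_gen_BR[OF E E] GL_inverse_fun[OF E] B_class_antipode_entry[OF E] in simp_all)

lemma B_antipode_alg_hom: "B_antipode E \<in> alg_hom (B_alg E E) (op_alg (B_alg E E))"
 unfolding B_antipode_def Let_def
 using B_hom(1)[OF E E k_algebra_op[OF kH] BR_inverse.opposite[OF s0_inv]] E by simp

lemma B_antipode_gen: "i < m ==> j < m ==> B_antipode E (B_gen E E i j) = sa i j"
 unfolding B_antipode_def Let_def
 using B_hom(2)[OF E E k_algebra_op[OF kH] BR_inverse.opposite[OF s0_inv]] E by simp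

lemma B_antipode_lin_hom: "B_antipode E \<in> lin_hom (B_alg E E) (B_alg E E)"
 using alg_hom_lin[OF B_antipode_alg_hom] by simp

private abbreviation "S \<equiv> B_antipode E"
private abbreviation "HH \<equiv> tensor_alg H H"
private abbreviation "\<Delta> \<equiv> B_coact E E"

private lemma S_mult: "x \<in> carrier H ==> y \<in> carrier H ==> S (x \<otimes>\<^bsub>H\<^esub> y) = S y \<otimes>\<^bsub>H\<^esub> S x"
 using alg_hom_mult[OF B_antipode_alg_hom] by simp

private lemma S_one: "S \<one>\<^bsub>H\<^esub> = \<one>\<^bsub>H\<^esub>"
 using alg_hom_one[OF B_antipode_alg_hom] by simp

private lemma bl: "bilin H H H (\<lambda>x y. S x \<otimes>\<^bsub>H\<^esub> y)" and br: "bilin H H H (\<lambda>x y. x \<otimes>\<^bsub>H\<^esub> S y)"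
 by (rule bilin_comp[OF bilin_mult[OF kH] B_antipode_lin_hom lin_hom_id(2)],
   rule bilin_comp[OF bilin_mult[OF kH] lin_hom_id(2) B_antipode_lin_hom])

private abbreviation "LS \<equiv> tensor_lift H H H (\<lambda>x y. S x \<otimes>\<^bsub>H\<^esub> y)"
private abbreviation "RS \<equiv> tensor_lift H H H (\<lambda>x y. x \<otimes>\<^bsub>H\<^esub> S y)"

private lemmas Ll = tensor_lift_lin_hom[OF vH vH vH bl] and Rl = tensor_lift_lin_hom[OF vH vH vH br]
private lemmas Lt = tensor_lift_tens[OF vH vH vH bl] and Rt = tensor_lift_tens[OF vH vH vH br]

private lemma L_mult:
 assumes s: "s \<in> carrier HH" "LS s = c \<odot>\<^bsub>H\<^esub> \<one>\<^bsub>H\<^esub>" and t: "t \<in> carrier HH"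
 shows "LS (s \<otimes>\<^bsub>HH\<^esub> t) = c \<odot>\<^bsub>H\<^esub> LS t"
proof (rule tensor_ext[OF vH vH vH lin_hom_comp[OF tensor_mult_lin_right[OF kH kH s(1)] Ll]
   lin_hom_comp[OF Ll lin_hom_smult_map[OF vH]] _ t])
 fix x y assume xy: "x \<in> carrier H" "y \<in> carrier H"
 have t': "tens H H x y \<in> carrier HH" using xy vH by simp
 note Sc = lin_hom_closed[OF B_antipode_lin_hom]
 have "LS (s \<otimes>\<^bsub>HH\<^esub> tens H H x y) = S x \<otimes>\<^bsub>H\<^esub> (LS s \<otimes>\<^bsub>H\<^esub> y)"
 proof (rule tensor_ext[OF vH vH vH lin_hom_comp[OF tensor_mult_lin_left[OF kH kH t'] Ll]
   lin_hom_comp[OF Ll lin_hom_comp[OF lin_hom_mult_right[OF kH xy(2)] lin_hom_mult_left[OF kH Sc[OF xy(1)]]]] _ s(1)])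
  fix x' y' assume xy': "x' \<in> carrier H" "y' \<in> carrier H"
  then show "LS (tens H H x' y' \<otimes>\<^bsub>HH\<^esub> tens H H x y) = S x \<otimes>\<^bsub>H\<^esub> (LS (tens H H x' y') \<otimes>\<^bsub>H\<^esub> y)"
   using xy kH Sc by (simp add: Lt S_mult k_algebra_assoc)
 qed
 then show "LS (s \<otimes>\<^bsub>HH\<^esub> tens H H x y) = c \<odot>\<^bsub>H\<^esub> LS (tens H H x y)"
  using xy kH Sc s(2) by (simp add: Lt)
qed

private lemma R_mult:
 assumes s: "s \<in> carrier HH" and t: "t \<in> carrier HH" "RS t = c \<odot>\<^bsub>H\<^esub> \<one>\<^bsub>H\<^esub>"
 shows "RS (s \<otimes>\<^bsub>HH\<^esub> t) = c \<odot>\<^bsub>H\<^esub> RS s"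
proof (rule tensor_ext[OF vH vH vH lin_hom_comp[OF tensor_mult_lin_left[OF kH kH t(1)] Rl]
   lin_hom_comp[OF Rl lin_hom_smult_map[OF vH]] _ s])
 fix x y assume xy: "x \<in> carrier H" "y \<in> carrier H"
 have t': "tens H H x y \<in> carrier HH" using xy vH by simp
 note Sc = lin_hom_closed[OF B_antipode_lin_hom]
 have "RS (tens H H x y \<otimes>\<^bsub>HH\<^esub> t) = x \<otimes>\<^bsub>H\<^esub> (RS t \<otimes>\<^bsub>H\<^esub> S y)"
 proof (rule tensor_ext[OF vH vH vH lin_hom_comp[OF tensor_mult_lin_right[OF kH kH t'] Rl]
   lin_hom_comp[OF Rl lin_hom_comp[OF lin_hom_mult_right[OF kH Sc[OF xy(2)]] lin_hom_mult_left[OF kH xy(1)]]] _ t(1)])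
  fix x' y' assume xy': "x' \<in> carrier H" "y' \<in> carrier H"
  then show "RS (tens H H x y \<otimes>\<^bsub>HH\<^esub> tens H H x' y') = x \<otimes>\<^bsub>H\<^esub> (RS (tens H H x' y') \<otimes>\<^bsub>H\<^esub> S y)"
   using xy kH Sc by (simp add: Rt S_mult k_algebra_assoc)
 qed
 then show "RS (tens H H x y \<otimes>\<^bsub>HH\<^esub> t) = c \<odot>\<^bsub>H\<^esub> RS (tens H H x y)"
  using xy kH Sc t(2) by (simp add: Rt)
qed

private lemmas \<Delta> = B_coact_alg_hom[OF E E] and \<epsilon> = B_counit_alg_hom

private lemma LR_gen:
 assumes ij: "i < m" "j < m"
 shows "LS (\<Delta> (u i j)) = B_counit E (u i j) \<odot>\<^bsub>H\<^esub> \<one>\<^bsub>H\<^esub>" "RS (\<Delta> (u i j)) = B_counit E (u i j) \<odot>\<^bsub>H\<^esub> \<one>\<^bsub>H\<^esub>"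
proof -
 have dc: "\<Delta> (u i j) \<in> carrier HH" using alg_hom_closed[OF \<Delta> uc[OF ij]] .
 have oc: "B_counit E (u i j) \<odot>\<^bsub>H\<^esub> \<one>\<^bsub>H\<^esub> \<in> carrier H" using kH by simp
 show "LS (\<Delta> (u i j)) = B_counit E (u i j) \<odot>\<^bsub>H\<^esub> \<one>\<^bsub>H\<^esub>"
 proof (rule kspace_eqI[OF vH lin_hom_closed[OF Ll dc] oc])
  fix \<phi> assume \<phi>: "\<phi> \<in> dual H"
  have "\<phi> (LS (\<Delta> (u i j))) = (\<Sum>k<m. \<phi> (LS (tens H H (u i k) (u k j))))"
   by (rule B_coact_gen_dual[OF E E dual_comp[OF Ll \<phi>] ij])
  also have "... = (\<Sum>k<m. \<phi> (sa i k \<otimes>\<^bsub>H\<^esub> u k j))"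
   using ij by (intro sum.cong) (auto simp: Lt uc B_antipode_gen)
  also have "... = of_bool (i = j) * \<phi> \<one>\<^bsub>H\<^esub>" by (rule BR_inverse.left_inverse[OF s0_inv \<phi> ij])
  finally show "\<phi> (LS (\<Delta> (u i j))) = \<phi> (B_counit E (u i j) \<odot>\<^bsub>H\<^esub> \<one>\<^bsub>H\<^esub>)"
   using \<phi> kH ij by (simp add: B_counit_gen)
 qed
 show "RS (\<Delta> (u i j)) = B_counit E (u i j) \<odot>\<^bsub>H\<^esub> \<one>\<^bsub>H\<^esub>"
 proof (rule kspace_eqI[OF vH lin_hom_closed[OF Rl dc] oc])
  fix \<phi> assume \<phi>: "\<phi> \<in> dual H"
  have "\<phi> (RS (\<Delta> (u i j))) = (\<Sum>k<m. \<phi> (RS (tens H H (u i k) (u k j))))"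
   by (rule B_coact_gen_dual[OF E E dual_comp[OF Rl \<phi>] ij])
  also have "... = (\<Sum>k<m. \<phi> (u i k \<otimes>\<^bsub>H\<^esub> sa k j))"
   using ij by (intro sum.cong) (auto simp: Rt uc B_antipode_gen)
  also have "... = of_bool (i = j) * \<phi> \<one>\<^bsub>H\<^esub>" by (rule BR_inverse.right_inverse[OF s0_inv \<phi> ij])
  finally show "\<phi> (RS (\<Delta> (u i j))) = \<phi> (B_counit E (u i j) \<odot>\<^bsub>H\<^esub> \<one>\<^bsub>H\<^esub>)"
   using \<phi> kH ij by (simp add: B_counit_gen)
 qed
qed

text \<open>
 At a generator the two axioms say that \<open>S(u)\<close> is inverse to \<open>u\<close>; they pass to products because \<open>S\<close>
 reverses products, so that a scalar appears in the middle.
\<close>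

private lemma antipode_axioms:
 assumes h: "h \<in> carrier H"
 shows "LS (\<Delta> h) = B_counit E h \<odot>\<^bsub>H\<^esub> \<one>\<^bsub>H\<^esub> \<and> RS (\<Delta> h) = B_counit E h \<odot>\<^bsub>H\<^esub> \<one>\<^bsub>H\<^esub>"
 using h
proof (induction h rule: B_induct[OF E E, consumes 1, case_names one gen add smult])
 case one
 have "\<Delta> \<one>\<^bsub>H\<^esub> = tens H H \<one>\<^bsub>H\<^esub> \<one>\<^bsub>H\<^esub>" using alg_hom_one[OF \<Delta>] by (simp add: tensor_alg_sel vH)
 then show ?case using kH alg_hom_one[OF \<epsilon>] by (simp add: Lt Rt S_one)
next
 case (gen i j y)
 note d = alg_hom_closed[OF \<Delta> uc[OF gen(1,2)]] alg_hom_closed[OF \<Delta> gen(3)]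
 have m: "\<Delta> (u i j \<otimes>\<^bsub>H\<^esub> y) = \<Delta> (u i j) \<otimes>\<^bsub>HH\<^esub> \<Delta> y" by (rule alg_hom_mult[OF \<Delta> uc[OF gen(1,2)] gen(3)])
 have e: "B_counit E (u i j \<otimes>\<^bsub>H\<^esub> y) = B_counit E (u i j) * B_counit E y"
  using alg_hom_mult[OF \<epsilon> uc[OF gen(1,2)] gen(3)] by simp
 have one: "\<one>\<^bsub>H\<^esub> \<in> carrier H" using kH by simp
 show ?case
  unfolding m e L_mult[OF d(1) LR_gen(1)[OF gen(1,2)] d(2)] R_mult[OF d conjunct2[OF gen(4)]]
   LR_gen(2)[OF gen(1,2)] conjunct1[OF gen(4)] kspace_smult_smult[OF vH one]
  by (simp add: mult.commute)
next
 case (add x y)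
 note d = alg_hom_closed[OF \<Delta> add(1)] alg_hom_closed[OF \<Delta> add(2)]
 show ?case
  using add kH alg_hom_add[OF \<Delta> add(1,2)] alg_hom_add[OF \<epsilon> add(1,2)] lin_hom_add[OF Ll d] lin_hom_add[OF Rl d]
  by (simp add: kspace_smult_add_left)
next
 case (smult c x)
 note d = alg_hom_closed[OF \<Delta> smult(1)]
 show ?case
  using smult kH alg_hom_smult[OF \<Delta> smult(1)] alg_hom_smult[OF \<epsilon> smult(1)] lin_hom_smult[OF Ll d] lin_hom_smult[OF Rl d]
  by (simp add: kspace_smult_smult)
qed

context
 fixes F :: "'k mat" and n :: nat
 assumes F: "F \<in> GL n"
begin

private abbreviation "C \<equiv> B_alg E F"
private abbreviation "g \<equiv> B_gen E F"
private abbreviation "\<alpha> \<equiv> B_coact E F"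
private lemmas kC = k_algebra_B[OF E F] and vC = k_algebra_kspace[OF k_algebra_B[OF E F]]
private lemmas gc = B_gen_closed[OF E F]
private lemmas \<alpha> = B_coact_alg_hom[OF E F]
private lemmas kHC = k_algebra_tensor[OF kH kC] and kTT = k_algebra_tensor[OF kH k_algebra_tensor[OF kH kC]]

lemma B_coact_coassoc:
 assumes a: "a \<in> carrier (B_alg E F)"
 shows "tensor_assoc H H C (tensor_map H C (tensor_alg H H) C \<Delta> id (\<alpha> a)) =
  tensor_map H C H (tensor_alg H C) id \<alpha> (\<alpha> a)"
proof -
 have id: "id \<in> alg_hom C C" "id \<in> alg_hom H H" by (auto intro!: alg_homI)
 note M1 = tensor_map_alg_hom[OF kH kC k_algebra_tensor[OF kH kH] kC \<Delta> id(1)]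
 note M2 = tensor_map_alg_hom[OF kH kC kH kHC id(2) \<alpha>]
 note t1 = tensor_map_tens[OF vH vC k_algebra_kspace[OF k_algebra_tensor[OF kH kH]] vC alg_hom_lin[OF \<Delta>] alg_hom_lin[OF id(1)]]
 note t2 = tensor_map_tens[OF vH vC vH k_algebra_kspace[OF kHC] alg_hom_lin[OF id(2)] alg_hom_lin[OF \<alpha>]]
 note as = tensor_assoc_alg_hom[OF kH kH kC]
 note f1 = alg_hom_comp[OF alg_hom_comp[OF \<alpha> M1] as]
 note f2 = alg_hom_comp[OF \<alpha> M2]
 show ?thesis
 proof (rule B_ext[OF E F kTT f1 f2 _ a])
  fix i j assume ij: "i < m" "j < n"
  note G = gc[OF ij]
  show "tensor_assoc H H C (tensor_map H C (tensor_alg H H) C \<Delta> id (\<alpha> (g i j))) =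
   tensor_map H C H (tensor_alg H C) id \<alpha> (\<alpha> (g i j))"
  proof (rule kspace_eqI[OF k_algebra_kspace[OF kTT] alg_hom_closed[OF f1 G] alg_hom_closed[OF f2 G]])
   fix \<Phi> assume \<Phi>: "\<Phi> \<in> dual (tensor_alg H (tensor_alg H C))"
   note \<Phi>1 = dual_comp[OF alg_hom_lin[OF alg_hom_comp[OF M1 as]] \<Phi>]
   note \<Phi>2 = dual_comp[OF alg_hom_lin[OF M2] \<Phi>]
   have "\<Phi> (tensor_assoc H H C (tensor_map H C (tensor_alg H H) C \<Delta> id (\<alpha> (g i j)))) =
    (\<Sum>k<m. \<Phi> (tensor_assoc H H C (tensor_map H C (tensor_alg H H) C \<Delta> id (tens H C (u i k) (g k j)))))"
    by (rule B_coact_gen_dual[OF E F \<Phi>1 ij])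
   also have "... = (\<Sum>k<m. \<Phi> (tensor_assoc H H C (tens (tensor_alg H H) C (\<Delta> (u i k)) (g k j))))"
    using ij uc gc by (intro sum.cong refl) (simp add: t1)
   also have "... = (\<Sum>k<m. \<Sum>l<m. \<Phi> (tensor_assoc H H C (tens (tensor_alg H H) C (tens H H (u i l) (u l k)) (g k j))))"
   proof (intro sum.cong refl)
    fix k assume k: "k \<in> {..<m}"
    note l = dual_comp[OF alg_hom_lin[OF as] \<Phi>]
    note l' = dual_tens_left[OF k_algebra_kspace[OF k_algebra_tensor[OF kH kH]] vC l gc[of k j]]
    show "\<Phi> (tensor_assoc H H C (tens (tensor_alg H H) C (\<Delta> (u i k)) (g k j))) =
     (\<Sum>l<m. \<Phi> (tensor_assoc H H C (tens (tensor_alg H H) C (tens H H (u i l) (u l k)) (g k j))))"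
     using B_coact_gen_dual[OF E E l'] k ij by simp
   qed
   also have "... = (\<Sum>k<m. \<Sum>l<m. \<Phi> (tens H (tensor_alg H C) (u i l) (tens H C (u l k) (g k j))))"
    using ij uc gc vH vC by (intro sum.cong refl) simp
   also have "... = (\<Sum>l<m. \<Sum>k<m. \<Phi> (tens H (tensor_alg H C) (u i l) (tens H C (u l k) (g k j))))"
    by (rule sum.swap)
   also have "... = (\<Sum>l<m. \<Phi> (tens H (tensor_alg H C) (u i l) (\<alpha> (g l j))))"
    using B_coact_gen_dual[OF E F dual_tens_right[OF vH k_algebra_kspace[OF kHC] \<Phi> uc]] ij
    by (intro sum.cong refl) simp
   also have "... = (\<Sum>l<m. \<Phi> (tensor_map H C H (tensor_alg H C) id \<alpha> (tens H C (u i l) (g l j))))"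
    using ij uc gc by (intro sum.cong refl) (simp add: t2)
   also have "... = \<Phi> (tensor_map H C H (tensor_alg H C) id \<alpha> (\<alpha> (g i j)))"
    by (rule B_coact_gen_dual[OF E F \<Phi>2 ij, symmetric])
   finally show "\<Phi> (tensor_assoc H H C (tensor_map H C (tensor_alg H H) C \<Delta> id (\<alpha> (g i j)))) =
    \<Phi> (tensor_map H C H (tensor_alg H C) id \<alpha> (\<alpha> (g i j)))" .
  qed
 qed
qed

lemma B_coact_counit:
 assumes a: "a \<in> carrier (B_alg E F)"
 shows "tensor_lift H C C (\<lambda>h x. B_counit E h \<odot>\<^bsub>C\<^esub> x) (\<alpha> a) = a"
proof -
 note b = bilin_smult_left[OF vC alg_hom_dual[OF \<epsilon>]]
 note lt = tensor_lift_tens[OF vH vC vC b]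
 have f: "tensor_lift H C C (\<lambda>h x. B_counit E h \<odot>\<^bsub>C\<^esub> x) \<in> alg_hom (tensor_alg H C) C"
  by (rule tensor_alg_homI[OF kH kC kC tensor_lift_lin_hom[OF vH vC vC b]])
   (use kH kC alg_hom_one[OF \<epsilon>] alg_hom_mult[OF \<epsilon>] in \<open>simp_all add: lt kspace_smult_smult mult.commute\<close>)
 have id: "(\<lambda>x. x) \<in> alg_hom C C" by (auto intro!: alg_homI)
 show ?thesis
 proof (rule B_ext[OF E F kC alg_hom_comp[OF \<alpha> f] id _ a])
  fix i j assume ij: "i < m" "j < n"
  show "tensor_lift H C C (\<lambda>h x. B_counit E h \<odot>\<^bsub>C\<^esub> x) (\<alpha> (g i j)) = g i j"
  proof (rule kspace_eqI[OF vC alg_hom_closed[OF alg_hom_comp[OF \<alpha> f] gc[OF ij]] gc[OF ij]])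
   fix \<phi> assume \<phi>: "\<phi> \<in> dual C"
   show "\<phi> (tensor_lift H C C (\<lambda>h x. B_counit E h \<odot>\<^bsub>C\<^esub> x) (\<alpha> (g i j))) = \<phi> (g i j)"
    using B_coact_gen_dual[OF E F dual_comp[OF alg_hom_lin[OF f] \<phi>] ij] ij \<phi>
    by (simp add: lt uc gc B_counit_gen cong: sum.cong_simp)
  qed
 qed
qed

lemma B_comodule_algebra: "comodule_algebra (B_hopf E) (B_comod E F)"
 unfolding comodule_algebra_def B_hopf_conv B_comod_conv B_hopf_sel B_comod_sel
 by (intro conjI ballI) (rule kC \<alpha> B_coact_coassoc B_coact_counit; assumption?)+

end

lemma B_counit_right:
 assumes a: "a \<in> carrier (B_alg E E)"
 shows "tensor_lift H H H (\<lambda>x y. B_counit E y \<odot>\<^bsub>H\<^esub> x) (\<Delta> a) = a"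
proof -
 note b = bilin_smult_right[OF vH alg_hom_dual[OF \<epsilon>]]
 note lt = tensor_lift_tens[OF vH vH vH b]
 have f: "tensor_lift H H H (\<lambda>x y. B_counit E y \<odot>\<^bsub>H\<^esub> x) \<in> alg_hom (tensor_alg H H) H"
  by (rule tensor_alg_homI[OF kH kH kH tensor_lift_lin_hom[OF vH vH vH b]])
   (use kH alg_hom_one[OF \<epsilon>] alg_hom_mult[OF \<epsilon>] in \<open>simp_all add: lt kspace_smult_smult mult.commute\<close>)
 have id: "(\<lambda>x. x) \<in> alg_hom H H" by (auto intro!: alg_homI)
 show ?thesis
 proof (rule B_ext[OF E E kH alg_hom_comp[OF \<Delta> f] id _ a])
  fix i j assume ij: "i < m" "j < m"
  show "tensor_lift H H H (\<lambda>x y. B_counit E y \<odot>\<^bsub>H\<^esub> x) (\<Delta> (u i j)) = u i j"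
  proof (rule kspace_eqI[OF vH alg_hom_closed[OF alg_hom_comp[OF \<Delta> f] uc[OF ij]] uc[OF ij]])
   fix \<phi> assume \<phi>: "\<phi> \<in> dual H"
   show "\<phi> (tensor_lift H H H (\<lambda>x y. B_counit E y \<odot>\<^bsub>H\<^esub> x) (\<Delta> (u i j))) = \<phi> (u i j)"
    using B_coact_gen_dual[OF E E dual_comp[OF alg_hom_lin[OF f] \<phi>] ij] ij \<phi>
    by (simp add: lt uc B_counit_gen cong: sum.cong_simp)
  qed
 qed
qed

lemma B_hopf_algebra: "hopf_algebra (B_hopf E)"
 unfolding hopf_algebra_def B_hopf_conv B_hopf_sel
 by (intro conjI ballI)
  (rule kH \<Delta> \<epsilon> B_antipode_lin_hom B_coact_coassoc[OF E] B_coact_counit[OF E] B_counit_right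
   antipode_axioms[THEN conjunct1] antipode_axioms[THEN conjunct2]; assumption?)+

end

section \<open>The canonical map\<close>

lemma
 fixes H :: "('k::field, 'h) hopf" and A :: "('k, 'h, 'a) comod_alg"
 assumes H: "k_algebra H" and A: "k_algebra A" and c: "coact A \<in> lin_hom A (tensor_alg H A)"
 shows galois_map_lin_hom: "galois_map H A \<in> lin_hom (tensor_alg A A) (tensor_alg H A)"
  and galois_map_tens: "x \<in> carrier A ==> y \<in> carrier A ==>
   galois_map H A (tens A A x y) = coact A x \<otimes>\<^bsub>tensor_alg H A\<^esub> tens H A \<one>\<^bsub>H\<^esub> y"
proof -
 note vH = k_algebra_kspace[OF H] and vA = k_algebra_kspace[OF A]
 note vHA = kspace_tensor_alg[OF vH vA] and vAA = kspace_tensor_alg[OF vA vA]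
 note \<mu> = tensor_lift_lin_hom[OF vA vA vA bilin_mult[OF A]]
 note M1 = tensor_map_lin_hom[OF vA vA vHA vA c lin_hom_id(1)]
 note M3 = tensor_map_lin_hom[OF vH vAA vH vA lin_hom_id(1) \<mu>]
 have l: "(\<lambda>t. galois_map H A t) \<in> lin_hom (tensor_alg A A) (tensor_alg H A)"
  unfolding galois_map_def
  by (rule lin_hom_comp[OF lin_hom_comp[OF M1 tensor_assoc_lin_hom[OF vH vA vA]] M3])
 then show "galois_map H A \<in> lin_hom (tensor_alg A A) (tensor_alg H A)" by simp
 assume xy: "x \<in> carrier A" "y \<in> carrier A"
 have oy: "tens H A \<one>\<^bsub>H\<^esub> y \<in> carrier (tensor_alg H A)" using H A xy by simp
 note cx = lin_hom_closed[OF c xy(1)]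
 note ty = bilinD(2)[OF bilin_tens[OF vA vA] xy(2)]
 note N = tensor_map_lin_hom[OF vH vA vH vAA lin_hom_id(1) ty]
 have 1: "galois_map H A (tens A A x y) = tensor_map H (tensor_alg A A) H A id (tensor_lift A A A (mult A))
   (tensor_map H A H (tensor_alg A A) id (\<lambda>z. tens A A z y) (coact A x))"
  unfolding galois_map_def tensor_map_tens[OF vA vA vHA vA c lin_hom_id(1) xy] id_apply
   tensor_assoc_tens[OF vH vA vA cx xy(2)] ..
 show "galois_map H A (tens A A x y) = coact A x \<otimes>\<^bsub>tensor_alg H A\<^esub> tens H A \<one>\<^bsub>H\<^esub> y"
  unfolding 1
 proof (rule tensor_ext[OF vH vA vHA lin_hom_comp[OF N M3] tensor_mult_lin_left[OF H A oy] _ cx])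
  fix h z assume hz: "h \<in> carrier H" "z \<in> carrier A"
  have zy: "tens A A z y \<in> carrier (tensor_alg A A)" using hz xy vA by simp
  show "tensor_map H (tensor_alg A A) H A id (tensor_lift A A A (mult A))
    (tensor_map H A H (tensor_alg A A) id (\<lambda>z. tens A A z y) (tens H A h z)) =
    tens H A h z \<otimes>\<^bsub>tensor_alg H A\<^esub> tens H A \<one>\<^bsub>H\<^esub> y"
   unfolding tensor_map_tens[OF vH vA vH vAA lin_hom_id(1) ty hz] id_apply
    tensor_map_tens[OF vH vAA vH vA lin_hom_id(1) \<mu> hz(1) zy]
    tensor_lift_tens[OF vA vA vA bilin_mult[OF A] hz(2) xy(2)]
   using H A hz xy by simp
 qed
qed

lemma alg_hom_op: "f \<in> alg_hom C A ==> f \<in> alg_hom (op_alg C) (op_alg A)"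
 by (rule alg_homI) auto

text \<open>
 For an algebra morphism \<open>f : \<B>(E,F) \<rightarrow> A\<close> the map \<open>b \<otimes> y \<mapsto> b\<^sub>(\<^sub>-\<^sub>1\<^sub>) \<otimes> f(b\<^sub>(\<^sub>0\<^sub>)) y\<close> is bijective.
 With \<open>s = F\<^sup>-\<^sup>1 a\<^sup>t E\<close> the inverse of the matrix of generators, the assignment \<open>u \<mapsto> a \<otimes> s\<close> extends
 to an algebra morphism \<open>\<gamma>\<close> from \<open>\<B>(E)\<close> to \<open>\<B>(E,F) \<otimes> A\<^sup>o\<^sup>p\<close>, and \<open>h \<otimes> y \<mapsto> (1 \<otimes> y) \<gamma>(h)\<close> is the inverse
 map. Both compositions are checked on generators and propagated to products.
\<close>

context
 fixes E F :: "'k::field mat" and m n :: nat and A :: "('k, 'a) module" (structure) and f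
 assumes E: "E \<in> GL m" and F: "F \<in> GL n" and A: "k_algebra A" and f: "f \<in> alg_hom (B_alg E F) A"
begin

private abbreviation "HB \<equiv> B_alg E E"
private abbreviation "CB \<equiv> B_alg E F"
private abbreviation "ub \<equiv> B_gen E E"
private abbreviation "gb \<equiv> B_gen E F"
private abbreviation "HA \<equiv> tensor_alg HB A"
private abbreviation "CA \<equiv> tensor_alg CB A"
private abbreviation "CO \<equiv> tensor_alg CB (op_alg A)"
private abbreviation "te \<equiv> tens CB A"
private abbreviation "th \<equiv> tens HB A"

private lemmas akH = k_algebra_B[OF E E] and akC = k_algebra_B[OF E F]
private lemmas avH = k_algebra_kspace[OF k_algebra_B[OF E E]] and avC = k_algebra_kspace[OF k_algebra_B[OF E F]]
private lemmas avA = k_algebra_kspace[OF A] and akO = k_algebra_op[OF A]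
private lemmas avO = k_algebra_kspace[OF k_algebra_op[OF A]]
private lemmas ubc = B_gen_closed[OF E E] and gbc = B_gen_closed[OF E F]
private lemmas fc = alg_hom_closed[OF f]
private lemmas kHA = k_algebra_tensor[OF akH A] and kCA = k_algebra_tensor[OF akC A] and kCO = k_algebra_tensor[OF akC akO]
private lemmas vHA = k_algebra_kspace[OF kHA] and vCA = k_algebra_kspace[OF kCA] and vCO = k_algebra_kspace[OF kCO]

private lemma CO_conv:
 "tens CB (op_alg A) = te" "lin_hom CO P = lin_hom CA P" "lin_hom P CO = lin_hom P CA" "carrier CO = carrier CA"
 unfolding lin_hom_tensor_alg[OF avC avO] lin_hom_tensor_alg[OF avC avA] tensor_alg_sel[OF avC avO]
  tensor_alg_sel[OF avC avA] op_tensor_alg by (rule refl)+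

private lemma CO_mult:
 "x \<in> carrier CB ==> y \<in> carrier A ==> x' \<in> carrier CB ==> y' \<in> carrier A ==>
  te x y \<otimes>\<^bsub>CO\<^esub> te x' y' = te (x \<otimes>\<^bsub>CB\<^esub> x') (y' \<otimes> y)"
 using tens_mult[OF akC akO, of x y x' y'] unfolding CO_conv op_alg_sel .

private lemma CO_one: "\<one>\<^bsub>CO\<^esub> = te \<one>\<^bsub>CB\<^esub> \<one>"
 unfolding tensor_alg_sel(5)[OF avC avO] CO_conv op_alg_sel ..

private lemma CO_assoc:
 "x \<in> carrier CA ==> y \<in> carrier CA ==> z \<in> carrier CA ==> (x \<otimes>\<^bsub>CO\<^esub> y) \<otimes>\<^bsub>CO\<^esub> z = x \<otimes>\<^bsub>CO\<^esub> (y \<otimes>\<^bsub>CO\<^esub> z)"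
 using k_algebra_assoc[OF kCO] unfolding CO_conv .

private lemma CO_closed: "x \<in> carrier CA ==> y \<in> carrier CA ==> x \<otimes>\<^bsub>CO\<^esub> y \<in> carrier CA"
 using k_algebra_mult[OF kCO] unfolding CO_conv .

private lemma CO_left: "a \<in> carrier CA ==> (\<lambda>x. a \<otimes>\<^bsub>CO\<^esub> x) \<in> lin_hom CA CA"
 using lin_hom_mult_left[OF kCO] unfolding CO_conv .

private lemma CO_right: "a \<in> carrier CA ==> (\<lambda>x. x \<otimes>\<^bsub>CO\<^esub> a) \<in> lin_hom CA CA"
 using lin_hom_mult_right[OF kCO] unfolding CO_conv .

private lemma tec: "x \<in> carrier CB ==> y \<in> carrier A ==> te x y \<in> carrier CA"
 using avC avA by simp

private lemma thc: "x \<in> carrier HB ==> y \<in> carrier A ==> th x y \<in> carrier HA"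
 using avH avA by simp

private lemmas one1 = k_algebra_one[OF akC] and one2 = k_algebra_one[OF A] and one3 = k_algebra_one[OF akH]

private definition "\<theta> b = tensor_map HB CB HB A id f (B_coact E F b)"

private lemma idH: "id \<in> alg_hom HB HB"
 by (auto intro!: alg_homI)

private lemmas fmap = tensor_map_alg_hom[OF akH akC akH A idH f]
private lemmas fmap_tens = tensor_map_tens[OF avH avC avH avA lin_hom_id(1) alg_hom_lin[OF f]]

private lemma \<theta>: "\<theta> \<in> alg_hom CB HA"
proof -
 have "(\<lambda>b. \<theta> b) \<in> alg_hom CB HA"
  unfolding \<theta>_def by (rule alg_hom_comp[OF B_coact_alg_hom[OF E F] fmap])
 then show ?thesis by simp
qed

private lemma c_bilin: "bilin CB A HA (\<lambda>b y. \<theta> b \<otimes>\<^bsub>HA\<^esub> th \<one>\<^bsub>HB\<^esub> y)"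
 by (rule bilin_comp[OF bilin_mult[OF kHA] alg_hom_lin[OF \<theta>] bilinD(1)[OF bilin_tens[OF avH avA] one3]])

definition B_canonical :: "('k, 'k belem, 'a) tensor => ('k, 'k belem, 'a) tensor" where
 "B_canonical = tensor_lift CB A HA (\<lambda>b y. tensor_map HB CB HB A id f (B_coact E F b) \<otimes>\<^bsub>HA\<^esub> th \<one>\<^bsub>HB\<^esub> y)"

private abbreviation "cc \<equiv> B_canonical"

lemma B_canonical_lin_hom: "B_canonical \<in> lin_hom (tensor_alg (B_alg E F) A) (tensor_alg (B_alg E E) A)"
 unfolding B_canonical_def \<theta>_def[symmetric] by (rule tensor_lift_lin_hom[OF avC avA vHA c_bilin])

private lemma cc_tens: "b \<in> carrier CB ==> y \<in> carrier A ==> cc (te b y) = \<theta> b \<otimes>\<^bsub>HA\<^esub> th \<one>\<^bsub>HB\<^esub> y"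
 unfolding B_canonical_def \<theta>_def[symmetric] by (rule tensor_lift_tens[OF avC avA vHA c_bilin])

lemma B_canonical_tens:
 "b \<in> carrier (B_alg E F) ==> y \<in> carrier A ==> B_canonical (tens (B_alg E F) A b y) =
  tensor_map HB CB HB A id f (B_coact E F b) \<otimes>\<^bsub>tensor_alg HB A\<^esub> tens HB A \<one>\<^bsub>HB\<^esub> y"
 using cc_tens unfolding \<theta>_def .

private lemmas cc_closed = lin_hom_closed[OF B_canonical_lin_hom]

private lemma cc_left:
 assumes p: "p \<in> carrier CB" and t: "t \<in> carrier CA"
 shows "cc (te p \<one> \<otimes>\<^bsub>CO\<^esub> t) = \<theta> p \<otimes>\<^bsub>HA\<^esub> cc t"
proof (rule tensor_ext[OF avC avA vHA lin_hom_comp[OF CO_left[OF tec[OF p one2]] B_canonical_lin_hom]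
   lin_hom_comp[OF B_canonical_lin_hom lin_hom_mult_left[OF kHA alg_hom_closed[OF \<theta> p]]] _ t])
 fix x y assume xy: "x \<in> carrier CB" "y \<in> carrier A"
 note c = alg_hom_closed[OF \<theta> p] alg_hom_closed[OF \<theta> xy(1)] thc[OF one3 xy(2)]
 show "cc (te p \<one> \<otimes>\<^bsub>CO\<^esub> te x y) = \<theta> p \<otimes>\<^bsub>HA\<^esub> cc (te x y)"
  unfolding CO_mult[OF p one2 xy] cc_tens[OF xy] k_algebra_rone[OF A xy(2)]
   cc_tens[OF k_algebra_mult[OF akC p xy(1)] xy(2)] alg_hom_mult[OF \<theta> p xy(1)]
  by (rule k_algebra_assoc[OF kHA c])
qed

private definition "translation \<gamma> s \<longleftrightarrow> \<gamma> \<in> alg_hom HB CO \<and>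
 BR_inverse CB m n (entry E) (entry (minv E)) (entry F) (entry (minv F)) gb s \<and>
 (\<forall>i<m. \<forall>j<m. \<gamma> (ub i j) = finsum CO (\<lambda>k. te (gb i k) (f (s k j))) {..<n})"

private lemma translation_ex: "\<exists>\<gamma> s. translation \<gamma> s"
proof -
 obtain s where s: "BR_inverse CB m n (entry E) (entry (minv E)) (entry F) (entry (minv F)) gb s"
  using BR_inverse_exists[OF akC B_gen_BR[OF E F] GL_inverse_fun[OF E] GL_inverse_fun[OF F]] by blast
 have "BR (op_alg A) n m (entry F) (entry (minv F)) (entry E) (entry (minv E)) (\<lambda>i j. f (s i j))"
  by (rule BR_hom[OF BR_inverse.opposite[OF s] alg_hom_op[OF f]])
 then have "BR CO m m (entry E) (entry (minv E)) (entry E) (entry (minv E))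
   (\<lambda>i j. finsum CO (\<lambda>k. te (gb i k) (f (s k j))) {..<n})"
  by (rule BR_tensor[OF akC akO B_gen_BR[OF E F]]) (simp add: CO_conv)
 then obtain \<gamma> where "\<gamma> \<in> alg_hom HB CO"
  "\<forall>i<m. \<forall>j<m. \<gamma> (ub i j) = finsum CO (\<lambda>k. te (gb i k) (f (s k j))) {..<n}"
  using B_hom_ex[OF E E kCO] by blast
 then show ?thesis using s unfolding translation_def by blast
qed

context
 fixes \<gamma> s assumes \<gamma>s: "translation \<gamma> s"
begin

private lemma \<gamma>: "\<gamma> \<in> alg_hom HB CO" and si: "BR_inverse CB m n (entry E) (entry (minv E)) (entry F) (entry (minv F)) gb s"
 using \<gamma>s by (auto simp: translation_def)

private lemma \<gamma>c: "h \<in> carrier HB ==> \<gamma> h \<in> carrier CA"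
 using alg_hom_closed[OF \<gamma>] unfolding CO_conv .

private lemmas sc = BR_inverse.sc[OF si]

private lemma \<gamma>_gen_dual:
 assumes \<Phi>: "\<Phi> \<in> dual CO" and ij: "i < m" "j < m"
 shows "\<Phi> (\<gamma> (ub i j)) = (\<Sum>k<n. \<Phi> (te (gb i k) (f (s k j))))"
proof -
 have "\<gamma> (ub i j) = finsum CO (\<lambda>k. te (gb i k) (f (s k j))) {..<n}" using \<gamma>s ij by (simp add: translation_def)
 moreover have "te (gb i k) (f (s k j)) \<in> carrier CO" if "k < n" for k
  unfolding CO_conv by (rule tec[OF gbc fc[OF sc]]) (use ij that in auto)
 ultimately show ?thesis using dual_finsum_lessThan[OF vCO \<Phi>, of n] by simp
qed

private definition "dd = tensor_lift HB A CA (\<lambda>h y. te \<one>\<^bsub>CB\<^esub> y \<otimes>\<^bsub>CO\<^esub> \<gamma> h)"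

private lemma d_bilin: "bilin HB A CA (\<lambda>h y. te \<one>\<^bsub>CB\<^esub> y \<otimes>\<^bsub>CO\<^esub> \<gamma> h)"
proof (rule bilinI)
 have g: "\<gamma> \<in> lin_hom HB CA" using alg_hom_lin[OF \<gamma>] unfolding CO_conv .
 show "(\<lambda>y. te \<one>\<^bsub>CB\<^esub> y \<otimes>\<^bsub>CO\<^esub> \<gamma> h) \<in> lin_hom A CA" if "h \<in> carrier HB" for h
  by (rule lin_hom_comp[OF bilinD(1)[OF bilin_tens[OF avC avA] one1] CO_right[OF \<gamma>c[OF that]]])
 show "(\<lambda>h. te \<one>\<^bsub>CB\<^esub> y \<otimes>\<^bsub>CO\<^esub> \<gamma> h) \<in> lin_hom HB CA" if "y \<in> carrier A" for y
  by (rule lin_hom_comp[OF g CO_left[OF tec[OF one1 that]]])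
qed

private lemma dd_lin: "dd \<in> lin_hom HA CA"
 unfolding dd_def by (rule tensor_lift_lin_hom[OF avH avA vCA d_bilin])

private lemma dd_tens: "h \<in> carrier HB ==> y \<in> carrier A ==> dd (th h y) = te \<one>\<^bsub>CB\<^esub> y \<otimes>\<^bsub>CO\<^esub> \<gamma> h"
 unfolding dd_def by (rule tensor_lift_tens[OF avH avA vCA d_bilin])

private lemma cd_step:
 assumes h': "h' \<in> carrier HB" and IH: "\<And>y. y \<in> carrier A ==> cc (te \<one>\<^bsub>CB\<^esub> y \<otimes>\<^bsub>CO\<^esub> \<gamma> h') = th h' y"
  and y: "y \<in> carrier A" and t: "t \<in> carrier CA"
 shows "cc (te \<one>\<^bsub>CB\<^esub> y \<otimes>\<^bsub>CO\<^esub> (t \<otimes>\<^bsub>CO\<^esub> \<gamma> h')) = cc (te \<one>\<^bsub>CB\<^esub> y \<otimes>\<^bsub>CO\<^esub> t) \<otimes>\<^bsub>HA\<^esub> th h' \<one>"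
proof (rule tensor_ext[OF avC avA vHA
   lin_hom_comp[OF lin_hom_comp[OF CO_right[OF \<gamma>c[OF h']] CO_left[OF tec[OF one1 y]]] B_canonical_lin_hom]
   lin_hom_comp[OF lin_hom_comp[OF CO_left[OF tec[OF one1 y]] B_canonical_lin_hom] lin_hom_mult_right[OF kHA thc[OF h' one2]]] _ t])
 fix p q assume pq: "p \<in> carrier CB" "q \<in> carrier A"
 note qy = k_algebra_mult[OF A pq(2) y]
 note c = alg_hom_closed[OF \<theta> pq(1)] thc[OF one3 qy] thc[OF h' one2]
 have e: "te \<one>\<^bsub>CB\<^esub> y \<otimes>\<^bsub>CO\<^esub> te p q = te p \<one> \<otimes>\<^bsub>CO\<^esub> te \<one>\<^bsub>CB\<^esub> (q \<otimes> y)"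
  unfolding CO_mult[OF one1 y pq] CO_mult[OF pq(1) one2 one1 qy] using akC A pq y by simp
 have "cc (te \<one>\<^bsub>CB\<^esub> y \<otimes>\<^bsub>CO\<^esub> (te p q \<otimes>\<^bsub>CO\<^esub> \<gamma> h')) = cc (te p \<one> \<otimes>\<^bsub>CO\<^esub> (te \<one>\<^bsub>CB\<^esub> (q \<otimes> y) \<otimes>\<^bsub>CO\<^esub> \<gamma> h'))"
  unfolding CO_assoc[OF tec[OF one1 y] tec[OF pq] \<gamma>c[OF h'], symmetric] e
   CO_assoc[OF tec[OF pq(1) one2] tec[OF one1 qy] \<gamma>c[OF h']] ..
 also have "... = \<theta> p \<otimes>\<^bsub>HA\<^esub> th h' (q \<otimes> y)"
  unfolding cc_left[OF pq(1) CO_closed[OF tec[OF one1 qy] \<gamma>c[OF h']]] IH[OF qy] ..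
 also have "th h' (q \<otimes> y) = th \<one>\<^bsub>HB\<^esub> (q \<otimes> y) \<otimes>\<^bsub>HA\<^esub> th h' \<one>"
  unfolding tens_mult[OF akH A one3 qy h' one2] using akH A h' qy by simp
 also have "\<theta> p \<otimes>\<^bsub>HA\<^esub> \<dots> = (\<theta> p \<otimes>\<^bsub>HA\<^esub> th \<one>\<^bsub>HB\<^esub> (q \<otimes> y)) \<otimes>\<^bsub>HA\<^esub> th h' \<one>"
  by (rule k_algebra_assoc[OF kHA c, symmetric])
 also have "\<theta> p \<otimes>\<^bsub>HA\<^esub> th \<one>\<^bsub>HB\<^esub> (q \<otimes> y) = cc (te \<one>\<^bsub>CB\<^esub> y \<otimes>\<^bsub>CO\<^esub> te p q)"
  unfolding CO_mult[OF one1 y pq] using cc_tens[OF pq(1) qy] akC pq by simp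
 finally show "cc (te \<one>\<^bsub>CB\<^esub> y \<otimes>\<^bsub>CO\<^esub> (te p q \<otimes>\<^bsub>CO\<^esub> \<gamma> h')) = cc (te \<one>\<^bsub>CB\<^esub> y \<otimes>\<^bsub>CO\<^esub> te p q) \<otimes>\<^bsub>HA\<^esub> th h' \<one>" .
qed

private lemma cd_gen:
 assumes ij: "i < m" "j < m" and y: "y \<in> carrier A"
 shows "cc (te \<one>\<^bsub>CB\<^esub> y \<otimes>\<^bsub>CO\<^esub> \<gamma> (ub i j)) = th (ub i j) y"
proof (rule kspace_eqI[OF vHA cc_closed[OF CO_closed[OF tec[OF one1 y] \<gamma>c[OF ubc[OF ij]]]] thc[OF ubc[OF ij] y]])
 fix \<Phi> assume \<Phi>: "\<Phi> \<in> dual HA"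
 have \<Psi>: "(\<lambda>t. \<Phi> (cc (te \<one>\<^bsub>CB\<^esub> y \<otimes>\<^bsub>CO\<^esub> t))) \<in> dual CO"
  by (rule dual_comp[OF _ \<Phi>], unfold CO_conv, rule lin_hom_comp[OF CO_left[OF tec[OF one1 y]] B_canonical_lin_hom])
 have "\<Phi> (cc (te \<one>\<^bsub>CB\<^esub> y \<otimes>\<^bsub>CO\<^esub> \<gamma> (ub i j))) = (\<Sum>k<n. \<Phi> (cc (te \<one>\<^bsub>CB\<^esub> y \<otimes>\<^bsub>CO\<^esub> te (gb i k) (f (s k j)))))"
  by (rule \<gamma>_gen_dual[OF \<Psi> ij])
 also have "... = (\<Sum>k<n. \<Sum>l<m. \<Phi> (th (ub i l) (f (gb l k \<otimes>\<^bsub>CB\<^esub> s k j) \<otimes> y)))"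
 proof (rule sum.cong[OF refl])
  fix k assume "k \<in> {..<n}"
  then have k: "k < n" by simp
  note g' = gbc[OF ij(1) k] and fs = fc[OF sc[OF k ij(2)]]
  note fsy = k_algebra_mult[OF A fs y]
  have "cc (te \<one>\<^bsub>CB\<^esub> y \<otimes>\<^bsub>CO\<^esub> te (gb i k) (f (s k j))) = \<theta> (gb i k) \<otimes>\<^bsub>HA\<^esub> th \<one>\<^bsub>HB\<^esub> (f (s k j) \<otimes> y)"
   unfolding CO_mult[OF one1 y g' fs] using cc_tens[OF g' fsy] akC g' by simp
  then have "\<Phi> (cc (te \<one>\<^bsub>CB\<^esub> y \<otimes>\<^bsub>CO\<^esub> te (gb i k) (f (s k j)))) =
    \<Phi> (\<theta> (gb i k) \<otimes>\<^bsub>HA\<^esub> th \<one>\<^bsub>HB\<^esub> (f (s k j) \<otimes> y))" by (rule arg_cong)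
  also have "... = (\<Sum>l<m. \<Phi> (tensor_map HB CB HB A id f (tens HB CB (ub i l) (gb l k)) \<otimes>\<^bsub>HA\<^esub> th \<one>\<^bsub>HB\<^esub> (f (s k j) \<otimes> y)))"
   unfolding \<theta>_def
   by (rule B_coact_gen_dual[OF E F dual_comp[OF alg_hom_lin[OF fmap] dual_mult_right[OF kHA \<Phi> thc[OF one3 fsy]]] ij(1) k])
  also have "... = (\<Sum>l<m. \<Phi> (th (ub i l) (f (gb l k \<otimes>\<^bsub>CB\<^esub> s k j) \<otimes> y)))"
  proof (rule sum.cong[OF refl])
   fix l assume "l \<in> {..<m}"
   then have l: "l < m" by simp
   have "tensor_map HB CB HB A id f (tens HB CB (ub i l) (gb l k)) \<otimes>\<^bsub>HA\<^esub> th \<one>\<^bsub>HB\<^esub> (f (s k j) \<otimes> y) =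
    th (ub i l) (f (gb l k) \<otimes> (f (s k j) \<otimes> y))"
    unfolding fmap_tens[OF ubc[OF ij(1) l] gbc[OF l k]] id_apply
     tens_mult[OF akH A ubc[OF ij(1) l] fc[OF gbc[OF l k]] one3 fsy]
    using akH ubc[OF ij(1) l] by simp
   then show "\<Phi> (tensor_map HB CB HB A id f (tens HB CB (ub i l) (gb l k)) \<otimes>\<^bsub>HA\<^esub> th \<one>\<^bsub>HB\<^esub> (f (s k j) \<otimes> y)) =
    \<Phi> (th (ub i l) (f (gb l k \<otimes>\<^bsub>CB\<^esub> s k j) \<otimes> y))"
    unfolding alg_hom_mult[OF f gbc[OF l k] sc[OF k ij(2)]] k_algebra_assoc[OF A fc[OF gbc[OF l k]] fs y] by simp
  qed
  finally show "\<Phi> (cc (te \<one>\<^bsub>CB\<^esub> y \<otimes>\<^bsub>CO\<^esub> te (gb i k) (f (s k j)))) =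
   (\<Sum>l<m. \<Phi> (th (ub i l) (f (gb l k \<otimes>\<^bsub>CB\<^esub> s k j) \<otimes> y)))" .
 qed
 also have "... = (\<Sum>l<m. \<Sum>k<n. \<Phi> (th (ub i l) (f (gb l k \<otimes>\<^bsub>CB\<^esub> s k j) \<otimes> y)))" by (rule sum.swap)
 also have "... = (\<Sum>l<m. of_bool (l = j) * \<Phi> (th (ub i l) y))"
 proof (rule sum.cong[OF refl])
  fix l assume "l \<in> {..<m}"
  then have l: "l < m" by simp
  note D = dual_comp[OF lin_hom_comp[OF alg_hom_lin[OF f] lin_hom_mult_right[OF A y]] dual_tens_right[OF avH avA \<Phi> ubc[OF ij(1) l]]]
  show "(\<Sum>k<n. \<Phi> (th (ub i l) (f (gb l k \<otimes>\<^bsub>CB\<^esub> s k j) \<otimes> y))) = of_bool (l = j) * \<Phi> (th (ub i l) y)"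
   using BR_inverse.right_inverse[OF si D l ij(2)] alg_hom_one[OF f] A y by simp
 qed
 finally show "\<Phi> (cc (te \<one>\<^bsub>CB\<^esub> y \<otimes>\<^bsub>CO\<^esub> \<gamma> (ub i j))) = \<Phi> (th (ub i j) y)" using ij by simp
qed

text \<open>
 One of the two compositions, by induction over products of generators; a generator is cancelled by
 \<open>f(a) f(s) = 1\<close>.
\<close>

private lemma cd:
 assumes h: "h \<in> carrier HB"
 shows "\<forall>y\<in>carrier A. cc (te \<one>\<^bsub>CB\<^esub> y \<otimes>\<^bsub>CO\<^esub> \<gamma> h) = th h y"
 using h
proof (induction h rule: B_induct[OF E E, consumes 1, case_names one gen add smult])
 case one
 show ?case
 proof
  fix y assume y: "y \<in> carrier A"
  have "te \<one>\<^bsub>CB\<^esub> y \<otimes>\<^bsub>CO\<^esub> \<gamma> \<one>\<^bsub>HB\<^esub> = te \<one>\<^bsub>CB\<^esub> y"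
   unfolding alg_hom_one[OF \<gamma>] CO_one CO_mult[OF one1 y one1 one2] using akC A y by simp
  then show "cc (te \<one>\<^bsub>CB\<^esub> y \<otimes>\<^bsub>CO\<^esub> \<gamma> \<one>\<^bsub>HB\<^esub>) = th \<one>\<^bsub>HB\<^esub> y"
   using cc_tens[OF one1 y] alg_hom_one[OF \<theta>] kHA thc[OF one3 y] by simp
 qed
next
 case (gen i j h')
 show ?case
 proof
  fix y assume y: "y \<in> carrier A"
  have "cc (te \<one>\<^bsub>CB\<^esub> y \<otimes>\<^bsub>CO\<^esub> \<gamma> (ub i j \<otimes>\<^bsub>HB\<^esub> h')) = th (ub i j) y \<otimes>\<^bsub>HA\<^esub> th h' \<one>"
   unfolding alg_hom_mult[OF \<gamma> ubc[OF gen(1,2)] gen(3)] cd_gen[OF gen(1,2) y, symmetric]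
   by (rule cd_step[OF gen(3) _ y \<gamma>c[OF ubc[OF gen(1,2)]]]) (rule bspec[OF gen(4)])
  also have "... = th (ub i j \<otimes>\<^bsub>HB\<^esub> h') y"
   unfolding tens_mult[OF akH A ubc[OF gen(1,2)] y gen(3) one2] using A y by simp
  finally show "cc (te \<one>\<^bsub>CB\<^esub> y \<otimes>\<^bsub>CO\<^esub> \<gamma> (ub i j \<otimes>\<^bsub>HB\<^esub> h')) = th (ub i j \<otimes>\<^bsub>HB\<^esub> h') y" .
 qed
next
 case (add x z)
 note l = lin_hom_comp[OF bilinD(2)[OF d_bilin] B_canonical_lin_hom]
 show ?case
  using add(3,4) lin_hom_add[OF l add(1,2)] tens_add_left[OF avH avA add(1,2)] by simp
next
 case (smult c x)
 note l = lin_hom_comp[OF bilinD(2)[OF d_bilin] B_canonical_lin_hom]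
 show ?case
  using smult(2) lin_hom_smult[OF l smult(1)] tens_smult_left[OF avH avA smult(1)] by simp
qed

private lemma dd_step:
 assumes t: "t \<in> carrier HA" and h': "h' \<in> carrier HB" "z' \<in> carrier A"
 shows "dd (t \<otimes>\<^bsub>HA\<^esub> th h' z') = te \<one>\<^bsub>CB\<^esub> z' \<otimes>\<^bsub>CO\<^esub> (dd t \<otimes>\<^bsub>CO\<^esub> \<gamma> h')"
proof (rule tensor_ext[OF avH avA vCA lin_hom_comp[OF tensor_mult_lin_left[OF akH A thc[OF h']] dd_lin]
   lin_hom_comp[OF dd_lin lin_hom_comp[OF CO_right[OF \<gamma>c[OF h'(1)]] CO_left[OF tec[OF one1 h'(2)]]]] _ t])
 fix h z assume hz: "h \<in> carrier HB" "z \<in> carrier A"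
 note hh = k_algebra_mult[OF akH hz(1) h'(1)] and zz = k_algebra_mult[OF A hz(2) h'(2)]
 have "te \<one>\<^bsub>CB\<^esub> (z \<otimes> z') = te \<one>\<^bsub>CB\<^esub> z' \<otimes>\<^bsub>CO\<^esub> te \<one>\<^bsub>CB\<^esub> z"
  unfolding CO_mult[OF one1 h'(2) one1 hz(2)] using akC by simp
 then show "dd (th h z \<otimes>\<^bsub>HA\<^esub> th h' z') = te \<one>\<^bsub>CB\<^esub> z' \<otimes>\<^bsub>CO\<^esub> (dd (th h z) \<otimes>\<^bsub>CO\<^esub> \<gamma> h')"
  unfolding tens_mult[OF akH A hz h'] dd_tens[OF hh zz] dd_tens[OF hz] alg_hom_mult[OF \<gamma> hz(1) h'(1)]
  using tec[OF one1 h'(2)] tec[OF one1 hz(2)] \<gamma>c[OF hz(1)] \<gamma>c[OF h'(1)]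
  by (simp add: CO_assoc CO_closed)
qed

private lemma dc_gen:
 assumes ij: "i < m" "j < n"
 shows "dd (\<theta> (gb i j)) = te (gb i j) \<one>"
proof (rule kspace_eqI[OF vCA lin_hom_closed[OF dd_lin alg_hom_closed[OF \<theta> gbc[OF ij]]] tec[OF gbc[OF ij] one2]])
 fix \<Phi> assume \<Phi>: "\<Phi> \<in> dual CA"
 have "\<Phi> (dd (\<theta> (gb i j))) = (\<Sum>k<m. \<Phi> (dd (tensor_map HB CB HB A id f (tens HB CB (ub i k) (gb k j)))))"
  unfolding \<theta>_def by (rule B_coact_gen_dual[OF E F dual_comp[OF lin_hom_comp[OF alg_hom_lin[OF fmap] dd_lin] \<Phi>] ij])
 also have "... = (\<Sum>k<m. \<Sum>l<n. \<Phi> (te (gb i l) (f (s l k \<otimes>\<^bsub>CB\<^esub> gb k j))))"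
 proof (rule sum.cong[OF refl])
  fix k assume "k \<in> {..<m}"
  then have k: "k < m" by simp
  note fg = fc[OF gbc[OF k ij(2)]]
  have \<Psi>: "(\<lambda>t. \<Phi> (te \<one>\<^bsub>CB\<^esub> (f (gb k j)) \<otimes>\<^bsub>CO\<^esub> t)) \<in> dual CO"
   by (rule dual_comp[OF _ \<Phi>], unfold CO_conv, rule CO_left[OF tec[OF one1 fg]])
  have "\<Phi> (dd (tensor_map HB CB HB A id f (tens HB CB (ub i k) (gb k j)))) = \<Phi> (te \<one>\<^bsub>CB\<^esub> (f (gb k j)) \<otimes>\<^bsub>CO\<^esub> \<gamma> (ub i k))"
   unfolding fmap_tens[OF ubc[OF ij(1) k] gbc[OF k ij(2)]] id_apply dd_tens[OF ubc[OF ij(1) k] fg] ..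
  also have "... = (\<Sum>l<n. \<Phi> (te \<one>\<^bsub>CB\<^esub> (f (gb k j)) \<otimes>\<^bsub>CO\<^esub> te (gb i l) (f (s l k))))"
   by (rule \<gamma>_gen_dual[OF \<Psi> ij(1) k])
  also have "... = (\<Sum>l<n. \<Phi> (te (gb i l) (f (s l k \<otimes>\<^bsub>CB\<^esub> gb k j))))"
  proof (rule sum.cong[OF refl])
   fix l assume "l \<in> {..<n}"
   then have l: "l < n" by simp
   show "\<Phi> (te \<one>\<^bsub>CB\<^esub> (f (gb k j)) \<otimes>\<^bsub>CO\<^esub> te (gb i l) (f (s l k))) = \<Phi> (te (gb i l) (f (s l k \<otimes>\<^bsub>CB\<^esub> gb k j)))"
    unfolding CO_mult[OF one1 fg gbc[OF ij(1) l] fc[OF sc[OF l k]]] alg_hom_mult[OF f sc[OF l k] gbc[OF k ij(2)]]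
    using akC gbc[OF ij(1) l] by simp
  qed
  finally show "\<Phi> (dd (tensor_map HB CB HB A id f (tens HB CB (ub i k) (gb k j)))) =
   (\<Sum>l<n. \<Phi> (te (gb i l) (f (s l k \<otimes>\<^bsub>CB\<^esub> gb k j))))" .
 qed
 also have "... = (\<Sum>l<n. \<Sum>k<m. \<Phi> (te (gb i l) (f (s l k \<otimes>\<^bsub>CB\<^esub> gb k j))))" by (rule sum.swap)
 also have "... = (\<Sum>l<n. of_bool (l = j) * \<Phi> (te (gb i l) \<one>))"
 proof (rule sum.cong[OF refl])
  fix l assume "l \<in> {..<n}"
  then have l: "l < n" by simp
  note D = dual_comp[OF alg_hom_lin[OF f] dual_tens_right[OF avC avA \<Phi> gbc[OF ij(1) l]]]
  show "(\<Sum>k<m. \<Phi> (te (gb i l) (f (s l k \<otimes>\<^bsub>CB\<^esub> gb k j)))) = of_bool (l = j) * \<Phi> (te (gb i l) \<one>)"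
   using BR_inverse.left_inverse[OF si D l ij(2)] alg_hom_one[OF f] by simp
 qed
 finally show "\<Phi> (dd (\<theta> (gb i j))) = \<Phi> (te (gb i j) \<one>)" using ij by simp
qed

private lemma dc_left:
 assumes ij: "i < m" "j < n" and t: "t \<in> carrier HA"
 shows "dd (\<theta> (gb i j) \<otimes>\<^bsub>HA\<^esub> t) = te (gb i j) \<one> \<otimes>\<^bsub>CO\<^esub> dd t"
proof (rule tensor_ext[OF avH avA vCA lin_hom_comp[OF tensor_mult_lin_right[OF akH A alg_hom_closed[OF \<theta> gbc[OF ij]]] dd_lin]
   lin_hom_comp[OF dd_lin CO_left[OF tec[OF gbc[OF ij] one2]]] _ t])
 fix h z assume hz: "h \<in> carrier HB" "z \<in> carrier A"
 note c = tec[OF one1 hz(2)] tec[OF gbc[OF ij] one2] \<gamma>c[OF hz(1)]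
 have "te \<one>\<^bsub>CB\<^esub> z \<otimes>\<^bsub>CO\<^esub> te (gb i j) \<one> = te (gb i j) \<one> \<otimes>\<^bsub>CO\<^esub> te \<one>\<^bsub>CB\<^esub> z"
  unfolding CO_mult[OF one1 hz(2) gbc[OF ij] one2] CO_mult[OF gbc[OF ij] one2 one1 hz(2)]
  using akC A gbc[OF ij] hz by simp
 then show "dd (\<theta> (gb i j) \<otimes>\<^bsub>HA\<^esub> th h z) = te (gb i j) \<one> \<otimes>\<^bsub>CO\<^esub> dd (th h z)"
  unfolding dd_step[OF alg_hom_closed[OF \<theta> gbc[OF ij]] hz] dc_gen[OF ij] dd_tens[OF hz]
  unfolding CO_assoc[OF c(1,2,3), symmetric] CO_assoc[OF c(2,1,3), symmetric] by simp
qed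

text \<open>
 The other composition; here a generator is cancelled by \<open>f(s) f(a) = 1\<close>.
\<close>

private lemma dc:
 assumes b: "b \<in> carrier CB"
 shows "\<forall>y\<in>carrier A. dd (\<theta> b \<otimes>\<^bsub>HA\<^esub> th \<one>\<^bsub>HB\<^esub> y) = te b y"
 using b
proof (induction b rule: B_induct[OF E F, consumes 1, case_names one gen add smult])
 case one
 show ?case
 proof
  fix y assume y: "y \<in> carrier A"
  have "te \<one>\<^bsub>CB\<^esub> y \<otimes>\<^bsub>CO\<^esub> \<gamma> \<one>\<^bsub>HB\<^esub> = te \<one>\<^bsub>CB\<^esub> y"
   unfolding alg_hom_one[OF \<gamma>] CO_one CO_mult[OF one1 y one1 one2] using akC A y by simp
  then show "dd (\<theta> \<one>\<^bsub>CB\<^esub> \<otimes>\<^bsub>HA\<^esub> th \<one>\<^bsub>HB\<^esub> y) = te \<one>\<^bsub>CB\<^esub> y"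
   unfolding alg_hom_one[OF \<theta>] k_algebra_lone[OF kHA thc[OF one3 y]] dd_tens[OF one3 y] .
 qed
next
 case (gen i j b')
 show ?case
 proof
  fix y assume y: "y \<in> carrier A"
  note c = alg_hom_closed[OF \<theta> gbc[OF gen(1,2)]] alg_hom_closed[OF \<theta> gen(3)] thc[OF one3 y]
  show "dd (\<theta> (gb i j \<otimes>\<^bsub>CB\<^esub> b') \<otimes>\<^bsub>HA\<^esub> th \<one>\<^bsub>HB\<^esub> y) = te (gb i j \<otimes>\<^bsub>CB\<^esub> b') y"
   unfolding alg_hom_mult[OF \<theta> gbc[OF gen(1,2)] gen(3)] k_algebra_assoc[OF kHA c]
    dc_left[OF gen(1,2) k_algebra_mult[OF kHA c(2,3)]] bspec[OF gen(4) y]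
    CO_mult[OF gbc[OF gen(1,2)] one2 gen(3) y] k_algebra_rone[OF A y] ..
 qed
next
 case (add x z)
 note l = lin_hom_comp[OF bilinD(2)[OF c_bilin] dd_lin]
 show ?case
  using add(3,4) lin_hom_add[OF l add(1,2)] tens_add_left[OF avC avA add(1,2)] by simp
next
 case (smult c x)
 note l = lin_hom_comp[OF bilinD(2)[OF c_bilin] dd_lin]
 show ?case
  using smult(2) lin_hom_smult[OF l smult(1)] tens_smult_left[OF avC avA smult(1)] by simp
qed

lemma canonical_bij_translation: "bij_betw cc (carrier CA) (carrier HA)"
proof (rule bij_betw_byWitness[where f' = dd])
 show "\<forall>t\<in>carrier CA. dd (cc t) = t"
 proof
  fix t assume t: "t \<in> carrier CA"
  show "dd (cc t) = t"
   by (rule tensor_ext[OF avC avA vCA lin_hom_comp[OF B_canonical_lin_hom dd_lin] lin_hom_id(2) _ t])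
    (use dc in \<open>simp add: cc_tens\<close>)
 qed
 show "\<forall>t\<in>carrier HA. cc (dd t) = t"
 proof
  fix t assume t: "t \<in> carrier HA"
  show "cc (dd t) = t"
   by (rule tensor_ext[OF avH avA vHA lin_hom_comp[OF dd_lin B_canonical_lin_hom] lin_hom_id(2) _ t])
    (use cd in \<open>simp add: dd_tens\<close>)
 qed
 show "cc ` carrier CA \<subseteq> carrier HA" using cc_closed by blast
 show "dd ` carrier HA \<subseteq> carrier CA" using lin_hom_closed[OF dd_lin] by blast
qed

end

lemma B_canonical_bij:
 "bij_betw B_canonical (carrier (tensor_alg (B_alg E F) A)) (carrier (tensor_alg (B_alg E E) A))"
 using translation_ex canonical_bij_translation by blast

end

text \<open>
 The canonical map of \<open>\<B>(E,F)\<close> is the case \<open>f = id\<close> of the bijection just constructed.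
\<close>

lemma B_galois_object:
 fixes E F :: "'k::field mat"
 assumes E: "E \<in> GL m" and F: "F \<in> GL n" and ne: "\<one>\<^bsub>B_alg E F\<^esub> \<noteq> \<zero>\<^bsub>B_alg E F\<^esub>"
 shows "galois_object (B_hopf E) (B_comod E F)"
proof -
 let ?H = "B_alg E E" and ?C = "B_alg E F"
 note kH = k_algebra_B[OF E E] and kC = k_algebra_B[OF E F]
 note vH = k_algebra_kspace[OF kH] and vC = k_algebra_kspace[OF kC]
 have id: "id \<in> alg_hom ?C ?C" by (auto intro!: alg_homI)
 have kH': "k_algebra (B_hopf E)" and kC': "k_algebra (B_comod E F)"
  unfolding B_hopf_conv B_comod_conv using kH kC by auto
 have c': "coact (B_comod E F) \<in> lin_hom (B_comod E F) (tensor_alg (B_hopf E) (B_comod E F))"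
  unfolding B_hopf_conv B_comod_conv B_comod_sel using alg_hom_lin[OF B_coact_alg_hom[OF E F]] .
 note gl = galois_map_lin_hom[OF kH' kC' c', unfolded B_hopf_conv B_comod_conv B_comod_sel]
 note gt = galois_map_tens[OF kH' kC' c', unfolded B_hopf_conv B_comod_conv B_comod_sel]
 note cl = B_canonical_lin_hom[OF E F kC id]
 have mid: "tensor_map ?H ?C ?H ?C id id t = t" if "t \<in> carrier (tensor_alg ?H ?C)" for t
  by (rule tensor_ext[OF vH vC kspace_tensor_alg[OF vH vC] tensor_map_lin_hom[OF vH vC vH vC lin_hom_id(1) lin_hom_id(1)] lin_hom_id(2) _ that])
   (simp add: tensor_map_tens[OF vH vC vH vC lin_hom_id(1) lin_hom_id(1)])
 have "galois_map (B_hopf E) (B_comod E F) t = B_canonical E F ?C id t" if t: "t \<in> carrier (tensor_alg ?C ?C)" for t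
 proof (rule tensor_ext[OF vC vC kspace_tensor_alg[OF vH vC] gl cl _ t])
  fix x y assume xy: "x \<in> carrier ?C" "y \<in> carrier ?C"
  show "galois_map (B_hopf E) (B_comod E F) (tens ?C ?C x y) = B_canonical E F ?C id (tens ?C ?C x y)"
   unfolding gt[OF xy] B_canonical_tens[OF E F kC id xy] mid[OF alg_hom_closed[OF B_coact_alg_hom[OF E F] xy(1)]] ..
 qed
 then have "bij_betw (galois_map (B_hopf E) (B_comod E F)) (carrier (tensor_alg ?C ?C)) (carrier (tensor_alg ?H ?C)) \<longleftrightarrow>
   bij_betw (B_canonical E F ?C id) (carrier (tensor_alg ?C ?C)) (carrier (tensor_alg ?H ?C))"
  by (rule bij_betw_cong)
 then have "bij_betw (galois_map (B_hopf E) (B_comod E F)) (carrier (tensor_alg ?C ?C)) (carrier (tensor_alg ?H ?C))"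
  using B_canonical_bij[OF E F kC id] by (rule iffD2)
 moreover have "carrier ?C \<noteq> {\<zero>\<^bsub>?C\<^esub>}" using ne k_algebra_one[OF kC] by blast
 ultimately show ?thesis
  unfolding galois_object_def using B_hopf_algebra[OF E] B_comodule_algebra[OF E F]
  unfolding B_hopf_conv B_comod_conv by blast
qed

lemma k_algebra_one_not_zero:
 fixes A (structure)
 assumes A: "k_algebra A" and ne: "carrier A \<noteq> {\<zero>}"
 shows "\<one> \<noteq> \<zero>"
proof
 note vA = k_algebra_kspace[OF A]
 assume z: "\<one> = \<zero>"
 have "x = \<zero>" if x: "x \<in> carrier A" for x
  using k_algebra_rone[OF A x] lin_hom_zero[OF vA vA lin_hom_mult_left[OF A x]] unfolding z
  by (rule trans[OF sym])
 then have "carrier A = {\<zero>}" using kspace_zero[OF vA] by blast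
 then show False using ne by contradiction
qed

text \<open>
 The canonical map of the Galois object \<open>A\<close> composed with \<open>f \<otimes> id\<close> is the map \<open>B_canonical\<close>. Since both are
 bijective, so is \<open>f \<otimes> id\<close>, and slicing with a functional that is \<open>1\<close> at the unit gives the claim for \<open>f\<close>.
\<close>

lemma B_to_galois_bij:
 fixes E F :: "'k::field mat" and A :: "('k, 'k belem, 'a) comod_alg" (structure)
 assumes E: "E \<in> GL m" and F: "F \<in> GL n" and A: "galois_object (B_hopf E) A"
  and f: "f \<in> alg_hom (B_alg E F) A"
  and col: "\<And>b. b \<in> carrier (B_alg E F) ==>
   coact A (f b) = tensor_map (B_alg E E) (B_alg E F) (B_alg E E) A id f (B_coact E F b)"
 shows "bij_betw f (carrier (B_alg E F)) (carrier A)"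
proof -
 let ?H = "B_alg E E" and ?C = "B_alg E F" and ?A = "module.truncate A"
 note kH = k_algebra_B[OF E E] and kC = k_algebra_B[OF E F]
 note vH = k_algebra_kspace[OF kH] and vC = k_algebra_kspace[OF kC]
 have ca: "comodule_algebra (B_hopf E) A" using A by (simp add: galois_object_def)
 then have kA: "k_algebra A" by (simp add: comodule_algebra_def)
 then have kA': "k_algebra ?A" by (simp add: truncate_k_algebra)
 note vA = k_algebra_kspace[OF kA]
 have f': "f \<in> alg_hom ?C ?A" using f by (simp add: truncate_alg_hom)
 have kH': "k_algebra (B_hopf E)" unfolding B_hopf_conv by (rule kH)
 have c': "coact A \<in> lin_hom A (tensor_alg (B_hopf E) A)"
  using ca alg_hom_lin unfolding comodule_algebra_def by blast
 note gl = galois_map_lin_hom[OF kH' kA c', unfolded B_hopf_conv]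
 note gt = galois_map_tens[OF kH' kA c', unfolded B_hopf_conv]
 note cl = B_canonical_lin_hom[OF E F kA' f', unfolded truncate_conv]
 note fm = tensor_map_lin_hom[OF vC vA vA vA alg_hom_lin[OF f] lin_hom_id(1)]
 note fmt = tensor_map_tens[OF vC vA vA vA alg_hom_lin[OF f] lin_hom_id(1)]
 let ?fm = "tensor_map ?C A A A f id"
 have eq: "galois_map (B_hopf E) A (?fm t) = B_canonical E F ?A f t" if t: "t \<in> carrier (tensor_alg ?C A)" for t
 proof (rule tensor_ext[OF vC vA kspace_tensor_alg[OF vH vA] lin_hom_comp[OF fm gl] cl _ t])
  fix x y assume xy: "x \<in> carrier ?C" "y \<in> carrier A"
  have xy': "x \<in> carrier ?C" "y \<in> carrier ?A" using xy by simp_all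
  show "galois_map (B_hopf E) A (?fm (tens ?C A x y)) = B_canonical E F ?A f (tens ?C A x y)"
   unfolding fmt[OF xy] id_apply gt[OF alg_hom_closed[OF f xy(1)] xy(2)] col[OF xy(1)]
    B_canonical_tens[OF E F kA' f' xy', unfolded truncate_conv] ..
 qed
 have gb: "bij_betw (galois_map (B_hopf E) A) (carrier (tensor_alg A A)) (carrier (tensor_alg ?H A))"
  using A unfolding galois_object_def B_hopf_conv by blast
 have "bij_betw (B_canonical E F ?A f) (carrier (tensor_alg ?C A)) (carrier (tensor_alg ?H A))"
  using B_canonical_bij[OF E F kA' f'] unfolding truncate_conv .
 moreover have "bij_betw (\<lambda>t. galois_map (B_hopf E) A (?fm t)) (carrier (tensor_alg ?C A)) (carrier (tensor_alg ?H A)) \<longleftrightarrow>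
   bij_betw (B_canonical E F ?A f) (carrier (tensor_alg ?C A)) (carrier (tensor_alg ?H A))"
  by (rule bij_betw_cong) (rule eq)
 ultimately have "bij_betw (\<lambda>t. galois_map (B_hopf E) A (?fm t)) (carrier (tensor_alg ?C A)) (carrier (tensor_alg ?H A))"
  by (rule iffD2[rotated])
 then have fb: "bij_betw ?fm (carrier (tensor_alg ?C A)) (carrier (tensor_alg A A))"
  using bij_betw_comp_iff2[OF gb, of ?fm "carrier (tensor_alg ?C A)"] lin_hom_closed[OF fm]
  unfolding comp_def by blast
 obtain \<psi> where \<psi>: "\<psi> \<in> dual A" "\<psi> \<one> = 1"
 proof -
  have "\<one> \<noteq> \<zero>" by (rule k_algebra_one_not_zero[OF kA]) (use A in \<open>simp add: galois_object_def\<close>)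
  then show ?thesis using dual_separates[OF vA k_algebra_one[OF kA]] that by blast
 qed
 note rC = rslice_lin_hom[OF vC vA \<psi>(1)] and rA = rslice_lin_hom[OF vA vA \<psi>(1)]
 note one = k_algebra_one[OF kA]
 have r1: "rslice ?C A \<psi> (tens ?C A x \<one>) = x" if "x \<in> carrier ?C" for x
  unfolding rslice_tens[OF vC vA \<psi>(1) that one] \<psi>(2) by (rule kspace_smult1[OF vC that])
 have r2: "rslice A A \<psi> (tens A A x \<one>) = x" if "x \<in> carrier A" for x
  unfolding rslice_tens[OF vA vA \<psi>(1) that one] \<psi>(2) by (rule kspace_smult1[OF vA that])
 have r3: "rslice A A \<psi> (?fm t) = f (rslice ?C A \<psi> t)" if t: "t \<in> carrier (tensor_alg ?C A)" for t
 proof (rule tensor_ext[OF vC vA vA lin_hom_comp[OF fm rA] lin_hom_comp[OF rC alg_hom_lin[OF f]] _ t])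
  fix x y assume xy: "x \<in> carrier ?C" "y \<in> carrier A"
  show "rslice A A \<psi> (?fm (tens ?C A x y)) = f (rslice ?C A \<psi> (tens ?C A x y))"
   unfolding fmt[OF xy] id_apply rslice_tens[OF vA vA \<psi>(1) alg_hom_closed[OF f xy(1)] xy(2)]
    rslice_tens[OF vC vA \<psi>(1) xy] alg_hom_smult[OF f xy(1)] ..
 qed
 have inj: "inj_on f (carrier ?C)"
 proof (rule inj_onI)
  fix x y assume xy: "x \<in> carrier ?C" "y \<in> carrier ?C" "f x = f y"
  have t: "tens ?C A x \<one> \<in> carrier (tensor_alg ?C A)" "tens ?C A y \<one> \<in> carrier (tensor_alg ?C A)"
   using xy one vC vA by simp_all
  have fe: "?fm (tens ?C A x \<one>) = ?fm (tens ?C A y \<one>)"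
   unfolding fmt[OF xy(1) one] fmt[OF xy(2) one] xy(3) ..
  have te: "tens ?C A x \<one> = tens ?C A y \<one>"
   by (rule inj_onD[OF bij_betw_imp_inj_on[OF fb] fe t])
  have "x = rslice ?C A \<psi> (tens ?C A x \<one>)" by (rule r1[OF xy(1), symmetric])
  also have "... = y" unfolding te by (rule r1[OF xy(2)])
  finally show "x = y" .
 qed
 have "carrier A \<subseteq> f ` carrier ?C"
 proof
  fix y assume y: "y \<in> carrier A"
  have "tens A A y \<one> \<in> carrier (tensor_alg A A)" using y one vA by simp
  then have "tens A A y \<one> \<in> ?fm ` carrier (tensor_alg ?C A)"
   unfolding bij_betw_imp_surj_on[OF fb] .
  then obtain t where t: "tens A A y \<one> = ?fm t" "t \<in> carrier (tensor_alg ?C A)"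
   by (rule imageE)
  have "y = f (rslice ?C A \<psi> t)" using r2[OF y] r3[OF t(2)] unfolding t(1) by (rule trans[OF sym])
  then show "y \<in> f ` carrier ?C" by (rule image_eqI) (rule lin_hom_closed[OF rC t(2)])
 qed
 moreover have "f ` carrier ?C \<subseteq> carrier A" by (rule image_subsetI) (rule alg_hom_closed[OF f])
 ultimately show ?thesis unfolding bij_betw_def using inj by (simp only: set_eq_subset)
qed

section \<open>Confluent rule systems\<close>

text \<open>
 A scalar version of the diamond lemma: well-founded recursion defines the value at a reducible word by
 some rule, and by confluence any other rule gives the same value.
\<close>

lemma confluent_rules_solution:
 fixes \<mu> :: "'w => nat" and rl :: "'w => (('w => 'k) => 'k) set" and c :: "'w => 'k"
 assumes loc: "\<And>w T h h'. T \<in> rl w ==> (\<And>w'. \<mu> w' < \<mu> w ==> h w' = h' w') ==> T h = T h'"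
  and conf: "\<And>w T T' h. T \<in> rl w ==> T' \<in> rl w ==>
   (\<And>w' T''. \<mu> w' < \<mu> w ==> T'' \<in> rl w' ==> h w' = T'' h) ==> T h = T' h"
 shows "\<exists>h. (\<forall>w. \<forall>T\<in>rl w. h w = T h) \<and> (\<forall>w. rl w = {} --> h w = c w)"
proof -
 define h where "h = wfrec (measure \<mu>) (\<lambda>g w. if rl w = {} then c w else (SOME T. T \<in> rl w) g)"
 have h: "h w = (if rl w = {} then c w else (SOME T. T \<in> rl w) h)" for w
 proof -
  have "h w = (if rl w = {} then c w else (SOME T. T \<in> rl w) (cut h (measure \<mu>) w))"
   unfolding h_def by (subst wfrec) auto
  moreover have "T (cut h (measure \<mu>) w) = T h" if "T \<in> rl w" for T
   by (rule loc[OF that]) (simp add: cut_def)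
  ultimately show ?thesis using some_in_eq by metis
 qed
 have "\<forall>T\<in>rl w. h w = T h" for w
 proof (induction "\<mu> w" arbitrary: w rule: less_induct)
  case less
  show ?case
  proof
   fix T assume T: "T \<in> rl w"
   have S: "(SOME T. T \<in> rl w) \<in> rl w" using someI[of "\<lambda>T. T \<in> rl w", OF T] .
   show "h w = T h"
    using h[of w] conf[OF S T, of h] less T by auto
  qed
 qed
 moreover have "rl w = {} --> h w = c w" for w using h[of w] by simp
 ultimately show ?thesis by blast
qed

text \<open>
 The identity behind every overlap of two rules. Summing \<open>e i * f j * G i j\<close> in the two orders and
 cancelling the part outside row \<open>i0\<close> and column \<open>j0\<close> compares the two expressions for \<open>G i0 j0\<close>.
\<close>

lemma overlap_identity:
 fixes e :: "'i => 'k::field" and f :: "'j => 'k"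
 assumes fin: "finite I" "finite J" and i0: "i0 \<in> I" "e i0 \<noteq> 0" and j0: "j0 \<in> J" "f j0 \<noteq> 0"
  and 1: "\<And>j. j \<in> J ==> j \<noteq> j0 ==> f j \<noteq> 0 ==> (\<Sum>i\<in>I. e i * G i j) = A j"
  and 2: "\<And>i. i \<in> I ==> i \<noteq> i0 ==> e i \<noteq> 0 ==> (\<Sum>j\<in>J. f j * G i j) = B i"
  and 3: "(\<Sum>j\<in>J. f j * A j) = (\<Sum>i\<in>I. e i * B i)"
 shows "(A j0 - (\<Sum>i\<in>I - {i0}. e i * G i j0)) / e i0 = (B i0 - (\<Sum>j\<in>J - {j0}. f j * G i0 j)) / f j0"
proof -
 define X where "X = (\<Sum>i\<in>I - {i0}. \<Sum>j\<in>J - {j0}. e i * f j * G i j)"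
 have a: "f j * A j = f j * e i0 * G i0 j + (\<Sum>i\<in>I - {i0}. e i * f j * G i j)" if "j \<in> J - {j0}" for j
 proof (cases "f j = 0")
  case False
  then have "A j = e i0 * G i0 j + (\<Sum>i\<in>I - {i0}. e i * G i j)"
   using 1[of j] that sum.remove[OF fin(1) i0(1), of "\<lambda>i. e i * G i j"] by simp
  then show ?thesis by (simp add: distrib_left sum_distrib_left mult_ac)
 qed simp
 have b: "e i * B i = e i * f j0 * G i j0 + (\<Sum>j\<in>J - {j0}. e i * f j * G i j)" if "i \<in> I - {i0}" for i
 proof (cases "e i = 0")
  case False
  then have "B i = f j0 * G i j0 + (\<Sum>j\<in>J - {j0}. f j * G i j)"
   using 2[of i] that sum.remove[OF fin(2) j0(1), of "\<lambda>j. f j * G i j"] by simp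
  then show ?thesis by (simp add: distrib_left sum_distrib_left mult_ac)
 qed simp
 have "(\<Sum>j\<in>J. f j * A j) = f j0 * A j0 + (\<Sum>j\<in>J - {j0}. f j * A j)"
  by (rule sum.remove[OF fin(2) j0(1)])
 also have "(\<Sum>j\<in>J - {j0}. f j * A j) = (\<Sum>j\<in>J - {j0}. f j * e i0 * G i0 j) + X"
  unfolding X_def by (subst sum.swap) (simp add: a sum.distrib)
 finally have A': "(\<Sum>j\<in>J. f j * A j) = f j0 * A j0 + ((\<Sum>j\<in>J - {j0}. f j * e i0 * G i0 j) + X)" .
 have "(\<Sum>i\<in>I. e i * B i) = e i0 * B i0 + (\<Sum>i\<in>I - {i0}. e i * B i)"
  by (rule sum.remove[OF fin(1) i0(1)])
 also have "(\<Sum>i\<in>I - {i0}. e i * B i) = (\<Sum>i\<in>I - {i0}. e i * f j0 * G i j0) + X"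
  unfolding X_def by (simp add: b sum.distrib)
 finally have B': "(\<Sum>i\<in>I. e i * B i) = e i0 * B i0 + ((\<Sum>i\<in>I - {i0}. e i * f j0 * G i j0) + X)" .
 have "f j0 * (A j0 - (\<Sum>i\<in>I - {i0}. e i * G i j0)) = f j0 * A j0 - (\<Sum>i\<in>I - {i0}. e i * f j0 * G i j0)"
  by (simp add: right_diff_distrib sum_distrib_left mult_ac)
 moreover have "e i0 * (B i0 - (\<Sum>j\<in>J - {j0}. f j * G i0 j)) = e i0 * B i0 - (\<Sum>j\<in>J - {j0}. f j * e i0 * G i0 j)"
  by (simp add: right_diff_distrib sum_distrib_left mult_ac)
 ultimately have "f j0 * (A j0 - (\<Sum>i\<in>I - {i0}. e i * G i j0)) = e i0 * (B i0 - (\<Sum>j\<in>J - {j0}. f j * G i0 j))"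
  using A' B' 3 by (simp add: algebra_simps)
 then show ?thesis using i0 j0 by (simp add: field_simps)
qed

section \<open>A functional on pairs of words\<close>

text \<open>
 A word in the generators \<open>a\<^sub>k\<^sub>i\<close> is a pair of index words of equal length, indexed by
 \<^const>\<open>True\<close> (row indices) and \<^const>\<open>False\<close> (column indices). The two families of relations then
 have the same form: contracting two neighbouring letters on side \<open>s\<close> with \<open>Q s\<close> removes this
 position from both words, at the cost of the factor given by \<open>C s\<close> at the two letters of the
 other side. If \<open>Q s 0 0 = 0\<close>, each relation can be solved for the word containing \<open>0, l0 s\<close>, which is
 then the largest one in the lexicographic order with \<open>0\<close> largest and \<open>l0 s\<close> second; as
 \<open>l0 s \<noteq> 0\<close>, two rules on the same side overlap only if they coincide.
\<close>

locale word_contraction =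
 fixes d :: "bool => nat" and Q C :: "bool => nat => nat => 'k::field" and l0 :: "bool => nat"
 assumes l0: "l0 s \<noteq> 0" "l0 s < d s" and Q00: "Q s 0 0 = 0" and Ql0: "Q s 0 (l0 s) \<noteq> 0"
  and inv: "inverse_fun (d (\<not> s)) (C s) (Q (\<not> s))"
  and trace: "(\<Sum>i<d False. \<Sum>j<d False. Q False i j * C True i j) = (\<Sum>i<d True. \<Sum>j<d True. Q True i j * C False i j)"
begin

definition ok :: "(bool => nat list) => bool" where
 "ok x \<longleftrightarrow> length (x True) = length (x False) \<and> (\<forall>s. set (x s) \<subseteq> {..<d s})"

definition upd :: "(bool => nat list) => bool => nat => nat \<times> nat => bool => nat list" where
 "upd x s p z = x(s := (x s)[p := fst z, Suc p := snd z])"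

definition del :: "nat => (bool => nat list) => bool => nat list" where
 "del p x = (\<lambda>s. take p (x s) @ drop (Suc (Suc p)) (x s))"

definition lead :: "bool => nat => (bool => nat list) => bool" where
 "lead s p x \<longleftrightarrow> Suc p < length (x s) \<and> x s ! p = 0 \<and> x s ! Suc p = l0 s"

definition coef :: "bool => nat => (bool => nat list) => 'k" where
 "coef s p x = C s (x (\<not> s) ! p) (x (\<not> s) ! Suc p)"

definition sq :: "bool => (nat \<times> nat) set" where
 "sq s = {..<d s} \<times> {..<d s}"

definition qq :: "bool => nat \<times> nat => 'k" where
 "qq s z = Q s (fst z) (snd z)"

definition reduct :: "bool => nat => (bool => nat list) => ((bool => nat list) => 'k) => 'k" where
 "reduct s p x h = (coef s p x * h (del p x) - (\<Sum>z\<in>sq s - {(0, l0 s)}. qq s z * h (upd x s p z))) / qq s (0, l0 s)"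

definition contracts :: "((bool => nat list) => 'k) => bool => nat => (bool => nat list) => bool" where
 "contracts h s p x \<longleftrightarrow> (\<Sum>z\<in>sq s. qq s z * h (upd x s p z)) = coef s p x * h (del p x)"

lemma sq_finite [simp]: "finite (sq s)"
 by (simp add: sq_def)

lemma lead_sq [simp]: "(0, l0 s) \<in> sq s"
 using l0(2)[of s] by (simp add: sq_def)

lemma qq_lead: "qq s (0, l0 s) \<noteq> 0"
 using Ql0 by (simp add: qq_def)

lemma ok_length: "ok x ==> length (x s) = length (x t)"
 by (cases s; cases t) (auto simp: ok_def)

lemma ok_nth: "ok x ==> p < length (x t) ==> x s ! p < d s"
 using ok_length[of x s t] nth_mem[of p "x s"] unfolding ok_def by (metis lessThan_iff subsetD)

lemma upd_length [simp]: "length (upd x s p z t) = length (x t)"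
 by (simp add: upd_def)

lemma ok_upd:
 assumes x: "ok x" and z: "z \<in> sq s"
 shows "ok (upd x s p z)"
proof -
 have "set ((x s)[p := fst z, Suc p := snd z]) \<subseteq> insert (snd z) (insert (fst z) (set (x s)))"
  by (rule order.trans[OF set_update_subset_insert]) (intro insert_mono set_update_subset_insert)
 also have "... \<subseteq> {..<d s}" using x z unfolding ok_def sq_def by (auto dest: subsetD)
 finally have "set (upd x s p z t) \<subseteq> {..<d t}" for t
  using x by (cases "t = s") (simp_all add: upd_def ok_def)
 then show ?thesis using x unfolding ok_def by simp
qed

lemma ok_del: "ok x ==> ok (del p x)"
 unfolding ok_def del_def by (auto dest: in_set_takeD in_set_dropD)

lemma del_length: "Suc p < length (x s) ==> length (del p x s) = length (x s) - 2"
 by (simp add: del_def)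

lemma upd_upd [simp]: "upd (upd x s p z) s p w = upd x s p w"
 by (simp add: upd_def list_update_swap[of "Suc p" p])

lemma upd_commute:
 assumes "s \<noteq> s' \<or> Suc (Suc p) \<le> q \<or> Suc (Suc q) \<le> p"
 shows "upd (upd x s p z) s' q w = upd (upd x s' q w) s p z"
proof (cases "s = s'")
 case True
 then have ne: "p \<noteq> q" "p \<noteq> Suc q" "Suc p \<noteq> q" using assms by auto
 show ?thesis
  using ne True by (simp add: upd_def list_update_swap[of p q] list_update_swap[of p "Suc q"]
   list_update_swap[of "Suc p" q] list_update_swap[of "Suc p" "Suc q"])
next
 case False
 then show ?thesis by (simp add: upd_def fun_upd_twist)
qed

lemma upd_lead:
 assumes "lead s p x"
 shows "upd x s p (0, l0 s) = x"
proof -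
 have "(x s)[p := 0] = x s" "(x s)[Suc p := l0 s] = x s"
  using assms list_update_id[of "x s" p] list_update_id[of "x s" "Suc p"] by (simp_all add: lead_def)
 then show ?thesis by (simp add: upd_def)
qed

lemma lead_upd: "Suc p < length (x s) ==> lead s p (upd x s p (0, l0 s))"
 by (simp add: lead_def upd_def)

lemma lead_upd_other:
 "lead s p x ==> s \<noteq> s' \<or> Suc (Suc p) \<le> q \<or> Suc (Suc q) \<le> p ==> lead s p (upd x s' q z)"
 by (auto simp: lead_def upd_def nth_list_update)

lemma del_upd [simp]: "del p (upd x s p z) = del p x"
 by (auto simp: upd_def del_def fun_eq_iff)

lemma coef_upd [simp]: "coef s p (upd x s p z) = coef s p x"
 by (simp add: upd_def coef_def)

lemma contracts_iff:
 assumes "Suc p < length (x s)"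
 shows "contracts h s p x \<longleftrightarrow> h (upd x s p (0, l0 s)) = reduct s p (upd x s p (0, l0 s)) h"
proof -
 have "(\<Sum>z\<in>sq s. qq s z * h (upd x s p z)) = qq s (0, l0 s) * h (upd x s p (0, l0 s)) +
   (\<Sum>z\<in>sq s - {(0, l0 s)}. qq s z * h (upd x s p z))"
  by (rule sum.remove) auto
 then show ?thesis
  unfolding contracts_def reduct_def using qq_lead[of s] by (auto simp: field_simps)
qed

text \<open>
 Words are read as numbers in base 3 with digit 2 for \<open>0\<close> and 1 for \<open>l0 s\<close>, which realizes the
 lexicographic order by natural numbers.
\<close>

definition wt :: "bool => nat => nat" where
 "wt s k = (if k = 0 then 2 else if k = l0 s then 1 else 0)"

primrec val :: "bool => nat list => nat" where
 "val s [] = 0"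
| "val s (k # ks) = wt s k * 3 ^ length ks + val s ks"

lemma val_append: "val s (xs @ ys) = val s xs * 3 ^ length ys + val s ys"
 by (induction xs) (simp_all add: power_add algebra_simps)

lemma val_bound: "val s xs < 3 ^ length xs"
proof (induction xs)
 case (Cons k ks)
 have "wt s k * 3 ^ length ks \<le> 2 * 3 ^ length ks" by (simp add: wt_def)
 then show ?case using Cons unfolding val.simps length_Cons power_Suc by linarith
qed simp

lemma split_pair:
 assumes "Suc p < length xs"
 obtains us a b vs where "xs = us @ a # b # vs" "p = length us"
proof -
 have "xs = take p xs @ xs ! p # xs ! Suc p # drop (Suc (Suc p)) xs"
  using assms by (simp add: Cons_nth_drop_Suc)
 moreover have "p = length (take p xs)" using assms by simp
 ultimately show thesis by (rule that)
qed

text \<open>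
 The first summand makes every shorter word smaller, whatever its letters are.
\<close>

definition size_of :: "(bool => nat list) => nat" where
 "size_of x = 2 * 3 ^ length (x True) + val True (x True) + val False (x False)"

lemma size_of_side: "size_of x = 2 * 3 ^ length (x True) + val s (x s) + val (\<not> s) (x (\<not> s))"
 by (cases s) (simp_all add: size_of_def)

lemma size_upd:
 assumes x: "lead s p x" and z: "z \<noteq> (0, l0 s)" "qq s z \<noteq> 0"
 shows "size_of (upd x s p z) < size_of x"
proof -
 have p: "Suc p < length (x s)" using x by (simp add: lead_def)
 have n1: "snd z \<noteq> 0" if "fst z = 0"
 proof
  assume "snd z = 0"
  then have "qq s z = Q s 0 0" unfolding qq_def that by simp
  then show False using z(2) unfolding Q00 by blast
 qed
 have n2: "snd z \<noteq> l0 s" if "fst z = 0"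
  using z(1) that by (metis prod.collapse)
 have w: "wt s (fst z) * 3 + wt s (snd z) < 7" unfolding wt_def using n1 n2 by simp
 have w0: "wt s (x s ! p) * 3 + wt s (x s ! Suc p) = 7" using x l0[of s] by (simp add: lead_def wt_def)
 obtain us a b vs where d: "x s = us @ a # b # vs" "p = length us" using split_pair[OF p] .
 have w7: "wt s a * 3 + wt s b = 7" using w0 by (simp add: d nth_append)
 have "val s (x s) = val s us * 3 ^ Suc (Suc (length vs)) + ((wt s a * 3 + wt s b) * 3 ^ length vs + val s vs)"
  unfolding d(1) val_append by (simp add: distrib_right)
 then have v0: "val s (x s) = val s us * 3 ^ Suc (Suc (length vs)) + (7 * 3 ^ length vs + val s vs)"
  unfolding w7 .
 have v1: "val s (upd x s p z s) = val s us * 3 ^ Suc (Suc (length vs)) +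
   ((wt s (fst z) * 3 + wt s (snd z)) * 3 ^ length vs + val s vs)"
  unfolding upd_def fun_upd_same d by (simp add: list_update_append val_append distrib_right)
 have "(wt s (fst z) * 3 + wt s (snd z)) * 3 ^ length vs < 7 * 3 ^ length vs" using w by simp
 then have "val s (upd x s p z s) < val s (x s)" unfolding v0 v1 by linarith
 moreover have "upd x s p z (\<not> s) = x (\<not> s)" by (simp add: upd_def)
 ultimately show ?thesis unfolding size_of_side[of _ s] by simp
qed

lemma size_shorter:
 assumes "ok x" "ok y" "length (x s) = Suc (Suc (length (y s)))"
 shows "size_of y < size_of x"
proof -
 have l: "length (x True) = Suc (Suc (length (y True)))" "length (y False) = length (y True)"
  using assms ok_length by metis+
 have "size_of y < 2 * 3 ^ length (y True) + 3 ^ length (y True) + 3 ^ length (y True)"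
  unfolding size_of_def using val_bound[of True "y True"] val_bound[of False "y False"] l by simp
 also have "... \<le> 2 * 3 ^ length (x True)" by (simp add: l)
 also have "... \<le> size_of x" by (simp add: size_of_def)
 finally show ?thesis .
qed

definition rules :: "(bool => nat list) => (((bool => nat list) => 'k) => 'k) set" where
 "rules x = {reduct s p x | s p. ok x \<and> lead s p x}"

lemma reduct_local:
 assumes x: "ok x" "lead s p x" and eq: "\<And>y. size_of y < size_of x ==> h y = h' y"
 shows "reduct s p x h = reduct s p x h'"
proof -
 have "Suc p < length (x s)" using x by (simp add: lead_def)
 then have "h (del p x) = h' (del p x)"
  by (intro eq size_shorter[of _ _ s] x ok_del) (simp add: del_length)
 moreover have "(\<Sum>z\<in>sq s - {(0, l0 s)}. qq s z * h (upd x s p z)) = (\<Sum>z\<in>sq s - {(0, l0 s)}. qq s z * h' (upd x s p z))"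
 proof (rule sum.cong[OF refl])
  fix z assume "z \<in> sq s - {(0, l0 s)}"
  then show "qq s z * h (upd x s p z) = qq s z * h' (upd x s p z)"
   using eq[OF size_upd[OF x(2), of z]] by (cases "qq s z = 0") auto
 qed
 ultimately show ?thesis by (simp add: reduct_def)
qed

context
 fixes x h
 assumes x: "ok x" and rl: "\<And>y T. size_of y < size_of x ==> T \<in> rules y ==> h y = T h"
begin

lemma contracts_smaller:
 assumes y: "ok y" "Suc p < length (y s)" and lt: "size_of (upd y s p (0, l0 s)) < size_of x"
 shows "contracts h s p y"
 unfolding contracts_iff[of p y s, OF y(2)]
proof (rule rl[OF lt])
 have "lead s p (upd y s p (0, l0 s))" "ok (upd y s p (0, l0 s))"
  by (rule lead_upd[of p y s, OF y(2)], rule ok_upd[OF y(1) lead_sq])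
 then show "reduct s p (upd y s p (0, l0 s)) \<in> rules (upd y s p (0, l0 s))"
  unfolding rules_def by blast
qed

lemma contracts_shorter:
 assumes y: "ok y" "Suc p < length (y s)" and l: "length (x t) = Suc (Suc (length (y t)))"
 shows "contracts h s p y"
 by (rule contracts_smaller[OF y size_shorter[OF x, of _ t]]) (use y l ok_upd in auto)

text \<open>
 Contracting at \<open>(s, p)\<close> and then at \<open>(s', q)\<close> gives the same value as in the other order. This is the
 third hypothesis of \<open>overlap_identity\<close>.
\<close>

definition consistent :: "bool => nat => bool => nat => bool" where
 "consistent s p s' q \<longleftrightarrow> (\<Sum>w\<in>sq s'. qq s' w * (coef s p (upd x s' q w) * h (del p (upd x s' q w)))) =
   (\<Sum>z\<in>sq s. qq s z * (coef s' q (upd x s p z) * h (del q (upd x s p z))))"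

lemma consistent_sym: "consistent s p s' q ==> consistent s' q s p"
 by (simp add: consistent_def)

lemma far_positions:
 assumes "Suc (Suc p) \<le> q" "Suc q < length xs"
 shows "take p (xs[q := c, Suc q := e]) @ drop (Suc (Suc p)) (xs[q := c, Suc q := e]) =
   (take p xs @ drop (Suc (Suc p)) xs)[q - 2 := c, Suc (q - 2) := e]"
  and "take q (xs[p := c, Suc p := e]) @ drop (Suc (Suc q)) (xs[p := c, Suc p := e]) =
   (take q xs @ drop (Suc (Suc q)) xs)[p := c, Suc p := e]"
  and "(take p xs @ drop (Suc (Suc p)) xs) ! (q - 2) = xs ! q"
  and "(take p xs @ drop (Suc (Suc p)) xs) ! Suc (q - 2) = xs ! Suc q"
  and "(take q xs @ drop (Suc (Suc q)) xs) ! p = xs ! p"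
  and "(take q xs @ drop (Suc (Suc q)) xs) ! Suc p = xs ! Suc p"
  and "take (q - 2) (take p xs @ drop (Suc (Suc p)) xs) @ drop (Suc (Suc (q - 2))) (take p xs @ drop (Suc (Suc p)) xs) =
   take p (take q xs @ drop (Suc (Suc q)) xs) @ drop (Suc (Suc p)) (take q xs @ drop (Suc (Suc q)) xs)"
proof -
 have lp: "Suc p < length xs" using assms by simp
 obtain us a b rs where 1: "xs = us @ a # b # rs" "p = length us" using split_pair[OF lp] .
 have lq: "Suc (q - 2 - p) < length rs" using assms 1 by simp
 obtain ws c' e' vs where 2: "rs = ws @ c' # e' # vs" "q - 2 - p = length ws" using split_pair[OF lq] .
 have q: "q = Suc (Suc (length us + length ws))" using 2 1 assms by simp
 show "take p (xs[q := c, Suc q := e]) @ drop (Suc (Suc p)) (xs[q := c, Suc q := e]) =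
   (take p xs @ drop (Suc (Suc p)) xs)[q - 2 := c, Suc (q - 2) := e]"
  "take q (xs[p := c, Suc p := e]) @ drop (Suc (Suc q)) (xs[p := c, Suc p := e]) =
   (take q xs @ drop (Suc (Suc q)) xs)[p := c, Suc p := e]"
  "(take p xs @ drop (Suc (Suc p)) xs) ! (q - 2) = xs ! q"
  "(take p xs @ drop (Suc (Suc p)) xs) ! Suc (q - 2) = xs ! Suc q"
  "(take q xs @ drop (Suc (Suc q)) xs) ! p = xs ! p"
  "(take q xs @ drop (Suc (Suc q)) xs) ! Suc p = xs ! Suc p"
  "take (q - 2) (take p xs @ drop (Suc (Suc p)) xs) @ drop (Suc (Suc (q - 2))) (take p xs @ drop (Suc (Suc p)) xs) =
   take p (take q xs @ drop (Suc (Suc q)) xs) @ drop (Suc (Suc p)) (take q xs @ drop (Suc (Suc q)) xs)"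
  unfolding q 1(1,2) 2(1) by (simp_all add: list_update_append nth_append numeral_eq_Suc)
qed

text \<open>
 Contractions at disjoint positions commute.
\<close>

lemma consistent_far:
 assumes pq: "Suc (Suc p) \<le> q" "Suc q < length (x s)"
 shows "consistent s p s' q"
proof -
 have len: "Suc q < length (x t)" for t using pq(2) ok_length[OF x] by metis
 have A: "coef s p (upd x s' q w) = coef s p x" "del p (upd x s' q w) = upd (del p x) s' (q - 2) w" for w
  using pq len far_positions(1)[OF pq(1) len[of s']] by (auto simp: coef_def upd_def del_def nth_list_update fun_eq_iff)
 have B: "coef s' q (upd x s p z) = coef s' q x" "del q (upd x s p z) = upd (del q x) s p z" for z
  using pq len far_positions(2)[OF pq(1) len[of s]] by (auto simp: coef_def upd_def del_def nth_list_update fun_eq_iff)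
 have C: "coef s' (q - 2) (del p x) = coef s' q x" "coef s p (del q x) = coef s p x"
  "del (q - 2) (del p x) = del p (del q x)"
  using far_positions(3-7)[OF pq(1) len] by (simp_all add: coef_def del_def fun_eq_iff)
 have l: "length (x t) = Suc (Suc (length (del p x t)))" "length (x t) = Suc (Suc (length (del q x t)))" for t
  using pq len[of t] by (simp_all add: del_length)
 have 1: "contracts h s' (q - 2) (del p x)"
  by (rule contracts_shorter[OF ok_del[OF x] _ l(1)[of True]]) (use l(1)[of s'] pq len[of s'] in simp)
 have 2: "contracts h s p (del q x)"
  by (rule contracts_shorter[OF ok_del[OF x] _ l(2)[of True]]) (use l(2)[of s] pq len[of s] in simp)
 have "(\<Sum>w\<in>sq s'. qq s' w * (coef s p (upd x s' q w) * h (del p (upd x s' q w)))) =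
  coef s p x * (\<Sum>w\<in>sq s'. qq s' w * h (upd (del p x) s' (q - 2) w))"
  by (simp add: A sum_distrib_left mult_ac)
 also have "... = coef s p x * (coef s' q x * h (del p (del q x)))"
  using 1 by (simp add: contracts_def C)
 also have "... = coef s' q x * (coef s p x * h (del p (del q x)))" by simp
 also have "... = coef s' q x * (\<Sum>z\<in>sq s. qq s z * h (upd (del q x) s p z))"
  using 2 by (simp add: contracts_def C)
 also have "... = (\<Sum>z\<in>sq s. qq s z * (coef s' q (upd x s p z) * h (del q (upd x s p z))))"
  by (simp add: B sum_distrib_left mult_ac)
 finally show ?thesis unfolding consistent_def .
qed

text \<open>
 At the same position on the two sides both orders remove the same letters, and the scalars that remain
 are the two sides of the trace condition.
\<close>

lemma consistent_same:
 assumes p: "Suc p < length (x s)"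
 shows "consistent s p (\<not> s) p"
proof -
 have len: "Suc p < length (x t)" for t using p ok_length[OF x] by metis
 have A: "coef t p (upd x (\<not> t) p w) = C t (fst w) (snd w)" for t w
  using len[of "\<not> t"] by (simp add: coef_def upd_def)
 have t: "(\<Sum>w\<in>sq (\<not> t). qq (\<not> t) w * C t (fst w) (snd w)) = (\<Sum>z\<in>sq t. qq t z * C (\<not> t) (fst z) (snd z))" for t
  using trace by (cases t) (simp_all add: sq_def qq_def sum.cartesian_product split_beta)
 have "(\<Sum>w\<in>sq (\<not> s). qq (\<not> s) w * (coef s p (upd x (\<not> s) p w) * h (del p (upd x (\<not> s) p w)))) =
   (\<Sum>w\<in>sq (\<not> s). qq (\<not> s) w * C s (fst w) (snd w)) * h (del p x)"
  by (simp add: A sum_distrib_right sum_distrib_left mult_ac)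
 also have "... = (\<Sum>z\<in>sq s. qq s z * (coef (\<not> s) p (upd x s p z) * h (del p (upd x s p z))))"
  unfolding t using A[of "\<not> s"] by (simp add: sum_distrib_right sum_distrib_left mult_ac)
 finally show ?thesis unfolding consistent_def .
qed

text \<open>
 At positions shifted by one on opposite sides, \<open>Q\<close> on one side meets its inverse \<open>C\<close> on the other side
 in one index, so both orders leave the same pair of words.
\<close>

lemma consistent_near:
 assumes p: "Suc (Suc p) < length (x s)"
 shows "consistent s p (\<not> s) (Suc p)"
proof -
 have len: "Suc (Suc p) < length (x t)" for t using p ok_length[OF x] by metis
 have dec: "\<exists>us a b c vs. xs = us @ a # b # c # vs \<and> p = length us" if l: "Suc (Suc p) < length xs" for xs :: "nat list"
 proof -
  have lp: "Suc p < length xs" using l by simp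
  obtain us a b vs where d: "xs = us @ a # b # vs" "p = length us" using split_pair[OF lp] .
  then obtain c vs' where "vs = c # vs'" using l by (cases vs) auto
  then show ?thesis using d by blast
 qed
 obtain us a b c vs where X: "x (\<not> s) = us @ a # b # c # vs" "p = length us" using dec[OF len] by blast
 obtain us2 a2 b2 c2 vs2 where Y: "x s = us2 @ a2 # b2 # c2 # vs2" "p = length us2" using dec[OF len] by blast
 have ac: "a < d (\<not> s)" "c2 < d s"
  using ok_nth[OF x, of p s "\<not> s"] ok_nth[OF x, of "Suc (Suc p)" s s] X Y len by (simp_all add: nth_append)
 define W where "W j k = (\<lambda>t. if t = s then us2 @ k # vs2 else us @ j # vs)" for j k
 have A: "coef s p (upd x (\<not> s) (Suc p) w) = C s a (fst w)" for w
  by (simp add: coef_def upd_def X nth_append list_update_append)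
 have B: "coef (\<not> s) (Suc p) (upd x s p z) = C (\<not> s) (snd z) c2" for z
  unfolding coef_def upd_def by (simp add: Y nth_append list_update_append)
 have D: "del p (upd x (\<not> s) (Suc p) w) = W (snd w) c2" for w
 proof
  fix t show "del p (upd x (\<not> s) (Suc p) w) t = W (snd w) c2 t"
  proof (cases "t = s")
   case True
   then show ?thesis by (simp add: del_def upd_def W_def Y)
  next
   case False
   then have "t = (\<not> s)" by auto
   then show ?thesis by (simp add: del_def upd_def W_def X list_update_append)
  qed
 qed
 have F: "del (Suc p) (upd x s p z) = W a (fst z)" for z
 proof
  fix t show "del (Suc p) (upd x s p z) t = W a (fst z) t"
  proof (cases "t = s")
   case True
   then show ?thesis by (simp add: del_def upd_def W_def Y list_update_append)
  next
   case False
   then have "t = (\<not> s)" by auto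
   then show ?thesis by (simp add: del_def upd_def W_def X)
  qed
 qed
 have "(\<Sum>w\<in>sq (\<not> s). qq (\<not> s) w * (coef s p (upd x (\<not> s) (Suc p) w) * h (del p (upd x (\<not> s) (Suc p) w)))) =
  (\<Sum>i<d (\<not> s). \<Sum>j<d (\<not> s). Q (\<not> s) i j * (C s a i * h (W j c2)))"
  by (simp add: A D sq_def qq_def sum.cartesian_product split_beta)
 also have "... = (\<Sum>j<d (\<not> s). \<Sum>i<d (\<not> s). Q (\<not> s) i j * (C s a i * h (W j c2)))" by (rule sum.swap)
 also have "... = (\<Sum>j<d (\<not> s). of_bool (a = j) * h (W j c2))"
 proof (rule sum.cong[OF refl])
  fix j assume j: "j \<in> {..<d (\<not> s)}"
  have "(\<Sum>i<d (\<not> s). Q (\<not> s) i j * (C s a i * h (W j c2))) = (\<Sum>i<d (\<not> s). C s a i * Q (\<not> s) i j) * h (W j c2)"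
   unfolding sum_distrib_right by (intro sum.cong refl) (simp add: mult_ac)
  then show "(\<Sum>i<d (\<not> s). Q (\<not> s) i j * (C s a i * h (W j c2))) = of_bool (a = j) * h (W j c2)"
   using inverse_funD(1)[OF inv ac(1), of j] j by simp
 qed
 also have "... = h (W a c2)" using ac by simp
 also have "... = (\<Sum>k<d s. of_bool (k = c2) * h (W a k))" using ac by simp
 also have "... = (\<Sum>k<d s. \<Sum>l<d s. Q s k l * (C (\<not> s) l c2 * h (W a k)))"
 proof (rule sum.cong[OF refl])
  fix k assume k: "k \<in> {..<d s}"
  have "(\<Sum>l<d s. Q s k l * (C (\<not> s) l c2 * h (W a k))) = (\<Sum>l<d s. Q s k l * C (\<not> s) l c2) * h (W a k)"
   unfolding sum_distrib_right by (intro sum.cong refl) (simp add: mult_ac)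
  then show "of_bool (k = c2) * h (W a k) = (\<Sum>l<d s. Q s k l * (C (\<not> s) l c2 * h (W a k)))"
   using inverse_funD(2)[OF inv[of "\<not> s"], of k c2] ac k by simp
 qed
 also have "... = (\<Sum>z\<in>sq s. qq s z * (coef (\<not> s) (Suc p) (upd x s p z) * h (del (Suc p) (upd x s p z))))"
  by (simp add: B F sq_def qq_def sum.cartesian_product split_beta)
 finally show ?thesis unfolding consistent_def .
qed

text \<open>
 Leading pairs on the same side cannot share a letter, because \<open>0\<close> and \<open>l0 s\<close> differ.
\<close>

lemma consistent_leads:
 assumes l: "lead s p x" "lead s' q x" and ne: "(s, p) \<noteq> (s', q)"
 shows "(s \<noteq> s' \<or> Suc (Suc p) \<le> q \<or> Suc (Suc q) \<le> p) \<and> consistent s p s' q"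
proof -
 have len: "Suc p < length (x t)" "Suc q < length (x t)" for t
  using l ok_length[OF x] by (metis lead_def)+
 consider "Suc (Suc p) \<le> q" | "Suc (Suc q) \<le> p" | "p = q" | "q = Suc p" | "p = Suc q" by linarith
 then show ?thesis
 proof cases
  case 1
  then show ?thesis using consistent_far[OF 1 len(2)] by simp
 next
  case 2
  then show ?thesis using consistent_sym[OF consistent_far[OF 2 len(1)]] by simp
 next
  case 3
  then have "s' = (\<not> s)" using ne by auto
  then show ?thesis using consistent_same[OF len(1)] 3 by auto
 next
  case 4
  have "s' = (\<not> s)" using l 4 l0(1)[of s] by (cases "s' = s") (auto simp: lead_def)
  then show ?thesis using consistent_near[of p s] len(2)[of s] 4 by auto
 next
  case 5
  have s: "s = (\<not> s')" using l 5 l0(1)[of s] by (cases "s' = s") (auto simp: lead_def)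
  then show ?thesis using consistent_sym[OF consistent_near[of q s']] len(1)[of s'] 5 by auto
 qed
qed

lemma reducts_agree:
 assumes l: "lead s p x" "lead s' q x"
 shows "reduct s p x h = reduct s' q x h"
proof (cases "(s, p) = (s', q)")
 case False
 note c = consistent_leads[OF l False]
 then have far: "s \<noteq> s' \<or> Suc (Suc p) \<le> q \<or> Suc (Suc q) \<le> p" by blast
 then have far': "s' \<noteq> s \<or> Suc (Suc q) \<le> p \<or> Suc (Suc p) \<le> q" by blast
 have len: "Suc p < length (x s)" "Suc q < length (x s')" using l by (auto simp: lead_def)
 define G where "G z w = h (upd (upd x s p z) s' q w)" for z w
 define A where "A w = coef s p (upd x s' q w) * h (del p (upd x s' q w))" for w
 define B where "B z = coef s' q (upd x s p z) * h (del q (upd x s p z))" for z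
 have "(A (0, l0 s') - (\<Sum>z\<in>sq s - {(0, l0 s)}. qq s z * G z (0, l0 s'))) / qq s (0, l0 s) =
  (B (0, l0 s) - (\<Sum>w\<in>sq s' - {(0, l0 s')}. qq s' w * G (0, l0 s) w)) / qq s' (0, l0 s')"
 proof (rule overlap_identity)
  fix w assume w: "w \<in> sq s'" "w \<noteq> (0, l0 s')" "qq s' w \<noteq> 0"
  have le: "lead s p (upd x s' q w)" by (rule lead_upd_other[OF l(1) far])
  have "contracts h s p (upd x s' q w)"
   by (rule contracts_smaller[OF ok_upd[OF x w(1)]])
    (use len in simp, unfold upd_lead[OF le], rule size_upd[OF l(2) w(2,3)])
  then show "(\<Sum>z\<in>sq s. qq s z * G z w) = A w"
   unfolding contracts_def G_def A_def upd_commute[OF far] .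
 next
  fix z assume z: "z \<in> sq s" "z \<noteq> (0, l0 s)" "qq s z \<noteq> 0"
  have le: "lead s' q (upd x s p z)" by (rule lead_upd_other[OF l(2) far'])
  have "contracts h s' q (upd x s p z)"
   by (rule contracts_smaller[OF ok_upd[OF x z(1)]])
    (use len in simp, unfold upd_lead[OF le], rule size_upd[OF l(1) z(2,3)])
  then show "(\<Sum>w\<in>sq s'. qq s' w * G z w) = B z"
   unfolding contracts_def G_def B_def .
 next
  show "(\<Sum>w\<in>sq s'. qq s' w * A w) = (\<Sum>z\<in>sq s. qq s z * B z)"
   using conjunct2[OF c] unfolding consistent_def A_def B_def .
 qed (auto simp: qq_lead)
 then show ?thesis
  unfolding reduct_def A_def B_def G_def upd_lead[OF l(1)] upd_lead[OF l(2)]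
   upd_commute[OF far, of _ _ "(0, l0 s')"] upd_lead[OF l(2)] .
qed auto

end

theorem contraction_functional_exists:
 "\<exists>h. h (\<lambda>_. []) = 1 \<and> (\<forall>s p x. ok x --> Suc p < length (x s) -->
   (\<Sum>k<d s. \<Sum>l<d s. Q s k l * h (upd x s p (k, l))) = coef s p x * h (del p x))"
proof -
 have "\<exists>h. (\<forall>w. \<forall>T\<in>rules w. h w = T h) \<and> (\<forall>w. rules w = {} --> h w = (\<lambda>_. 1) w)"
 proof (rule confluent_rules_solution[where \<mu> = size_of])
  fix w T and h h' :: "(bool => nat list) => 'k" assume "T \<in> rules w" "\<And>w'. size_of w' < size_of w ==> h w' = h' w'"
  then show "T h = T h'" unfolding rules_def by (elim CollectE exE conjE) (simp only:, rule reduct_local)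
 next
  fix w T T' and h :: "(bool => nat list) => 'k" assume T: "T \<in> rules w" "T' \<in> rules w"
   and r: "\<And>w' T''. size_of w' < size_of w ==> T'' \<in> rules w' ==> h w' = T'' h"
  obtain s p s' q where *: "T = reduct s p w" "T' = reduct s' q w" "ok w" "lead s p w" "lead s' q w"
   using T unfolding rules_def by blast
  show "T h = T' h" unfolding *(1,2) by (rule reducts_agree[where h = h and x = w]) (rule *(3) *(4) *(5) | rule r, assumption, assumption)+
 qed
 then obtain h where h: "\<And>w T. T \<in> rules w ==> h w = T h" "\<And>w. rules w = {} ==> h w = 1" by blast
 have "contracts h s p x" if "ok x" "Suc p < length (x s)" for s p x
  unfolding contracts_iff[of p x s, OF that(2)]
  by (rule h(1)) (use lead_upd[of p x s, OF that(2)] ok_upd[OF that(1) lead_sq] in \<open>unfold rules_def, blast\<close>)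
 then have "(\<Sum>k<d s. \<Sum>l<d s. Q s k l * h (upd x s p (k, l))) = coef s p x * h (del p x)"
  if "ok x" "Suc p < length (x s)" for s p x
  using that unfolding contracts_def by (simp add: sq_def qq_def sum.cartesian_product split_beta)
 moreover have "h (\<lambda>_. []) = 1" by (rule h(2)) (auto simp: rules_def lead_def)
 ultimately show ?thesis by blast
qed

end

section \<open>Nonvanishing of \<open>\<B>(E,F)\<close>\<close>

text \<open>
 In the normalized situation the functional of the previous section, read on words in the
 generators, vanishes on the two-sided ideal generated by the relations but not at \<open>1\<close>. The
 quotient by the largest ideal in its kernel is a nonzero algebra with a solution.
\<close>

lemma normalized_nonzero_algebra:
 fixes E E' F F' :: "nat => nat => 'k::field"
 assumes mn: "0 < m" "0 < n" and E: "inverse_fun m E E'" and F: "inverse_fun n F F'"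
  and E0: "E 0 0 = 0" and F0: "F' 0 0 = 0"
  and tr: "(\<Sum>i<n. \<Sum>j<n. F' i j * F i j) = (\<Sum>k<m. \<Sum>l<m. E k l * E' k l)"
 shows "\<exists>(A :: ('k, 'k bpoly set) module) a. k_algebra A \<and> \<one>\<^bsub>A\<^esub> \<noteq> \<zero>\<^bsub>A\<^esub> \<and> BR A m n E E' F F' a"
proof -
 have ex: "\<exists>l<r. Y 0 l \<noteq> 0" if "0 < r" "inverse_fun r Y Y'" for r and Y Y' :: "nat => nat => 'k"
 proof (rule ccontr)
  assume "\<not> (\<exists>l<r. Y 0 l \<noteq> 0)"
  then have "(\<Sum>k<r. Y 0 k * Y' k 0) = 0" by simp
  then show False using inverse_funD(1)[OF that(2,1,1)] by simp
 qed
 obtain l1 where l1: "l1 < m" "E 0 l1 \<noteq> 0" using ex[OF mn(1) E] by blast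
 obtain l2 where l2: "l2 < n" "F' 0 l2 \<noteq> 0" using ex[OF mn(2) inverse_fun_sym[OF F]] by blast
 define d where "d s = (if s then m else n)" for s
 define Q where "Q s = (if s then E else F')" for s
 define C where "C s = (if s then F else E')" for s
 define l0 where "l0 s = (if s then l1 else l2)" for s
 interpret word_contraction d Q C l0
 proof
  fix s
  show "l0 s \<noteq> 0" "l0 s < d s" "Q s 0 0 = 0" "Q s 0 (l0 s) \<noteq> 0"
   using l1 l2 E0 F0 by (auto simp: l0_def d_def Q_def intro!: gr0I)
  show "inverse_fun (d (\<not> s)) (C s) (Q (\<not> s))"
   using F inverse_fun_sym[OF E] by (simp add: d_def C_def Q_def)
  show "(\<Sum>i<d False. \<Sum>j<d False. Q False i j * C True i j) = (\<Sum>i<d True. \<Sum>j<d True. Q True i j * C False i j)"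
   using tr by (simp add: d_def Q_def C_def)
 qed
 obtain h where h1: "h (\<lambda>_. []) = 1" and h: "\<And>s p x. ok x ==> Suc p < length (x s) ==>
   (\<Sum>k<d s. \<Sum>l<d s. Q s k l * h (upd x s p (k, l))) = coef s p x * h (del p x)"
  using contraction_functional_exists by blast
 define sd where "sd ls = (\<lambda>s. map (if s then fst else snd) ls :: nat list)" for ls :: "(nat \<times> nat) list"
 define Hw where "Hw w = h (sd (letters w))" for w
 define S where "S = {..<m} \<times> {..<n}"
 define W where "W = {w. set (letters w) \<subseteq> S}"
 define FA where "FA = (free_alg S :: ('k, 'k bpoly) module)"
 have kFA: "k_algebra FA" by (simp add: FA_def)
 have ok_sd: "ok (sd ls)" if "set ls \<subseteq> S" for ls
  using that by (auto simp: ok_def sd_def S_def d_def)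
 have rel1: "(\<Sum>k<m. \<Sum>l<m. E k l * h (sd (us @ [(k, i), (l, j)] @ vs))) = F i j * h (sd (us @ vs))"
  if "set us \<subseteq> S" "set vs \<subseteq> S" "i < n" "j < n" for us vs i j
 proof -
  let ?x = "sd (us @ [(0, i), (0, j)] @ vs)"
  have "ok ?x" using that mn by (intro ok_sd) (auto simp: S_def)
  moreover have "Suc (length us) < length (?x True)" by (simp add: sd_def)
  moreover have "upd ?x True (length us) (k, l) = sd (us @ [(k, i), (l, j)] @ vs)" for k l
   by (auto simp: upd_def sd_def fun_eq_iff list_update_append)
  moreover have "coef True (length us) ?x = F i j" by (simp add: coef_def sd_def C_def nth_append)
  moreover have "del (length us) ?x = sd (us @ vs)" by (simp add: del_def sd_def fun_eq_iff)
  ultimately show ?thesis using h[of ?x "length us" True] by (simp add: d_def Q_def)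
 qed
 have rel2: "(\<Sum>i<n. \<Sum>j<n. F' i j * h (sd (us @ [(k, i), (l, j)] @ vs))) = E' k l * h (sd (us @ vs))"
  if "set us \<subseteq> S" "set vs \<subseteq> S" "k < m" "l < m" for us vs k l
 proof -
  let ?x = "sd (us @ [(k, 0), (l, 0)] @ vs)"
  have "ok ?x" using that mn by (intro ok_sd) (auto simp: S_def)
  moreover have "Suc (length us) < length (?x False)" by (simp add: sd_def)
  moreover have "upd ?x False (length us) (i, j) = sd (us @ [(k, i), (l, j)] @ vs)" for i j
   by (auto simp: upd_def sd_def fun_eq_iff list_update_append)
  moreover have "coef False (length us) ?x = E' k l" by (simp add: coef_def sd_def C_def nth_append)
  moreover have "del (length us) ?x = sd (us @ vs)" by (simp add: del_def sd_def fun_eq_iff)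
  ultimately show ?thesis using h[of ?x "length us" False] by (simp add: d_def Q_def)
 qed
 define \<Lambda> where "\<Lambda> = lin_ext (scalar_alg :: ('k, 'k) module) Hw"
 have \<Lambda>l: "\<Lambda> \<in> lin_hom (free_space W) scalar_alg"
  unfolding \<Lambda>_def by (rule lin_ext_lin_hom) (simp_all add: k_algebra_kspace)
 have \<Lambda>: "\<Lambda> \<in> dual FA"
  by (rule dualI; insert lin_hom_add[OF \<Lambda>l] lin_hom_smult[OF \<Lambda>l]; simp add: FA_def W_def)
 have \<Lambda>s: "\<Lambda> (single w c) = c * Hw w" for w c
  unfolding \<Lambda>_def using lin_ext_single[of scalar_alg Hw w c] by (simp add: k_algebra_kspace)
 let ?s = "\<lambda>w. single w (1::'k)"
 define M where "M u v p = \<Lambda> (?s u * p * ?s v)" for u v p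
 have sF: "single w c \<in> carrier FA" if "w \<in> W" for w and c :: 'k
  using that by (simp add: FA_def W_def)
 have M: "M u v \<in> dual FA" if "u \<in> W" "v \<in> W" for u v
 proof -
  have "(\<lambda>p. \<Lambda> (?s u \<otimes>\<^bsub>FA\<^esub> p \<otimes>\<^bsub>FA\<^esub> ?s v)) \<in> dual FA"
   by (rule dual_comp[OF lin_hom_comp[OF lin_hom_mult_left[OF kFA sF[OF that(1)]] lin_hom_mult_right[OF kFA sF[OF that(2)]]] \<Lambda>])
  then show ?thesis unfolding M_def[abs_def] by (simp add: FA_def)
 qed
 define Z where "Z = {p \<in> carrier FA. \<forall>u\<in>W. \<forall>v\<in>W. M u v p = 0}"
 have kvFA: "kspace FA" using kFA by simp
 have Zsub: "ksubspace Z FA"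
  unfolding ksubspace_def Z_def using kvFA by (auto simp: dual_zero[OF kvFA M] dual_add[OF M] dual_smult[OF M])
 have Wadd: "u + v \<in> W" if "u \<in> W" "v \<in> W" for u v
  using that by (auto simp: W_def plus_word_def)
 have Zl: "q * z \<in> Z" and Zr: "z * q \<in> Z" if z: "z \<in> Z" and q: "q \<in> carrier FA" for q z
 proof -
  have zc: "z \<in> carrier FA" using z by (simp add: Z_def)
  have qW: "Poly_Mapping.keys q \<subseteq> W" using q by (simp add: FA_def W_def)
  note mF = k_algebra_mult[OF kFA]
  have mult: "x \<otimes>\<^bsub>FA\<^esub> y = x * y" "x \<oplus>\<^bsub>FA\<^esub> y = x + y" for x y by (simp_all add: FA_def)
  have pF: "p \<in> carrier FA" if "Poly_Mapping.keys p \<subseteq> W" for p :: "'k bpoly" using that by (simp add: FA_def W_def)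
  have Zadd: "x + y \<in> Z" if "x \<in> Z" "y \<in> Z" for x y using Zsub that unfolding ksubspace_def mult by blast
  have Z0: "0 \<in> Z" using Zsub unfolding ksubspace_def by (simp add: FA_def)
  show "q * z \<in> Z"
   using qW
  proof (induction q rule: poly_mapping_sum_induct)
   case zero
   then show ?case using Z0 by simp
  next
   case (add w c q)
   have "single w c * z \<in> Z"
    unfolding Z_def
   proof (intro CollectI conjI ballI)
    show "single w c * z \<in> carrier FA" using mF[OF sF[OF add(1)] zc] unfolding mult .
    fix u v assume uv: "u \<in> W" "v \<in> W"
    have "?s u * (single w c * z) * ?s v = single 0 c * (?s (u + w) * z * ?s v)"
     by (simp add: mult_single flip: mult.assoc)
    then have "M u v (single w c * z) = \<Lambda> (single 0 c * (?s (u + w) * z * ?s v))"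
     by (simp add: M_def)
    also have "... = c * M (u + w) v z"
     unfolding M_def
     by (rule free_dual_scalar[OF \<Lambda>[unfolded FA_def]])
      (use mF[OF mF[OF sF[OF Wadd[OF uv(1) add(1)]] zc] sF[OF uv(2)]] in \<open>simp add: FA_def\<close>)
    also have "... = 0" using z Wadd[OF uv(1) add(1)] uv by (simp add: Z_def)
    finally show "M u v (single w c * z) = 0" .
   qed
   then show ?case using Zadd add(3) by (simp add: distrib_right)
  qed
  show "z * q \<in> Z"
   using qW
  proof (induction q rule: poly_mapping_sum_induct)
   case zero
   then show ?case using Z0 by simp
  next
   case (add w c q)
   have "z * single w c \<in> Z"
    unfolding Z_def
   proof (intro CollectI conjI ballI)
    show "z * single w c \<in> carrier FA" using mF[OF zc sF[OF add(1)]] unfolding mult .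
    fix u v assume uv: "u \<in> W" "v \<in> W"
    have "?s u * (z * single w c) * ?s v = (?s u * z * ?s (w + v)) * single 0 c"
     by (simp add: mult_single mult.assoc)
    also have "... = single 0 c * (?s u * z * ?s (w + v))" by (rule single_zero_commute)
    finally have "M u v (z * single w c) = \<Lambda> (single 0 c * (?s u * z * ?s (w + v)))"
     by (simp add: M_def)
    also have "... = c * M u (w + v) z"
     unfolding M_def
     by (rule free_dual_scalar[OF \<Lambda>[unfolded FA_def]])
      (use mF[OF mF[OF sF[OF uv(1)] zc] sF[OF Wadd[OF add(1) uv(2)]]] in \<open>simp add: FA_def\<close>)
    also have "... = 0" using z Wadd[OF add(1) uv(2)] uv by (simp add: Z_def)
    finally show "M u v (z * single w c) = 0" .
   qed
   then show ?case using Zadd add(3) by (simp add: distrib_left)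
  qed
 qed
 have Zi: "ideal Z FA"
 proof (rule idealI[OF k_algebra_ring[OF kFA]])
  show "subgroup Z (add_monoid FA)"
   using ksubspace_abelian_subgroup[OF kvFA Zsub] by (simp add: abelian_subgroup_def additive_subgroup.a_subgroup)
  show "x \<otimes>\<^bsub>FA\<^esub> z \<in> Z" "z \<otimes>\<^bsub>FA\<^esub> x \<in> Z" if "z \<in> Z" "x \<in> carrier FA" for z x
   using Zl[OF that] Zr[OF that] by (simp_all add: FA_def)
 qed
 let ?A = "alg_quot FA Z"
 let ?c = "\<lambda>p. Z +>\<^bsub>FA\<^esub> p"
 have kA: "k_algebra ?A" by (rule k_algebra_quot[OF kFA Zi])
 note c = coset_alg_hom[OF kFA Zi]
 have czero: "?c z = \<zero>\<^bsub>?A\<^esub> \<longleftrightarrow> z \<in> Z" if "z \<in> carrier FA" for z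
  using coset_eq_iff[OF kvFA Zsub that kspace_zero[OF kvFA]] coset_zero[OF kvFA Zsub] that kvFA by simp
 have W0: "0 \<in> W" by (simp add: W_def zero_word_def)
 have oneF: "1 \<in> carrier FA" using k_algebra_one[OF kFA] by (simp add: FA_def)
 have M1: "M u v 1 = h (sd (letters u @ letters v))" for u v
  by (simp add: M_def mult_single \<Lambda>s Hw_def plus_word_def)
 have "1 \<notin> Z"
 proof
  assume "1 \<in> Z"
  then have "M 0 0 1 = 0" using W0 by (simp add: Z_def)
  moreover have "sd [] = (\<lambda>_. [])" by (simp add: sd_def)
  ultimately show False using h1 by (simp add: M1 zero_word_def)
 qed
 then have ne: "\<one>\<^bsub>?A\<^esub> \<noteq> \<zero>\<^bsub>?A\<^esub>"
  using czero[OF oneF] alg_hom_one[OF c] by (simp add: FA_def)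
 let ?v = "\<lambda>i j. free_var (i, j) :: 'k bpoly"
 have vF: "?v i j \<in> carrier FA" if "i < m" "j < n" for i j
  unfolding FA_def by (rule free_alg_closed(2)) (use that in \<open>simp add: S_def\<close>)
 have vvF: "?v k i * ?v l j \<in> carrier FA" if "k < m" "i < n" "l < m" "j < n" for k i l j
  using k_algebra_mult[OF kFA vF[OF that(1,2)] vF[OF that(3,4)]] by (simp add: FA_def)
 have Mv: "M u v (?v k i * ?v l j) = h (sd (letters u @ [(k, i), (l, j)] @ letters v))" for u v k i l j
  by (simp add: M_def free_var_def mult_single \<Lambda>s Hw_def plus_word_def)
 define lc where "lc N Y y e = (\<Sum>k<N. \<Sum>l<N. single 0 (Y k l) * y k l) - single 0 e * 1"
  for N and Y :: "nat => nat => 'k" and y :: "nat => nat => 'k bpoly" and e :: 'k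
 have lcF: "lc N Y y e \<in> carrier FA" and lcL: "L \<in> dual FA ==> L (lc N Y y e) = (\<Sum>k<N. \<Sum>l<N. Y k l * L (y k l)) - e * L 1"
  if y: "\<And>k l. k < N ==> l < N ==> y k l \<in> carrier FA" for N Y y e L
 proof -
  have t: "single 0 (Y k l) * y k l \<in> carrier FA" if "k < N" "l < N" for k l
   using y[OF that] free_alg_closed(3)[OF free_alg_closed(6)] unfolding FA_def by blast
  have s1: "(\<Sum>k<N. \<Sum>l<N. single 0 (Y k l) * y k l) \<in> carrier FA"
   unfolding FA_def by (intro free_alg_closed(5)) (use t in \<open>simp add: FA_def\<close>)
  have s2: "single 0 e * 1 \<in> carrier FA"
   unfolding FA_def by (intro free_alg_closed)
  show "lc N Y y e \<in> carrier FA"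
   unfolding lc_def FA_def by (rule free_alg_closed(4)) (use s1 s2 in \<open>simp_all add: FA_def\<close>)
  assume L: "L \<in> dual FA"
  note L' = L[unfolded FA_def]
  have "L (lc N Y y e) = L (\<Sum>k<N. \<Sum>l<N. single 0 (Y k l) * y k l) - L (single 0 e * 1)"
   unfolding lc_def by (rule free_dual_minus[OF L']) (use s1 s2 in \<open>simp_all add: FA_def\<close>)
  also have "L (single 0 e * 1) = e * L 1"
   by (rule free_dual_scalar[OF L']) (use oneF in \<open>simp add: FA_def\<close>)
  also have "L (\<Sum>k<N. \<Sum>l<N. single 0 (Y k l) * y k l) = (\<Sum>k<N. \<Sum>l<N. L (single 0 (Y k l) * y k l))"
   by (rule free_dual_sum2[OF L']) (use t in \<open>simp add: FA_def\<close>)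
  also have "... = (\<Sum>k<N. \<Sum>l<N. Y k l * L (y k l))"
   by (intro sum.cong refl free_dual_scalar[OF L']) (use y in \<open>simp add: FA_def\<close>)
  finally show "L (lc N Y y e) = (\<Sum>k<N. \<Sum>l<N. Y k l * L (y k l)) - e * L 1" .
 qed
 have "BR ?A m n E E' F F' (\<lambda>i j. ?c (?v i j))"
 proof (rule BRI)
  show "?c (?v i j) \<in> carrier ?A" if "i < m" "j < n" for i j
   by (rule alg_hom_closed[OF c vF[OF that]])
  fix \<phi> assume \<phi>: "\<phi> \<in> dual ?A"
  note L = dual_comp[OF alg_hom_lin[OF c] \<phi>]
  have cm: "?c (?v k i) \<otimes>\<^bsub>?A\<^esub> ?c (?v l j) = ?c (?v k i * ?v l j)" if "k < m" "i < n" "l < m" "j < n" for k i l j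
   using alg_hom_mult[OF c vF[OF that(1,2)] vF[OF that(3,4)]] by (simp add: FA_def)
  have c1: "\<one>\<^bsub>?A\<^esub> = ?c 1" using alg_hom_one[OF c] by (simp add: FA_def)
  have van: "\<phi> (?c z) = 0" if "z \<in> Z" for z
   using czero[of z] that dual_zero[OF k_algebra_kspace[OF kA] \<phi>] by (simp add: Z_def)
  show "(\<Sum>k<m. \<Sum>l<m. E k l * \<phi> (?c (?v k i) \<otimes>\<^bsub>?A\<^esub> ?c (?v l j))) = F i j * \<phi> \<one>\<^bsub>?A\<^esub>" if ij: "i < n" "j < n" for i j
  proof -
   have yc: "?v k i * ?v l j \<in> carrier FA" if "k < m" "l < m" for k l using vvF that ij by blast
   have "lc m E (\<lambda>k l. ?v k i * ?v l j) (F i j) \<in> Z"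
    unfolding Z_def using lcF[OF yc] lcL[OF yc M] rel1 ij by (simp add: Mv M1 W_def)
   from van[OF this] have "(\<Sum>k<m. \<Sum>l<m. E k l * \<phi> (?c (?v k i * ?v l j))) = F i j * \<phi> (?c 1)"
    by (simp add: lcL[OF yc L])
   then show ?thesis using ij by (simp add: cm c1 cong: sum.cong_simp)
  qed
  show "(\<Sum>i<n. \<Sum>j<n. F' i j * \<phi> (?c (?v k i) \<otimes>\<^bsub>?A\<^esub> ?c (?v l j))) = E' k l * \<phi> \<one>\<^bsub>?A\<^esub>" if kl: "k < m" "l < m" for k l
  proof -
   have yc: "?v k i * ?v l j \<in> carrier FA" if "i < n" "j < n" for i j using vvF that kl by blast
   have "lc n F' (\<lambda>i j. ?v k i * ?v l j) (E' k l) \<in> Z"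
    unfolding Z_def using lcF[OF yc] lcL[OF yc M] rel2 kl by (simp add: Mv M1 W_def)
   from van[OF this] have "(\<Sum>i<n. \<Sum>j<n. F' i j * \<phi> (?c (?v k i * ?v l j))) = E' k l * \<phi> (?c 1)"
    by (simp add: lcL[OF yc L])
   then show ?thesis using kl by (simp add: cm c1 cong: sum.cong_simp)
  qed
 qed
 then show ?thesis using kA ne by blast
qed

lemma sandwich_entry:
 assumes "P \<in> carrier_mat n n" "Y \<in> carrier_mat n n" "R \<in> carrier_mat n n" "i < n" "j < n"
 shows "(P * Y * R) $$ (i, j) = (\<Sum>r<n. \<Sum>s<n. P $$ (i, r) * Y $$ (r, s) * R $$ (s, j))"
proof -
 have "(P * Y * R) $$ (i, j) = (\<Sum>s<n. (\<Sum>r<n. P $$ (i, r) * Y $$ (r, s)) * R $$ (s, j))"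
  using assms by (subst entry_mult[of _ n n _ n]) (auto simp: entry_mult[of P n n Y n] simp del: index_mult_mat(1) intro!: sum.cong)
 also have "... = (\<Sum>s<n. \<Sum>r<n. P $$ (i, r) * Y $$ (r, s) * R $$ (s, j))" by (simp add: sum_distrib_right)
 also have "... = (\<Sum>r<n. \<Sum>s<n. P $$ (i, r) * Y $$ (r, s) * R $$ (s, j))" by (rule sum.swap)
 finally show ?thesis .
qed

lemma congruence_cancel:
 fixes P P' Y :: "'k::field mat"
 assumes P: "P \<in> carrier_mat n n" "P' \<in> carrier_mat n n" "P * P' = 1\<^sub>m n" and Y: "Y \<in> carrier_mat n n"
 shows "P * (P' * Y * transpose_mat P') * transpose_mat P = Y"
proof -
 have t: "transpose_mat P \<in> carrier_mat n n" "transpose_mat P' \<in> carrier_mat n n" using P by simp_all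
 have PY: "P' * Y \<in> carrier_mat n n" "P * (P' * Y) \<in> carrier_mat n n" using P Y by simp_all
 have "P * (P' * Y * transpose_mat P') * transpose_mat P = (P * (P' * Y) * transpose_mat P') * transpose_mat P"
  unfolding assoc_mult_mat[OF P(1) PY(1) t(2)] ..
 also have "... = (P * (P' * Y)) * (transpose_mat P' * transpose_mat P)"
  by (rule assoc_mult_mat[OF PY(2) t(2,1)])
 also have "P * (P' * Y) = (P * P') * Y"
  by (rule assoc_mult_mat[OF P(1,2) Y, symmetric])
 also have "transpose_mat P' * transpose_mat P = transpose_mat (P * P')"
  by (rule transpose_mult[OF P(1,2), symmetric])
 finally show ?thesis using P Y by simp
qed

text \<open>
 A solution is a morphism between two bilinear forms, so a change of basis for one of the forms is
 absorbed by the solution.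
\<close>

lemma BR_change_basis:
 fixes A :: "('k::field, 'a, 'z) module_scheme" (structure) and F F' P P' :: "'k mat"
 assumes A: "k_algebra A" and a: "BR A m n E E' (entry F) (entry F') a"
  and F: "F \<in> carrier_mat n n" "F' \<in> carrier_mat n n"
  and P: "P \<in> carrier_mat n n" "P' \<in> carrier_mat n n" "P * P' = 1\<^sub>m n"
  and b: "\<And>i j. i < m ==> j < n ==> b i j = finsum A (\<lambda>l. P $$ (l, j) \<odot> a i l) {..<n}"
 shows "BR A m n E E' (entry (transpose_mat P * F * P)) (entry (P' * F' * transpose_mat P')) b"
proof (rule BRI)
 have vA: "kspace A" using A by simp
 note ac = BR_closed[OF a]
 have pc: "P $$ (l, j) \<odot> a i l \<in> carrier A" if "i < m" "l < n" for i l j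
  using vA ac that by simp
 show bc: "b i j \<in> carrier A" if "i < m" "j < n" for i j
  unfolding b[OF that] by (intro kspace_finsum[OF vA] pc) (use that in auto)
 fix \<phi> assume \<phi>: "\<phi> \<in> dual A"
 have ev: "\<phi> (b k i \<otimes> b l j) = (\<Sum>r<n. \<Sum>s<n. P $$ (r, i) * P $$ (s, j) * \<phi> (a k r \<otimes> a l s))"
  if "k < m" "l < m" "i < n" "j < n" for k l i j
 proof -
  have "\<phi> (b k i \<otimes> b l j) = (\<Sum>r<n. \<phi> ((P $$ (r, i) \<odot> a k r) \<otimes> b l j))"
   unfolding b[OF that(1,3)] by (rule dual_mult_finsum_left[OF A \<phi> bc[OF that(2,4)] pc]) (use that in auto)
  also have "... = (\<Sum>r<n. \<Sum>s<n. \<phi> ((P $$ (r, i) \<odot> a k r) \<otimes> (P $$ (s, j) \<odot> a l s)))"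
   unfolding b[OF that(2,4)] by (intro sum.cong refl dual_mult_finsum_right[OF A \<phi> pc pc]) (use that in auto)
  also have "... = (\<Sum>r<n. \<Sum>s<n. P $$ (r, i) * P $$ (s, j) * \<phi> (a k r \<otimes> a l s))"
   by (intro sum.cong refl) (use A \<phi> ac that in \<open>simp add: mult_ac\<close>)
  finally show ?thesis .
 qed
 show "(\<Sum>k<m. \<Sum>l<m. E k l * \<phi> (b k i \<otimes> b l j)) = (transpose_mat P * F * P) $$ (i, j) * \<phi> \<one>"
  if ij: "i < n" "j < n" for i j
 proof -
  have "(\<Sum>k<m. \<Sum>l<m. E k l * \<phi> (b k i \<otimes> b l j)) =
   (\<Sum>k<m. \<Sum>l<m. \<Sum>r<n. \<Sum>s<n. P $$ (r, i) * P $$ (s, j) * (E k l * \<phi> (a k r \<otimes> a l s)))"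
   using ev ij by (simp add: sum_distrib_left mult_ac cong: sum.cong_simp)
  also have "... = (\<Sum>r<n. \<Sum>s<n. \<Sum>k<m. \<Sum>l<m. P $$ (r, i) * P $$ (s, j) * (E k l * \<phi> (a k r \<otimes> a l s)))"
   by (rule sum_swap4)
  also have "... = (\<Sum>r<n. \<Sum>s<n. P $$ (r, i) * P $$ (s, j) * (F $$ (r, s) * \<phi> \<one>))"
   using BR1[OF a \<phi>] by (simp flip: sum_distrib_left)
  also have "... = (transpose_mat P * F * P) $$ (i, j) * \<phi> \<one>"
   using ij P F by (subst sandwich_entry[of _ n]) (simp_all add: sum_distrib_left sum_distrib_right mult_ac)
  finally show ?thesis .
 qed
 show "(\<Sum>i<n. \<Sum>j<n. (P' * F' * transpose_mat P') $$ (i, j) * \<phi> (b k i \<otimes> b l j)) = E' k l * \<phi> \<one>"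
  if kl: "k < m" "l < m" for k l
 proof -
  let ?G = "P' * F' * transpose_mat P'"
  have G: "?G \<in> carrier_mat n n" using P F by simp
  have cancel: "P * ?G * transpose_mat P = F'" by (rule congruence_cancel[OF P F(2)])
  have "(\<Sum>i<n. \<Sum>j<n. ?G $$ (i, j) * \<phi> (b k i \<otimes> b l j)) =
   (\<Sum>i<n. \<Sum>j<n. \<Sum>r<n. \<Sum>s<n. P $$ (r, i) * ?G $$ (i, j) * P $$ (s, j) * \<phi> (a k r \<otimes> a l s))"
   using ev kl by (simp add: sum_distrib_left mult_ac del: index_mult_mat(1) cong: sum.cong_simp)
  also have "... = (\<Sum>r<n. \<Sum>s<n. \<Sum>i<n. \<Sum>j<n. P $$ (r, i) * ?G $$ (i, j) * P $$ (s, j) * \<phi> (a k r \<otimes> a l s))"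
   by (rule sum_swap4)
  also have "... = (\<Sum>r<n. \<Sum>s<n. (P * ?G * transpose_mat P) $$ (r, s) * \<phi> (a k r \<otimes> a l s))"
  proof (intro sum.cong refl)
   fix r s assume rs: "r \<in> {..<n}" "s \<in> {..<n}"
   then have "(P * ?G * transpose_mat P) $$ (r, s) = (\<Sum>i<n. \<Sum>j<n. P $$ (r, i) * ?G $$ (i, j) * P $$ (s, j))"
    using P G by (subst sandwich_entry[of _ n]) (simp_all del: index_mult_mat(1))
   then show "(\<Sum>i<n. \<Sum>j<n. P $$ (r, i) * ?G $$ (i, j) * P $$ (s, j) * \<phi> (a k r \<otimes> a l s)) =
    (P * ?G * transpose_mat P) $$ (r, s) * \<phi> (a k r \<otimes> a l s)"
    by (simp add: sum_distrib_right del: index_mult_mat(1))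
  qed
  also have "... = E' k l * \<phi> \<one>" unfolding cancel by (rule BR2[OF a \<phi> kl])
  finally show ?thesis .
 qed
qed

lemma inverse_fun_entry:
 assumes A: "A \<in> carrier_mat n n" "B \<in> carrier_mat n n" and AB: "A * B = 1\<^sub>m n"
 shows "inverse_fun n (entry A) (entry B)"
 unfolding inverse_fun_def
proof (intro allI impI conjI)
 fix i j assume ij: "i < n" "j < n"
 show "(\<Sum>k<n. entry A i k * entry B k j) = of_bool (i = j)"
  unfolding entry_mult[OF A ij, symmetric] AB using ij by simp
 show "(\<Sum>k<n. entry B i k * entry A k j) = of_bool (i = j)"
  unfolding entry_mult[OF A(2,1) ij, symmetric] mat_mult_left_right_inverse[OF A AB] using ij by simp
qed

lemma congruence_inverse:
 fixes P P' Y Z :: "'k::field mat"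
 assumes P: "P \<in> carrier_mat n n" "P' \<in> carrier_mat n n" "P * P' = 1\<^sub>m n"
  and Y: "Y \<in> carrier_mat n n" "Z \<in> carrier_mat n n" "Y * Z = 1\<^sub>m n"
 shows "(transpose_mat P * Y * P) * (P' * Z * transpose_mat P') = 1\<^sub>m n"
proof -
 note t = P(1,2)[THEN transpose_carrier_mat[THEN iffD2]]
 have Zt: "Z * transpose_mat P' \<in> carrier_mat n n" using Y t by simp
 have 1: "P * (P' * (Z * transpose_mat P')) = Z * transpose_mat P'"
  unfolding assoc_mult_mat[OF P(1,2) Zt, symmetric] P(3) by (rule left_mult_one_mat[OF Zt])
 have 2: "Y * (Z * transpose_mat P') = transpose_mat P'"
  unfolding assoc_mult_mat[OF Y(1,2) t(2), symmetric] Y(3) by (rule left_mult_one_mat[OF t(2)])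
 have "(transpose_mat P * Y * P) * (P' * Z * transpose_mat P') =
   transpose_mat P * (Y * (P * (P' * (Z * transpose_mat P'))))"
  using P Y t by (simp add: assoc_mult_mat[of _ n n _ n _ n])
 also have "... = transpose_mat P * transpose_mat P'" unfolding 1 2 ..
 also have "... = transpose_mat (P' * P)" using P by (simp add: transpose_mult)
 finally show ?thesis using mat_mult_left_right_inverse[OF P] by simp
qed

text \<open>
 The trace in the definition of \<open>X\<^sub>0(E)\<close> is this pairing of a matrix with its inverse, which is
 why the condition survives a change of basis.
\<close>

lemma congruence_pairing:
 fixes P P' Y Z :: "'k::field mat"
 assumes P: "P \<in> carrier_mat n n" "P' \<in> carrier_mat n n" "P * P' = 1\<^sub>m n"
  and Y: "Y \<in> carrier_mat n n" and Z: "Z \<in> carrier_mat n n"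
 shows "(\<Sum>i<n. \<Sum>j<n. (transpose_mat P * Y * P) $$ (i, j) * (P' * Z * transpose_mat P') $$ (i, j)) =
  (\<Sum>i<n. \<Sum>j<n. Y $$ (i, j) * Z $$ (i, j))"
proof -
 define W where "W = P' * Z * transpose_mat P'"
 have W: "W \<in> carrier_mat n n" using P Z by (simp add: W_def)
 have t: "transpose_mat P \<in> carrier_mat n n" using P by simp
 have 1: "(transpose_mat P * Y * P) $$ (i, j) = (\<Sum>r<n. \<Sum>s<n. P $$ (r, i) * Y $$ (r, s) * P $$ (s, j))"
  if "i < n" "j < n" for i j
  unfolding sandwich_entry[OF t Y P(1) that] using P(1) that by simp
 have 2: "(P * W * transpose_mat P) $$ (r, s) = (\<Sum>i<n. \<Sum>j<n. P $$ (r, i) * W $$ (i, j) * P $$ (s, j))"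
  if "r < n" "s < n" for r s
  unfolding sandwich_entry[OF P(1) W t that] using P(1) that by simp
 have "(\<Sum>i<n. \<Sum>j<n. (transpose_mat P * Y * P) $$ (i, j) * W $$ (i, j)) =
   (\<Sum>i<n. \<Sum>j<n. \<Sum>r<n. \<Sum>s<n. Y $$ (r, s) * (P $$ (r, i) * W $$ (i, j) * P $$ (s, j)))"
  by (intro sum.cong refl) (simp add: 1 sum_distrib_left sum_distrib_right mult_ac del: index_mult_mat(1))
 also have "... = (\<Sum>r<n. \<Sum>s<n. \<Sum>i<n. \<Sum>j<n. Y $$ (r, s) * (P $$ (r, i) * W $$ (i, j) * P $$ (s, j)))"
  by (rule sum_swap4)
 also have "... = (\<Sum>r<n. \<Sum>s<n. Y $$ (r, s) * (P * W * transpose_mat P) $$ (r, s))"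
  by (intro sum.cong refl) (simp add: 2 sum_distrib_left mult.assoc del: index_mult_mat(1))
 also have "P * W * transpose_mat P = Z" unfolding W_def by (rule congruence_cancel[OF P Z])
 finally show ?thesis unfolding W_def .
qed

text \<open>
 The first new basis vector is isotropic; it is found in the span of the first two old ones by solving a
 quadratic equation.
\<close>

lemma isotropic_basis:
 fixes Y :: "'k::alg_closed_field mat"
 assumes n: "2 \<le> n" and Y: "Y \<in> carrier_mat n n"
 shows "\<exists>P P'. P \<in> carrier_mat n n \<and> P' \<in> carrier_mat n n \<and> P * P' = 1\<^sub>m n \<and> (transpose_mat P * Y * P) $$ (0, 0) = 0"
proof (cases "Y $$ (0, 0) = 0")
 case True
 then show ?thesis using n Y by (intro exI[of _ "1\<^sub>m n"]) simp
next
 case False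
 obtain p where p: "n = Suc (Suc p)" using n by (metis Suc_le_D numeral_2_eq_2 Suc_le_mono)
 define f where "f k = (if k = 0 then Y $$ (1, 1) else if k = 1 then Y $$ (0, 1) + Y $$ (1, 0) else Y $$ (0, 0))" for k :: nat
 obtain z where "(\<Sum>k\<le>2. f k * z ^ k) = 0" using alg_closed[of 2 f] False by (auto simp: f_def)
 then have z: "Y $$ (1, 1) + (Y $$ (0, 1) + Y $$ (1, 0)) * z + Y $$ (0, 0) * z ^ 2 = 0"
  by (simp add: f_def numeral_2_eq_2)
 \<comment> \<open>the isotropic vector \<open>(z, 1, 0, \<dots>, 0)\<close> becomes the first basis vector\<close>
 define P where "P = mat n n (\<lambda>(i, j). if j = 0 then (if i = 0 then z else of_bool (i = 1))
  else if j = 1 then of_bool (i = 0) else of_bool (i = j))"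
 define P' where "P' = mat n n (\<lambda>(i, j). if i = 0 then of_bool (j = 1)
  else if i = 1 then (if j = 0 then 1 else if j = 1 then - z else 0) else of_bool (i = j))"
 have P: "P \<in> carrier_mat n n" "P' \<in> carrier_mat n n" by (simp_all add: P_def P'_def)
 have sum2: "(\<Sum>k<n. g k) = g 0 + (g 1 + (\<Sum>k<p. g (Suc (Suc k))))" for g :: "nat => 'k"
  unfolding p sum.lessThan_Suc_shift by simp
 have "P * P' = 1\<^sub>m n"
 proof (rule eq_matI)
  fix i j assume "i < dim_row (1\<^sub>m n :: 'k mat)" "j < dim_col (1\<^sub>m n :: 'k mat)"
  then have ij: "i < n" "j < n" by simp_all
  have tail: "(\<Sum>k<p. P $$ (i, Suc (Suc k)) * P' $$ (Suc (Suc k), j)) = (\<Sum>k<p. of_bool (i = Suc (Suc k) \<and> i = j) :: 'k)"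
   by (intro sum.cong refl) (use ij p in \<open>auto simp: P_def P'_def\<close>)
  have "(\<Sum>k<p. of_bool (i = Suc (Suc k) \<and> i = j)) = (of_bool (2 \<le> i \<and> i = j) :: 'k)"
  proof (cases "2 \<le> i \<and> i = j")
   case True
   then have "(\<Sum>k<p. of_bool (i = Suc (Suc k) \<and> i = j)) = (\<Sum>k<p. of_bool (k = i - 2) * 1 :: 'k)"
    by (intro sum.cong refl) auto
   also have "... = 1" by (rule sum_of_bool_mult(2)) (use True ij p in auto)
   finally show ?thesis using True by simp
  next
   case False
   then have "(\<Sum>k<p. of_bool (i = Suc (Suc k) \<and> i = j)) = (0 :: 'k)" by (intro sum.neutral) auto
   then show ?thesis using False by simp
  qed
  then have "(\<Sum>k<n. P $$ (i, k) * P' $$ (k, j)) = P $$ (i, 0) * P' $$ (0, j) + (P $$ (i, 1) * P' $$ (1, j) + of_bool (2 \<le> i \<and> i = j))"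
   unfolding sum2 tail by simp
  also have "P $$ (i, 0) = (if i = 0 then z else of_bool (i = 1))" using ij n by (simp add: P_def)
  also have "P $$ (i, 1) = of_bool (i = 0)" using ij n by (simp add: P_def)
  also have "P' $$ (0, j) = of_bool (j = 1)" using ij n by (simp add: P'_def)
  also have "P' $$ (1, j) = (if j = 0 then 1 else if j = 1 then - z else 0)" using ij n by (simp add: P'_def)
  also have "(if i = 0 then z else of_bool (i = 1)) * of_bool (j = 1) +
    (of_bool (i = 0) * (if j = 0 then 1 else if j = 1 then - z else 0) + of_bool (2 \<le> i \<and> i = j)) = 1\<^sub>m n $$ (i, j)"
  proof -
   consider "i = 0" | "i = 1" | "2 \<le> i" by linarith
   then show ?thesis by cases (use ij in auto)
  qed
  finally have "(\<Sum>k<n. P $$ (i, k) * P' $$ (k, j)) = 1\<^sub>m n $$ (i, j)" .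
  then show "(P * P') $$ (i, j) = 1\<^sub>m n $$ (i, j)" unfolding entry_mult[OF P ij] .
 qed (simp_all add: P_def P'_def)
 moreover have "(transpose_mat P * Y * P) $$ (0, 0) = 0"
 proof -
  have "(transpose_mat P * Y * P) $$ (0, 0) = (\<Sum>r<n. \<Sum>s<n. P $$ (r, 0) * Y $$ (r, s) * P $$ (s, 0))"
   using n P Y by (subst sandwich_entry[of _ n]) auto
  also have "... = z * Y $$ (0, 0) * z + z * Y $$ (0, 1) + (Y $$ (1, 0) * z + Y $$ (1, 1))"
   using n Y by (simp add: sum2 P_def)
  finally show ?thesis using z by (simp add: algebra_simps power2_eq_square)
 qed
 ultimately show ?thesis using P by blast
qed

definition restrict_scalars :: "('k::field alg_closure, 'a) module => ('k, 'a) module" where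
 "restrict_scalars A = \<lparr>carrier = carrier A, monoid.mult = monoid.mult A, one = monoid.one A, zero = ring.zero A, add = ring.add A,
   module.smult = (\<lambda>c. module.smult A (to_ac c))\<rparr>"

lemma restrict_scalars_sel [simp]:
 "carrier (restrict_scalars A) = carrier A" "monoid.mult (restrict_scalars A) = monoid.mult A"
 "monoid.one (restrict_scalars A) = monoid.one A" "ring.zero (restrict_scalars A) = ring.zero A"
 "ring.add (restrict_scalars A) = ring.add A" "module.smult (restrict_scalars A) c x = module.smult A (to_ac c) x"
 by (simp_all add: restrict_scalars_def)

lemma finsum_restrict_scalars: "finsum (restrict_scalars A) f I = finsum A f I"
 by (simp add: finsum_def finprod_def)

lemma k_algebra_restrict_scalars:
 fixes A :: "('k::field alg_closure, 'a) module"
 assumes A: "k_algebra A"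
 shows "k_algebra (restrict_scalars A)"
proof (rule k_algebraI[OF kspaceI])
 note vA = k_algebra_kspace[OF A]
 show "(c + d) \<odot>\<^bsub>restrict_scalars A\<^esub> x = c \<odot>\<^bsub>restrict_scalars A\<^esub> x \<oplus>\<^bsub>restrict_scalars A\<^esub> d \<odot>\<^bsub>restrict_scalars A\<^esub> x"
  if "x \<in> carrier (restrict_scalars A)" for c d x
  using kspace_smult_add_left[OF vA] that by simp
 show "c \<odot>\<^bsub>restrict_scalars A\<^esub> (x \<oplus>\<^bsub>restrict_scalars A\<^esub> y) = c \<odot>\<^bsub>restrict_scalars A\<^esub> x \<oplus>\<^bsub>restrict_scalars A\<^esub> c \<odot>\<^bsub>restrict_scalars A\<^esub> y"
  if "x \<in> carrier (restrict_scalars A)" "y \<in> carrier (restrict_scalars A)" for c x y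
  using kspace_smult_add_right[OF vA] that by simp
 show "x \<oplus>\<^bsub>restrict_scalars A\<^esub> y = y \<oplus>\<^bsub>restrict_scalars A\<^esub> x"
  if "x \<in> carrier (restrict_scalars A)" "y \<in> carrier (restrict_scalars A)" for x y
  using kspace_comm[OF vA] that by simp
qed (use A k_algebra_kspace[OF A] in \<open>simp_all add: kspace_assoc kspace_smult_smult k_algebra_assoc k_algebra_add_mult k_algebra_mult_add\<close>)

text \<open>
 The relations are identities between elements, hence independent of the field whose functionals test
 them.
\<close>

lemma BR_restrict_scalars:
 fixes A :: "('k::field alg_closure, 'a) module" (structure)
 assumes A: "k_algebra A"
  and a: "BR A m n (\<lambda>i j. to_ac (E i j)) (\<lambda>i j. to_ac (E' i j)) (\<lambda>i j. to_ac (F i j)) (\<lambda>i j. to_ac (F' i j)) a"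
 shows "BR (restrict_scalars A) m n E E' F F' a"
proof (rule BRI)
 let ?R = "restrict_scalars A"
 note vA = k_algebra_kspace[OF A] and vR = k_algebra_kspace[OF k_algebra_restrict_scalars[OF A]]
 note ac = BR_closed[OF a]
 show "a i j \<in> carrier ?R" if "i < m" "j < n" for i j using ac that by simp
 fix \<phi> assume \<phi>: "\<phi> \<in> dual ?R"
 have descend: "(\<Sum>k<N. \<Sum>l<N. c k l * \<phi> (y k l)) = e * \<phi> \<one>\<^bsub>?R\<^esub>"
  if y: "\<And>k l. k < N ==> l < N ==> y k l \<in> carrier A"
   and eq: "\<And>\<psi>. \<psi> \<in> dual A ==> (\<Sum>k<N. \<Sum>l<N. to_ac (c k l) * \<psi> (y k l)) = to_ac e * \<psi> \<one>"
  for N :: nat and y c e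
 proof -
  have yc: "to_ac (c k l) \<odot> y k l \<in> carrier A" if "k < N" "l < N" for k l
   using y[OF that] vA by simp
  have yf: "finsum A (\<lambda>l. to_ac (c k l) \<odot> y k l) {..<N} \<in> carrier A" if "k < N" for k
   by (intro kspace_finsum[OF vA] yc) (use that in auto)
  have "finsum A (\<lambda>k. finsum A (\<lambda>l. to_ac (c k l) \<odot> y k l) {..<N}) {..<N} = to_ac e \<odot> \<one>"
  proof (rule kspace_eqI[OF vA])
   show "finsum A (\<lambda>k. finsum A (\<lambda>l. to_ac (c k l) \<odot> y k l) {..<N}) {..<N} \<in> carrier A"
    by (intro kspace_finsum[OF vA] yf) auto
   show "to_ac e \<odot> \<one> \<in> carrier A" using A vA by simp
   fix \<psi> assume \<psi>: "\<psi> \<in> dual A"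
   have "\<psi> (finsum A (\<lambda>k. finsum A (\<lambda>l. to_ac (c k l) \<odot> y k l) {..<N}) {..<N}) =
     (\<Sum>k<N. \<Sum>l<N. to_ac (c k l) * \<psi> (y k l))"
    using vA \<psi> yf yc y by simp
   then show "\<psi> (finsum A (\<lambda>k. finsum A (\<lambda>l. to_ac (c k l) \<odot> y k l) {..<N}) {..<N}) = \<psi> (to_ac e \<odot> \<one>)"
    using eq[OF \<psi>] \<psi> A by simp
  qed
  then have "\<phi> (finsum ?R (\<lambda>k. finsum ?R (\<lambda>l. c k l \<odot>\<^bsub>?R\<^esub> y k l) {..<N}) {..<N}) = \<phi> (e \<odot>\<^bsub>?R\<^esub> \<one>\<^bsub>?R\<^esub>)"
   by (simp add: finsum_restrict_scalars)
  also have "... = e * \<phi> \<one>\<^bsub>?R\<^esub>" by (rule dual_smult[OF \<phi>]) (use A in simp)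
  also have "\<phi> (finsum ?R (\<lambda>k. finsum ?R (\<lambda>l. c k l \<odot>\<^bsub>?R\<^esub> y k l) {..<N}) {..<N}) =
    (\<Sum>k<N. \<phi> (finsum ?R (\<lambda>l. c k l \<odot>\<^bsub>?R\<^esub> y k l) {..<N}))"
   by (rule dual_finsum_lessThan[OF vR \<phi>]) (use yf in \<open>simp add: finsum_restrict_scalars\<close>)
  also have "... = (\<Sum>k<N. \<Sum>l<N. \<phi> (c k l \<odot>\<^bsub>?R\<^esub> y k l))"
   by (intro sum.cong refl dual_finsum_lessThan[OF vR \<phi>]) (use yc in simp)
  also have "... = (\<Sum>k<N. \<Sum>l<N. c k l * \<phi> (y k l))"
   by (intro sum.cong refl dual_smult[OF \<phi>]) (use y in simp)
  finally show ?thesis .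
 qed
 show "(\<Sum>k<m. \<Sum>l<m. E k l * \<phi> (a k i \<otimes>\<^bsub>?R\<^esub> a l j)) = F i j * \<phi> \<one>\<^bsub>?R\<^esub>" if "i < n" "j < n" for i j
  by (rule descend) (use A ac BR1[OF a] that in simp_all)
 show "(\<Sum>i<n. \<Sum>j<n. F' i j * \<phi> (a k i \<otimes>\<^bsub>?R\<^esub> a l j)) = E' k l * \<phi> \<one>\<^bsub>?R\<^esub>" if "k < m" "l < m" for k l
  by (rule descend) (use A ac BR2[OF a] that in simp_all)
qed

lemma tr_minv_transpose:
 assumes "E \<in> GL m"
 shows "tr (minv E * transpose_mat E) = (\<Sum>i<m. \<Sum>j<m. minv E $$ (i, j) * E $$ (i, j))"
proof -
 note c = GL_carrier[OF assms] GL_inverse(1)[OF assms]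
 have "tr (minv E * transpose_mat E) = (\<Sum>i<m. (minv E * transpose_mat E) $$ (i, i))"
  using c by (simp add: tr_def del: index_mult_mat(1))
 also have "... = (\<Sum>i<m. \<Sum>j<m. minv E $$ (i, j) * transpose_mat E $$ (j, i))"
  by (intro sum.cong refl entry_mult[of _ _ m _ m]) (use c in auto)
 also have "... = (\<Sum>i<m. \<Sum>j<m. minv E $$ (i, j) * E $$ (i, j))"
  by (intro sum.cong refl) (use c in auto)
 finally show ?thesis .
qed

text \<open>
 Passing to an algebraic closure and changing both bases, one may assume that the first diagonal
 entries of \<open>E\<close> and \<open>F\<^sup>-\<^sup>1\<close> vanish, which is the normalized situation.
\<close>

theorem B_nonzero:
 fixes E F :: "'k::field mat"
 assumes E: "E \<in> GL m" "2 \<le> m" and F: "F \<in> GL n" "2 \<le> n"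
  and tr: "tr (minv E * transpose_mat E) = tr (minv F * transpose_mat F)"
 shows "\<one>\<^bsub>B_alg E F\<^esub> \<noteq> \<zero>\<^bsub>B_alg E F\<^esub>"
proof -
 interpret ac: comm_ring_hom "to_ac :: 'k => 'k alg_closure" by unfold_locales auto
 let ?h = "map_mat to_ac :: 'k mat => 'k alg_closure mat"
 note Ec = GL_carrier[OF E(1)] GL_inverse(1)[OF E(1)] and Fc = GL_carrier[OF F(1)] GL_inverse(1)[OF F(1)]
 have hE: "?h E \<in> carrier_mat m m" "?h (minv E) \<in> carrier_mat m m" using Ec by simp_all
 have hF: "?h F \<in> carrier_mat n n" "?h (minv F) \<in> carrier_mat n n" using Fc by simp_all
 have iE: "?h E * ?h (minv E) = 1\<^sub>m m"
  unfolding ac.mat_hom_mult[OF Ec, symmetric] GL_inverse(2)[OF E(1)] by (rule ac.mat_hom_one)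
 have iF: "?h (minv F) * ?h F = 1\<^sub>m n"
  unfolding ac.mat_hom_mult[OF Fc(2,1), symmetric] GL_inverse(3)[OF F(1)] by (rule ac.mat_hom_one)
 obtain P P' where P: "P \<in> carrier_mat m m" "P' \<in> carrier_mat m m" "P * P' = 1\<^sub>m m"
  and P0: "(transpose_mat P * ?h E * P) $$ (0, 0) = 0"
  using isotropic_basis[OF E(2) hE(1)] by blast
 obtain Q Q' where Q: "Q \<in> carrier_mat n n" "Q' \<in> carrier_mat n n" "Q * Q' = 1\<^sub>m n"
  and Q0: "(transpose_mat Q * ?h (minv F) * Q) $$ (0, 0) = 0"
  using isotropic_basis[OF F(2) hF(2)] by blast
 define E1 where "E1 = transpose_mat P * ?h E * P"
 define E1' where "E1' = P' * ?h (minv E) * transpose_mat P'"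
 define F1 where "F1 = Q' * ?h F * transpose_mat Q'"
 define F1' where "F1' = transpose_mat Q * ?h (minv F) * Q"
 have c1: "E1 \<in> carrier_mat m m" "E1' \<in> carrier_mat m m" "F1 \<in> carrier_mat n n" "F1' \<in> carrier_mat n n"
  using P Q hE hF by (simp_all add: E1_def E1'_def F1_def F1'_def)
 have invE: "inverse_fun m (entry E1) (entry E1')"
  by (rule inverse_fun_entry[OF c1(1,2)]) (unfold E1_def E1'_def, rule congruence_inverse[OF P hE iE])
 have invF: "inverse_fun n (entry F1) (entry F1')"
  by (rule inverse_fun_sym, rule inverse_fun_entry[OF c1(4,3)])
   (unfold F1_def F1'_def, rule congruence_inverse[OF Q hF(2,1) iF])
 have "(\<Sum>i<n. \<Sum>j<n. F1' $$ (i, j) * F1 $$ (i, j)) = (\<Sum>i<n. \<Sum>j<n. ?h (minv F) $$ (i, j) * ?h F $$ (i, j))"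
  unfolding F1_def F1'_def by (rule congruence_pairing[OF Q hF(2,1)])
 also have "... = to_ac (tr (minv F * transpose_mat F))"
  unfolding tr_minv_transpose[OF F(1)] using Fc by (simp add: to_ac_sum)
 also have "... = to_ac (\<Sum>i<m. \<Sum>j<m. minv E $$ (i, j) * E $$ (i, j))"
  unfolding tr[symmetric] tr_minv_transpose[OF E(1)] ..
 also have "... = (\<Sum>i<m. \<Sum>j<m. ?h E $$ (i, j) * ?h (minv E) $$ (i, j))"
  using Ec by (simp add: to_ac_sum mult.commute)
 also have "... = (\<Sum>i<m. \<Sum>j<m. E1 $$ (i, j) * E1' $$ (i, j))"
  unfolding E1_def E1'_def by (rule congruence_pairing[OF P hE, symmetric])
 finally have tr1: "(\<Sum>i<n. \<Sum>j<n. entry F1' i j * entry F1 i j) = (\<Sum>k<m. \<Sum>l<m. entry E1 k l * entry E1' k l)" .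
 obtain A :: "('k alg_closure, 'k alg_closure bpoly set) module" and a where A: "k_algebra A" "\<one>\<^bsub>A\<^esub> \<noteq> \<zero>\<^bsub>A\<^esub>"
  and a: "BR A m n (entry E1) (entry E1') (entry F1) (entry F1') a"
  using normalized_nonzero_algebra[OF _ _ invE invF _ _ tr1] E(2) F(2) P0 Q0 unfolding E1_def F1'_def by auto
 have tP: "transpose_mat P \<in> carrier_mat m m" "transpose_mat P' \<in> carrier_mat m m" using P by simp_all
 have tQ: "transpose_mat Q \<in> carrier_mat n n" "transpose_mat Q' \<in> carrier_mat n n" using Q by simp_all
 have tP1: "transpose_mat P' * transpose_mat P = 1\<^sub>m m" "transpose_mat P * transpose_mat P' = 1\<^sub>m m"
  using P mat_mult_left_right_inverse[OF P] by (simp_all flip: transpose_mult)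
 have tQ1: "transpose_mat Q' * transpose_mat Q = 1\<^sub>m n" "transpose_mat Q * transpose_mat Q' = 1\<^sub>m n"
  using Q mat_mult_left_right_inverse[OF Q] by (simp_all flip: transpose_mult)
 have back_F: "transpose_mat (transpose_mat Q) * F1 * transpose_mat Q = ?h F"
  "transpose_mat Q' * F1' * transpose_mat (transpose_mat Q') = ?h (minv F)"
  using congruence_cancel[OF Q hF(1)] congruence_cancel[OF tQ(2,1) tQ1(1) hF(2)] by (simp_all add: F1_def F1'_def)
 have back_E: "transpose_mat (transpose_mat P) * E1' * transpose_mat P = ?h (minv E)"
  "transpose_mat P' * E1 * transpose_mat (transpose_mat P') = ?h E"
  using congruence_cancel[OF P hE(2)] congruence_cancel[OF tP(2,1) tP1(1) hE(1)] by (simp_all add: E1_def E1'_def)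
 define b where "b i j = finsum A (\<lambda>l. transpose_mat Q $$ (l, j) \<odot>\<^bsub>A\<^esub> a i l) {..<n}" for i j
 have b: "BR A m n (entry E1) (entry E1') (entry (?h F)) (entry (?h (minv F))) b"
  using BR_change_basis[OF A(1) a c1(3,4) tQ tQ1(2) b_def] unfolding back_F .
 define c where "c i j = finsum A (\<lambda>l. transpose_mat P $$ (l, j) \<odot>\<^bsub>A\<^esub> b l i) {..<m}" for i j
 have "BR A n m (entry (?h (minv F))) (entry (?h F)) (entry (?h (minv E))) (entry (?h E)) c"
  using BR_change_basis[OF A(1) BR_transpose[OF b] c1(2,1) tP tP1(2) c_def] unfolding back_E .
 from BR_transpose[OF this]
 have "BR A m n (\<lambda>i j. to_ac (entry E i j)) (\<lambda>i j. to_ac (entry (minv E) i j))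
   (\<lambda>i j. to_ac (entry F i j)) (\<lambda>i j. to_ac (entry (minv F) i j)) (\<lambda>i j. c j i)"
  unfolding BR_def using Ec Fc by (simp cong: sum.cong_simp)
 from BR_restrict_scalars[OF A(1) this]
 obtain f where f: "f \<in> alg_hom (B_alg E F) (restrict_scalars A)"
  using B_hom_ex[OF E(1) F(1) k_algebra_restrict_scalars[OF A(1)]] by blast
 have kR: "kspace (restrict_scalars A)" "kspace (B_alg E F)"
  using k_algebra_restrict_scalars[OF A(1)] k_algebra_B[OF E(1) F(1)] by simp_all
 show ?thesis
 proof
  assume "\<one>\<^bsub>B_alg E F\<^esub> = \<zero>\<^bsub>B_alg E F\<^esub>"
  then have "\<one>\<^bsub>restrict_scalars A\<^esub> = \<zero>\<^bsub>restrict_scalars A\<^esub>"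
   using alg_hom_one[OF f] lin_hom_zero[OF kR(2,1) alg_hom_lin[OF f]] by simp
  then show False using A(2) by simp
 qed
qed

section \<open>Columns of Galois objects\<close>

text \<open>
 A column is a tuple that the coaction transforms like a column of generators of \<open>\<B>(E,F)\<close>.
 Columns correspond to colinear maps from the standard \<open>m\<close>-dimensional comodule to \<open>A\<close>.
\<close>

definition coaction_column :: "'k::field mat => ('k, 'k belem, 'a) comod_alg => (nat => 'a) => bool" where
 "coaction_column E A x \<longleftrightarrow> (\<forall>i<dim_row E. x i \<in> carrier A \<and> coact A (x i) =
   finsum (tensor_alg (B_alg E E) A) (\<lambda>k. tens (B_alg E E) A (B_gen E E i k) (x k)) {..<dim_row E})"

lemma tensor_map_id_comp:
 assumes "kspace M" "kspace N" "kspace P" "kspace Q" "f \<in> lin_hom N P" "g \<in> lin_hom P Q"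
  and "\<And>x. x \<in> carrier N ==> h x = g (f x)" and h: "h \<in> lin_hom N Q" and t: "t \<in> carrier (tensor_alg M N)"
 shows "tensor_map M P M Q id g (tensor_map M N M P id f t) = tensor_map M N M Q id h t"
proof -
 note i = lin_hom_id(1)[of M]
 note m1 = tensor_map_lin_hom[OF assms(1,2,1,3) i assms(5)] and m2 = tensor_map_lin_hom[OF assms(1,3,1,4) i assms(6)]
 show ?thesis
 proof (rule tensor_ext[OF assms(1,2) kspace_tensor_alg[OF assms(1,4)] lin_hom_comp[OF m1 m2]
    tensor_map_lin_hom[OF assms(1,2,1,4) i h] _ t])
  fix x y assume xy: "x \<in> carrier M" "y \<in> carrier N"
  show "tensor_map M P M Q id g (tensor_map M N M P id f (tens M N x y)) = tensor_map M N M Q id h (tens M N x y)"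
   unfolding tensor_map_tens[OF assms(1,2,1,3) i assms(5) xy] tensor_map_tens[OF assms(1,2,1,4) i h xy]
    tensor_map_tens[OF assms(1,3,1,4) i assms(6) lin_hom_closed[OF i xy(1)] lin_hom_closed[OF assms(5) xy(2)]]
    assms(7)[OF xy(2)] by simp
 qed
qed

lemma tensor_map_id_id:
 assumes "kspace M" "kspace N" "h \<in> lin_hom N N" "\<And>x. x \<in> carrier N ==> h x = x" and t: "t \<in> carrier (tensor_alg M N)"
 shows "tensor_map M N M N id h t = t"
proof -
 note i = lin_hom_id(1)[of M]
 show ?thesis
  by (rule tensor_ext[OF assms(1,2) kspace_tensor_alg[OF assms(1,2)] tensor_map_lin_hom[OF assms(1,2,1,2) i assms(3)] lin_hom_id(2) _ t])
   (simp add: tensor_map_tens[OF assms(1,2,1,2) i assms(3)] assms(4))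
qed

lemma bilin_counit_alg_hom:
 fixes A (structure)
 assumes H: "k_algebra H" and A: "k_algebra A" and \<epsilon>: "\<epsilon> \<in> alg_hom H scalar_alg"
 shows "tensor_lift H A A (\<lambda>h x. \<epsilon> h \<odot> x) \<in> alg_hom (tensor_alg H A) A"
  and "h \<in> carrier H ==> x \<in> carrier A ==> tensor_lift H A A (\<lambda>h x. \<epsilon> h \<odot> x) (tens H A h x) = \<epsilon> h \<odot> x"
proof -
 note vH = k_algebra_kspace[OF H] and vA = k_algebra_kspace[OF A]
 note b = bilin_smult_left[OF vA alg_hom_dual[OF \<epsilon>]]
 note lt = tensor_lift_tens[OF vH vA vA b]
 show "tensor_lift H A A (\<lambda>h x. \<epsilon> h \<odot> x) \<in> alg_hom (tensor_alg H A) A"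
  by (rule tensor_alg_homI[OF H A A tensor_lift_lin_hom[OF vH vA vA b]])
   (use H A alg_hom_one[OF \<epsilon>] alg_hom_mult[OF \<epsilon>] in \<open>simp_all add: lt kspace_smult_smult mult.commute\<close>)
 show "h \<in> carrier H ==> x \<in> carrier A ==> tensor_lift H A A (\<lambda>h x. \<epsilon> h \<odot> x) (tens H A h x) = \<epsilon> h \<odot> x"
  by (rule lt)
qed

locale galois_over_B =
 fixes E :: "'k::field mat" and m :: nat and A :: "('k, 'k belem, 'a) comod_alg" (structure)
 assumes E: "E \<in> GL m" and galois: "galois_object (B_hopf E) A"
begin

abbreviation "H \<equiv> B_alg E E"
abbreviation "u \<equiv> B_gen E E"
abbreviation "HA \<equiv> tensor_alg H A"
abbreviation "AA \<equiv> tensor_alg A A"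
abbreviation "te \<equiv> tens H A"
abbreviation "can \<equiv> galois_map (B_hopf E) A"

lemmas kH = k_algebra_B[OF E E]
lemmas vH = k_algebra_kspace[OF kH]
lemmas uc = B_gen_closed[OF E E]

lemma comod: "comodule_algebra (B_hopf E) A"
 using galois unfolding galois_object_def by blast

lemma kA: "k_algebra A"
 using comod unfolding comodule_algebra_def by blast

lemmas vA = k_algebra_kspace[OF kA]
lemmas vHA = kspace_tensor_alg[OF vH vA]
lemmas vAA = kspace_tensor_alg[OF vA vA]
lemmas kHA = k_algebra_tensor[OF kH kA]
lemmas Aone = k_algebra_one[OF kA]
lemmas Hone = k_algebra_one[OF kH]

lemma coact_hom: "coact A \<in> alg_hom A HA"
 using comod unfolding comodule_algebra_def B_hopf_conv by blast

lemmas coact_lin = alg_hom_lin[OF coact_hom]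

lemma coassoc: "x \<in> carrier A ==>
  tensor_assoc H H A (tensor_map H A (tensor_alg H H) A (B_coact E E) id (coact A x)) =
  tensor_map H A H HA id (coact A) (coact A x)"
 using comod unfolding comodule_algebra_def B_hopf_conv B_hopf_sel by blast

lemma counital: "x \<in> carrier A ==> tensor_lift H A A (\<lambda>h x. B_counit E h \<odot> x) (coact A x) = x"
 using comod unfolding comodule_algebra_def B_hopf_conv B_hopf_sel by blast

lemma one_not_zero: "\<one> \<noteq> \<zero>"
 by (rule k_algebra_one_not_zero[OF kA]) (use galois in \<open>simp add: galois_object_def\<close>)

lemma dual_one: "\<exists>\<phi>\<in>dual A. \<phi> \<one> = 1"
 by (rule dual_separates[OF vA Aone one_not_zero])

lemmas can_lin = galois_map_lin_hom[where H = "B_hopf E" and A = A, unfolded B_hopf_conv, OF kH kA coact_lin]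
lemmas can_tens = galois_map_tens[where H = "B_hopf E" and A = A, unfolded B_hopf_conv, OF kH kA coact_lin]

lemma can_bij: "bij_betw can (carrier AA) (carrier HA)"
 using galois unfolding galois_object_def B_hopf_conv by blast

text \<open>
 For coinvariant \<open>y\<close> the elements \<open>y \<otimes> 1\<close> and \<open>1 \<otimes> y\<close> have the same image under the injective canonical
 map, and slicing \<open>y \<otimes> 1 = 1 \<otimes> y\<close> shows that \<open>y\<close> is a scalar.
\<close>

lemma coinvariant_scalar:
 assumes y: "y \<in> carrier A" and co: "coact A y = te \<one>\<^bsub>H\<^esub> y"
 shows "\<exists>c. y = c \<odot> \<one>"
proof -
 obtain \<phi> where \<phi>: "\<phi> \<in> dual A" "\<phi> \<one> = 1" using dual_one by blast
 have 1: "can (tens A A y \<one>) = te \<one>\<^bsub>H\<^esub> y"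
  unfolding can_tens[OF y Aone] co tens_mult[OF kH kA Hone y Hone Aone] using kH kA y by simp
 have 2: "can (tens A A \<one> y) = te \<one>\<^bsub>H\<^esub> y"
  unfolding can_tens[OF Aone y] alg_hom_one[OF coact_hom] tensor_alg_sel[OF vH vA]
   tens_mult[OF kH kA Hone Aone Hone y] using kH kA y by simp
 have "tens A A y \<one> = tens A A \<one> y"
  by (rule inj_onD[OF bij_betw_imp_inj_on[OF can_bij] trans[OF 1 2[symmetric]]
    tens_closed[OF vA vA y Aone] tens_closed[OF vA vA Aone y]])
 then have "rslice A A \<phi> (tens A A y \<one>) = rslice A A \<phi> (tens A A \<one> y)" by (rule arg_cong)
 then have "y = \<phi> y \<odot> \<one>"
  unfolding rslice_tens[OF vA vA \<phi>(1) y Aone] rslice_tens[OF vA vA \<phi>(1) Aone y] \<phi>(2) kspace_smult1[OF vA y] .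
 then show ?thesis by (rule exI)
qed

abbreviation "column \<equiv> coaction_column E A"

lemma column_closed: "column x ==> i < m ==> x i \<in> carrier A"
 using E unfolding coaction_column_def by simp

lemma column_coact: "column x ==> i < m ==> coact A (x i) = finsum HA (\<lambda>k. te (u i k) (x k)) {..<m}"
 using E unfolding coaction_column_def by simp

lemma column_coact_dual:
 assumes "column x" "i < m" "\<Phi> \<in> dual HA"
 shows "\<Phi> (coact A (x i)) = (\<Sum>k<m. \<Phi> (te (u i k) (x k)))"
 unfolding column_coact[OF assms(1,2)]
 by (rule dual_finsum_lessThan[OF vHA assms(3)]) (use vH vA uc column_closed[OF assms(1)] assms(2) in simp)

lemma columnI:
 assumes x: "\<And>i. i < m ==> x i \<in> carrier A"
  and co: "\<And>i \<Phi>. i < m ==> \<Phi> \<in> dual HA ==> \<Phi> (coact A (x i)) = (\<Sum>k<m. \<Phi> (te (u i k) (x k)))"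
 shows "column x"
 unfolding coaction_column_def GL_dim[OF E]
proof (intro allI impI conjI)
 fix i assume i: "i < m"
 show "x i \<in> carrier A" by (rule x[OF i])
 have t: "te (u i k) (x k) \<in> carrier HA" if "k < m" for k using vH vA uc x i that by simp
 show "coact A (x i) = finsum HA (\<lambda>k. te (u i k) (x k)) {..<m}"
 proof (rule kspace_eqI[OF vHA alg_hom_closed[OF coact_hom x[OF i]]])
  show "finsum HA (\<lambda>k. te (u i k) (x k)) {..<m} \<in> carrier HA"
   by (intro kspace_finsum[OF vHA] t) simp
  fix \<Phi> assume \<Phi>: "\<Phi> \<in> dual HA"
  show "\<Phi> (coact A (x i)) = \<Phi> (finsum HA (\<lambda>k. te (u i k) (x k)) {..<m})"
   unfolding co[OF i \<Phi>] by (rule dual_finsum_lessThan[OF vHA \<Phi> t, symmetric])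
 qed
qed

text \<open>
 The generators of \<open>\<B>(E)\<close> preserve the bilinear form \<open>E\<close>, so this pairing is coinvariant.
\<close>

lemma column_pairing_scalar:
 assumes x: "column x" and y: "column y"
 shows "\<exists>c. \<forall>\<phi>\<in>dual A. (\<Sum>k<m. \<Sum>l<m. E $$ (k, l) * \<phi> (x k \<otimes> y l)) = c * \<phi> \<one>"
proof -
 note xc = column_closed[OF x] and yc = column_closed[OF y]
 have c0: "E $$ (k, l) \<odot> (x k \<otimes> y l) \<in> carrier A" if "k < m" "l < m" for k l
  using kA vA xc yc that by simp
 have c1: "finsum A (\<lambda>l. E $$ (k, l) \<odot> (x k \<otimes> y l)) {..<m} \<in> carrier A" if "k < m" for k
  by (intro kspace_finsum[OF vA] c0) (use that in auto)
 define z where "z = finsum A (\<lambda>k. finsum A (\<lambda>l. E $$ (k, l) \<odot> (x k \<otimes> y l)) {..<m}) {..<m}"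
 have zc: "z \<in> carrier A" unfolding z_def by (intro kspace_finsum[OF vA] c1) auto
 have z: "\<phi> z = (\<Sum>k<m. \<Sum>l<m. E $$ (k, l) * \<phi> (x k \<otimes> y l))" if \<phi>: "\<phi> \<in> dual A" for \<phi>
  unfolding z_def using vA kA c0 c1 xc yc \<phi> by simp
 have "coact A z = te \<one>\<^bsub>H\<^esub> z"
 proof (rule kspace_eqI[OF vHA alg_hom_closed[OF coact_hom zc] tens_closed[OF vH vA Hone zc]])
  fix \<Phi> assume \<Phi>: "\<Phi> \<in> dual HA"
  have tc: "te (u k r) (x r) \<in> carrier HA" "te (u k r) (y r) \<in> carrier HA" if "k < m" "r < m" for k r
   using vH vA uc xc yc that by simp_all
  have co: "\<Phi> (coact A (x k \<otimes> y l)) = (\<Sum>r<m. \<Sum>s<m. \<Phi> (te (u k r \<otimes>\<^bsub>H\<^esub> u l s) (x r \<otimes> y s)))"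
   if kl: "k < m" "l < m" for k l
  proof -
   note cy = alg_hom_closed[OF coact_hom yc[OF kl(2)]]
   have "\<Phi> (coact A (x k \<otimes> y l)) = \<Phi> (coact A (x k) \<otimes>\<^bsub>HA\<^esub> coact A (y l))"
    unfolding alg_hom_mult[OF coact_hom xc[OF kl(1)] yc[OF kl(2)]] ..
   also have "... = (\<Sum>r<m. \<Phi> (te (u k r) (x r) \<otimes>\<^bsub>HA\<^esub> coact A (y l)))"
    by (rule column_coact_dual[OF x kl(1) dual_mult_right[OF kHA \<Phi> cy]])
   also have "... = (\<Sum>r<m. \<Sum>s<m. \<Phi> (te (u k r) (x r) \<otimes>\<^bsub>HA\<^esub> te (u l s) (y s)))"
    by (intro sum.cong refl column_coact_dual[OF y kl(2) dual_mult_left[OF kHA \<Phi> tc(1)]]) (use kl in auto)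
   also have "... = (\<Sum>r<m. \<Sum>s<m. \<Phi> (te (u k r \<otimes>\<^bsub>H\<^esub> u l s) (x r \<otimes> y s)))"
    by (intro sum.cong refl) (use tens_mult[OF kH kA] uc xc yc kl in simp)
   finally show ?thesis .
  qed
  have "\<Phi> (coact A z) = (\<Sum>k<m. \<Sum>l<m. E $$ (k, l) * \<Phi> (coact A (x k \<otimes> y l)))"
   by (rule z[OF dual_comp[OF coact_lin \<Phi>]])
  also have "... = (\<Sum>k<m. \<Sum>l<m. \<Sum>r<m. \<Sum>s<m. E $$ (k, l) * \<Phi> (te (u k r \<otimes>\<^bsub>H\<^esub> u l s) (x r \<otimes> y s)))"
   by (intro sum.cong refl) (simp add: co sum_distrib_left)
  also have "... = (\<Sum>r<m. \<Sum>s<m. \<Sum>k<m. \<Sum>l<m. E $$ (k, l) * \<Phi> (te (u k r \<otimes>\<^bsub>H\<^esub> u l s) (x r \<otimes> y s)))"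
   by (rule sum_swap4)
  also have "... = (\<Sum>r<m. \<Sum>s<m. E $$ (r, s) * \<Phi> (te \<one>\<^bsub>H\<^esub> (x r \<otimes> y s)))"
   by (intro sum.cong refl BR1[OF B_gen_BR[OF E E] dual_tens_left[OF vH vA \<Phi>]]) (use kA xc yc in auto)
  also have "... = \<Phi> (te \<one>\<^bsub>H\<^esub> z)"
   by (rule z[OF dual_tens_right[OF vH vA \<Phi> Hone], symmetric])
  finally show "\<Phi> (coact A z) = \<Phi> (te \<one>\<^bsub>H\<^esub> z)" .
 qed
 from coinvariant_scalar[OF zc this] obtain c where "z = c \<odot> \<one>" by blast
 then have c: "\<phi> z = c * \<phi> \<one>" if "\<phi> \<in> dual A" for \<phi>
  unfolding dual_smult[OF that Aone, symmetric] by (rule arg_cong)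
 show ?thesis
  by (intro exI[of _ c] ballI) (rule trans[OF z[symmetric] c])
qed

text \<open>
 The canonical map is colinear for the coaction on the left factors. On \<open>x \<otimes> y\<close> both sides arise from the
 twofold coaction of \<open>x\<close>, by coassociativity.
\<close>

lemma can_colinear:
 assumes t: "t \<in> carrier AA"
 shows "tensor_map H AA H HA id can (tensor_assoc H A A (tensor_map A A HA A (coact A) id t)) =
  tensor_assoc H H A (tensor_map H A (tensor_alg H H) A (B_coact E E) id (can t))"
proof -
 note vHH = kspace_tensor_alg[OF vH vH]
 note kHH = k_algebra_tensor[OF kH kH]
 note d1 = tensor_map_lin_hom[OF vA vA vHA vA coact_lin lin_hom_id(1)]
 note as1 = tensor_assoc_lin_hom[OF vH vA vA]
 note c' = tensor_map_lin_hom[OF vH vAA vH vHA lin_hom_id(1) can_lin]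
 have idA: "id \<in> alg_hom A A" by (auto intro!: alg_homI)
 note \<Delta> = B_coact_alg_hom[OF E E]
 note d2 = tensor_map_alg_hom[OF kH kA kHH kA \<Delta> idA]
 note D2 = alg_hom_comp[OF d2 tensor_assoc_alg_hom[OF kH kH kA]]
 show ?thesis
 proof (rule tensor_ext[OF vA vA kspace_tensor_alg[OF vH vHA] lin_hom_comp[OF lin_hom_comp[OF d1 as1] c']
    lin_hom_comp[OF can_lin alg_hom_lin[OF D2]] _ t])
  fix x y assume xy: "x \<in> carrier A" "y \<in> carrier A"
  note cx = alg_hom_closed[OF coact_hom xy(1)]
  have ly: "(\<lambda>z. tens A A z y) \<in> lin_hom A AA" by (rule bilinD(2)[OF bilin_tens[OF vA vA] xy(2)])
  have 1: "te \<one>\<^bsub>H\<^esub> y \<in> carrier HA" by (rule tens_closed[OF vH vA Hone xy(2)])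
  note K = k_algebra_tensor[OF kH kHA]
  have T: "tens H HA \<one>\<^bsub>H\<^esub> (te \<one>\<^bsub>H\<^esub> y) \<in> carrier (tensor_alg H HA)" by (rule tens_closed[OF vH vHA Hone 1])
  have "tensor_map H AA H HA id can (tensor_assoc H A A (tensor_map A A HA A (coact A) id (tens A A x y))) =
    tensor_map H AA H HA id can (tensor_map H A H AA id (\<lambda>z. tens A A z y) (coact A x))"
   unfolding tensor_map_tens[OF vA vA vHA vA coact_lin lin_hom_id(1) xy] id_apply tensor_assoc_tens[OF vH vA vA cx xy(2)] ..
  also have "... = tensor_map H A H HA id (coact A) (coact A x) \<otimes>\<^bsub>tensor_alg H HA\<^esub> tens H HA \<one>\<^bsub>H\<^esub> (te \<one>\<^bsub>H\<^esub> y)"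
  proof (rule tensor_ext[OF vH vA kspace_tensor_alg[OF vH vHA]
     lin_hom_comp[OF tensor_map_lin_hom[OF vH vA vH vAA lin_hom_id(1) ly] c']
     lin_hom_comp[OF tensor_map_lin_hom[OF vH vA vH vHA lin_hom_id(1) coact_lin] lin_hom_mult_right[OF K T]] _ cx])
   fix h z assume hz: "h \<in> carrier H" "z \<in> carrier A"
   note cz = alg_hom_closed[OF coact_hom hz(2)]
   show "tensor_map H AA H HA id can (tensor_map H A H AA id (\<lambda>z. tens A A z y) (te h z)) =
    tensor_map H A H HA id (coact A) (te h z) \<otimes>\<^bsub>tensor_alg H HA\<^esub> tens H HA \<one>\<^bsub>H\<^esub> (te \<one>\<^bsub>H\<^esub> y)"
    unfolding tensor_map_tens[OF vH vA vH vAA lin_hom_id(1) ly hz] tensor_map_tens[OF vH vA vH vHA lin_hom_id(1) coact_lin hz] id_apply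
     tensor_map_tens[OF vH vAA vH vHA lin_hom_id(1) can_lin hz(1) tens_closed[OF vA vA hz(2) xy(2)]]
     tens_mult[OF kH kHA hz(1) cz Hone 1] can_tens[OF hz(2) xy(2)] k_algebra_rone[OF kH hz(1)] ..
  qed
  also have "... = tensor_assoc H H A (tensor_map H A (tensor_alg H H) A (B_coact E E) id (coact A x)) \<otimes>\<^bsub>tensor_alg H HA\<^esub>
    tensor_assoc H H A (tensor_map H A (tensor_alg H H) A (B_coact E E) id (te \<one>\<^bsub>H\<^esub> y))"
   unfolding coassoc[OF xy(1)] tensor_map_tens[OF vH vA vHH vA alg_hom_lin[OF \<Delta>] lin_hom_id(1) Hone xy(2)] id_apply
    alg_hom_one[OF \<Delta>] tensor_alg_sel[OF vH vH] tensor_assoc_tens_tens[OF vH vH vA Hone Hone xy(2)] ..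
  also have "... = tensor_assoc H H A (tensor_map H A (tensor_alg H H) A (B_coact E E) id (can (tens A A x y)))"
   unfolding can_tens[OF xy] by (rule alg_hom_mult[OF D2 cx 1, symmetric])
  finally show "tensor_map H AA H HA id can (tensor_assoc H A A (tensor_map A A HA A (coact A) id (tens A A x y))) =
   tensor_assoc H H A (tensor_map H A (tensor_alg H H) A (B_coact E E) id (can (tens A A x y)))" .
 qed
qed

lemma id_can_left_inverse:
 assumes s: "s \<in> carrier (tensor_alg H AA)"
 shows "tensor_map H HA H AA id (inv_into (carrier AA) can) (tensor_map H AA H HA id can s) = s"
proof -
 note inv = inv_into_lin_hom[OF vAA vHA can_lin can_bij]
 have "tensor_map H HA H AA id (inv_into (carrier AA) can) (tensor_map H AA H HA id can s) = tensor_map H AA H AA id (\<lambda>x. x) s"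
  by (rule tensor_map_id_comp[OF vH vAA vHA vAA can_lin inv _ lin_hom_id(2) s])
   (rule inv_into_f_f[OF bij_betw_imp_inj_on[OF can_bij], symmetric])
 also have "... = s" by (rule tensor_map_id_id[OF vH vAA lin_hom_id(2) refl s])
 finally show ?thesis .
qed

text \<open>
 Slicing off the right factor commutes with the coaction on the left factor, so it turns tensors with
 the coaction of a column into columns.
\<close>

lemma coact_rslice:
 assumes \<phi>: "\<phi> \<in> dual A" and t: "t \<in> carrier AA"
 shows "coact A (rslice A A \<phi> t) =
  tensor_map H AA H A id (rslice A A \<phi>) (tensor_assoc H A A (tensor_map A A HA A (coact A) id t))"
proof -
 note d1 = tensor_map_lin_hom[OF vA vA vHA vA coact_lin lin_hom_id(1)]
 note as1 = tensor_assoc_lin_hom[OF vH vA vA]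
 note r = rslice_lin_hom[OF vA vA \<phi>]
 note r' = tensor_map_lin_hom[OF vH vAA vH vA lin_hom_id(1) r]
 show ?thesis
 proof (rule tensor_ext[OF vA vA vHA lin_hom_comp[OF r coact_lin] lin_hom_comp[OF lin_hom_comp[OF d1 as1] r'] _ t])
  fix x y assume xy: "x \<in> carrier A" "y \<in> carrier A"
  note cx = alg_hom_closed[OF coact_hom xy(1)]
  have ly: "(\<lambda>z. tens A A z y) \<in> lin_hom A AA" by (rule bilinD(2)[OF bilin_tens[OF vA vA] xy(2)])
  have "tensor_map H AA H A id (rslice A A \<phi>) (tensor_assoc H A A (tensor_map A A HA A (coact A) id (tens A A x y))) =
    tensor_map H AA H A id (rslice A A \<phi>) (tensor_map H A H AA id (\<lambda>z. tens A A z y) (coact A x))"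
   unfolding tensor_map_tens[OF vA vA vHA vA coact_lin lin_hom_id(1) xy] id_apply tensor_assoc_tens[OF vH vA vA cx xy(2)] ..
  also have "... = \<phi> y \<odot>\<^bsub>HA\<^esub> coact A x"
  proof (rule tensor_ext[OF vH vA vHA lin_hom_comp[OF tensor_map_lin_hom[OF vH vA vH vAA lin_hom_id(1) ly] r']
     lin_hom_smult_map[OF vHA] _ cx])
   fix h z assume hz: "h \<in> carrier H" "z \<in> carrier A"
   show "tensor_map H AA H A id (rslice A A \<phi>) (tensor_map H A H AA id (\<lambda>z. tens A A z y) (te h z)) = \<phi> y \<odot>\<^bsub>HA\<^esub> te h z"
    unfolding tensor_map_tens[OF vH vA vH vAA lin_hom_id(1) ly hz] id_apply
     tensor_map_tens[OF vH vAA vH vA lin_hom_id(1) r hz(1) tens_closed[OF vA vA hz(2) xy(2)]]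
     rslice_tens[OF vA vA \<phi> hz(2) xy(2)] tens_smult_right[OF vH vA hz] ..
  qed
  also have "... = coact A (rslice A A \<phi> (tens A A x y))"
   unfolding rslice_tens[OF vA vA \<phi> xy] by (rule lin_hom_smult[OF coact_lin xy(1), symmetric])
  finally show "coact A (rslice A A \<phi> (tens A A x y)) =
   tensor_map H AA H A id (rslice A A \<phi>) (tensor_assoc H A A (tensor_map A A HA A (coact A) id (tens A A x y)))" by (rule sym)
 qed
qed

text \<open>
 The counit undoes the coaction hidden in the canonical map and leaves the product.
\<close>

lemma mult_via_can:
 assumes t: "t \<in> carrier AA"
 shows "tensor_lift H A A (\<lambda>h x. B_counit E h \<odot> x) (can t) = tensor_lift A A A (\<lambda>x y. x \<otimes> y) t"
proof -
 note c = bilin_counit_alg_hom[OF kH kA B_counit_alg_hom[OF E]]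
 note \<mu> = bilin_mult[OF kA]
 show ?thesis
 proof (rule tensor_ext[OF vA vA vA lin_hom_comp[OF can_lin alg_hom_lin[OF c(1)]] tensor_lift_lin_hom[OF vA vA vA \<mu>] _ t])
  fix x y assume xy: "x \<in> carrier A" "y \<in> carrier A"
  show "tensor_lift H A A (\<lambda>h x. B_counit E h \<odot> x) (can (tens A A x y)) = tensor_lift A A A (\<lambda>x y. x \<otimes> y) (tens A A x y)"
   unfolding can_tens[OF xy] alg_hom_mult[OF c(1) alg_hom_closed[OF coact_hom xy(1)] tens_closed[OF vH vA Hone xy(2)]]
    counital[OF xy(1)] c(2)[OF Hone xy(2)] tensor_lift_tens[OF vA vA vA \<mu> xy] alg_hom_one[OF B_counit_alg_hom[OF E]]
   using vA xy by simp
 qed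
qed

text \<open>
 Let \<open>t\<^sub>i\<^sub>j\<close> have the canonical image \<open>u\<^sub>i\<^sub>j \<otimes> 1\<close>. By colinearity the coaction on the left factor turns it
 into \<open>\<Sum>k u\<^sub>i\<^sub>k \<otimes> t\<^sub>k\<^sub>j\<close>, and the product of its two factors is \<open>\<epsilon>(u\<^sub>i\<^sub>j)\<close>. Expanding all \<open>t\<^sub>i\<^sub>j\<close> along
 common right factors \<open>q\<close> therefore gives columns whose products with \<open>q\<close> sum up to the identity matrix.
\<close>

lemma enough_columns:
 "\<exists>N p q. (\<forall>j<m. \<forall>s<N. column (\<lambda>i. p i j s)) \<and> (\<forall>s<(N::nat). q s \<in> carrier A) \<and>
  (\<forall>\<phi>\<in>dual A. \<forall>i<m. \<forall>j<m. (\<Sum>s<N. \<phi> (p i j s \<otimes> q s)) = of_bool (i = j) * \<phi> \<one>)"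
proof -
 define t where "t i j = inv_into (carrier AA) can (te (u i j) \<one>)" for i j
 have u1: "te (u i j) \<one> \<in> carrier HA" if "i < m" "j < m" for i j
  by (rule tens_closed[OF vH vA uc[OF that] Aone])
 have tc: "t i j \<in> carrier AA" if "i < m" "j < m" for i j
  unfolding t_def by (rule lin_hom_closed[OF inv_into_lin_hom[OF vAA vHA can_lin can_bij] u1[OF that]])
 have ct: "can (t i j) = te (u i j) \<one>" if "i < m" "j < m" for i j
  unfolding t_def by (rule bij_betw_inv_into_right[OF can_bij u1[OF that]])
 let ?d = "\<lambda>s. tensor_assoc H A A (tensor_map A A HA A (coact A) id s)"
 let ?W = "tensor_alg H AA"
 note vW = kspace_tensor_alg[OF vH vAA]
 note d = lin_hom_comp[OF tensor_map_lin_hom[OF vA vA vHA vA coact_lin lin_hom_id(1)] tensor_assoc_lin_hom[OF vH vA vA]]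
 note inv = inv_into_lin_hom[OF vAA vHA can_lin can_bij]
 let ?c = "tensor_map H AA H HA id can" and ?g = "tensor_map H HA H AA id (inv_into (carrier AA) can)"
 have tw: "tens H AA (u i k) (t k j) \<in> carrier ?W" if "i < m" "j < m" "k < m" for i j k
  by (rule tens_closed[OF vH vAA uc tc]) (use that in auto)
 have dt: "?d (t i j) = finsum ?W (\<lambda>k. tens H AA (u i k) (t k j)) {..<m}" if ij: "i < m" "j < m" for i j
 proof -
  let ?R = "finsum ?W (\<lambda>k. tens H AA (u i k) (t k j)) {..<m}"
  have Rc: "?R \<in> carrier ?W" by (intro kspace_finsum[OF vW] tw) (use ij in auto)
  note vHH = kspace_tensor_alg[OF vH vH] and vHHA = kspace_tensor_alg[OF vH vHA]
  note c' = tensor_map_lin_hom[OF vH vAA vH vHA lin_hom_id(1) can_lin]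
  note \<Delta> = alg_hom_lin[OF B_coact_alg_hom[OF E E]]
  have l1: "(\<lambda>s. tensor_assoc H H A (tens (tensor_alg H H) A s \<one>)) \<in> lin_hom (tensor_alg H H) (tensor_alg H HA)"
   by (rule lin_hom_comp[OF bilinD(2)[OF bilin_tens[OF vHH vA] Aone] tensor_assoc_lin_hom[OF vH vH vA]])
  have uu: "tens H H (u i k) (u k j) \<in> carrier (tensor_alg H H)" if "k < m" for k
   by (rule tens_closed[OF vH vH uc uc]) (use that ij in auto)
  have "?c (?d (t i j)) = tensor_assoc H H A (tensor_map H A (tensor_alg H H) A (B_coact E E) id (te (u i j) \<one>))"
   unfolding can_colinear[OF tc[OF ij]] ct[OF ij] ..
  also have "... = tensor_assoc H H A (tens (tensor_alg H H) A (B_coact E E (u i j)) \<one>)"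
   unfolding tensor_map_tens[OF vH vA vHH vA \<Delta> lin_hom_id(1) uc[OF ij] Aone] id_apply ..
  also have "... = finsum (tensor_alg H HA) (\<lambda>k. tensor_assoc H H A (tens (tensor_alg H H) A (tens H H (u i k) (u k j)) \<one>)) {..<m}"
   unfolding B_coact_gen[OF E E ij] by (rule lin_hom_finsum_lessThan[OF vHH vHHA l1 uu])
  also have "... = finsum (tensor_alg H HA) (\<lambda>k. ?c (tens H AA (u i k) (t k j))) {..<m}"
  proof (rule kspace_finsum_cong[OF vHHA refl])
   fix k assume "k \<in> {..<m}"
   then have k: "k < m" by simp
   show "tensor_assoc H H A (tens (tensor_alg H H) A (tens H H (u i k) (u k j)) \<one>) = ?c (tens H AA (u i k) (t k j))"
    unfolding tensor_assoc_tens_tens[OF vH vH vA uc[OF ij(1) k] uc[OF k ij(2)] Aone]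
     tensor_map_tens[OF vH vAA vH vHA lin_hom_id(1) can_lin uc[OF ij(1) k] tc[OF k ij(2)]] ct[OF k ij(2)] by simp
   show "?c (tens H AA (u i k) (t k j)) \<in> carrier (tensor_alg H HA)"
    by (rule lin_hom_closed[OF c' tw[OF ij k]])
  qed
  also have "... = ?c ?R" by (rule lin_hom_finsum_lessThan[OF vW vHHA c' tw[OF ij], symmetric])
  finally have "?c (?d (t i j)) = ?c ?R" .
  then have "?g (?c (?d (t i j))) = ?g (?c ?R)" by (rule arg_cong)
  then show ?thesis
   unfolding id_can_left_inverse[OF lin_hom_closed[OF d tc[OF ij]]] id_can_left_inverse[OF Rc] .
 qed
 let ?I = "{..<m} \<times> {..<m}"
 have "finite ?I" by simp
 moreover have "(\<lambda>(i, j). t i j) x \<in> carrier AA" if "x \<in> ?I" for x using that tc by auto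
 ultimately obtain N q \<phi> where q: "\<And>s. s < N ==> q s \<in> carrier A" "\<And>s. s < N ==> \<phi> s \<in> dual A"
  and ex: "\<forall>x\<in>?I. (\<lambda>(i, j). t i j) x = finsum AA (\<lambda>s. tens A A (rslice A A (\<phi> s) ((\<lambda>(i, j). t i j) x)) (q s)) {..<N::nat}"
  using tensor_expand[OF vA vA, of ?I "\<lambda>(i, j). t i j"] by blast
 define p where "p i j s = rslice A A (\<phi> s) (t i j)" for i j s
 have pc: "p i j s \<in> carrier A" if "i < m" "j < m" "s < N" for i j s
  unfolding p_def by (rule lin_hom_closed[OF rslice_lin_hom[OF vA vA q(2)] tc]) (use that in auto)
 have tp: "t i j = finsum AA (\<lambda>s. tens A A (p i j s) (q s)) {..<N}" if "i < m" "j < m" for i j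
  using bspec[OF ex, of "(i, j)"] that unfolding p_def by simp
 have col: "column (\<lambda>i. p i j s)" if js: "j < m" "s < N" for j s
 proof (rule columnI)
  show "p i j s \<in> carrier A" if "i < m" for i by (rule pc[OF that js])
  fix i \<Phi> assume i: "i < m" and \<Phi>: "\<Phi> \<in> dual HA"
  note r = rslice_lin_hom[OF vA vA q(2)[OF js(2)]]
  note r' = tensor_map_lin_hom[OF vH vAA vH vA lin_hom_id(1) r]
  have "\<Phi> (coact A (p i j s)) = \<Phi> (tensor_map H AA H A id (rslice A A (\<phi> s)) (finsum ?W (\<lambda>k. tens H AA (u i k) (t k j)) {..<m}))"
   unfolding p_def coact_rslice[OF q(2)[OF js(2)] tc[OF i js(1)]] dt[OF i js(1)] ..
  also have "... = (\<Sum>k<m. \<Phi> (tensor_map H AA H A id (rslice A A (\<phi> s)) (tens H AA (u i k) (t k j))))"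
   by (rule dual_finsum_lessThan[OF vW dual_comp[OF r' \<Phi>] tw[OF i js(1)]])
  also have "... = (\<Sum>k<m. \<Phi> (te (u i k) (p k j s)))"
  proof (intro sum.cong refl)
   fix k assume "k \<in> {..<m}"
   then have k: "k < m" by simp
   show "\<Phi> (tensor_map H AA H A id (rslice A A (\<phi> s)) (tens H AA (u i k) (t k j))) = \<Phi> (te (u i k) (p k j s))"
    unfolding tensor_map_tens[OF vH vAA vH vA lin_hom_id(1) r uc[OF i k] tc[OF k js(1)]] p_def id_apply ..
  qed
  finally show "\<Phi> (coact A (p i j s)) = (\<Sum>k<m. \<Phi> (te (u i k) (p k j s)))" .
 qed
 have one: "(\<Sum>s<N. \<psi> (p i j s \<otimes> q s)) = of_bool (i = j) * \<psi> \<one>" if \<psi>: "\<psi> \<in> dual A" and ij: "i < m" "j < m" for \<psi> i j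
 proof -
  note \<mu> = bilin_mult[OF kA]
  note \<mu>l = tensor_lift_lin_hom[OF vA vA vA \<mu>]
  have pq: "tens A A (p i j s) (q s) \<in> carrier AA" if "s < N" for s
   by (rule tens_closed[OF vA vA pc[OF ij that] q(1)[OF that]])
  have "\<psi> (tensor_lift A A A (\<lambda>x y. x \<otimes> y) (t i j)) = (\<Sum>s<N. \<psi> (tensor_lift A A A (\<lambda>x y. x \<otimes> y) (tens A A (p i j s) (q s))))"
   unfolding tp[OF ij] by (rule dual_finsum_lessThan[OF vAA dual_comp[OF \<mu>l \<psi>] pq])
  also have "... = (\<Sum>s<N. \<psi> (p i j s \<otimes> q s))"
   by (intro sum.cong refl arg_cong[of _ _ \<psi>] tensor_lift_tens[OF vA vA vA \<mu> pc q(1)]) (use ij in auto)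
  also have "tensor_lift A A A (\<lambda>x y. x \<otimes> y) (t i j) = of_bool (i = j) \<odot> \<one>"
   unfolding mult_via_can[OF tc[OF ij], symmetric] ct[OF ij]
    bilin_counit_alg_hom(2)[OF kH kA B_counit_alg_hom[OF E] uc[OF ij] Aone] B_counit_gen[OF E ij] ..
  finally show ?thesis unfolding dual_smult[OF \<psi> Aone] by (rule sym)
 qed
 show ?thesis
  by (intro exI[of _ N] exI[of _ p] exI[of _ q] conjI ballI allI impI) (assumption | rule col q(1) one)+
qed

text \<open>
 Among the columns just found choose a smallest family that still has a right inverse; its members
 are linearly independent, since a dependent column could be absorbed by the others.
\<close>

lemma independent_columns:
 "\<exists>n a b. (\<forall>j<n. column (\<lambda>i. a i j)) \<and> (\<forall>i<(n::nat). \<forall>j<m. b i j \<in> carrier A) \<and>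
  (\<forall>\<phi>\<in>dual A. \<forall>i<m. \<forall>r<m. (\<Sum>j<n. \<phi> (a i j \<otimes> b j r)) = of_bool (i = r) * \<phi> \<one>) \<and>
  (\<forall>c. (\<forall>\<phi>\<in>dual A. \<forall>i<m. (\<Sum>j<n. c j * \<phi> (a i j)) = 0) --> (\<forall>j<n. c j = 0))"
proof -
 obtain N p q where p: "\<And>j s. j < m ==> s < N ==> column (\<lambda>i. p i j s)" and q: "\<And>s. s < (N::nat) ==> q s \<in> carrier A"
  and pq: "\<And>\<phi> i j. \<phi> \<in> dual A ==> i < m ==> j < m ==> (\<Sum>s<N. \<phi> (p i j s \<otimes> q s)) = of_bool (i = j) * \<phi> \<one>"
  using enough_columns by blast
 define S0 where "S0 = {..<m} \<times> {..<N}"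
 define a where "a i c = p i (fst c) (snd c)" for i and c :: "nat \<times> nat"
 have col: "column (\<lambda>i. a i c)" if "c \<in> S0" for c unfolding a_def by (rule p) (use that in \<open>auto simp: S0_def\<close>)
 define good where "good S \<longleftrightarrow> S \<subseteq> S0 \<and> (\<exists>b. (\<forall>c\<in>S. \<forall>r<m. b c r \<in> carrier A) \<and>
  (\<forall>\<phi>\<in>dual A. \<forall>i<m. \<forall>r<m. (\<Sum>c\<in>S. \<phi> (a i c \<otimes> b c r)) = of_bool (i = r) * \<phi> \<one>))" for S
 have "good S0"
  unfolding good_def
 proof (intro conjI subset_refl exI[of _ "\<lambda>c r. if fst c = r then q (snd c) else \<zero>"] ballI allI impI)
  show "(if fst c = r then q (snd c) else \<zero>) \<in> carrier A" if "c \<in> S0" for c r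
   using q that kspace_zero[OF vA] by (auto simp: S0_def)
  fix \<phi> i r assume \<phi>: "\<phi> \<in> dual A" and ir: "i < m" "r < m"
  have pz: "\<phi> (p i j s \<otimes> \<zero>) = 0" if "j < m" "s < N" for j s
   by (rule dual_zero[OF vA dual_mult_left[OF kA \<phi> column_closed[OF p[OF that] ir(1)]]])
  have "(\<Sum>c\<in>S0. \<phi> (a i c \<otimes> (if fst c = r then q (snd c) else \<zero>))) =
   (\<Sum>j<m. \<Sum>s<N. \<phi> (p i j s \<otimes> (if j = r then q s else \<zero>)))"
   unfolding S0_def sum.cartesian_product by (rule sum.cong) (auto simp: a_def)
  also have "... = (\<Sum>j<m. of_bool (j = r) * (\<Sum>s<N. \<phi> (p i j s \<otimes> q s)))"
   by (intro sum.cong refl) (simp add: pz)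
  also have "... = of_bool (i = r) * \<phi> \<one>"
   unfolding sum_of_bool_mult(2)[OF ir(2)] by (rule pq[OF \<phi> ir])
  finally show "(\<Sum>c\<in>S0. \<phi> (a i c \<otimes> (if fst c = r then q (snd c) else \<zero>))) = of_bool (i = r) * \<phi> \<one>" .
 qed
 then obtain S where S: "good S" and least: "\<And>T. good T ==> card S \<le> card T"
  using arg_min_natI[of good S0 card] arg_min_nat_le[of good _ card] by blast
 have fS: "finite S" using S finite_subset[of S S0] by (simp add: good_def S0_def)
 have Ssub: "S \<subseteq> S0" using S by (simp add: good_def)
 obtain b where b: "\<And>c r. c \<in> S ==> r < m ==> b c r \<in> carrier A"
  and ab: "\<And>\<phi> i r. \<phi> \<in> dual A ==> i < m ==> r < m ==> (\<Sum>c\<in>S. \<phi> (a i c \<otimes> b c r)) = of_bool (i = r) * \<phi> \<one>"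
  using S unfolding good_def by blast
 have ac: "a i c \<in> carrier A" if "c \<in> S" "i < m" for c i
  by (rule column_closed[OF col that(2)]) (use that Ssub in blast)
 have indep: "x l = 0" if l: "l \<in> S" and x: "\<And>\<phi> i. \<phi> \<in> dual A ==> i < m ==> (\<Sum>c\<in>S. x c * \<phi> (a i c)) = 0" for x l
 proof (rule ccontr)
  assume nz: "x l \<noteq> 0"
  \<comment> \<open>the column \<open>l\<close> equals minus the sum of \<open>x c / x l\<close> times the other columns\<close>
  define b' where "b' c r = b c r \<oplus> (- x c / x l) \<odot> b l r" for c r
  have "good (S - {l})"
   unfolding good_def
  proof (intro conjI exI[of _ b'] ballI allI impI)
   show "S - {l} \<subseteq> S0" using Ssub by blast
   show "b' c r \<in> carrier A" if "c \<in> S - {l}" "r < m" for c r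
    unfolding b'_def by (intro kspace_add[OF vA] kspace_smult[OF vA] b) (use that l in auto)
   fix \<phi> i r assume \<phi>: "\<phi> \<in> dual A" and ir: "i < m" "r < m"
   have b'e: "\<phi> (a i c \<otimes> b' c r) = \<phi> (a i c \<otimes> b c r) - x c * \<phi> (a i c \<otimes> b l r) / x l" if c: "c \<in> S" for c
   proof -
    note \<psi> = dual_mult_left[OF kA \<phi> ac[OF c ir(1)]]
    show ?thesis
     unfolding b'_def dual_add[OF \<psi> b[OF c ir(2)] kspace_smult[OF vA b[OF l ir(2)]]] dual_smult[OF \<psi> b[OF l ir(2)]]
     by simp
   qed
   have "(\<Sum>c\<in>S - {l}. \<phi> (a i c \<otimes> b' c r)) = (\<Sum>c\<in>S. \<phi> (a i c \<otimes> b' c r)) - \<phi> (a i l \<otimes> b' l r)"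
    using sum.remove[OF fS l, of "\<lambda>c. \<phi> (a i c \<otimes> b' c r)"] by simp
   also have "\<phi> (a i l \<otimes> b' l r) = 0" unfolding b'e[OF l] using nz by simp
   also have "(\<Sum>c\<in>S. \<phi> (a i c \<otimes> b' c r)) = (\<Sum>c\<in>S. \<phi> (a i c \<otimes> b c r)) - (\<Sum>c\<in>S. x c * \<phi> (a i c \<otimes> b l r)) / x l"
    by (simp add: b'e sum_subtractf sum_divide_distrib)
   also have "... = of_bool (i = r) * \<phi> \<one>"
    unfolding ab[OF \<phi> ir] x[OF dual_mult_right[OF kA \<phi> b[OF l ir(2)]] ir(1)] by simp
   finally show "(\<Sum>c\<in>S - {l}. \<phi> (a i c \<otimes> b' c r)) = of_bool (i = r) * \<phi> \<one>" by simp
  qed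
  from least[OF this] show False using card_Diff1_less[OF fS l] by linarith
 qed
 obtain \<rho> where \<rho>: "bij_betw \<rho> {..<card S} S"
  using ex_bij_betw_nat_finite[OF fS] by (auto simp: atLeast0LessThan)
 have \<rho>S: "\<rho> j \<in> S" if "j < card S" for j using \<rho> that by (auto simp: bij_betw_def)
 note re = sum.reindex_bij_betw[OF \<rho>]
 show ?thesis
 proof (rule exI[of _ "card S"], rule exI[of _ "\<lambda>i j. a i (\<rho> j)"], rule exI[of _ "\<lambda>j. b (\<rho> j)"], intro conjI allI impI ballI)
  show "column (\<lambda>i. a i (\<rho> j))" if "j < card S" for j using col \<rho>S[OF that] Ssub by blast
  show "b (\<rho> i) j \<in> carrier A" if "i < card S" "j < m" for i j by (rule b[OF \<rho>S[OF that(1)] that(2)])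
  show "(\<Sum>j<card S. \<phi> (a i (\<rho> j) \<otimes> b (\<rho> j) r)) = of_bool (i = r) * \<phi> \<one>"
   if "\<phi> \<in> dual A" "i < m" "r < m" for \<phi> i r
   unfolding re[of "\<lambda>c. \<phi> (a i c \<otimes> b c r)"] by (rule ab[OF that])
  fix x :: "nat => 'k" and j
  assume x: "\<forall>\<phi>\<in>dual A. \<forall>i<m. (\<Sum>j<card S. x j * \<phi> (a i (\<rho> j))) = 0" and j: "j < card S"
  define y where "y = (\<lambda>c. x (inv_into {..<card S} \<rho> c))"
  have yr: "y (\<rho> j) = x j" if "j < card S" for j
   unfolding y_def using bij_betw_inv_into_left[OF \<rho>, of j] that by simp
  have "y (\<rho> j) = 0"
  proof (rule indep[OF \<rho>S[OF j]])
   fix \<phi> i assume \<phi>: "\<phi> \<in> dual A" "i < m"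
   have "(\<Sum>c\<in>S. y c * \<phi> (a i c)) = (\<Sum>j<card S. y (\<rho> j) * \<phi> (a i (\<rho> j)))" by (rule re[symmetric])
   also have "... = (\<Sum>j<card S. x j * \<phi> (a i (\<rho> j)))" by (intro sum.cong refl) (simp add: yr)
   finally show "(\<Sum>c\<in>S. y c * \<phi> (a i c)) = 0" using x \<phi> by simp
  qed
  then show "x j = 0" unfolding yr[OF j] .
 qed
qed

end

section \<open>Every Galois object is some \<open>\<B>(E,F)\<close>\<close>

lemma BR_trace:
 fixes A (structure)
 assumes r: "BR A m n E E' F F' a" and \<phi>: "\<phi> \<in> dual A" "\<phi> \<one> = 1"
 shows "(\<Sum>i<n. \<Sum>j<n. F' i j * F i j) = (\<Sum>k<m. \<Sum>l<m. E k l * E' k l)"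
proof -
 have "(\<Sum>i<n. \<Sum>j<n. F' i j * F i j) =
   (\<Sum>i<n. \<Sum>j<n. F' i j * (\<Sum>k<m. \<Sum>l<m. E k l * \<phi> (a k i \<otimes> a l j)))"
  using BR1[OF r \<phi>(1)] \<phi>(2) by simp
 also have "... = (\<Sum>i<n. \<Sum>j<n. \<Sum>k<m. \<Sum>l<m. E k l * (F' i j * \<phi> (a k i \<otimes> a l j)))"
  by (simp add: sum_distrib_left mult.left_commute)
 also have "... = (\<Sum>k<m. \<Sum>l<m. \<Sum>i<n. \<Sum>j<n. E k l * (F' i j * \<phi> (a k i \<otimes> a l j)))"
  by (rule sum_swap4)
 also have "... = (\<Sum>k<m. \<Sum>l<m. E k l * E' k l)"
  using BR2[OF r \<phi>(1)] \<phi>(2) by (simp flip: sum_distrib_left)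
 finally show ?thesis .
qed

text \<open>
 With a single column \<open>x\<close> all products \<open>x\<^sub>k x\<^sub>l\<close> would be scalars, and comparing the two ways to
 bracket \<open>x\<^sub>k x\<^sub>l x\<^sub>r x\<^sub>t\<close> shows that \<open>E'\<close> would have rank at most one.
\<close>

lemma BR_two_columns:
 fixes A :: "('k::field, 'a, 'z) module_scheme" (structure)
 assumes A: "k_algebra A" and r: "BR A m n E E' F F' a" and \<phi>: "\<phi> \<in> dual A" "\<phi> \<one> = 1"
  and E: "inverse_fun m E E'" and m: "2 \<le> m"
 shows "2 \<le> n"
proof (rule ccontr)
 assume n: "\<not> 2 \<le> n"
 have nz: False if "\<forall>k<m. \<forall>l<m. E' k l = 0"
  using inverse_funD(1)[OF E, of 0 0] m that by simp
 show False
 proof (cases "n = 0")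
  case True
  then show False using BR2[OF r \<phi>(1)] \<phi>(2) nz by simp
 next
  case False
  with n have n1: "n = 1" by linarith
  let ?c = "F' 0 0"
  have ac: "a k 0 \<in> carrier A" if "k < m" for k using BR_closed[OF r that] n1 by simp
  have s: "?c * \<psi> (a k 0 \<otimes> a l 0) = E' k l * \<psi> \<one>" if "\<psi> \<in> dual A" "k < m" "l < m" for \<psi> k l
   using BR2[OF r that] n1 by simp
  have eq: "E' k l * E' r t = E' l r * E' k t" if klrt: "k < m" "l < m" "r < m" "t < m" for k l r t
  proof -
   let ?rt = "a r 0 \<otimes> a t 0"
   have rt: "?rt \<in> carrier A" using A ac klrt by simp
   note d1 = dual_mult_right[OF A \<phi>(1) rt]
   have "?c * (?c * \<phi> ((a k 0 \<otimes> a l 0) \<otimes> ?rt)) = ?c * (E' k l * \<phi> (\<one> \<otimes> ?rt))"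
    by (rule arg_cong[OF s[OF d1 klrt(1,2)]])
   also have "... = E' k l * (?c * \<phi> ?rt)" using A rt by simp
   also have "... = E' k l * E' r t" using s[OF \<phi>(1) klrt(3,4)] \<phi>(2) by simp
   finally have 1: "?c * (?c * \<phi> ((a k 0 \<otimes> a l 0) \<otimes> ?rt)) = E' k l * E' r t" .
   have "(a k 0 \<otimes> a l 0) \<otimes> ?rt = a k 0 \<otimes> ((a l 0 \<otimes> a r 0) \<otimes> a t 0)"
    using k_algebra_assoc[OF A] k_algebra_mult[OF A] ac klrt by simp
   then have "?c * (?c * \<phi> ((a k 0 \<otimes> a l 0) \<otimes> ?rt)) =
     ?c * (?c * \<phi> (a k 0 \<otimes> ((a l 0 \<otimes> a r 0) \<otimes> a t 0)))" by simp
   also have "... = ?c * (E' l r * \<phi> (a k 0 \<otimes> (\<one> \<otimes> a t 0)))"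
    by (rule arg_cong[OF s[OF dual_mult_right[OF A dual_mult_left[OF A \<phi>(1) ac[OF klrt(1)]] ac[OF klrt(4)]] klrt(2,3)]])
   also have "... = E' l r * (?c * \<phi> (a k 0 \<otimes> a t 0))" using A ac klrt by simp
   also have "... = E' l r * E' k t" using s[OF \<phi>(1) klrt(1,4)] \<phi>(2) by simp
   finally show ?thesis using 1 by simp
  qed
  have "E' k l = 0" if kl: "k < m" "l < m" for k l
  proof -
   obtain r where rk: "r < m" "r \<noteq> k" using m by (cases "k = 0") (auto intro: that[of 0] that[of 1])
   have "E' k l * (\<Sum>t<m. E' r t * E t r) = E' l r * (\<Sum>t<m. E' k t * E t r)"
    unfolding sum_distrib_left using eq[OF kl rk(1)] by (intro sum.cong refl) (simp flip: mult.assoc)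
   then show ?thesis
    using inverse_funD(2)[OF E rk(1) rk(1)] inverse_funD(2)[OF E kl(1) rk(1)] rk(2) by simp
  qed
  then show False using nz by blast
 qed
qed

lemma GL_if_left_kernel_trivial:
 fixes F :: "'k::field mat"
 assumes F: "F \<in> carrier_mat n n"
  and ker: "\<And>c. (\<And>j. j < n ==> (\<Sum>i<n. c i * F $$ (i, j)) = 0) ==> \<forall>i<n. c i = 0"
 shows "F \<in> GL n"
proof -
 have t: "transpose_mat F \<in> carrier_mat n n" using F by simp
 have "det (transpose_mat F) \<noteq> 0"
 proof
  assume "det (transpose_mat F) = 0"
  then obtain v where v: "v \<in> carrier_vec n" "v \<noteq> 0\<^sub>v n" "transpose_mat F *\<^sub>v v = 0\<^sub>v n"
   unfolding det_0_iff_vec_prod_zero_field[OF t] by blast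
  have "(\<Sum>i<n. v $ i * F $$ (i, j)) = 0" if j: "j < n" for j
  proof -
   have "(transpose_mat F *\<^sub>v v) $ j = (\<Sum>i<n. F $$ (i, j) * v $ i)"
    using v(1) F j by (simp add: scalar_prod_def atLeast0LessThan)
   then show ?thesis unfolding v(3) using j by (simp add: mult.commute)
  qed
  from ker[OF this] have "\<forall>i<n. v $ i = 0" by blast
  then have "v = 0\<^sub>v n" using v(1) by (intro eq_vecI) auto
  then show False using v(2) by contradiction
 qed
 then have "det F \<noteq> 0" unfolding det_transpose[OF F] .
 then show ?thesis unfolding GL_def by (rule det_non_zero_imp_unit[OF F])
qed

context galois_over_B
begin

text \<open>
 For a linearly independent family \<open>a\<close> of columns with right inverse \<open>b\<close> the matrix \<open>F = a\<^sup>t E a\<close> has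
 scalar entries. It is invertible: \<open>c\<^sup>t F = 0\<close> gives \<open>(a c)\<^sup>t E = (a c)\<^sup>t E a b = 0\<close>, hence \<open>a c = 0\<close> and \<open>c = 0\<close>.
 Then \<open>b = F\<^sup>-\<^sup>1 a\<^sup>t E\<close>, so that \<open>a\<close> solves the relations of \<open>\<B>(E,F)\<close>.
\<close>

lemma column_solution:
 "\<exists>n F a. F \<in> GL n \<and> BR A m n (entry E) (entry (minv E)) (entry F) (entry (minv F)) a \<and>
   (\<forall>j<n. column (\<lambda>i. a i j))"
proof -
 from independent_columns obtain n a b where ic:
  "(\<forall>j<n. column (\<lambda>i. a i j)) \<and> (\<forall>i<(n::nat). \<forall>j<m. b i j \<in> carrier A) \<and>
  (\<forall>\<phi>\<in>dual A. \<forall>i<m. \<forall>r<m. (\<Sum>j<n. \<phi> (a i j \<otimes> b j r)) = of_bool (i = r) * \<phi> \<one>) \<and>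
  (\<forall>c. (\<forall>\<phi>\<in>dual A. \<forall>i<m. (\<Sum>j<n. c j * \<phi> (a i j)) = 0) --> (\<forall>j<n. c j = 0))"
  by (elim exE)
 note col = ic[THEN conjunct1, rule_format]
  and b = ic[THEN conjunct2, THEN conjunct1, rule_format]
  and ab = ic[THEN conjunct2, THEN conjunct2, THEN conjunct1, rule_format]
 have indep: "\<forall>j<n. c j = 0" if "\<And>\<phi> i. \<phi> \<in> dual A ==> i < m ==> (\<Sum>j<n. c j * \<phi> (a i j)) = 0" for c
  by (rule ic[THEN conjunct2, THEN conjunct2, THEN conjunct2, THEN spec, THEN mp]) (intro ballI allI impI that)
 have ac: "a i j \<in> carrier A" if "i < m" "j < n" for i j by (rule column_closed[OF col[OF that(2)] that(1)])
 define f where "f i j = (SOME c. \<forall>\<phi>\<in>dual A. (\<Sum>k<m. \<Sum>l<m. E $$ (k, l) * \<phi> (a k i \<otimes> a l j)) = c * \<phi> \<one>)" for i j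
 have f: "(\<Sum>k<m. \<Sum>l<m. E $$ (k, l) * \<phi> (a k i \<otimes> a l j)) = f i j * \<phi> \<one>" if "i < n" "j < n" "\<phi> \<in> dual A" for i j \<phi>
  unfolding f_def by (rule bspec[OF someI_ex[OF column_pairing_scalar[OF col[OF that(1)] col[OF that(2)]]] that(3)])
 define F where "F = mat n n (\<lambda>(i, j). f i j)"
 have Fe: "F $$ (i, j) = f i j" if "i < n" "j < n" for i j using that by (simp add: F_def)
 have Fc: "F \<in> carrier_mat n n" by (simp add: F_def)
 note iE = GL_inverse_fun[OF E]
 \<comment> \<open>the identity \<open>F b = a\<^sup>t E\<close>\<close>
 have Fb: "(\<Sum>j<n. F $$ (i, j) * \<psi> (b j r)) = (\<Sum>k<m. E $$ (k, r) * \<psi> (a k i))" if \<psi>: "\<psi> \<in> dual A" and ir: "i < n" "r < m" for \<psi> i r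
 proof -
  have "(\<Sum>j<n. F $$ (i, j) * \<psi> (b j r)) = (\<Sum>j<n. \<Sum>k<m. \<Sum>l<m. E $$ (k, l) * \<psi> ((a k i \<otimes> a l j) \<otimes> b j r))"
  proof (intro sum.cong refl)
   fix j assume "j \<in> {..<n}"
   then have j: "j < n" by simp
   show "F $$ (i, j) * \<psi> (b j r) = (\<Sum>k<m. \<Sum>l<m. E $$ (k, l) * \<psi> ((a k i \<otimes> a l j) \<otimes> b j r))"
    unfolding f[OF ir(1) j dual_mult_right[OF kA \<psi> b[OF j ir(2)]]] Fe[OF ir(1) j] k_algebra_lone[OF kA b[OF j ir(2)]] ..
  qed
  also have "... = (\<Sum>k<m. \<Sum>j<n. \<Sum>l<m. E $$ (k, l) * \<psi> ((a k i \<otimes> a l j) \<otimes> b j r))"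
   by (rule sum.swap)
  also have "... = (\<Sum>k<m. \<Sum>l<m. \<Sum>j<n. E $$ (k, l) * \<psi> ((a k i \<otimes> a l j) \<otimes> b j r))"
   by (intro sum.cong refl sum.swap)
  also have "... = (\<Sum>k<m. \<Sum>l<m. E $$ (k, l) * \<psi> (a k i) * of_bool (l = r))"
  proof (intro sum.cong refl)
   fix k l assume "k \<in> {..<m}" "l \<in> {..<m}"
   then have kl: "k < m" "l < m" by simp_all
   have "(\<Sum>j<n. E $$ (k, l) * \<psi> ((a k i \<otimes> a l j) \<otimes> b j r)) = E $$ (k, l) * (\<Sum>j<n. \<psi> (a k i \<otimes> (a l j \<otimes> b j r)))"
    unfolding sum_distrib_left
    by (intro sum.cong refl) (use k_algebra_assoc[OF kA ac[OF kl(1) ir(1)] ac[OF kl(2)] b[OF _ ir(2)]] in simp)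
   also have "... = E $$ (k, l) * (of_bool (l = r) * \<psi> (a k i \<otimes> \<one>))"
    unfolding ab[OF dual_mult_left[OF kA \<psi> ac[OF kl(1) ir(1)]] kl(2) ir(2)] ..
   also have "... = E $$ (k, l) * \<psi> (a k i) * of_bool (l = r)"
    unfolding k_algebra_rone[OF kA ac[OF kl(1) ir(1)]] by simp
   finally show "(\<Sum>j<n. E $$ (k, l) * \<psi> ((a k i \<otimes> a l j) \<otimes> b j r)) = E $$ (k, l) * \<psi> (a k i) * of_bool (l = r)" .
  qed
  also have "... = (\<Sum>k<m. E $$ (k, r) * \<psi> (a k i))"
   by (intro sum.cong refl sum_of_bool_mult(4)[OF ir(2)])
  finally show ?thesis .
 qed
 have GL: "F \<in> GL n"
 proof (rule GL_if_left_kernel_trivial[OF Fc])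
  fix c assume c: "\<And>j. j < n ==> (\<Sum>i<n. c i * F $$ (i, j)) = 0"
  show "\<forall>i<n. c i = 0"
  proof (rule indep)
   fix \<phi> r assume \<phi>: "\<phi> \<in> dual A" and r: "r < m"
   define y where "y k = (\<Sum>i<n. c i * \<phi> (a k i))" for k
   have y0: "(\<Sum>k<m. y k * E $$ (k, s)) = 0" if s: "s < m" for s
   proof -
    have "(\<Sum>k<m. y k * E $$ (k, s)) = (\<Sum>k<m. \<Sum>i<n. c i * (E $$ (k, s) * \<phi> (a k i)))"
     unfolding y_def sum_distrib_right by (simp add: mult_ac)
    also have "... = (\<Sum>i<n. \<Sum>k<m. c i * (E $$ (k, s) * \<phi> (a k i)))" by (rule sum.swap)
    also have "... = (\<Sum>i<n. c i * (\<Sum>j<n. F $$ (i, j) * \<phi> (b j s)))"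
     by (intro sum.cong refl) (simp add: Fb[OF \<phi> _ s] sum_distrib_left)
    also have "... = (\<Sum>i<n. \<Sum>j<n. c i * F $$ (i, j) * \<phi> (b j s))"
     by (simp add: sum_distrib_left mult.assoc)
    also have "... = (\<Sum>j<n. \<Sum>i<n. c i * F $$ (i, j) * \<phi> (b j s))" by (rule sum.swap)
    also have "... = 0" using c by (simp flip: sum_distrib_right)
    finally show ?thesis .
   qed
   have "y r = (\<Sum>s<m. (\<Sum>k<m. y k * E $$ (k, s)) * minv E $$ (s, r))"
    by (rule inverse_fun_cancel_right[OF iE r, symmetric])
   also have "... = 0" using y0 by simp
   finally show "(\<Sum>j<n. c j * \<phi> (a r j)) = 0" unfolding y_def .
  qed
 qed
 note iF = GL_inverse_fun[OF GL]
 have bF: "\<psi> (b j r) = (\<Sum>i<n. minv F $$ (j, i) * (\<Sum>k<m. E $$ (k, r) * \<psi> (a k i)))" if \<psi>: "\<psi> \<in> dual A" and jr: "j < n" "r < m" for \<psi> j r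
 proof -
  have "\<psi> (b j r) = (\<Sum>i<n. minv F $$ (j, i) * (\<Sum>j<n. F $$ (i, j) * \<psi> (b j r)))"
   by (rule inverse_fun_cancel[OF inverse_fun_sym[OF iF] jr(1), symmetric])
  also have "... = (\<Sum>i<n. minv F $$ (j, i) * (\<Sum>k<m. E $$ (k, r) * \<psi> (a k i)))"
   using Fb[OF \<psi> _ jr(2)] by (intro sum.cong refl) simp
  finally show ?thesis .
 qed
 have "BR A m n (entry E) (entry (minv E)) (entry F) (entry (minv F)) a"
 proof (rule BRI)
  show "a i j \<in> carrier A" if "i < m" "j < n" for i j by (rule ac[OF that])
  fix \<phi> assume \<phi>: "\<phi> \<in> dual A"
  show "(\<Sum>k<m. \<Sum>l<m. E $$ (k, l) * \<phi> (a k i \<otimes> a l j)) = F $$ (i, j) * \<phi> \<one>" if "i < n" "j < n" for i j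
   unfolding Fe[OF that] by (rule f[OF that \<phi>])
  fix l q assume lq: "l < m" "q < m"
  define z where "z k = (\<Sum>j<n. \<Sum>i<n. minv F $$ (j, i) * \<phi> (a l j \<otimes> a k i))" for k
  have zE: "(\<Sum>k<m. z k * E $$ (k, r)) = of_bool (l = r) * \<phi> \<one>" if r: "r < m" for r
  proof -
   have "(\<Sum>k<m. z k * E $$ (k, r)) = (\<Sum>k<m. \<Sum>j<n. \<Sum>i<n. minv F $$ (j, i) * (E $$ (k, r) * \<phi> (a l j \<otimes> a k i)))"
    unfolding z_def sum_distrib_right by (simp add: mult_ac)
   also have "... = (\<Sum>j<n. \<Sum>k<m. \<Sum>i<n. minv F $$ (j, i) * (E $$ (k, r) * \<phi> (a l j \<otimes> a k i)))"
    by (rule sum.swap)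
   also have "... = (\<Sum>j<n. \<Sum>i<n. \<Sum>k<m. minv F $$ (j, i) * (E $$ (k, r) * \<phi> (a l j \<otimes> a k i)))"
    by (intro sum.cong refl sum.swap)
   also have "... = (\<Sum>j<n. \<phi> (a l j \<otimes> b j r))"
    by (intro sum.cong refl) (use bF[OF dual_mult_left[OF kA \<phi> ac[OF lq(1)]] _ r] in \<open>simp add: sum_distrib_left\<close>)
   also have "... = of_bool (l = r) * \<phi> \<one>" by (rule ab[OF \<phi> lq(1) r])
   finally show ?thesis .
  qed
  have "z q = (\<Sum>r<m. (\<Sum>k<m. z k * E $$ (k, r)) * minv E $$ (r, q))"
   by (rule inverse_fun_cancel_right[OF iE lq(2), symmetric])
  also have "... = (\<Sum>r<m. of_bool (l = r) * (\<phi> \<one> * minv E $$ (r, q)))"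
   by (intro sum.cong refl) (simp add: zE)
  also have "... = minv E $$ (l, q) * \<phi> \<one>"
   unfolding sum_of_bool_mult(1)[OF lq(1)] by (rule mult.commute)
  finally show "(\<Sum>i<n. \<Sum>j<n. minv F $$ (i, j) * \<phi> (a l i \<otimes> a q j)) = minv E $$ (l, q) * \<phi> \<one>"
   unfolding z_def .
 qed
 then show ?thesis using GL col by blast
qed

text \<open>
 Both sides are algebra morphisms in \<open>x\<close>, so only the generators matter.
\<close>

lemma colinear_of_columns:
 assumes F: "F \<in> GL n" and f: "f \<in> alg_hom (B_alg E F) A"
  and col: "\<And>j. j < n ==> column (\<lambda>i. f (B_gen E F i j))"
  and x: "x \<in> carrier (B_alg E F)"
 shows "coact A (f x) = tensor_map H (B_alg E F) H A id f (B_coact E F x)"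
proof -
 let ?C = "B_alg E F"
 note kC = k_algebra_B[OF E F] and gc = B_gen_closed[OF E F]
 note vC = k_algebra_kspace[OF kC]
 have idH: "id \<in> alg_hom H H" by (auto intro!: alg_homI)
 note M = tensor_map_alg_hom[OF kH kC kH kA idH f]
 note vHC = kspace_tensor_alg[OF vH vC]
 show ?thesis
 proof (rule B_ext[OF E F kHA alg_hom_comp[OF f coact_hom] alg_hom_comp[OF B_coact_alg_hom[OF E F] M] _ x])
  fix i j assume ij: "i < m" "j < n"
  have t: "tens H ?C (u i k) (B_gen E F k j) \<in> carrier (tensor_alg H ?C)" if "k < m" for k
   by (rule tens_closed[OF vH vC uc[OF ij(1) that] gc[OF that ij(2)]])
  have "tensor_map H ?C H A id f (B_coact E F (B_gen E F i j)) =
    finsum HA (\<lambda>k. tensor_map H ?C H A id f (tens H ?C (u i k) (B_gen E F k j))) {..<m}"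
   unfolding B_coact_gen[OF E F ij] by (rule lin_hom_finsum_lessThan[OF vHC vHA alg_hom_lin[OF M] t])
  also have "... = finsum HA (\<lambda>k. te (u i k) (f (B_gen E F k j))) {..<m}"
  proof (rule kspace_finsum_cong[OF vHA refl])
   fix k assume "k \<in> {..<m}"
   then have k: "k < m" by simp
   show "tensor_map H ?C H A id f (tens H ?C (u i k) (B_gen E F k j)) = te (u i k) (f (B_gen E F k j))"
    unfolding tensor_map_tens[OF vH vC vH vA lin_hom_id(1) alg_hom_lin[OF f] uc[OF ij(1) k] gc[OF k ij(2)]] id_apply ..
   show "te (u i k) (f (B_gen E F k j)) \<in> carrier HA"
    by (rule tens_closed[OF vH vA uc[OF ij(1) k] alg_hom_closed[OF f gc[OF k ij(2)]]])
  qed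
  also have "... = coact A (f (B_gen E F i j))" by (rule column_coact[OF col[OF ij(2)] ij(1), symmetric])
  finally show "coact A (f (B_gen E F i j)) = tensor_map H ?C H A id f (B_coact E F (B_gen E F i j))" by (rule sym)
 qed
qed

lemma iso_of_columns:
 assumes F: "F \<in> GL n" and a: "BR A m n (entry E) (entry (minv E)) (entry F) (entry (minv F)) a"
  and col: "\<And>j. j < n ==> column (\<lambda>i. a i j)"
 shows "comod_alg_iso (B_hopf E) (B_comod E F) A"
proof -
 obtain f where f: "f \<in> alg_hom (B_alg E F) A" and fg: "\<And>i j. i < m ==> j < n ==> f (B_gen E F i j) = a i j"
  using B_hom_ex[OF E F kA a] by blast
 have col': "column (\<lambda>i. f (B_gen E F i j))" if j: "j < n" for j
 proof (rule columnI)
  fix i assume i: "i < m"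
  show "f (B_gen E F i j) \<in> carrier A" unfolding fg[OF i j] by (rule column_closed[OF col[OF j] i])
  fix \<Phi> assume \<Phi>: "\<Phi> \<in> dual HA"
  show "\<Phi> (coact A (f (B_gen E F i j))) = (\<Sum>k<m. \<Phi> (te (u i k) (f (B_gen E F k j))))"
   unfolding fg[OF i j] column_coact_dual[OF col[OF j] i \<Phi>] by (intro sum.cong refl) (simp add: fg j)
 qed
 note colin = colinear_of_columns[OF F f col']
 show ?thesis
  unfolding comod_alg_iso_def B_hopf_conv B_comod_conv B_comod_sel
 proof (intro exI[of _ f] conjI ballI)
  show "f \<in> alg_hom (B_alg E F) A" by (rule f)
  show "bij_betw f (carrier (B_alg E F)) (carrier A)" by (rule B_to_galois_bij[OF E F galois f colin])
 qed (rule colin)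
qed

lemma classification:
 assumes m: "2 \<le> m"
 shows "\<exists>F\<in>X0 E. comod_alg_iso (B_hopf E) (B_comod E F) A"
proof -
 obtain n F a where F: "F \<in> GL n" and a: "BR A m n (entry E) (entry (minv E)) (entry F) (entry (minv F)) a"
  and col: "\<And>j. j < n ==> column (\<lambda>i. a i j)"
  using column_solution by blast
 obtain \<phi> where \<phi>: "\<phi> \<in> dual A" "\<phi> \<one> = 1" using dual_one by blast
 have "2 \<le> n" by (rule BR_two_columns[OF kA a \<phi> GL_inverse_fun[OF E] m])
 moreover have "tr (minv E * transpose_mat E) = tr (minv F * transpose_mat F)"
  unfolding tr_minv_transpose[OF E] tr_minv_transpose[OF F] BR_trace[OF a \<phi>] by (intro sum.cong refl mult.commute)
 ultimately have "F \<in> X0 E" using F unfolding X0_def by blast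
 then show ?thesis using iso_of_columns[OF F a col] by blast
qed

end

section \<open>Isomorphisms between the algebras \<open>\<B>(E,F)\<close>\<close>

context galois_over_B
begin

text \<open>
 One has \<open>x = g G\<^sup>-\<^sup>1 g\<^sup>t E x\<close>, and the entries of \<open>g\<^sup>t E x\<close> are scalars, being pairings of columns.
\<close>

lemma column_expansion:
 assumes g: "BR A m p (entry E) (entry (minv E)) G G' g" and cg: "\<And>j. j < p ==> column (\<lambda>i. g i j)"
  and x: "column x"
 shows "\<exists>P. \<forall>\<phi>\<in>dual A. \<forall>r<m. \<phi> (x r) = (\<Sum>i<p. P i * \<phi> (g r i))"
proof -
 note gc = BR_closed[OF g] and xc = column_closed[OF x]
 define z where "z j = (SOME c. \<forall>\<phi>\<in>dual A. (\<Sum>k<m. \<Sum>l<m. E $$ (k, l) * \<phi> (g k j \<otimes> x l)) = c * \<phi> \<one>)" for j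
 have z: "(\<Sum>k<m. \<Sum>l<m. E $$ (k, l) * \<phi> (g k j \<otimes> x l)) = z j * \<phi> \<one>" if "j < p" "\<phi> \<in> dual A" for j \<phi>
  unfolding z_def by (rule bspec[OF someI_ex[OF column_pairing_scalar[OF cg[OF that(1)] x]] that(2)])
 have "\<phi> (x r) = (\<Sum>i<p. (\<Sum>j<p. G' i j * z j) * \<phi> (g r i))" if \<phi>: "\<phi> \<in> dual A" and r: "r < m" for \<phi> r
 proof -
  have "(\<Sum>i<p. (\<Sum>j<p. G' i j * z j) * \<phi> (g r i)) = (\<Sum>i<p. \<Sum>j<p. G' i j * (z j * \<phi> (g r i)))"
   by (simp add: sum_distrib_right mult.assoc)
  also have "... = (\<Sum>i<p. \<Sum>j<p. \<Sum>k<m. \<Sum>l<m. G' i j * (E $$ (k, l) * \<phi> ((g r i \<otimes> g k j) \<otimes> x l)))"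
  proof (intro sum.cong refl)
   fix i j assume "i \<in> {..<p}" "j \<in> {..<p}"
   then have ij: "i < p" "j < p" by simp_all
   have "z j * \<phi> (g r i) = (\<Sum>k<m. \<Sum>l<m. E $$ (k, l) * \<phi> (g r i \<otimes> (g k j \<otimes> x l)))"
    unfolding z[OF ij(2) dual_mult_left[OF kA \<phi> gc[OF r ij(1)]]] k_algebra_rone[OF kA gc[OF r ij(1)]] ..
   also have "... = (\<Sum>k<m. \<Sum>l<m. E $$ (k, l) * \<phi> ((g r i \<otimes> g k j) \<otimes> x l))"
    by (intro sum.cong refl) (use k_algebra_assoc[OF kA gc[OF r ij(1)] gc[OF _ ij(2)] xc] in simp)
   finally show "G' i j * (z j * \<phi> (g r i)) = (\<Sum>k<m. \<Sum>l<m. G' i j * (E $$ (k, l) * \<phi> ((g r i \<otimes> g k j) \<otimes> x l)))"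
    by (simp add: sum_distrib_left)
  qed
  also have "... = (\<Sum>k<m. \<Sum>l<m. \<Sum>i<p. \<Sum>j<p. G' i j * (E $$ (k, l) * \<phi> ((g r i \<otimes> g k j) \<otimes> x l)))"
   by (rule sum_swap4)
  also have "... = (\<Sum>k<m. \<Sum>l<m. minv E $$ (r, k) * (E $$ (k, l) * \<phi> (x l)))"
  proof (intro sum.cong refl)
   fix k l assume "k \<in> {..<m}" "l \<in> {..<m}"
   then have kl: "k < m" "l < m" by simp_all
   have "(\<Sum>i<p. \<Sum>j<p. G' i j * (E $$ (k, l) * \<phi> ((g r i \<otimes> g k j) \<otimes> x l))) =
     E $$ (k, l) * (\<Sum>i<p. \<Sum>j<p. G' i j * \<phi> ((g r i \<otimes> g k j) \<otimes> x l))"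
    by (simp add: sum_distrib_left mult.left_commute)
   also have "... = E $$ (k, l) * (minv E $$ (r, k) * \<phi> (x l))"
    unfolding BR2[OF g dual_mult_right[OF kA \<phi> xc[OF kl(2)]] r kl(1)] k_algebra_lone[OF kA xc[OF kl(2)]] ..
   finally show "(\<Sum>i<p. \<Sum>j<p. G' i j * (E $$ (k, l) * \<phi> ((g r i \<otimes> g k j) \<otimes> x l))) =
     minv E $$ (r, k) * (E $$ (k, l) * \<phi> (x l))" by (simp add: mult.left_commute)
  qed
  also have "... = (\<Sum>k<m. minv E $$ (r, k) * (\<Sum>l<m. E $$ (k, l) * \<phi> (x l)))" by (simp add: sum_distrib_left)
  also have "... = \<phi> (x r)" by (rule inverse_fun_cancel[OF inverse_fun_sym[OF GL_inverse_fun[OF E]] r])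
  finally show ?thesis by (rule sym)
 qed
 then show ?thesis by (intro exI[of _ "\<lambda>i. \<Sum>j<p. G' i j * z j"] ballI allI impI)
qed

lemma column_combination:
 assumes g: "\<And>l. l < (p::nat) ==> column (\<lambda>i. g i l)"
 shows "column (\<lambda>i. finsum A (\<lambda>l. c l \<odot> g i l) {..<p})"
proof (rule columnI)
 have gc: "g i l \<in> carrier A" if "i < m" "l < p" for i l by (rule column_closed[OF g[OF that(2)] that(1)])
 have t: "c l \<odot> g i l \<in> carrier A" if "i < m" "l < p" for i l by (rule kspace_smult[OF vA gc[OF that]])
 fix i assume i: "i < m"
 show "finsum A (\<lambda>l. c l \<odot> g i l) {..<p} \<in> carrier A" by (intro kspace_finsum[OF vA] t) (use i in auto)
 fix \<Phi> assume \<Phi>: "\<Phi> \<in> dual HA"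
 have ev: "\<psi> (finsum A (\<lambda>l. c l \<odot> g k l) {..<p}) = (\<Sum>l<p. c l * \<psi> (g k l))" if "\<psi> \<in> dual A" "k < m" for \<psi> k
 proof -
  have "\<psi> (finsum A (\<lambda>l. c l \<odot> g k l) {..<p}) = (\<Sum>l<p. \<psi> (c l \<odot> g k l))"
   by (rule dual_finsum_lessThan[OF vA that(1)]) (rule t[OF that(2)])
  also have "... = (\<Sum>l<p. c l * \<psi> (g k l))"
   by (intro sum.cong refl dual_smult[OF that(1)] gc that(2)) simp
  finally show ?thesis .
 qed
 have "\<Phi> (coact A (finsum A (\<lambda>l. c l \<odot> g i l) {..<p})) = (\<Sum>l<p. c l * \<Phi> (coact A (g i l)))"
  by (rule ev[OF dual_comp[OF coact_lin \<Phi>] i])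
 also have "... = (\<Sum>l<p. \<Sum>k<m. c l * \<Phi> (te (u i k) (g k l)))"
  by (intro sum.cong refl) (simp add: column_coact_dual[OF g i \<Phi>] sum_distrib_left)
 also have "... = (\<Sum>k<m. \<Sum>l<p. c l * \<Phi> (te (u i k) (g k l)))" by (rule sum.swap)
 also have "... = (\<Sum>k<m. \<Phi> (te (u i k) (finsum A (\<lambda>l. c l \<odot> g k l) {..<p})))"
  by (intro sum.cong refl ev[OF dual_tens_right[OF vH vA \<Phi> uc[OF i]], symmetric]) auto
 finally show "\<Phi> (coact A (finsum A (\<lambda>l. c l \<odot> g i l) {..<p})) =
  (\<Sum>k<m. \<Phi> (te (u i k) (finsum A (\<lambda>l. c l \<odot> g k l) {..<p})))" .
qed

lemma column_of_colinear:
 assumes F: "F \<in> GL n" and f: "f \<in> alg_hom (B_alg E F) A"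
  and colin: "\<And>x. x \<in> carrier (B_alg E F) ==> coact A (f x) = tensor_map H (B_alg E F) H A id f (B_coact E F x)"
  and j: "j < n"
 shows "column (\<lambda>i. f (B_gen E F i j))"
proof (rule columnI)
 let ?C = "B_alg E F"
 note kC = k_algebra_B[OF E F] and gc = B_gen_closed[OF E F]
 note vC = k_algebra_kspace[OF kC]
 fix i assume i: "i < m"
 show "f (B_gen E F i j) \<in> carrier A" by (rule alg_hom_closed[OF f gc[OF i j]])
 fix \<Phi> assume \<Phi>: "\<Phi> \<in> dual HA"
 note M = tensor_map_lin_hom[OF vH vC vH vA lin_hom_id(1) alg_hom_lin[OF f]]
 have "\<Phi> (coact A (f (B_gen E F i j))) = (\<Sum>k<m. \<Phi> (tensor_map H ?C H A id f (tens H ?C (u i k) (B_gen E F k j))))"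
  unfolding colin[OF gc[OF i j]] by (rule B_coact_gen_dual[OF E F dual_comp[OF M \<Phi>] i j])
 also have "... = (\<Sum>k<m. \<Phi> (te (u i k) (f (B_gen E F k j))))"
 proof (intro sum.cong refl)
  fix k assume "k \<in> {..<m}"
  then have k: "k < m" by simp
  show "\<Phi> (tensor_map H ?C H A id f (tens H ?C (u i k) (B_gen E F k j))) = \<Phi> (te (u i k) (f (B_gen E F k j)))"
   unfolding tensor_map_tens[OF vH vC vH vA lin_hom_id(1) alg_hom_lin[OF f] uc[OF i k] gc[OF k j]] id_apply ..
 qed
 finally show "\<Phi> (coact A (f (B_gen E F i j))) = (\<Sum>k<m. \<Phi> (te (u i k) (f (B_gen E F k j))))" .
qed

text \<open>
 The images of the columns of generators are columns, hence combinations of the columns of \<open>g\<close> with a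
 coefficient matrix \<open>P\<close>; pairing them by \<open>E\<close> expresses \<open>F\<close> through \<open>G\<close>.
\<close>

lemma colinear_congruence:
 assumes F: "F \<in> GL n" and g: "BR A m p (entry E) (entry (minv E)) G G' g" and cg: "\<And>j. j < p ==> column (\<lambda>i. g i j)"
  and iso: "comod_alg_iso (B_hopf E) (B_comod E F) A"
 shows "\<exists>P. \<forall>i<n. \<forall>j<n. F $$ (i, j) = (\<Sum>r<p. \<Sum>s<p. P r i * G r s * P s j)"
proof -
 obtain f where f: "f \<in> alg_hom (B_alg E F) A"
  and colin: "\<And>x. x \<in> carrier (B_alg E F) ==> coact A (f x) = tensor_map H (B_alg E F) H A id f (B_coact E F x)"
  using iso unfolding comod_alg_iso_def B_hopf_conv B_comod_conv B_comod_sel by blast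
 define Q where "Q j = (SOME P. \<forall>\<phi>\<in>dual A. \<forall>r<m. \<phi> (f (B_gen E F r j)) = (\<Sum>i<p. P i * \<phi> (g r i)))" for j
 have ex: "\<exists>P. \<forall>\<phi>\<in>dual A. \<forall>r<m. \<phi> (f (B_gen E F r j)) = (\<Sum>i<p. P i * \<phi> (g r i))" if "j < n" for j
  by (rule column_expansion[OF g]) (assumption | rule cg column_of_colinear[OF F f] colin that)+
 have Q: "\<phi> (f (B_gen E F r j)) = (\<Sum>i<p. Q j i * \<phi> (g r i))" if "j < n" "\<phi> \<in> dual A" "r < m" for j \<phi> r
 proof -
  have "\<forall>\<phi>\<in>dual A. \<forall>r<m. \<phi> (f (B_gen E F r j)) = (\<Sum>i<p. Q j i * \<phi> (g r i))"
   unfolding Q_def by (rule someI_ex[OF ex[OF that(1)]])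
  from bspec[OF this that(2)] show ?thesis using that(3) by (elim allE impE) assumption+
 qed
 obtain \<phi> where \<phi>: "\<phi> \<in> dual A" "\<phi> \<one> = 1" using dual_one by blast
 let ?a = "\<lambda>i j. f (B_gen E F i j)"
 note fa = BR_hom[OF B_gen_BR[OF E F] f]
 note gc = BR_closed[OF g] and ac = BR_closed[OF fa]
 have "F $$ (i, j) = (\<Sum>r<p. \<Sum>s<p. Q i r * G r s * Q j s)" if ij: "i < n" "j < n" for i j
 proof -
  have aa: "\<phi> (?a k i \<otimes> ?a l j) = (\<Sum>r<p. \<Sum>s<p. Q i r * (Q j s * \<phi> (g k r \<otimes> g l s)))" if kl: "k < m" "l < m" for k l
  proof -
   have "\<phi> (?a k i \<otimes> ?a l j) = (\<Sum>r<p. Q i r * \<phi> (g k r \<otimes> ?a l j))"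
    by (rule Q[OF ij(1) dual_mult_right[OF kA \<phi>(1) ac[OF kl(2) ij(2)]] kl(1)])
   also have "... = (\<Sum>r<p. Q i r * (\<Sum>s<p. Q j s * \<phi> (g k r \<otimes> g l s)))"
   proof (intro sum.cong refl)
    fix r assume "r \<in> {..<p}"
    then have r: "r < p" by simp
    show "Q i r * \<phi> (g k r \<otimes> ?a l j) = Q i r * (\<Sum>s<p. Q j s * \<phi> (g k r \<otimes> g l s))"
     unfolding Q[OF ij(2) dual_mult_left[OF kA \<phi>(1) gc[OF kl(1) r]] kl(2)] ..
   qed
   finally show ?thesis by (simp add: sum_distrib_left)
  qed
  have "F $$ (i, j) = (\<Sum>k<m. \<Sum>l<m. E $$ (k, l) * \<phi> (?a k i \<otimes> ?a l j))"
   using BR1[OF fa \<phi>(1) ij] \<phi>(2) by simp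
  also have "... = (\<Sum>k<m. \<Sum>l<m. \<Sum>r<p. \<Sum>s<p. Q i r * Q j s * (E $$ (k, l) * \<phi> (g k r \<otimes> g l s)))"
   by (intro sum.cong refl) (simp add: aa sum_distrib_left mult_ac)
  also have "... = (\<Sum>r<p. \<Sum>s<p. \<Sum>k<m. \<Sum>l<m. Q i r * Q j s * (E $$ (k, l) * \<phi> (g k r \<otimes> g l s)))"
   by (rule sum_swap4)
  also have "... = (\<Sum>r<p. \<Sum>s<p. Q i r * Q j s * G r s)"
   using BR1[OF g \<phi>(1)] \<phi>(2) by (simp flip: sum_distrib_left)
  finally show ?thesis by (simp add: mult_ac)
 qed
 then show ?thesis by (intro exI[of _ "\<lambda>r i. Q i r"]) blast
qed

end

lemma left_inverse_dim:
 fixes W P :: "nat => nat => 'k::field"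
 assumes WP: "\<And>i j. i < n ==> j < n ==> (\<Sum>s<p. W i s * P s j) = of_bool (i = j)"
 shows "n \<le> p"
proof (rule ccontr)
 assume "\<not> n \<le> p"
 then have pn: "p < n" by simp
 \<comment> \<open>pad both matrices by zeros to square ones\<close>
 define W0 where "W0 = mat n n (\<lambda>(i, s). if s < p then W i s else 0)"
 define P0 where "P0 = mat n n (\<lambda>(s, j). if s < p then P s j else 0)"
 have c: "W0 \<in> carrier_mat n n" "P0 \<in> carrier_mat n n" by (simp_all add: W0_def P0_def)
 have "W0 * P0 = 1\<^sub>m n"
 proof (rule eq_matI)
  fix i j assume "i < dim_row (1\<^sub>m n :: 'k mat)" "j < dim_col (1\<^sub>m n :: 'k mat)"
  then have ij: "i < n" "j < n" by simp_all
  have "(W0 * P0) $$ (i, j) = (\<Sum>s<n. if s < p then W i s * P s j else 0)"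
   unfolding entry_mult[OF c ij] by (intro sum.cong refl) (use ij in \<open>simp add: W0_def P0_def\<close>)
  also have "... = (\<Sum>s<p. W i s * P s j)"
   using pn by (intro sum.mono_neutral_cong_right) auto
  finally show "(W0 * P0) $$ (i, j) = 1\<^sub>m n $$ (i, j)" unfolding WP[OF ij] using ij by simp
 qed (simp_all add: W0_def P0_def)
 then have "P0 * W0 = 1\<^sub>m n" by (rule mat_mult_left_right_inverse[OF c])
 then have "(P0 * W0) $$ (p, p) = 1" using pn by simp
 moreover have "(P0 * W0) $$ (p, p) = 0"
  unfolding entry_mult[OF c(2,1) pn pn] by (intro sum.neutral) (use pn in \<open>auto simp: P0_def\<close>)
 ultimately show False by simp
qed

text \<open>
 From \<open>F = P\<^sup>t G P\<close> the matrix \<open>F\<^sup>-\<^sup>1 P\<^sup>t G\<close> is a left inverse of \<open>P\<close>. Together with the previous lemma,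
 applied in both directions, this forces isomorphic \<open>\<B>(E,F)\<close> and \<open>\<B>(E,G)\<close> to have matrices of the same size.
\<close>

lemma congruence_left_inverse:
 fixes F :: "'k::field mat"
 assumes F: "F \<in> GL n" and P: "\<And>i j. i < n ==> j < n ==> F $$ (i, j) = (\<Sum>r<p. \<Sum>s<p. P r i * G r s * P s j)"
 shows "\<exists>W. \<forall>i<n. \<forall>j<n. (\<Sum>s<p. W i s * P s j) = of_bool (i = j)"
proof (intro exI allI impI)
 fix i j assume ij: "i < n" "j < n"
 have "(\<Sum>s<p. (\<Sum>q<n. \<Sum>r<p. minv F $$ (i, q) * P r q * G r s) * P s j) =
   (\<Sum>s<p. \<Sum>q<n. \<Sum>r<p. minv F $$ (i, q) * (P r q * G r s * P s j))"
  by (simp add: sum_distrib_right mult.assoc)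
 also have "... = (\<Sum>q<n. \<Sum>s<p. \<Sum>r<p. minv F $$ (i, q) * (P r q * G r s * P s j))" by (rule sum.swap)
 also have "... = (\<Sum>q<n. \<Sum>r<p. \<Sum>s<p. minv F $$ (i, q) * (P r q * G r s * P s j))"
  by (intro sum.cong refl sum.swap)
 also have "... = (\<Sum>q<n. minv F $$ (i, q) * F $$ (q, j))"
  by (intro sum.cong refl) (simp add: P ij sum_distrib_left)
 also have "... = of_bool (i = j)" by (rule inverse_funD(2)[OF GL_inverse_fun[OF F] ij])
 finally show "(\<Sum>s<p. (\<Sum>q<n. \<Sum>r<p. minv F $$ (i, q) * P r q * G r s) * P s j) = of_bool (i = j)" .
qed

lemma congruence_matrix:
 fixes F G :: "'k::field mat"
 assumes F: "F \<in> GL n" and G: "G \<in> carrier_mat n n"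
  and P: "\<And>i j. i < n ==> j < n ==> F $$ (i, j) = (\<Sum>r<n. \<Sum>s<n. P r i * G $$ (r, s) * P s j)"
 shows "\<exists>Q\<in>GL n. F = Q * G * transpose_mat Q"
proof -
 obtain W where W: "\<And>i j. i < n ==> j < n ==> (\<Sum>s<n. W i s * P s j) = of_bool (i = j)"
  using congruence_left_inverse[OF F P] by blast
 define Q where "Q = mat n n (\<lambda>(i, j). P j i)"
 define V where "V = mat n n (\<lambda>(i, j). W j i)"
 have c: "Q \<in> carrier_mat n n" "V \<in> carrier_mat n n" "transpose_mat Q \<in> carrier_mat n n" by (simp_all add: Q_def V_def)
 have QV: "Q * V = 1\<^sub>m n"
 proof (rule eq_matI)
  fix i j assume "i < dim_row (1\<^sub>m n :: 'k mat)" "j < dim_col (1\<^sub>m n :: 'k mat)"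
  then have ij: "i < n" "j < n" by simp_all
  have "(Q * V) $$ (i, j) = (\<Sum>s<n. W j s * P s i)"
   unfolding entry_mult[OF c(1,2) ij] by (intro sum.cong refl) (use ij in \<open>simp add: Q_def V_def\<close>)
  then show "(Q * V) $$ (i, j) = 1\<^sub>m n $$ (i, j)" unfolding W[OF ij(2,1)] using ij by (cases "i = j") simp_all
 qed (use c in simp_all)
 have "Q \<in> GL n" by (rule GLI[OF c(1,2) QV mat_mult_left_right_inverse[OF c(1,2) QV]])
 moreover have "F = Q * G * transpose_mat Q"
 proof (rule eq_matI)
  fix i j assume "i < dim_row (Q * G * transpose_mat Q)" "j < dim_col (Q * G * transpose_mat Q)"
  then have ij: "i < n" "j < n" using c by simp_all
  show "F $$ (i, j) = (Q * G * transpose_mat Q) $$ (i, j)"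
   unfolding sandwich_entry[OF c(1) G c(3) ij] P[OF ij] by (intro sum.cong refl) (use ij in \<open>simp add: Q_def\<close>)
 qed (use F c in simp_all)
 ultimately show ?thesis by blast
qed

section \<open>Isomorphism and transport of comodule algebras\<close>

lemma galois_objectD:
 assumes "galois_object H A"
 shows "k_algebra H" "k_algebra A" "coact A \<in> alg_hom A (tensor_alg H A)"
 using assms unfolding galois_object_def hopf_algebra_def comodule_algebra_def by blast+

lemma alg_hom_id: "id \<in> alg_hom A A"
 by (auto intro!: alg_homI)

lemma alg_hom_cong:
 fixes A (structure)
 assumes A: "k_algebra A" and f: "f \<in> alg_hom A B" and eq: "\<And>x. x \<in> carrier A ==> g x = f x"
 shows "g \<in> alg_hom A B"
proof (rule alg_homI[OF lin_homI])
 note vA = k_algebra_kspace[OF A]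
 show "g x \<in> carrier B" if "x \<in> carrier A" for x unfolding eq[OF that] by (rule alg_hom_closed[OF f that])
 show "g (x \<oplus> y) = g x \<oplus>\<^bsub>B\<^esub> g y" if "x \<in> carrier A" "y \<in> carrier A" for x y
  unfolding eq[OF kspace_add[OF vA that]] eq[OF that(1)] eq[OF that(2)] by (rule alg_hom_add[OF f that])
 show "g (c \<odot> x) = c \<odot>\<^bsub>B\<^esub> g x" if "x \<in> carrier A" for c x
  unfolding eq[OF kspace_smult[OF vA that]] eq[OF that] by (rule alg_hom_smult[OF f that])
 show "g (x \<otimes> y) = g x \<otimes>\<^bsub>B\<^esub> g y" if "x \<in> carrier A" "y \<in> carrier A" for x y
  unfolding eq[OF k_algebra_mult[OF A that]] eq[OF that(1)] eq[OF that(2)] by (rule alg_hom_mult[OF f that])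
 show "g \<one> = \<one>\<^bsub>B\<^esub>" unfolding eq[OF k_algebra_one[OF A]] by (rule alg_hom_one[OF f])
qed

lemma inv_into_alg_hom:
 fixes A (structure)
 assumes A: "k_algebra A" and B: "k_algebra B" and f: "f \<in> alg_hom A B" and bij: "bij_betw f (carrier A) (carrier B)"
 shows "inv_into (carrier A) f \<in> alg_hom B A"
proof (rule alg_homI[OF inv_into_lin_hom[OF k_algebra_kspace[OF A] k_algebra_kspace[OF B] alg_hom_lin[OF f] bij]])
 let ?g = "inv_into (carrier A) f"
 note inj = bij_betw_imp_inj_on[OF bij]
 have g: "?g y \<in> carrier A" "f (?g y) = y" if "y \<in> carrier B" for y
  using bij that by (auto simp: bij_betw_def inv_into_into f_inv_into_f)
 show "?g (x \<otimes>\<^bsub>B\<^esub> y) = ?g x \<otimes> ?g y" if xy: "x \<in> carrier B" "y \<in> carrier B" for x y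
 proof -
  have "f (?g x \<otimes> ?g y) = x \<otimes>\<^bsub>B\<^esub> y"
   unfolding alg_hom_mult[OF f g(1)[OF xy(1)] g(1)[OF xy(2)]] g(2)[OF xy(1)] g(2)[OF xy(2)] ..
  then show ?thesis by (rule inv_into_f_eq[OF inj k_algebra_mult[OF A g(1)[OF xy(1)] g(1)[OF xy(2)]]])
 qed
 show "?g \<one>\<^bsub>B\<^esub> = \<one>"
  by (rule inv_into_f_eq[OF inj k_algebra_one[OF A] alg_hom_one[OF f]])
qed

lemma comod_alg_iso_sym:
 assumes A: "galois_object H A" and B: "galois_object H B" and iso: "comod_alg_iso H A B"
 shows "comod_alg_iso H B A"
proof -
 obtain f where f: "f \<in> alg_hom A B" "bij_betw f (carrier A) (carrier B)"
  and col: "\<And>a. a \<in> carrier A ==> coact B (f a) = tensor_map H A H B id f (coact A a)"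
  using iso unfolding comod_alg_iso_def by blast
 note DA = galois_objectD[OF A] and DB = galois_objectD[OF B]
 note v = k_algebra_kspace[OF DA(1)] k_algebra_kspace[OF DA(2)] k_algebra_kspace[OF DB(2)]
 let ?g = "inv_into (carrier A) f"
 note g = inv_into_alg_hom[OF DA(2) DB(2) f]
 have gf: "?g (f a) = a" if "a \<in> carrier A" for a by (rule inv_into_f_f[OF bij_betw_imp_inj_on[OF f(2)] that])
 show ?thesis
  unfolding comod_alg_iso_def
 proof (intro exI[of _ ?g] conjI ballI)
  show "?g \<in> alg_hom B A" by (rule g)
  show "bij_betw ?g (carrier B) (carrier A)" by (rule bij_betw_inv_into[OF f(2)])
  fix b assume b: "b \<in> carrier B"
  note gb = alg_hom_closed[OF g b]
  have fgb: "f (?g b) = b" by (rule bij_betw_inv_into_right[OF f(2) b])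
  have "tensor_map H B H A id ?g (coact B b) = tensor_map H B H A id ?g (tensor_map H A H B id f (coact A (?g b)))"
   unfolding col[OF gb, symmetric] fgb ..
  also have "... = tensor_map H A H A id (\<lambda>x. x) (coact A (?g b))"
   by (rule tensor_map_id_comp[OF v(1,2,3,2) alg_hom_lin[OF f(1)] alg_hom_lin[OF g] gf[symmetric] lin_hom_id(2) alg_hom_closed[OF DA(3) gb]])
  also have "... = coact A (?g b)"
   by (rule tensor_map_id_id[OF v(1,2) lin_hom_id(2) refl alg_hom_closed[OF DA(3) gb]])
  finally show "coact A (?g b) = tensor_map H B H A id ?g (coact B b)" by (rule sym)
 qed
qed

lemma comod_alg_iso_trans:
 assumes A: "galois_object H A" and B: "galois_object H B" and C: "galois_object H C"
  and iso: "comod_alg_iso H A B" "comod_alg_iso H B C"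
 shows "comod_alg_iso H A C"
proof -
 obtain f where f: "f \<in> alg_hom A B" "bij_betw f (carrier A) (carrier B)"
  and cf: "\<And>a. a \<in> carrier A ==> coact B (f a) = tensor_map H A H B id f (coact A a)"
  using iso(1) unfolding comod_alg_iso_def by blast
 obtain g where g: "g \<in> alg_hom B C" "bij_betw g (carrier B) (carrier C)"
  and cg: "\<And>a. a \<in> carrier B ==> coact C (g a) = tensor_map H B H C id g (coact B a)"
  using iso(2) unfolding comod_alg_iso_def by blast
 note DA = galois_objectD[OF A] and DB = galois_objectD[OF B] and DC = galois_objectD[OF C]
 note v = k_algebra_kspace[OF DA(1)] k_algebra_kspace[OF DA(2)] k_algebra_kspace[OF DB(2)] k_algebra_kspace[OF DC(2)]
 show ?thesis
  unfolding comod_alg_iso_def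
 proof (intro exI[of _ "\<lambda>x. g (f x)"] conjI ballI)
  show "(\<lambda>x. g (f x)) \<in> alg_hom A C" by (rule alg_hom_comp[OF f(1) g(1)])
  show "bij_betw (\<lambda>x. g (f x)) (carrier A) (carrier C)" using bij_betw_trans[OF f(2) g(2)] unfolding comp_def .
  fix a assume a: "a \<in> carrier A"
  show "coact C (g (f a)) = tensor_map H A H C id (\<lambda>x. g (f x)) (coact A a)"
   unfolding cg[OF alg_hom_closed[OF f(1) a]] cf[OF a]
   by (rule tensor_map_id_comp[OF v(1,2,3,4) alg_hom_lin[OF f(1)] alg_hom_lin[OF g(1)] refl
     alg_hom_lin[OF alg_hom_comp[OF f(1) g(1)]] alg_hom_closed[OF DA(3) a]])
 qed
qed

lemma tensor_map_inverse:
 assumes v: "kspace M" "kspace N" "kspace M'" "kspace N'"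
  and f: "f \<in> lin_hom M M'" "f' \<in> lin_hom M' M" "\<And>x. x \<in> carrier M ==> f' (f x) = x"
  and g: "g \<in> lin_hom N N'" "g' \<in> lin_hom N' N" "\<And>x. x \<in> carrier N ==> g' (g x) = x"
  and t: "t \<in> carrier (tensor_alg M N)"
 shows "tensor_map M' N' M N f' g' (tensor_map M N M' N' f g t) = t"
proof (rule tensor_ext[OF v(1,2) kspace_tensor_alg[OF v(1,2)]
   lin_hom_comp[OF tensor_map_lin_hom[OF v f(1) g(1)] tensor_map_lin_hom[OF v(3,4,1,2) f(2) g(2)]] lin_hom_id(2) _ t])
 fix x y assume xy: "x \<in> carrier M" "y \<in> carrier N"
 show "tensor_map M' N' M N f' g' (tensor_map M N M' N' f g (tens M N x y)) = tens M N x y"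
  unfolding tensor_map_tens[OF v f(1) g(1) xy]
   tensor_map_tens[OF v(3,4,1,2) f(2) g(2) lin_hom_closed[OF f(1) xy(1)] lin_hom_closed[OF g(1) xy(2)]] f(3)[OF xy(1)] g(3)[OF xy(2)] ..
qed

text \<open>
 All structure maps of \<open>B\<close> are conjugates of those of \<open>A\<close> by tensor powers of \<open>f\<close>; each axiom is
 compared on pure tensors.
\<close>

lemma galois_object_transport:
 fixes H :: "('k::field, 'h) hopf" and A :: "('k, 'h, 'a) comod_alg" (structure) and B :: "('k, 'h, 'b) comod_alg"
 assumes G: "galois_object H A" and B: "k_algebra B" and f: "f \<in> alg_hom A B" and bij: "bij_betw f (carrier A) (carrier B)"
  and col: "\<And>a. a \<in> carrier A ==> coact B (f a) = tensor_map H A H B id f (coact A a)"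
 shows "galois_object H B"
proof -
 note D = galois_objectD[OF G]
 have hopf: "hopf_algebra H" and ca: "comodule_algebra H A" using G unfolding galois_object_def by blast+
 have \<Delta>: "comult H \<in> alg_hom H (tensor_alg H H)" and \<epsilon>: "counit H \<in> alg_hom H scalar_alg"
  using hopf unfolding hopf_algebra_def by blast+
 note v = k_algebra_kspace[OF D(1)] k_algebra_kspace[OF D(2)] k_algebra_kspace[OF B]
 note kHA = k_algebra_tensor[OF D(1,2)] and kHB = k_algebra_tensor[OF D(1) B]
 note vHA = k_algebra_kspace[OF kHA] and vHB = k_algebra_kspace[OF kHB]
 note vHH = kspace_tensor_alg[OF v(1) v(1)]
 let ?g = "inv_into (carrier A) f"
 note g = inv_into_alg_hom[OF D(2) B f bij]
 have gf: "?g (f a) = a" if "a \<in> carrier A" for a by (rule inv_into_f_f[OF bij_betw_imp_inj_on[OF bij] that])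
 have fg: "f (?g b) = b" if "b \<in> carrier B" for b by (rule bij_betw_inv_into_right[OF bij that])
 note gc = alg_hom_closed[OF g]
 note i = lin_hom_id(1)[of H] and fl = alg_hom_lin[OF f] and \<Delta>l = alg_hom_lin[OF \<Delta>] and dl = alg_hom_lin[OF D(3)]
 let ?F = "tensor_map H A H B id f"
 note F = tensor_map_alg_hom[OF D(1,2,1) B alg_hom_id f]
 note Fl = alg_hom_lin[OF F]
 have cB: "coact B \<in> alg_hom B (tensor_alg H B)"
 proof (rule alg_hom_cong[OF B alg_hom_comp[OF alg_hom_comp[OF g D(3)] F]])
  show "coact B b = ?F (coact A (?g b))" if "b \<in> carrier B" for b
   unfolding col[OF gc[OF that], symmetric] fg[OF that] ..
 qed
 note cBl = alg_hom_lin[OF cB]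
 let ?FF = "tensor_map H (tensor_alg H A) H (tensor_alg H B) id ?F"
 note FF = tensor_map_lin_hom[OF v(1) vHA v(1) vHB i Fl]
 have coassoc: "tensor_assoc H H B (tensor_map H B (tensor_alg H H) B (comult H) id (coact B b)) =
   tensor_map H B H (tensor_alg H B) id (coact B) (coact B b)" if b: "b \<in> carrier B" for b
 proof -
  define s where "s = coact A (?g b)"
  have s: "s \<in> carrier (tensor_alg H A)" unfolding s_def by (rule alg_hom_closed[OF D(3) gc[OF b]])
  have bs: "coact B b = ?F s" unfolding s_def col[OF gc[OF b], symmetric] fg[OF b] ..
  note dB = lin_hom_comp[OF tensor_map_lin_hom[OF v(1,3) vHH v(3) \<Delta>l lin_hom_id(1)] tensor_assoc_lin_hom[OF v(1,1,3)]]
  note dA = lin_hom_comp[OF tensor_map_lin_hom[OF v(1,2) vHH v(2) \<Delta>l lin_hom_id(1)] tensor_assoc_lin_hom[OF v(1,1,2)]]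
  have "tensor_assoc H H B (tensor_map H B (tensor_alg H H) B (comult H) id (?F s)) =
    ?FF (tensor_assoc H H A (tensor_map H A (tensor_alg H H) A (comult H) id s))"
  proof (rule tensor_ext[OF v(1,2) kspace_tensor_alg[OF v(1) vHB] lin_hom_comp[OF Fl dB] lin_hom_comp[OF dA FF] _ s])
   fix h x assume hx: "h \<in> carrier H" "x \<in> carrier A"
   note fx = alg_hom_closed[OF f hx(2)] and \<Delta>h = alg_hom_closed[OF \<Delta> hx(1)]
   have lA: "(\<lambda>y. tens H A y x) \<in> lin_hom H (tensor_alg H A)" by (rule bilinD(2)[OF bilin_tens[OF v(1,2)] hx(2)])
   have lB: "(\<lambda>y. tens H B y (f x)) \<in> lin_hom H (tensor_alg H B)" by (rule bilinD(2)[OF bilin_tens[OF v(1,3)] fx])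
   have "tensor_assoc H H B (tensor_map H B (tensor_alg H H) B (comult H) id (?F (tens H A h x))) =
     tensor_map H H H (tensor_alg H B) id (\<lambda>y. tens H B y (f x)) (comult H h)"
    unfolding tensor_map_tens[OF v(1,2,1,3) i fl hx] id_apply
     tensor_map_tens[OF v(1,3) vHH v(3) \<Delta>l lin_hom_id(1) hx(1) fx] tensor_assoc_tens[OF v(1,1,3) \<Delta>h fx] ..
   also have "... = ?FF (tensor_map H H H (tensor_alg H A) id (\<lambda>y. tens H A y x) (comult H h))"
    by (rule tensor_map_id_comp[OF v(1,1) vHA vHB lA Fl _ lB \<Delta>h, symmetric])
     (simp add: tensor_map_tens[OF v(1,2,1,3) i fl _ hx(2)])
   also have "... = ?FF (tensor_assoc H H A (tensor_map H A (tensor_alg H H) A (comult H) id (tens H A h x)))"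
    unfolding tensor_map_tens[OF v(1,2) vHH v(2) \<Delta>l lin_hom_id(1) hx] id_apply tensor_assoc_tens[OF v(1,1,2) \<Delta>h hx(2)] ..
   finally show "tensor_assoc H H B (tensor_map H B (tensor_alg H H) B (comult H) id (?F (tens H A h x))) =
    ?FF (tensor_assoc H H A (tensor_map H A (tensor_alg H H) A (comult H) id (tens H A h x)))" .
  qed
  also have "... = ?FF (tensor_map H A H (tensor_alg H A) id (coact A) s)"
   using ca gc[OF b] unfolding comodule_algebra_def s_def by simp
  also have "... = tensor_map H A H (tensor_alg H B) id (\<lambda>x. coact B (f x)) s"
   by (rule tensor_map_id_comp[OF v(1,2) vHA vHB dl Fl col lin_hom_comp[OF fl cBl] s])
  also have "... = tensor_map H B H (tensor_alg H B) id (coact B) (?F s)"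
   by (rule tensor_map_id_comp[OF v(1,2,3) vHB fl cBl refl lin_hom_comp[OF fl cBl] s, symmetric])
  finally show ?thesis unfolding bs .
 qed
 have counit: "tensor_lift H B B (\<lambda>h x. counit H h \<odot>\<^bsub>B\<^esub> x) (coact B b) = b" if b: "b \<in> carrier B" for b
 proof -
  note eA = bilin_counit_alg_hom[OF D(1,2) \<epsilon>] and eB = bilin_counit_alg_hom[OF D(1) B \<epsilon>]
  note s = alg_hom_closed[OF D(3) gc[OF b]]
  have "tensor_lift H B B (\<lambda>h x. counit H h \<odot>\<^bsub>B\<^esub> x) (?F (coact A (?g b))) =
    f (tensor_lift H A A (\<lambda>h x. counit H h \<odot> x) (coact A (?g b)))"
  proof (rule tensor_ext[OF v(1,2,3) lin_hom_comp[OF Fl alg_hom_lin[OF eB(1)]] lin_hom_comp[OF alg_hom_lin[OF eA(1)] fl] _ s])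
   fix h x assume hx: "h \<in> carrier H" "x \<in> carrier A"
   show "tensor_lift H B B (\<lambda>h x. counit H h \<odot>\<^bsub>B\<^esub> x) (?F (tens H A h x)) = f (tensor_lift H A A (\<lambda>h x. counit H h \<odot> x) (tens H A h x))"
    unfolding tensor_map_tens[OF v(1,2,1,3) i fl hx] id_apply eB(2)[OF hx(1) alg_hom_closed[OF f hx(2)]] eA(2)[OF hx]
    by (rule alg_hom_smult[OF f hx(2), symmetric])
  qed
  also have "tensor_lift H A A (\<lambda>h x. counit H h \<odot> x) (coact A (?g b)) = ?g b"
   using ca gc[OF b] unfolding comodule_algebra_def by simp
  finally show ?thesis unfolding fg[OF b] col[OF gc[OF b], symmetric] .
 qed
 have ne: "carrier B \<noteq> {\<zero>\<^bsub>B\<^esub>}"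
 proof
  assume z: "carrier B = {\<zero>\<^bsub>B\<^esub>}"
  have "x = \<zero>" if x: "x \<in> carrier A" for x
  proof (rule inj_onD[OF bij_betw_imp_inj_on[OF bij] _ x kspace_zero[OF v(2)]])
   show "f x = f \<zero>" using alg_hom_closed[OF f x] alg_hom_closed[OF f kspace_zero[OF v(2)]] unfolding z by simp
  qed
  then have "carrier A = {\<zero>}" using kspace_zero[OF v(2)] by blast
  then show False using G unfolding galois_object_def by blast
 qed
 have idid: "id (id x) = x" for x :: 'h by simp
 have bijF: "bij_betw ?F (carrier (tensor_alg H A)) (carrier (tensor_alg H B))"
  by (rule bij_betw_byWitness[where f' = "tensor_map H B H A id ?g"])
   (use tensor_map_inverse[OF v(1,2,1,3) i i idid fl alg_hom_lin[OF g] gf]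
     tensor_map_inverse[OF v(1,3,1,2) i i idid alg_hom_lin[OF g] fl fg]
     lin_hom_closed[OF Fl] lin_hom_closed[OF tensor_map_lin_hom[OF v(1,3,1,2) i alg_hom_lin[OF g]]] in blast)+
 let ?K = "tensor_map A A B B f f" and ?L = "tensor_map B B A A ?g ?g"
 note Kl = tensor_map_lin_hom[OF v(2,2,3,3) fl fl] and Ll = tensor_map_lin_hom[OF v(3,3,2,2) alg_hom_lin[OF g] alg_hom_lin[OF g]]
 have bijL: "bij_betw ?L (carrier (tensor_alg B B)) (carrier (tensor_alg A A))"
  by (rule bij_betw_byWitness[where f' = ?K])
   (use tensor_map_inverse[OF v(3,3,2,2) alg_hom_lin[OF g] fl fg alg_hom_lin[OF g] fl fg]
     tensor_map_inverse[OF v(2,2,3,3) fl alg_hom_lin[OF g] gf fl alg_hom_lin[OF g] gf]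
     lin_hom_closed[OF Kl] lin_hom_closed[OF Ll] in blast)+
 note canA = galois_map_lin_hom[OF D(1,2) dl] galois_map_tens[OF D(1,2) dl]
 note canB = galois_map_lin_hom[OF D(1) B cBl] galois_map_tens[OF D(1) B cBl]
 have eq: "?F (galois_map H A (?L t)) = galois_map H B t" if t: "t \<in> carrier (tensor_alg B B)" for t
 proof (rule tensor_ext[OF v(3,3) vHB lin_hom_comp[OF lin_hom_comp[OF Ll canA(1)] Fl] canB(1) _ t])
  fix x y assume xy: "x \<in> carrier B" "y \<in> carrier B"
  note one = k_algebra_one[OF D(1)]
  show "?F (galois_map H A (?L (tens B B x y))) = galois_map H B (tens B B x y)"
   unfolding tensor_map_tens[OF v(3,3,2,2) alg_hom_lin[OF g] alg_hom_lin[OF g] xy] canA(2)[OF gc[OF xy(1)] gc[OF xy(2)]]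
    alg_hom_mult[OF F alg_hom_closed[OF D(3) gc[OF xy(1)]] tens_closed[OF v(1,2) one gc[OF xy(2)]]]
    tensor_map_tens[OF v(1,2,1,3) i fl one gc[OF xy(2)]] col[OF gc[OF xy(1)], symmetric] id_apply fg[OF xy(1)] fg[OF xy(2)] canB(2)[OF xy] ..
 qed
 have "bij_betw (galois_map H A) (carrier (tensor_alg A A)) (carrier (tensor_alg H A))"
  using G unfolding galois_object_def by blast
 from bij_betw_trans[OF bij_betw_trans[OF bijL this] bijF]
 have "bij_betw (galois_map H B) (carrier (tensor_alg B B)) (carrier (tensor_alg H B))"
  using bij_betw_cong[of "carrier (tensor_alg B B)" "?F \<circ> (galois_map H A \<circ> ?L)" "galois_map H B"] eq by simp
 then show ?thesis
  unfolding galois_object_def comodule_algebra_def using hopf B cB coassoc counit ne by blast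
qed

lemma galois_object_copy:
 fixes H :: "('k::field, 'h) hopf" and A :: "('k, 'h, 'a) comod_alg" (structure) and \<iota> :: "'a => 'u"
 assumes G: "galois_object H A" and \<iota>: "inj \<iota>"
 shows "\<exists>B :: ('k, 'h, 'u) comod_alg. galois_object H B \<and> comod_alg_iso H A B"
proof -
 note D = galois_objectD[OF G]
 let ?g = "inv_into UNIV \<iota>"
 define M where "M = \<lparr>carrier = \<iota> ` carrier A, monoid.mult = \<lambda>x y. \<iota> (?g x \<otimes> ?g y), monoid.one = \<iota> \<one>,
  ring.zero = \<iota> \<zero>, ring.add = \<lambda>x y. \<iota> (?g x \<oplus> ?g y), module.smult = \<lambda>c x. \<iota> (c \<odot> ?g x)\<rparr>"
 define B where "B = module.extend M (comod_alg.fields (\<lambda>x. tensor_map H A H M id \<iota> (coact A (?g x))))"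
 have tB: "module.truncate B = M" and cB: "coact B = (\<lambda>x. tensor_map H A H M id \<iota> (coact A (?g x)))"
  by (simp_all add: B_def M_def module.defs comod_alg.defs)
 have gi: "?g (\<iota> x) = x" for x using \<iota> by simp
 have lM: "\<iota> \<in> lin_hom A M" by (rule lin_homI) (simp_all add: M_def gi)
 have hM: "\<iota> \<in> alg_hom A M" by (rule alg_homI[OF lM]) (simp_all add: M_def gi)
 have kM: "k_algebra M"
  by (rule k_algebra_image[OF D(2) lM]) (simp_all add: M_def gi)
 have bij: "bij_betw \<iota> (carrier A) (carrier M)"
  using inj_on_subset[OF \<iota>] by (simp add: bij_betw_def M_def)
 have f: "\<iota> \<in> alg_hom A B" using hM unfolding tB[symmetric] truncate_alg_hom .
 have bijB: "bij_betw \<iota> (carrier A) (carrier B)" using bij unfolding tB[symmetric] truncate_sel .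
 have kB: "k_algebra B" using kM unfolding tB[symmetric] truncate_k_algebra .
 have col: "coact B (\<iota> a) = tensor_map H A H B id \<iota> (coact A a)" for a
  unfolding cB gi tB[symmetric] truncate_tensor_map ..
 show ?thesis
  using galois_object_transport[OF G kB f bijB col] f bijB col unfolding comod_alg_iso_def by blast
qed

section \<open>The classification\<close>

lemma B_comod_galois:
 assumes E: "E \<in> GL m" "2 \<le> m" and F: "F \<in> X0 E"
 shows "galois_object (B_hopf E) (B_comod E F)"
proof -
 obtain n where "2 \<le> n" "F \<in> GL n" "tr (minv E * transpose_mat E) = tr (minv F * transpose_mat F)"
  using F unfolding X0_def by blast
 then show ?thesis using B_galois_object[OF E(1)] B_nonzero[OF E] by blast
qed

lemma B_gen_column:
 assumes E: "E \<in> GL m" and F: "F \<in> GL n" and j: "j < n"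
 shows "coaction_column E (B_comod E F) (\<lambda>i. B_gen E F i j)"
 unfolding coaction_column_def B_comod_conv B_comod_sel GL_dim[OF E]
 using B_gen_closed[OF E F _ j] B_coact_gen[OF E F _ j] by blast

lemma GL_minv_unique:
 assumes F: "F \<in> GL n" and Y: "Y \<in> carrier_mat n n" "F * Y = 1\<^sub>m n"
 shows "minv F = Y"
proof -
 have "minv F = minv F * (F * Y)" unfolding Y(2) by (rule right_mult_one_mat[OF GL_inverse(1)[OF F], symmetric])
 also have "... = (minv F * F) * Y" by (rule assoc_mult_mat[OF GL_inverse(1)[OF F] GL_carrier[OF F] Y(1), symmetric])
 also have "... = Y" unfolding GL_inverse(3)[OF F] by (rule left_mult_one_mat[OF Y(1)])
 finally show ?thesis .
qed

text \<open>
 If \<open>F = P G P\<^sup>t\<close>, then \<open>g P\<^sup>t\<close> is a solution for \<open>(E,F)\<close> in \<open>\<B>(E,G)\<close> whose columns are combinations of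
 the columns of \<open>g\<close>.
\<close>

lemma congruent_imp_iso:
 assumes E: "E \<in> GL m" "2 \<le> m" and FG: "(F, G) \<in> congr_rel E"
 shows "comod_alg_iso (B_hopf E) (B_comod E F) (B_comod E G)"
proof -
 have F0: "F \<in> X0 E" and G0: "G \<in> X0 E" and dim: "dim_row F = dim_row G"
  and "\<exists>P\<in>GL (dim_row F). F = P * G * transpose_mat P"
  using FG unfolding congr_rel_def by blast+
 then obtain P where P: "P \<in> GL (dim_row F)" and FP: "F = P * G * transpose_mat P" by blast
 obtain n where F: "F \<in> GL n" using F0 unfolding X0_def by blast
 obtain n' where G': "G \<in> GL n'" using G0 unfolding X0_def by blast
 have "n' = n" using dim unfolding GL_dim[OF F] GL_dim[OF G'] by simp
 then have G: "G \<in> GL n" using G' by simp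
 have P: "P \<in> GL n" using P unfolding GL_dim[OF F] .
 interpret C: galois_over_B E m "B_comod E G"
  by (rule galois_over_B.intro[OF E(1) B_comod_galois[OF E G0]])
 note Pc = GL_carrier[OF P] GL_inverse(1)[OF P]
 note Gc = GL_carrier[OF G] GL_inverse(1)[OF G]
 let ?R = "transpose_mat P" and ?R' = "transpose_mat (minv P)"
 have R: "?R \<in> carrier_mat n n" "?R' \<in> carrier_mat n n" using Pc by simp_all
 have RR: "?R * ?R' = 1\<^sub>m n"
  unfolding transpose_mult[OF Pc(2,1), symmetric] GL_inverse(3)[OF P] by simp
 define b where "b i j = finsum (B_comod E G) (\<lambda>l. ?R $$ (l, j) \<odot>\<^bsub>B_comod E G\<^esub> B_gen E G i l) {..<n}" for i j
 have g: "BR (B_comod E G) m n (entry E) (entry (minv E)) (entry G) (entry (minv G)) (B_gen E G)"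
  using B_gen_BR[OF E(1) G] unfolding BR_def B_comod_conv .
 have minvF: "minv F = ?R' * minv G * transpose_mat ?R'"
 proof (rule GL_minv_unique[OF F])
  show "?R' * minv G * transpose_mat ?R' \<in> carrier_mat n n" using R Gc by simp
  show "F * (?R' * minv G * transpose_mat ?R') = 1\<^sub>m n"
   using congruence_inverse[OF R RR Gc GL_inverse(2)[OF G]] unfolding FP transpose_transpose .
 qed
 have "BR (B_comod E G) m n (entry E) (entry (minv E)) (entry F) (entry (minv F)) b"
  using BR_change_basis[OF C.kA g Gc R RR b_def] unfolding minvF unfolding FP transpose_transpose .
 then show ?thesis
 proof (rule C.iso_of_columns[OF F])
  show "coaction_column E (B_comod E G) (\<lambda>i. b i j)" if "j < n" for j
   unfolding b_def by (rule C.column_combination[OF B_gen_column[OF E(1) G]])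
 qed
qed

lemma iso_imp_congruent:
 assumes E: "E \<in> GL m" "2 \<le> m" and F: "F \<in> X0 E" and G: "G \<in> X0 E"
  and iso: "comod_alg_iso (B_hopf E) (B_comod E F) (B_comod E G)"
 shows "(F, G) \<in> congr_rel E"
proof -
 have cong: "\<exists>P. \<forall>i<n. \<forall>j<n. F $$ (i, j) = (\<Sum>r<p. \<Sum>s<p. P r i * entry G r s * P s j)"
  if F: "F \<in> GL n" and G: "G \<in> GL p" "G \<in> X0 E" and iso: "comod_alg_iso (B_hopf E) (B_comod E F) (B_comod E G)" for F G n p
 proof -
  interpret C: galois_over_B E m "B_comod E G"
   by (rule galois_over_B.intro[OF E(1) B_comod_galois[OF E G(2)]])
  have g: "BR (B_comod E G) m p (entry E) (entry (minv E)) (entry G) (entry (minv G)) (B_gen E G)"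
   using B_gen_BR[OF E(1) G(1)] unfolding BR_def B_comod_conv .
  show ?thesis by (rule C.colinear_congruence[OF F g B_gen_column[OF E(1) G(1)] iso])
 qed
 have dim: "n \<le> p" if F: "F \<in> GL n" and G: "G \<in> GL p" "G \<in> X0 E" and iso: "comod_alg_iso (B_hopf E) (B_comod E F) (B_comod E G)" for F G n p
 proof -
  obtain P where P: "\<And>i j. i < n ==> j < n ==> F $$ (i, j) = (\<Sum>r<p. \<Sum>s<p. P r i * entry G r s * P s j)"
   using cong[OF F G iso] by blast
  obtain W where "\<And>i j. i < n ==> j < n ==> (\<Sum>s<p. W i s * P s j) = of_bool (i = j)"
   using congruence_left_inverse[OF F P] by blast
  then show ?thesis by (rule left_inverse_dim)
 qed
 obtain n where Fn: "F \<in> GL n" using F unfolding X0_def by blast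
 obtain p where Gp: "G \<in> GL p" using G unfolding X0_def by blast
 note iso' = comod_alg_iso_sym[OF B_comod_galois[OF E F] B_comod_galois[OF E G] iso]
 have np: "p = n" using dim[OF Fn Gp G iso] dim[OF Gp Fn F iso'] by simp
 have Gn: "G \<in> GL n" using Gp unfolding np .
 obtain P where P: "\<And>i j. i < n ==> j < n ==> F $$ (i, j) = (\<Sum>r<n. \<Sum>s<n. P r i * entry G r s * P s j)"
  using cong[OF Fn Gn G iso] by blast
 have "\<exists>Q\<in>GL n. F = Q * G * transpose_mat Q" by (rule congruence_matrix[OF Fn GL_carrier[OF Gn] P])
 then show ?thesis unfolding congr_rel_def using F G GL_dim[OF Fn] GL_dim[OF Gn] by simp
qed

theorem theorem4p1:
 fixes E :: "'k::field mat" and m :: nat and \<iota> :: "'k belem => 'u"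
 assumes "m \<ge> 2" and "E \<in> GL m"
  and "inj \<iota>"
 shows "\<exists>\<Phi>. bij_betw \<Phi> (X E) (Gal (B_hopf E) :: ('k, 'k belem, 'u) comod_alg set set) \<and>
      (\<forall>F\<in>X0 E. \<Phi> (congr_rel E `` {F}) = gal_class (B_hopf E) (B_comod E F))"
proof -
 let ?H = "B_hopf E" and ?B = "B_comod E"
 let ?cl = "\<lambda>F. gal_class ?H (?B F) :: ('k, 'k belem, 'u) comod_alg set"
 let ?R = "{(A, A'). galois_object ?H A \<and> galois_object ?H A' \<and> comod_alg_iso ?H A A'} :: (('k, 'k belem, 'u) comod_alg \<times> _) set"
 note E = assms(2,1)
 note gB = B_comod_galois[OF E]
 have congr_iff: "(F, G) \<in> congr_rel E \<longleftrightarrow> comod_alg_iso ?H (?B F) (?B G)" if "F \<in> X0 E" "G \<in> X0 E" for F G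
  using congruent_imp_iso[OF E] iso_imp_congruent[OF E that] by blast
 have class_eq: "?cl F = ?R `` {A}" if F: "F \<in> X0 E" and A: "galois_object ?H A" and iso: "comod_alg_iso ?H (?B F) A"
  for F and A :: "('k, 'k belem, 'u) comod_alg"
  using comod_alg_iso_trans[OF gB[OF F] A _ iso] comod_alg_iso_trans[OF A gB[OF F] _ comod_alg_iso_sym[OF gB[OF F] A iso]] A
  unfolding gal_class_def by blast
 have copy: "\<exists>A :: ('k, 'k belem, 'u) comod_alg. galois_object ?H A \<and> comod_alg_iso ?H (?B F) A" if "F \<in> X0 E" for F
  by (rule galois_object_copy[OF gB[OF that] assms(3)])
 have cl_eq_iff: "?cl F = ?cl G \<longleftrightarrow> (F, G) \<in> congr_rel E" if FG: "F \<in> X0 E" "G \<in> X0 E" for F G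
 proof
  assume eq: "?cl F = ?cl G"
  obtain A :: "('k, 'k belem, 'u) comod_alg" where A: "galois_object ?H A" "comod_alg_iso ?H (?B F) A"
   using copy[OF FG(1)] by blast
  then have "A \<in> ?cl F" unfolding gal_class_def by simp
  then have "A \<in> ?cl G" unfolding eq .
  then have "comod_alg_iso ?H (?B G) A" unfolding gal_class_def by simp
  then show "(F, G) \<in> congr_rel E"
   unfolding congr_iff[OF FG]
   by (rule comod_alg_iso_trans[OF gB[OF FG(1)] A(1) gB[OF FG(2)] A(2) comod_alg_iso_sym[OF gB[OF FG(2)] A(1)]])
 next
  assume "(F, G) \<in> congr_rel E"
  then have iso: "comod_alg_iso ?H (?B F) (?B G)" unfolding congr_iff[OF FG] .
  note iso' = comod_alg_iso_sym[OF gB[OF FG(1)] gB[OF FG(2)] iso]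
  show "?cl F = ?cl G"
   unfolding gal_class_def
   using comod_alg_iso_trans[OF gB[OF FG(1)] gB[OF FG(2)] _ iso] comod_alg_iso_trans[OF gB[OF FG(2)] gB[OF FG(1)] _ iso'] by blast
 qed
 \<comment> \<open>all members of \<open>c\<close> have the same class, so the union is this class\<close>
 define \<Phi> where "\<Phi> c = (\<Union>F\<in>c. ?cl F)" for c
 have X0: "G \<in> X0 E" if "(F, G) \<in> congr_rel E" for F G using that unfolding congr_rel_def by blast
 have refl: "(F, F) \<in> congr_rel E" if "F \<in> X0 E" for F using cl_eq_iff[OF that that] by blast
 have \<Phi>: "\<Phi> (congr_rel E `` {F}) = ?cl F" if F: "F \<in> X0 E" for F
 proof -
  have "?cl G = ?cl F" if "G \<in> congr_rel E `` {F}" for G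
   using cl_eq_iff[OF F X0[of F G]] that by blast
  then show ?thesis unfolding \<Phi>_def using refl[OF F] by blast
 qed
 have "bij_betw \<Phi> (X E) (Gal ?H)"
 proof (rule bij_betw_imageI)
  show "inj_on \<Phi> (X E)"
  proof (rule inj_onI)
   fix c d assume "c \<in> X E" "d \<in> X E" and eq: "\<Phi> c = \<Phi> d"
   then obtain F G where F: "F \<in> X0 E" "c = congr_rel E `` {F}" and G: "G \<in> X0 E" "d = congr_rel E `` {G}"
    unfolding X_def by (blast elim: quotientE)
   have FG: "?cl F = ?cl G" using eq unfolding F(2) G(2) \<Phi>[OF F(1)] \<Phi>[OF G(1)] .
   have "(F, K) \<in> congr_rel E \<longleftrightarrow> (G, K) \<in> congr_rel E" for K
   proof (cases "K \<in> X0 E")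
    case True
    show ?thesis unfolding cl_eq_iff[OF F(1) True, symmetric] cl_eq_iff[OF G(1) True, symmetric] FG ..
   next
    case False
    then show ?thesis using X0 by blast
   qed
   then show "c = d" unfolding F(2) G(2) by blast
  qed
  show "\<Phi> ` X E = Gal ?H"
  proof (intro equalityI subsetI)
   fix y assume "y \<in> \<Phi> ` X E"
   then obtain F where F: "F \<in> X0 E" and y: "y = ?cl F"
    unfolding X_def using \<Phi> by (blast elim: quotientE)
   obtain A :: "('k, 'k belem, 'u) comod_alg" where A: "galois_object ?H A" "comod_alg_iso ?H (?B F) A"
    using copy[OF F] by blast
   show "y \<in> Gal ?H" unfolding y class_eq[OF F A] Gal_def by (rule quotientI) (use A in simp)
  next
   fix y :: "('k, 'k belem, 'u) comod_alg set" assume "y \<in> Gal ?H"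
   then obtain A where A: "galois_object ?H A" and y: "y = ?R `` {A}"
    unfolding Gal_def by (blast elim: quotientE)
   interpret A: galois_over_B E m A by (rule galois_over_B.intro[OF E(1) A])
   obtain F where F: "F \<in> X0 E" "comod_alg_iso ?H (?B F) A" using A.classification[OF E(2)] by blast
   have "y = \<Phi> (congr_rel E `` {F})" unfolding y \<Phi>[OF F(1)] class_eq[OF F(1) A F(2)] ..
   then show "y \<in> \<Phi> ` X E" unfolding X_def using quotientI[OF F(1), of "congr_rel E"] by blast
  qed
 qed
 then show ?thesis using \<Phi> by blast
qed

end
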